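(* Let $\mathfrak g$ be one of the types $A^{(2)}_{2n}$ ($n\ge 2$), $A^{(2)}_{2n-1}$ ($n\ge3$), $A^{(2)\dagger}_{2n-1}$ ($n\ge3$), $C^{(1)}_n$ ($n\ge2$), let $\overline{\mathfrak g}=B_n,C_n,D_n,C_n$ respectively, let $V$ be the vector representation, let $W=\mathrm{Im}\,\check R(q^2)\subset V\otimes V$, and for $1\le k\le n$ put $$V^k=V^{\otimes k}\Big/\sum_{i=1}^{k-1}V^{\otimes(i-1)}\otimes W\otimes V^{\otimes(k-i-1)} .$$ Then, as a $U_q(\overline{\mathfrak g})$-module, $V^k$ is isomorphic to the irreducible highest weight module $V(\omega_k)$ with highest weight $\omega_k$, with the following exceptions: (i) for $\mathfrak g=A^{(2)\dagger}_{2n-1}$ and $k=n$, $V^n\simeq V(\omega_n)\oplus V(\overline\omega_n)$; (ii) for $\mathfrak g=A^{(2)}_{2n-1}$, $V^k\simeq V(\omega_k)\oplus V(\omega_{k-2})\oplus\cdots\oplus V(\omega_{k\bmod 2})$, where $\omega_0=0$.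
   Context: **Types and weights.** $\mathfrak g$ is one of $A^{(2)}_{2n}$, $A^{(2)}_{2n-1}$, $A^{(2)\dagger}_{2n-1}$ (the same affine algebra as $A^{(2)}_{2n-1}$ with a different labeling of the Dynkin vertices), $C^{(1)}_n$. Let $\epsilon_1,\dots,\epsilon_n$ be orthonormal for $(\cdot|\cdot)$. The simple roots of $\overline{\mathfrak g}$ are $\alpha_i=\epsilon_i-\epsilon_{i+1}$ ($1\le i\le n-1$) and $\alpha_n=\epsilon_n$ for $A^{(2)}_{2n}$, $2\epsilon_n$ for $A^{(2)}_{2n-1},C^{(1)}_n$, $\epsilon_{n-1}+\epsilon_n$ for $A^{(2)\dagger}_{2n-1}$. Put $\omega_i=\epsilon_1+\cdots+\epsilon_i$ and $\overline\omega_n=\epsilon_1+\cdots+\epsilon_{n-1}-\epsilon_n$. **Algebra.** The base field is $K=\mathbf Q(q^{1/2})$ for $A^{(2)}_{2n}$ and $K=\mathbf Q(q)$ otherwise. Put $q_i=q^{(\alpha_i|\alpha_i)/2}$, $[m]_i=(q_i^m-q_i^{-m})/(q_i-q_i^{-1})$. $U_q(\overline{\mathfrak g})$ is the $K$-algebra generated by $e_i,f_i,t_i^{\pm1}$ ($1\le i\le n$) with commuting $t_i$, $t_ie_jt_i^{-1}=q^{(\alpha_i|\alpha_j)}e_j$, $t_if_jt_i^{-1}=q^{-(\alpha_i|\alpha_j)}f_j$, $[e_i,f_j]=\delta_{ij}(t_i-t_i^{-1})/(q_i-q_i^{-1})$ and the quantum Serre relations. Coproduct: $\Delta(e_i)=e_i\otimes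 t_i^{-1}+1\otimes e_i$, $\Delta(f_i)=f_i\otimes1+t_i\otimes f_i$, $\Delta(t_i)=t_i\otimes t_i$; tensor powers are modules via iterated $\Delta$. $V(\lambda)$ is the finite-dimensional irreducible module generated by a vector $u$ with $e_iu=0$, $t_iu=q^{(\alpha_i|\lambda)}u$. **Vector representation.** $J=\{\pm1,\dots,\pm n\}$, together with $0$ for $A^{(2)}_{2n}$, ordered by $1\prec2\prec\cdots\prec n(\prec0)\prec-n\prec\cdots\prec-1$. $V$ has basis $\{v_j\}_{j\in J}$, $E_{ij}v_k=\delta_{jk}v_i$. The action: $e_i=E_{i,i+1}+E_{-i-1,-i}$ ($1\le i<n$); $e_n=[2]_nE_{n0}+E_{0,-n}$ for $A^{(2)}_{2n}$, $E_{n,-n}$ for $A^{(2)}_{2n-1},C^{(1)}_n$, $E_{n-1,-n}+E_{n,-n+1}$ for $A^{(2)\dagger}_{2n-1}$; $f_i=e_i^{t}$ (transpose) except $f_n=E_{0n}+[2]_nE_{-n,0}$ for $A^{(2)}_{2n}$; $t_iv_j=q^{(\alpha_i|\mathrm{wt}\,v_j)}v_j$ with $\mathrm{wt}\,v_{\pm j}=\pm\epsilon_j$ ($j>0$), $\mathrm{wt}\,v_0=0$. **The operator $\check R(z)$ on $V\otimes V$.** $$\check R(z)=(1-q^2z)(1-\xi z)\sum_{i\ne0}E_{ii}\otimes E_{ii}+q(1-z)(1-\xi z)\sum_{i\ne\pm j}E_{ij}\otimes E_{ji}$$ $$+(1-q^2)(1-\xi z)\Big(\sum_{i\succ j,\,i\ne-j}+z\sum_{i\prec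 j,\,i\ne-j}\Big)E_{ii}\otimes E_{jj}+\sum_{i,j}a_{ij}(z)E_{-i,j}\otimes E_{i,-j},$$ where $a_{ii}(z)=(q^2-\xi z)(1-z)+\delta_{i0}(1-q)(q+z)(1-\xi z)$; for $i\prec j$, $a_{ij}(z)=(1-q^2)\big(\varepsilon_j\varepsilon_i^{-1}(-q)^{\bar j-\bar i}(z-1)+\delta_{i,-j}(1-\xi z)\big)$; for $i\succ j$, $a_{ij}(z)=(1-q^2)z\big(\varepsilon_j\varepsilon_i^{-1}\xi(-q)^{\bar j-\bar i}(z-1)+\delta_{i,-j}(1-\xi z)\big)$. Here $\varepsilon_j=1$ for all $j$ if $\mathfrak g=A^{(2)\dagger}_{2n-1}$; otherwise $\varepsilon_j=1$ ($j>0$), $[2]_n$ ($j=0$), $-1$ ($j<0$). Also $\bar j=j$ ($j>0$), $\bar0=n+1$, $\bar j=j+N$ ($j<0$), and $(N,\xi)=(2n+1,-q^{2n+1})$, $(2n+2,-q^{2n})$, $(2n,-q^{2n})$, $(2n+2,q^{2n+2})$ for $A^{(2)}_{2n},A^{(2)}_{2n-1},A^{(2)\dagger}_{2n-1},C^{(1)}_n$ respectively. *)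

theory Defs
  imports "HOL-Algebra.Algebra" "HOL-Algebra.Algebraic_Closure_Type" "HOL-Computational_Algebra.Computational_Algebra"
begin

text \<open>The finite-dimensional parts are of type \<open>B\<^sub>n\<close>, \<open>C\<^sub>n\<close>, \<open>D\<^sub>n\<close> and \<open>C\<^sub>n\<close>; \<open>A2_odd_dagger\<close> is the affine
  algebra of \<open>A2_odd\<close> with another labelling of the Dynkin vertices.\<close>

datatype affine_type = A2_even | A2_odd | A2_odd_dagger | C1

text \<open>The field of rational functions over the rationals in one indeterminate.  The indeterminate
  is \<open>q\<close>, except for \<open>A2_even\<close>, where it is the square root of \<open>q\<close>.\<close>

type_synonym K = "rat poly fract"

abbreviation Kring :: "K ring" where
  "Kring \<equiv> ring_of_type_algebra"

definition indet :: K where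
  "indet = Fract [:0, 1:] 1"

definition q :: "affine_type \<Rightarrow> K" where
  "q tp = (if tp = A2_even then indet ^ 2 else indet)"

text \<open>\<open>q_half tp m\<close> is \<open>q\<close> to the power \<open>m / 2\<close>; for types other than \<open>A2_even\<close> it is
  meaningful for even \<open>m\<close> only.\<close>

definition q_half :: "affine_type \<Rightarrow> int \<Rightarrow> K" where
  "q_half tp m = (if tp = A2_even then indet powi m else indet powi (m div 2))"

text \<open>A weight is given by its coordinates at \<open>1, \<dots>, n\<close> with respect to the orthonormal
  family \<open>\<epsilon>\<close>.\<close>

type_synonym weight = "nat \<Rightarrow> int"

definition inner_wt :: "nat \<Rightarrow> weight \<Rightarrow> weight \<Rightarrow> int" where
  "inner_wt n x y = (\<Sum>m\<in>{1..n}. x m * y m)"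

definition eps_wt :: "nat \<Rightarrow> weight" where
  "eps_wt i = (\<lambda>m. if m = i then 1 else 0)"

definition simple_root :: "affine_type \<Rightarrow> nat \<Rightarrow> nat \<Rightarrow> weight" where
  "simple_root tp n i =
     (if i < n then (\<lambda>m. eps_wt i m - eps_wt (i + 1) m)
      else case tp of
        A2_even \<Rightarrow> eps_wt n
      | A2_odd \<Rightarrow> (\<lambda>m. 2 * eps_wt n m)
      | A2_odd_dagger \<Rightarrow> (\<lambda>m. eps_wt (n - 1) m + eps_wt n m)
      | C1 \<Rightarrow> (\<lambda>m. 2 * eps_wt n m))"

definition omega :: "nat \<Rightarrow> weight" where
  "omega k = (\<lambda>m. \<Sum>i\<in>{1..k}. eps_wt i m)"

definition omega_bar :: "nat \<Rightarrow> weight" where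
  "omega_bar n = (\<lambda>m. (\<Sum>i\<in>{1..n - 1}. eps_wt i m) - eps_wt n m)"

definition root_ip :: "affine_type \<Rightarrow> nat \<Rightarrow> nat \<Rightarrow> nat \<Rightarrow> int" where
  "root_ip tp n i j = inner_wt n (simple_root tp n i) (simple_root tp n j)"

definition cartan :: "affine_type \<Rightarrow> nat \<Rightarrow> nat \<Rightarrow> nat \<Rightarrow> int" where
  "cartan tp n i j = (2 * root_ip tp n i j) div root_ip tp n i i"

definition q_i :: "affine_type \<Rightarrow> nat \<Rightarrow> nat \<Rightarrow> K" where
  "q_i tp n i = q_half tp (root_ip tp n i i)"

definition qint :: "affine_type \<Rightarrow> nat \<Rightarrow> nat \<Rightarrow> nat \<Rightarrow> K" where
  "qint tp n i m = (q_i tp n i ^ m - inverse (q_i tp n i) ^ m) / (q_i tp n i - inverse (q_i tp n i))"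

definition qfact :: "affine_type \<Rightarrow> nat \<Rightarrow> nat \<Rightarrow> nat \<Rightarrow> K" where
  "qfact tp n i r = (\<Prod>m\<in>{1..r}. qint tp n i m)"

definition qbinom :: "affine_type \<Rightarrow> nat \<Rightarrow> nat \<Rightarrow> nat \<Rightarrow> nat \<Rightarrow> K" where
  "qbinom tp n i r m = qfact tp n i r / (qfact tp n i m * qfact tp n i (r - m))"

text \<open>The algebra is given by generators and relations over \<open>K\<close>, so a module over it is a
  \<open>K\<close>-vector space with linear operators, one for each generator, that satisfy the relations.
  Submodules and homomorphisms only have to respect the generators.  The fields \<open>mult\<close> and
  \<open>one\<close> inherited from the record \<open>module\<close> play no role.\<close>

datatype uq_gen = gen_e nat | gen_f nat | gen_t nat | gen_tinv nat

definition uq_gens :: "nat \<Rightarrow> uq_gen set" where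
  "uq_gens n = gen_e ` {1..n} \<union> gen_f ` {1..n} \<union> gen_t ` {1..n} \<union> gen_tinv ` {1..n}"

record ('a, 'b) uq_rep = "('a, 'b) module" +
  act :: "uq_gen \<Rightarrow> 'b \<Rightarrow> 'b"

locale uq_module = module Kring M
  for tp :: affine_type and n :: nat and M :: "(K, 'b) uq_rep" (structure) +
  assumes act_closed: "\<lbrakk>g \<in> uq_gens n; x \<in> carrier M\<rbrakk> \<Longrightarrow> act M g x \<in> carrier M"
    and act_add: "\<lbrakk>g \<in> uq_gens n; x \<in> carrier M; y \<in> carrier M\<rbrakk>
          \<Longrightarrow> act M g (x \<oplus>\<^bsub>M\<^esub> y) = act M g x \<oplus>\<^bsub>M\<^esub> act M g y"
    and act_smult: "\<lbrakk>g \<in> uq_gens n; x \<in> carrier M\<rbrakk>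
          \<Longrightarrow> act M g (c \<odot>\<^bsub>M\<^esub> x) = c \<odot>\<^bsub>M\<^esub> act M g x"
    and t_tinv: "\<lbrakk>i \<in> {1..n}; x \<in> carrier M\<rbrakk> \<Longrightarrow> act M (gen_t i) (act M (gen_tinv i) x) = x"
    and tinv_t: "\<lbrakk>i \<in> {1..n}; x \<in> carrier M\<rbrakk> \<Longrightarrow> act M (gen_tinv i) (act M (gen_t i) x) = x"
    and t_t: "\<lbrakk>i \<in> {1..n}; j \<in> {1..n}; x \<in> carrier M\<rbrakk>
          \<Longrightarrow> act M (gen_t i) (act M (gen_t j) x) = act M (gen_t j) (act M (gen_t i) x)"
    and t_e: "\<lbrakk>i \<in> {1..n}; j \<in> {1..n}; x \<in> carrier M\<rbrakk>
          \<Longrightarrow> act M (gen_t i) (act M (gen_e j) (act M (gen_tinv i) x))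
              = (q tp powi root_ip tp n i j) \<odot>\<^bsub>M\<^esub> act M (gen_e j) x"
    and t_f: "\<lbrakk>i \<in> {1..n}; j \<in> {1..n}; x \<in> carrier M\<rbrakk>
          \<Longrightarrow> act M (gen_t i) (act M (gen_f j) (act M (gen_tinv i) x))
              = (q tp powi (- root_ip tp n i j)) \<odot>\<^bsub>M\<^esub> act M (gen_f j) x"
    and e_f: "\<lbrakk>i \<in> {1..n}; j \<in> {1..n}; x \<in> carrier M\<rbrakk>
          \<Longrightarrow> act M (gen_e i) (act M (gen_f j) x) \<ominus>\<^bsub>M\<^esub> act M (gen_f j) (act M (gen_e i) x)
              = (if i = j
                 then inverse (q_i tp n i - inverse (q_i tp n i))
                        \<odot>\<^bsub>M\<^esub> (act M (gen_t i) x \<ominus>\<^bsub>M\<^esub> act M (gen_tinv i) x)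
                 else \<zero>\<^bsub>M\<^esub>)"
    and serre_e: "\<lbrakk>i \<in> {1..n}; j \<in> {1..n}; i \<noteq> j; x \<in> carrier M; r = nat (1 - cartan tp n i j)\<rbrakk>
          \<Longrightarrow> (\<Oplus>\<^bsub>M\<^esub>m\<in>{..r}. ((- 1) ^ m * qbinom tp n i r m) \<odot>\<^bsub>M\<^esub>
                 (act M (gen_e i) ^^ (r - m)) (act M (gen_e j) ((act M (gen_e i) ^^ m) x))) = \<zero>\<^bsub>M\<^esub>"
    and serre_f: "\<lbrakk>i \<in> {1..n}; j \<in> {1..n}; i \<noteq> j; x \<in> carrier M; r = nat (1 - cartan tp n i j)\<rbrakk>
          \<Longrightarrow> (\<Oplus>\<^bsub>M\<^esub>m\<in>{..r}. ((- 1) ^ m * qbinom tp n i r m) \<odot>\<^bsub>M\<^esub>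
                 (act M (gen_f i) ^^ (r - m)) (act M (gen_f j) ((act M (gen_f i) ^^ m) x))) = \<zero>\<^bsub>M\<^esub>"

definition uq_hom :: "nat \<Rightarrow> (K, 'b) uq_rep \<Rightarrow> (K, 'c) uq_rep \<Rightarrow> ('b \<Rightarrow> 'c) set" where
  "uq_hom n M N = {h \<in> carrier M \<rightarrow> carrier N.
     (\<forall>x\<in>carrier M. \<forall>y\<in>carrier M. h (x \<oplus>\<^bsub>M\<^esub> y) = h x \<oplus>\<^bsub>N\<^esub> h y) \<and>
     (\<forall>c. \<forall>x\<in>carrier M. h (c \<odot>\<^bsub>M\<^esub> x) = c \<odot>\<^bsub>N\<^esub> h x) \<and>
     (\<forall>g\<in>uq_gens n. \<forall>x\<in>carrier M. h (act M g x) = act N g (h x))}"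

definition uq_iso :: "nat \<Rightarrow> (K, 'b) uq_rep \<Rightarrow> (K, 'c) uq_rep \<Rightarrow> bool" where
  "uq_iso n M N \<longleftrightarrow> (\<exists>h\<in>uq_hom n M N. bij_betw h (carrier M) (carrier N))"

definition uq_submodule :: "nat \<Rightarrow> 'b set \<Rightarrow> (K, 'b) uq_rep \<Rightarrow> bool" where
  "uq_submodule n N M \<longleftrightarrow> submodule N Kring M \<and> (\<forall>g\<in>uq_gens n. \<forall>x\<in>N. act M g x \<in> N)"

definition uq_irreducible :: "nat \<Rightarrow> (K, 'b) uq_rep \<Rightarrow> bool" where
  "uq_irreducible n M \<longleftrightarrow> carrier M \<noteq> {\<zero>\<^bsub>M\<^esub>} \<and>
     (\<forall>N. uq_submodule n N M \<longrightarrow> N = {\<zero>\<^bsub>M\<^esub>} \<or> N = carrier M)"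

definition K_span :: "(K, 'b) uq_rep \<Rightarrow> 'b set \<Rightarrow> 'b set" where
  "K_span M B = (\<lambda>N. submodule N Kring M) hull B"

definition finite_dimensional :: "(K, 'b) uq_rep \<Rightarrow> bool" where
  "finite_dimensional M \<longleftrightarrow> (\<exists>B. finite B \<and> B \<subseteq> carrier M \<and> K_span M B = carrier M)"

text \<open>\<open>is_V tp n \<mu> M\<close> says that \<open>M\<close> is the module \<open>V(\<mu>)\<close>, which is specified up to isomorphism
  by its defining properties.\<close>

definition is_V :: "affine_type \<Rightarrow> nat \<Rightarrow> weight \<Rightarrow> (K, 'b) uq_rep \<Rightarrow> bool" where
  "is_V tp n \<mu> M \<longleftrightarrow> uq_module tp n M \<and> finite_dimensional M \<and> uq_irreducible n M \<and>
     (\<exists>u\<in>carrier M. (\<lambda>N. uq_submodule n N M) hull {u} = carrier M \<and>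
        (\<forall>i\<in>{1..n}. act M (gen_e i) u = \<zero>\<^bsub>M\<^esub> \<and>
           act M (gen_t i) u = (q tp powi inner_wt n (simple_root tp n i) \<mu>) \<odot>\<^bsub>M\<^esub> u))"

definition uq_direct_sum :: "'i set \<Rightarrow> ('i \<Rightarrow> (K, 'b) uq_rep) \<Rightarrow> (K, 'i \<Rightarrow> 'b) uq_rep" where
  "uq_direct_sum I M =
     \<lparr>carrier = (\<Pi>\<^sub>E i\<in>I. carrier (M i)),
      monoid.mult = undefined, one = undefined,
      ring.zero = (\<lambda>i\<in>I. \<zero>\<^bsub>M i\<^esub>),
      add = (\<lambda>x y. \<lambda>i\<in>I. x i \<oplus>\<^bsub>M i\<^esub> y i),
      module.smult = (\<lambda>c x. \<lambda>i\<in>I. c \<odot>\<^bsub>M i\<^esub> x i),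
      act = (\<lambda>g x. \<lambda>i\<in>I. act (M i) g (x i))\<rparr>"

text \<open>The quotient by a submodule \<open>S\<close>, with cosets as elements.  The union over the
  representatives \<open>x\<close> is a single coset whenever the operation is well defined.\<close>

definition uq_quotient :: "(K, 'b) uq_rep \<Rightarrow> 'b set \<Rightarrow> (K, 'b set) uq_rep" where
  "uq_quotient M S =
     \<lparr>carrier = a_rcosets\<^bsub>M\<^esub> S,
      monoid.mult = undefined, one = undefined,
      ring.zero = S,
      add = set_add M,
      module.smult = (\<lambda>c C. \<Union>x\<in>C. S +>\<^bsub>M\<^esub> (c \<odot>\<^bsub>M\<^esub> x)),
      act = (\<lambda>g C. \<Union>x\<in>C. S +>\<^bsub>M\<^esub> act M g x)\<rparr>"

definition idx :: "affine_type \<Rightarrow> nat \<Rightarrow> int set" where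
  "idx tp n = {j. 1 \<le> \<bar>j\<bar> \<and> \<bar>j\<bar> \<le> int n} \<union> (if tp = A2_even then {0} else {})"

text \<open>Position in the order \<open>1 \<prec> \<dots> \<prec> n \<prec> 0 \<prec> -n \<prec> \<dots> \<prec> -1\<close>.\<close>

definition idx_pos :: "nat \<Rightarrow> int \<Rightarrow> int" where
  "idx_pos n j = (if j > 0 then j else if j = 0 then int n + 1 else 2 * int n + 2 + j)"

definition prec :: "nat \<Rightarrow> int \<Rightarrow> int \<Rightarrow> bool" where
  "prec n i j \<longleftrightarrow> idx_pos n i < idx_pos n j"

definition idx_wt :: "int \<Rightarrow> weight" where
  "idx_wt j = (\<lambda>m. if int m = \<bar>j\<bar> then sgn j else 0)"

definition EE :: "int \<Rightarrow> int \<Rightarrow> int \<Rightarrow> int \<Rightarrow> K" where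
  "EE i j = (\<lambda>a b. if a = i \<and> b = j then 1 else 0)"

definition vec_e :: "affine_type \<Rightarrow> nat \<Rightarrow> nat \<Rightarrow> int \<Rightarrow> int \<Rightarrow> K" where
  "vec_e tp n i = (\<lambda>a b.
     if i < n then EE (int i) (int i + 1) a b + EE (- int i - 1) (- int i) a b
     else case tp of
       A2_even \<Rightarrow> qint tp n n 2 * EE (int n) 0 a b + EE 0 (- int n) a b
     | A2_odd \<Rightarrow> EE (int n) (- int n) a b
     | A2_odd_dagger \<Rightarrow> EE (int n - 1) (- int n) a b + EE (int n) (- int n + 1) a b
     | C1 \<Rightarrow> EE (int n) (- int n) a b)"

definition vec_f :: "affine_type \<Rightarrow> nat \<Rightarrow> nat \<Rightarrow> int \<Rightarrow> int \<Rightarrow> K" where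
  "vec_f tp n i = (\<lambda>a b.
     if tp = A2_even \<and> i = n then EE 0 (int n) a b + qint tp n n 2 * EE (- int n) 0 a b
     else vec_e tp n i b a)"

text \<open>A vector of \<open>V\<close> is given by its coefficients in the basis \<open>v\<^sub>j\<close>.\<close>

definition mat_op :: "affine_type \<Rightarrow> nat \<Rightarrow> (int \<Rightarrow> int \<Rightarrow> K) \<Rightarrow> (int \<Rightarrow> K) \<Rightarrow> int \<Rightarrow> K" where
  "mat_op tp n A v = (\<lambda>a. \<Sum>b\<in>idx tp n. A a b * v b)"

fun vec_act :: "affine_type \<Rightarrow> nat \<Rightarrow> uq_gen \<Rightarrow> (int \<Rightarrow> K) \<Rightarrow> int \<Rightarrow> K" where
  "vec_act tp n (gen_e i) v = mat_op tp n (vec_e tp n i) v"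
| "vec_act tp n (gen_f i) v = mat_op tp n (vec_f tp n i) v"
| "vec_act tp n (gen_t i) v = (\<lambda>j. q tp powi inner_wt n (simple_root tp n i) (idx_wt j) * v j)"
| "vec_act tp n (gen_tinv i) v = (\<lambda>j. q tp powi (- inner_wt n (simple_root tp n i) (idx_wt j)) * v j)"

text \<open>An element of the \<open>k\<close>-th tensor power of \<open>V\<close> is given by its coefficients in the basis of
  tensors of basis vectors, indexed by words of length \<open>k\<close> over the index set.  \<open>op_tensor A B\<close>
  is the operator \<open>A \<otimes> B\<close> on the tensor product of \<open>V\<close> and another tensor power of \<open>V\<close>.\<close>

definition op_tensor ::
  "((int \<Rightarrow> K) \<Rightarrow> int \<Rightarrow> K) \<Rightarrow> ((int list \<Rightarrow> K) \<Rightarrow> int list \<Rightarrow> K) \<Rightarrow> (int list \<Rightarrow> K) \<Rightarrow> int list \<Rightarrow> K"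
  where
  "op_tensor A B x = (\<lambda>w. case w of [] \<Rightarrow> 0 | a # u \<Rightarrow> A (\<lambda>j. B (\<lambda>u'. x (j # u')) u) a)"

text \<open>Iterated coproduct; the empty tensor power is the trivial module given by the counit.\<close>

fun tpow_act :: "affine_type \<Rightarrow> nat \<Rightarrow> nat \<Rightarrow> uq_gen \<Rightarrow> (int list \<Rightarrow> K) \<Rightarrow> int list \<Rightarrow> K" where
  "tpow_act tp n 0 (gen_e i) x = (\<lambda>w. 0)"
| "tpow_act tp n 0 (gen_f i) x = (\<lambda>w. 0)"
| "tpow_act tp n 0 (gen_t i) x = x"
| "tpow_act tp n 0 (gen_tinv i) x = x"
| "tpow_act tp n (Suc k) (gen_e i) x = (\<lambda>w.
     op_tensor (vec_act tp n (gen_e i)) (tpow_act tp n k (gen_tinv i)) x w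
     + op_tensor (\<lambda>v. v) (tpow_act tp n k (gen_e i)) x w)"
| "tpow_act tp n (Suc k) (gen_f i) x = (\<lambda>w.
     op_tensor (vec_act tp n (gen_f i)) (\<lambda>y. y) x w
     + op_tensor (vec_act tp n (gen_t i)) (tpow_act tp n k (gen_f i)) x w)"
| "tpow_act tp n (Suc k) (gen_t i) x =
     op_tensor (vec_act tp n (gen_t i)) (tpow_act tp n k (gen_t i)) x"
| "tpow_act tp n (Suc k) (gen_tinv i) x =
     op_tensor (vec_act tp n (gen_tinv i)) (tpow_act tp n k (gen_tinv i)) x"

definition tpow :: "affine_type \<Rightarrow> nat \<Rightarrow> nat \<Rightarrow> (K, int list \<Rightarrow> K) uq_rep" where
  "tpow tp n k =
     \<lparr>carrier = {x. \<forall>w. x w \<noteq> 0 \<longrightarrow> length w = k \<and> set w \<subseteq> idx tp n},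
      monoid.mult = undefined, one = undefined,
      ring.zero = (\<lambda>w. 0),
      add = (\<lambda>x y w. x w + y w),
      module.smult = (\<lambda>c x w. c * x w),
      act = tpow_act tp n k\<rparr>"

definition shift_N :: "affine_type \<Rightarrow> nat \<Rightarrow> int" where
  "shift_N tp n = (case tp of
     A2_even \<Rightarrow> 2 * int n + 1
   | A2_odd \<Rightarrow> 2 * int n + 2
   | A2_odd_dagger \<Rightarrow> 2 * int n
   | C1 \<Rightarrow> 2 * int n + 2)"

definition xi :: "affine_type \<Rightarrow> nat \<Rightarrow> K" where
  "xi tp n = (case tp of
     A2_even \<Rightarrow> - (q tp ^ (2 * n + 1))
   | A2_odd \<Rightarrow> - (q tp ^ (2 * n))
   | A2_odd_dagger \<Rightarrow> - (q tp ^ (2 * n))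
   | C1 \<Rightarrow> q tp ^ (2 * n + 2))"

definition idx_sign :: "affine_type \<Rightarrow> nat \<Rightarrow> int \<Rightarrow> K" where
  "idx_sign tp n j =
     (if tp = A2_odd_dagger then 1
      else if j > 0 then 1 else if j = 0 then qint tp n n 2 else - 1)"

definition idx_bar :: "affine_type \<Rightarrow> nat \<Rightarrow> int \<Rightarrow> int" where
  "idx_bar tp n j = (if j > 0 then j else if j = 0 then int n + 1 else j + shift_N tp n)"

definition R_coeff :: "affine_type \<Rightarrow> nat \<Rightarrow> K \<Rightarrow> int \<Rightarrow> int \<Rightarrow> K" where
  "R_coeff tp n z i j =
     (if i = j then
        (q tp ^ 2 - xi tp n * z) * (1 - z)
        + of_bool (i = 0) * ((1 - q tp) * (q tp + z) * (1 - xi tp n * z))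
      else if prec n i j then
        (1 - q tp ^ 2) *
          (idx_sign tp n j * inverse (idx_sign tp n i)
             * (- q tp) powi (idx_bar tp n j - idx_bar tp n i) * (z - 1)
           + of_bool (i = - j) * (1 - xi tp n * z))
      else
        (1 - q tp ^ 2) * z *
          (idx_sign tp n j * inverse (idx_sign tp n i) * xi tp n
             * (- q tp) powi (idx_bar tp n j - idx_bar tp n i) * (z - 1)
           + of_bool (i = - j) * (1 - xi tp n * z)))"

text \<open>\<open>R_matrix tp n z a b c d\<close> is the coefficient of \<open>v\<^sub>a \<otimes> v\<^sub>b\<close> in the image of \<open>v\<^sub>c \<otimes> v\<^sub>d\<close>.\<close>

definition R_matrix :: "affine_type \<Rightarrow> nat \<Rightarrow> K \<Rightarrow> int \<Rightarrow> int \<Rightarrow> int \<Rightarrow> int \<Rightarrow> K" where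
  "R_matrix tp n z a b c d =
     (let J = idx tp n in
      (1 - q tp ^ 2 * z) * (1 - xi tp n * z) * (\<Sum>i\<in>J - {0}. EE i i a c * EE i i b d)
      + q tp * (1 - z) * (1 - xi tp n * z) *
          (\<Sum>(i, j)\<in>{(i, j) \<in> J \<times> J. i \<noteq> j \<and> i \<noteq> - j}. EE i j a c * EE j i b d)
      + (1 - q tp ^ 2) * (1 - xi tp n * z) *
          ((\<Sum>(i, j)\<in>{(i, j) \<in> J \<times> J. prec n j i \<and> i \<noteq> - j}. EE i i a c * EE j j b d)
           + z * (\<Sum>(i, j)\<in>{(i, j) \<in> J \<times> J. prec n i j \<and> i \<noteq> - j}. EE i i a c * EE j j b d))
      + (\<Sum>(i, j)\<in>J \<times> J. R_coeff tp n z i j * (EE (- i) j a c * EE i (- j) b d)))"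

definition R_op :: "affine_type \<Rightarrow> nat \<Rightarrow> K \<Rightarrow> (int list \<Rightarrow> K) \<Rightarrow> int list \<Rightarrow> K" where
  "R_op tp n z x = (\<lambda>w. case w of
     [a, b] \<Rightarrow> (\<Sum>c\<in>idx tp n. \<Sum>d\<in>idx tp n. R_matrix tp n z a b c d * x [c, d])
   | _ \<Rightarrow> 0)"

definition W :: "affine_type \<Rightarrow> nat \<Rightarrow> (int list \<Rightarrow> K) set" where
  "W tp n = R_op tp n (q tp ^ 2) ` carrier (tpow tp n 2)"

text \<open>The tensor product of a vector in the \<open>a\<close>-th tensor power with another vector.\<close>

definition vec_tensor :: "nat \<Rightarrow> (int list \<Rightarrow> K) \<Rightarrow> (int list \<Rightarrow> K) \<Rightarrow> int list \<Rightarrow> K" where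
  "vec_tensor a x y = (\<lambda>w. x (take a w) * y (drop a w))"

definition tensor_W :: "affine_type \<Rightarrow> nat \<Rightarrow> nat \<Rightarrow> nat \<Rightarrow> (int list \<Rightarrow> K) set" where
  "tensor_W tp n a b = K_span (tpow tp n (a + 2 + b))
     {vec_tensor a x (vec_tensor 2 w y) |x w y.
        x \<in> carrier (tpow tp n a) \<and> w \<in> W tp n \<and> y \<in> carrier (tpow tp n b)}"

definition relations :: "affine_type \<Rightarrow> nat \<Rightarrow> nat \<Rightarrow> (int list \<Rightarrow> K) set" where
  "relations tp n k = K_span (tpow tp n k) (\<Union>i\<in>{1..k - 1}. tensor_W tp n (i - 1) (k - i - 1))"

definition V_quot :: "affine_type \<Rightarrow> nat \<Rightarrow> nat \<Rightarrow> (K, (int list \<Rightarrow> K) set) uq_rep" where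
  "V_quot tp n k = uq_quotient (tpow tp n k) (relations tp n k)"

text \<open>\<open>M\<close> is isomorphic to the direct sum of the modules \<open>V(\<mu>)\<close>, one for each weight \<open>\<mu>\<close>
  in the finite set \<open>\<Lambda>\<close>.  Taking the summands over the carrier type of \<open>M\<close> is no restriction,
  since submodules of \<open>M\<close> live there.\<close>

definition iso_sum_V :: "affine_type \<Rightarrow> nat \<Rightarrow> (K, 'b) uq_rep \<Rightarrow> weight set \<Rightarrow> bool" where
  "iso_sum_V tp n M \<Lambda> \<longleftrightarrow>
     (\<exists>L :: weight \<Rightarrow> (K, 'b) uq_rep. (\<forall>\<mu>\<in>\<Lambda>. is_V tp n \<mu> (L \<mu>)) \<and> uq_iso n M (uq_direct_sum \<Lambda> L))"

end

theory Submission
  imports Defs "HOL-Library.Function_Algebras"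
begin

text \<open>
  Everything is done over the field of rational functions, ordered such that \<open>q > 1\<close>.  The tensor
  power carries a positive definite form for which \<open>f\<^sub>i\<close> is, up to a positive factor and powers of
  \<open>t\<^sub>i\<close>, the adjoint of \<open>e\<^sub>i\<close>.  Hence complete reducibility and the theory of highest weights
  become elementary: the quotient of the tensor power by \<open>W\<close>-relations is isomorphic to their
  orthogonal complement, which is the sum of the submodules generated by its primitive vectors.

  The complement consists of the vectors whose coefficients satisfy explicit quantum antisymmetry
  relations in adjacent letters.  Such a vector is determined by its coefficients at increasing words.
  If it is primitive, dominance leaves only the words with letters \<open>1, \<dots>, s\<close>, to which pairs \<open>j, -j\<close>
  with \<open>j > s\<close> (and possibly \<open>0\<close>) are added; the equations \<open>e\<^sub>i x = 0\<close> reduce these to a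
  single coefficient, and outside type \<open>A2_odd\<close> the relation at \<open>1, -1\<close>, transported along the
  chain \<open>j, -j\<close>, forces it to vanish if there are any pairs.  The remaining primitive vectors exist because
  the quantum exterior algebra of type \<open>A2_odd\<close> has a basis of increasing words.
\<close>

subsection \<open>Definite forms on spaces of functions\<close>

text \<open>The order makes the indeterminate larger than every constant, so nothing is specialised
  to a number: a sum of squares with positive weights vanishes only termwise, and projections and
  positivity arguments need no more.

  The exceptional role of \<open>A2_odd\<close> comes from one constant. Orthogonality to the zero
  weight columns of the R-matrix gives one equation per letter. Differences of neighbouring
  equations relate the coefficients at j,-j to those at j+1,-j-1, and the equation left over reduces
  to c - 1 times the sum of the coefficients at (1,-1) and (-1,1). Here c is 1 exactly for
  \<open>A2_odd\<close>, so that the relation at 1,-1 is lost and further highest weights survive;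
  otherwise c is \<open>- q\<^sup>2\<close>.

  A single exterior algebra serves all types for existence because the types differ only in
  relations involving opposite letters or 0. If the absolute values of the coordinates of a weight
  add up to k, its words of length k contain neither, and those relations are void.

  The Serre relations are not checked on words: they follow from the other relations, as every
  \<open>e_i\<close> acts nilpotently on a finite set of words.\<close>

definition smul :: "'k::times \<Rightarrow> ('w \<Rightarrow> 'k) \<Rightarrow> 'w \<Rightarrow> 'k"  (infixr \<open>\<star>\<close> 75)
  where "c \<star> x = (\<lambda>w. c * x w)"

lemma smul_apply [simp]: "(c \<star> x) w = c * x w"
  by (simp add: smul_def)

lemma smul_simps [simp]:
  fixes x :: "'w \<Rightarrow> 'k::comm_ring_1"
  shows "1 \<star> x = x" "0 \<star> x = 0" "c \<star> (0 :: 'w \<Rightarrow> 'k) = 0" "c \<star> d \<star> x = (c * d) \<star> x"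
  by (auto simp: fun_eq_iff)

lemma smul_distribs:
  fixes x y :: "'w \<Rightarrow> 'k::comm_ring_1"
  shows "c \<star> (x + y) = c \<star> x + c \<star> y" "c \<star> (x - y) = c \<star> x - c \<star> y"
    "(c + d) \<star> x = c \<star> x + d \<star> x" "(c - d) \<star> x = c \<star> x - d \<star> x"
    "(- c) \<star> x = - (c \<star> x)" "c \<star> (- x) = - (c \<star> x)"
  by (auto simp: fun_eq_iff algebra_simps)

definition subsp :: "('w \<Rightarrow> 'k::comm_ring_1) set \<Rightarrow> bool" where
  "subsp P \<longleftrightarrow> 0 \<in> P \<and> (\<forall>x\<in>P. \<forall>y\<in>P. x + y \<in> P) \<and> (\<forall>c. \<forall>x\<in>P. c \<star> x \<in> P)"

lemma subspD:
  assumes "subsp P"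
  shows "0 \<in> P" "x \<in> P \<Longrightarrow> y \<in> P \<Longrightarrow> x + y \<in> P" "x \<in> P \<Longrightarrow> c \<star> x \<in> P"
    "x \<in> P \<Longrightarrow> - x \<in> P" "x \<in> P \<Longrightarrow> y \<in> P \<Longrightarrow> x - y \<in> P"
proof -
  show *: "0 \<in> P" "x \<in> P \<Longrightarrow> y \<in> P \<Longrightarrow> x + y \<in> P" "x \<in> P \<Longrightarrow> c \<star> x \<in> P" for x y c
    using assms by (auto simp: subsp_def)
  have "- x = (- 1) \<star> x" for x :: "'a \<Rightarrow> 'b" by (auto simp: fun_eq_iff)
  then show **: "x \<in> P \<Longrightarrow> - x \<in> P" for x using *(3)[of x "- 1"] by simp
  show "x \<in> P \<Longrightarrow> y \<in> P \<Longrightarrow> x - y \<in> P" using *(2)[of x "- y"] **[of y] by simp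
qed

lemma subsp_sum: "subsp P \<Longrightarrow> (\<And>i. i \<in> I \<Longrightarrow> f i \<in> P) \<Longrightarrow> (\<Sum>i\<in>I. f i) \<in> P"
  by (induction I rule: infinite_finite_induct) (simp_all add: subspD(1,2))

lemma sum_fun_apply: "(\<Sum>i\<in>I. f i) w = (\<Sum>i\<in>I. f i w)"
  by (induction I rule: infinite_finite_induct) auto

definition supported :: "'w set \<Rightarrow> ('w \<Rightarrow> 'k::comm_ring_1) set" where
  "supported D = {x. \<forall>w. x w \<noteq> 0 \<longrightarrow> w \<in> D}"

lemma supportedI: "(\<And>w. w \<notin> D \<Longrightarrow> x w = 0) \<Longrightarrow> x \<in> supported D"
  by (auto simp: supported_def)

lemma supportedD: "x \<in> supported D \<Longrightarrow> w \<notin> D \<Longrightarrow> x w = 0"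
  by (auto simp: supported_def)

lemma subsp_supported: "subsp (supported D :: ('w \<Rightarrow> 'k::comm_ring_1) set)"
  by (force simp: subsp_def supported_def)

definition wip :: "'w set \<Rightarrow> ('w \<Rightarrow> 'k) \<Rightarrow> ('w \<Rightarrow> 'k) \<Rightarrow> ('w \<Rightarrow> 'k) \<Rightarrow> 'k::linordered_field" where
  "wip D g x y = (\<Sum>w\<in>D. g w * x w * y w)"

lemma wip_linear:
  "wip D g (x + y) z = wip D g x z + wip D g y z" "wip D g x (y + z) = wip D g x y + wip D g x z"
  "wip D g (x - y) z = wip D g x z - wip D g y z" "wip D g x (y - z) = wip D g x y - wip D g x z"
  "wip D g (c \<star> x) z = c * wip D g x z" "wip D g x (c \<star> z) = c * wip D g x z"
  "wip D g 0 x = 0" "wip D g x 0 = 0"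
  by (simp_all add: wip_def sum.distrib sum_subtractf sum_distrib_left algebra_simps)

lemma wip_commute: "wip D g x y = wip D g y x"
  by (simp add: wip_def mult.commute mult.left_commute)

lemma wip_nonneg: "(\<And>w. g w > 0) \<Longrightarrow> wip D g x x \<ge> 0"
  unfolding wip_def by (rule sum_nonneg) (simp add: mult.assoc less_imp_le)

lemma wip_pos:
  assumes "finite D" "\<And>w. g w > 0" "w \<in> D" "x w \<noteq> 0"
  shows "wip D g x x > 0"
proof -
  have "g w * (x w * x w) > 0"
    using assms(4) by (intro mult_pos_pos[OF assms(2)]) (simp add: less_le)
  then show ?thesis
    unfolding wip_def using assms(1,3)
    by (intro sum_pos2[of D w]) (auto simp: assms(2) less_imp_le mult.assoc)
qed

text \<open>Orthogonal projection; the induction on the index set splits off the vectors vanishing at the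
  new index and, if there are others, one vector orthogonal to them.\<close>

lemma wip_projection:
  assumes "finite D" "\<And>w. g w > 0" "subsp P" "P \<subseteq> supported D"
  shows "\<exists>p\<in>P. \<forall>y\<in>P. wip D g (x - p) y = 0"
  using assms(1,3,4)
proof (induction D arbitrary: P x)
  case empty
  then have "P = {0}" using subspD(1)[OF empty(1)] by (auto simp: supported_def fun_eq_iff)
  then show ?case by (simp add: wip_def)
next
  case (insert w D)
  define P' where "P' = {p \<in> P. p w = 0}"
  have P': "subsp P'" "P' \<subseteq> supported D"
    using insert.prems subspD[OF insert.prems(1)] unfolding subsp_def P'_def supported_def by auto
  have ipD: "wip (insert w D) g x y = wip D g x y" if "y \<in> P'" for x y
    using that insert.hyps by (simp add: wip_def P'_def)
  have proj: "\<exists>p\<in>P'. \<forall>y\<in>P'. wip (insert w D) g (x - p) y = 0" for x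
    using insert.IH[OF P', of x] ipD by metis
  show ?case
  proof (cases "P = P'")
    case True
    show ?thesis using proj[of x] by (subst (1 2) True)
  next
    case False
    then obtain p0 where p0: "p0 \<in> P" "p0 w \<noteq> 0" by (auto simp: P'_def)
    obtain p1 where p1: "p1 \<in> P'" "\<And>y. y \<in> P' \<Longrightarrow> wip (insert w D) g (p0 - p1) y = 0"
      using proj by blast
    \<comment> \<open>\<open>d\<close> is nonzero at \<open>w\<close> and orthogonal to
      \<open>P'\<close>, so \<open>P\<close> is the orthogonal sum of \<open>P'\<close> and the line
      through \<open>d\<close>; \<open>r\<close> below is the coefficient of the projection to that
      line.\<close>
    define d where "d = p0 - p1"
    have d: "d \<in> P" "d w \<noteq> 0" "\<And>y. y \<in> P' \<Longrightarrow> wip (insert w D) g d y = 0"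
      using p0 p1 subspD[OF insert.prems(1)] by (auto simp: d_def P'_def)
    have dd: "wip (insert w D) g d d > 0"
      using insert.hyps d(2) assms(2) by (intro wip_pos[of _ _ w]) auto
    obtain p where p: "p \<in> P'" "\<And>y. y \<in> P' \<Longrightarrow> wip (insert w D) g (x - p) y = 0"
      using proj by blast
    define r where "r = wip (insert w D) g x d / wip (insert w D) g d d"
    have pP: "p \<in> P" using p by (simp add: P'_def)
    have zero: "wip (insert w D) g (x - (p + r \<star> d)) d = 0"
      using dd d(3)[OF p(1)] by (simp add: wip_linear r_def wip_commute[of _ _ p])
    have "wip (insert w D) g (x - (p + r \<star> d)) y = 0" if y: "y \<in> P" for y
    proof -
      define y' where "y' = y - (y w / d w) \<star> d"
      have y': "y' \<in> P'" using y d subspD[OF insert.prems(1)] by (auto simp: y'_def P'_def)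
      have eq: "y = y' + (y w / d w) \<star> d" by (simp add: y'_def)
      have "wip (insert w D) g (x - (p + r \<star> d)) y' = 0"
        using p(2)[OF y'] d(3)[OF y'] by (simp add: wip_linear)
      with zero have "wip (insert w D) g (x - (p + r \<star> d)) (y' + (y w / d w) \<star> d) = 0"
        unfolding wip_linear(2)[of _ _ _ y'] wip_linear(6) by simp
      then show ?thesis using eq by simp
    qed
    moreover have "p + r \<star> d \<in> P" using pP d(1) subspD[OF insert.prems(1)] by auto
    ultimately show ?thesis by blast
  qed
qed

locale weighted_space =
  fixes D :: "'w set" and g :: "'w \<Rightarrow> 'k::linordered_field"
  assumes finD: "finite D" and g_pos: "g w > 0"
begin

abbreviation "Car \<equiv> supported D :: ('w \<Rightarrow> 'k) set"
abbreviation "ip \<equiv> wip D g"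

definition perp :: "('w \<Rightarrow> 'k) set \<Rightarrow> ('w \<Rightarrow> 'k) set" where
  "perp P = {x \<in> Car. \<forall>y\<in>P. ip x y = 0}"

lemma ip_definite: "x \<in> Car \<Longrightarrow> (ip x x = 0) = (x = 0)"
proof
  assume x: "x \<in> Car" "ip x x = 0"
  have "x w = 0" for w
    using wip_pos[OF finD, of g w x] g_pos supportedD[OF x(1), of w] x(2) by fastforce
  then show "x = 0" by (simp add: fun_eq_iff)
qed (simp add: wip_linear)

lemma subsp_perp: "subsp (perp P)"
  using subspD[OF subsp_supported[of D]] unfolding subsp_def perp_def by (auto simp: wip_linear)

lemma perp_sub: "perp P \<subseteq> Car"
  by (auto simp: perp_def)

lemma projection:
  assumes "subsp P" "P \<subseteq> Car"
  obtains p where "p \<in> P" "\<And>y. y \<in> P \<Longrightarrow> ip (x - p) y = 0"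
  using wip_projection[OF finD _ assms, of g x] g_pos by blast

text \<open>If x is orthogonal to \<open>perp P\<close>, then x minus its projection to P lies in
  \<open>perp P\<close> and is therefore orthogonal to itself.\<close>

lemma perp_perp: "subsp P \<Longrightarrow> P \<subseteq> Car \<Longrightarrow> perp (perp P) = P"
proof safe
  fix x assume P: "subsp P" "P \<subseteq> Car" and x: "x \<in> perp (perp P)"
  obtain p where p: "p \<in> P" "\<And>y. y \<in> P \<Longrightarrow> ip (x - p) y = 0" using projection[OF P] by blast
  have "x - p \<in> Car" using x p P perp_sub subspD(5)[OF subsp_supported] by blast
  then have xp: "x - p \<in> perp P" using p by (auto simp: perp_def)
  have "ip x (x - p) = 0" using x xp by (simp add: perp_def)
  moreover have "ip p (x - p) = 0" using xp p(1) by (simp add: perp_def wip_commute[of _ _ p])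
  ultimately have "ip (x - p) (x - p) = 0" using wip_linear(3)[of D g x p "x - p"] by simp
  then have "x = p" using ip_definite[of "x - p"] \<open>x - p \<in> Car\<close> by simp
  then show "x \<in> P" using p by simp
qed (auto simp: perp_def wip_commute)

lemma perp_anti: "P \<subseteq> Q \<Longrightarrow> perp Q \<subseteq> perp P"
  by (auto simp: perp_def)

end

subsection \<open>The Serre relations as a consequence of the other relations\<close>

text \<open>Operators with the commutation relations of \<open>e\<^sub>i, f\<^sub>i, t\<^sub>i\<close> for one fixed \<open>i\<close> together with \<open>e\<^sub>j\<close> for
  some \<open>j \<noteq> i\<close>.  The grading \<open>ht\<close> bounds the number of times \<open>e\<^sub>i\<close> and \<open>e\<^sub>j\<close> can be applied.\<close>

definition raising :: "'w set \<Rightarrow> ('w \<Rightarrow> int) \<Rightarrow> int \<Rightarrow> (('w \<Rightarrow> 'k::comm_ring_1) \<Rightarrow> 'w \<Rightarrow> 'k) \<Rightarrow> bool" where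
  "raising D ht d A \<longleftrightarrow> (\<forall>x\<in>supported D. \<forall>w. A x w \<noteq> 0 \<longrightarrow> (\<exists>w'. x w' \<noteq> 0 \<and> ht w \<ge> ht w' + d))"

definition lin_on :: "'w set \<Rightarrow> (('w \<Rightarrow> 'k::comm_ring_1) \<Rightarrow> 'w \<Rightarrow> 'k) \<Rightarrow> bool" where
  "lin_on D A \<longleftrightarrow> (\<forall>x\<in>supported D. A x \<in> supported D \<and> (\<forall>c. A (c \<star> x) = c \<star> A x) \<and>
     (\<forall>y\<in>supported D. A (x + y) = A x + A y))"

lemma lin_onD:
  assumes "lin_on D A"
  shows "x \<in> supported D \<Longrightarrow> A x \<in> supported D" "x \<in> supported D \<Longrightarrow> A (c \<star> x) = c \<star> A x"
    "x \<in> supported D \<Longrightarrow> y \<in> supported D \<Longrightarrow> A (x + y) = A x + A y"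
    "x \<in> supported D \<Longrightarrow> y \<in> supported D \<Longrightarrow> A (x - y) = A x - A y"
    "A 0 = 0"
proof -
  show *: "x \<in> supported D \<Longrightarrow> A x \<in> supported D" "x \<in> supported D \<Longrightarrow> A (c \<star> x) = c \<star> A x"
    "x \<in> supported D \<Longrightarrow> y \<in> supported D \<Longrightarrow> A (x + y) = A x + A y" for x y c
    using assms by (auto simp: lin_on_def)
  have m: "x - y = x + (- 1) \<star> y" for x y :: "'a \<Rightarrow> 'b" by (auto simp: fun_eq_iff)
  show "x \<in> supported D \<Longrightarrow> y \<in> supported D \<Longrightarrow> A (x - y) = A x - A y"
    using *(2)[of y "- 1"] *(3)[of x "(- 1) \<star> y"] subspD(3)[OF subsp_supported[of D], of y "- 1"]
    by (simp add: m)
  show "A 0 = 0" using *(2)[OF subspD(1)[OF subsp_supported[of D]], of 0] by simp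
qed

text \<open>In the application \<open>E\<close>, \<open>F\<close>, \<open>T\<close> are the actions
  of \<open>e_i\<close>, \<open>f_i\<close>, \<open>t_i\<close> and \<open>J\<close> is that of
  \<open>e_j\<close>; s and r are the powers of q with exponents
  (\<open>\<alpha>\<^sub>i\<close>|\<open>\<alpha>\<^sub>i\<close>) and
  (\<open>\<alpha>\<^sub>i\<close>|\<open>\<alpha>\<^sub>j\<close>). \<open>N\<close> is minus the
  Cartan integer, which is what \<open>rN\<close> expresses.\<close>

locale sl2_ad =
  fixes D :: "'w set" and ht :: "'w \<Rightarrow> int"
    and E F T T' J :: "('w \<Rightarrow> 'k::linordered_field) \<Rightarrow> 'w \<Rightarrow> 'k"
    and d s r :: 'k and N :: nat
  assumes finD: "finite D" and s_pos: "s > 1" and r_pos: "r > 0" and d0: "d \<noteq> 0"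
    and lin: "lin_on D E" "lin_on D F" "lin_on D T" "lin_on D T'" "lin_on D J"
    and TT': "x \<in> supported D \<Longrightarrow> T (T' x) = x" and T'T: "x \<in> supported D \<Longrightarrow> T' (T x) = x"
    and TE: "x \<in> supported D \<Longrightarrow> T (E x) = s \<star> E (T x)"
    and TJ: "x \<in> supported D \<Longrightarrow> T (J x) = r \<star> J (T x)"
    and EF: "x \<in> supported D \<Longrightarrow> E (F x) = F (E x) + d \<star> (T x - T' x)"
    and JF: "x \<in> supported D \<Longrightarrow> J (F x) = F (J x)"
    and raise: "raising D ht 1 E" "raising D ht 0 J"
    and rN: "r * r * s ^ N = 1"
begin

text \<open>The p-fold quantum adjoint action of \<open>e_i\<close> on \<open>e_j\<close>; for p = N
  + 1 it is the left side of the Serre relation.\<close>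

fun ad :: "nat \<Rightarrow> ('w \<Rightarrow> 'k) \<Rightarrow> 'w \<Rightarrow> 'k" where
  "ad 0 x = J x"
| "ad (Suc p) x = E (ad p x) - (r * s ^ p) \<star> ad p (E x)"

definition \<gamma> :: "nat \<Rightarrow> 'k" where
  "\<gamma> p = - d * (\<Sum>l<p. r * s ^ l - inverse (r * s ^ l))"

abbreviation "Car \<equiv> supported D :: ('w \<Rightarrow> 'k) set"

lemmas sub = subspD[OF subsp_supported[of D]]
lemmas linD = lin[THEN lin_onD(1)] lin[THEN lin_onD(2)] lin[THEN lin_onD(3)] lin[THEN lin_onD(4)]

lemma ad_lin: "lin_on D (ad p)"
proof (induction p)
  case 0 then show ?case using lin(5) by (simp add: lin_on_def)
next
  case (Suc p)
  note IH = lin_onD[OF Suc]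
  show ?case unfolding lin_on_def
    by (simp add: linD IH sub) (auto simp: fun_eq_iff algebra_simps)
qed

lemmas adD = ad_lin[THEN lin_onD(1)] ad_lin[THEN lin_onD(2)] ad_lin[THEN lin_onD(3)] ad_lin[THEN lin_onD(4)]

lemma T_ad: "x \<in> Car \<Longrightarrow> T (ad p x) = (r * s ^ p) \<star> ad p (T x)"
proof -
  let ?P = "\<lambda>p. \<forall>x\<in>Car. T (ad p x) = (r * s ^ p) \<star> ad p (T x)"
  have "?P p"
  proof (rule nat_induct[of ?P])
    show "?P 0" by (simp add: TJ)
  next
    fix p assume "?P p"
    then show "?P (Suc p)"
      by (simp add: linD adD sub TE smul_distribs mult.commute mult.left_commute)
  qed
  then show "x \<in> Car \<Longrightarrow> ?thesis" by blast
qed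

lemma T'_ad: assumes x: "x \<in> Car" shows "T' (ad p x) = inverse (r * s ^ p) \<star> ad p (T' x)"
proof -
  have "T (inverse (r * s ^ p) \<star> ad p (T' x)) = ad p x"
    using x r_pos s_pos by (simp add: linD adD T_ad TT' sub del: inverse_mult_distrib)
  then show ?thesis using T'T[of "inverse (r * s ^ p) \<star> ad p (T' x)"] x by (simp add: linD adD sub)
qed

lemma T'_E: assumes x: "x \<in> Car" shows "T' (E x) = inverse s \<star> E (T' x)"
proof -
  have "T (inverse s \<star> E (T' x)) = E x" using x s_pos by (simp add: linD TE TT')
  then show ?thesis using T'T[of "inverse s \<star> E (T' x)"] x by (simp add: linD sub)
qed

text \<open>As in a string of weight vectors for sl2, \<open>F\<close> lowers \<open>ad p\<close> to
  \<open>ad (p - 1)\<close>, with \<open>T'\<close> on the right. Since \<open>F\<close> commutes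
  with \<open>J\<close>, only the commutators of \<open>F\<close> with the p factors
  \<open>E\<close> contribute; their weights sum to \<open>\<gamma> p\<close>.\<close>

lemma F_ad:
  "\<forall>x\<in>Car. F (ad p x) = ad p (F x) + \<gamma> p \<star> (case p of 0 \<Rightarrow> 0 | Suc p' \<Rightarrow> ad p' (T' x))"
  (is "?P p")
proof (rule nat_induct[of ?P])
  show "?P 0" by (simp add: JF)
next
  fix p assume Suc_IH: "?P p"
  define G where "G x = (case p of 0 \<Rightarrow> 0 | Suc p' \<Rightarrow> ad p' (T' x))" for x
  have IH: "F (ad p x) = ad p (F x) + \<gamma> p \<star> G x" if "x \<in> Car" for x
    using bspec[OF Suc_IH that] by (simp only: G_def)
  have GC: "G x \<in> Car" if "x \<in> Car" for x
    using that by (cases p) (simp_all add: G_def sub adD linD)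
  \<comment> \<open>Passing \<open>T'\<close> through \<open>E\<close> costs one factor s, which
    turns the twist \<open>r * s ^ p\<close> into the one that belongs to \<open>p'\<close>; so the
    expression is again a quantum commutator.\<close>
  have EG: "\<gamma> p \<star> (E (G x) - (r * s ^ p) \<star> G (E x)) = \<gamma> p \<star> ad p (T' x)" if x: "x \<in> Car" for x
  proof (cases p)
    case 0 then show ?thesis by (simp add: \<gamma>_def)
  next
    case (Suc p')
    then show ?thesis using x s_pos
      by (simp add: G_def T'_E adD linD field_simps)
  qed
  have g: "\<gamma> (Suc p) = \<gamma> p - d * (r * s ^ p - inverse (r * s ^ p))"
    by (simp add: \<gamma>_def algebra_simps)
  let ?w = "r * s ^ p"
  have w0: "?w \<noteq> 0" using r_pos s_pos by simp
  show "?P (Suc p)"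
  proof
  fix x assume x: "x \<in> Car"
  have 1: "F (E (ad p x)) = E (ad p (F x)) + \<gamma> p \<star> E (G x) - d \<star> (?w \<star> ad p (T x) - inverse ?w \<star> ad p (T' x))"
  proof -
    have "E (F (ad p x)) = F (E (ad p x)) + d \<star> (T (ad p x) - T' (ad p x))"
      using x by (simp add: EF adD)
    moreover have "E (F (ad p x)) = E (ad p (F x)) + \<gamma> p \<star> E (G x)"
      using x GC by (simp add: IH linD adD sub)
    ultimately show ?thesis using x by (simp add: T_ad T'_ad algebra_simps)
  qed
  have 2: "F (ad p (E x)) = ad p (E (F x)) - d \<star> (ad p (T x) - ad p (T' x)) + \<gamma> p \<star> G (E x)"
  proof -
    have "ad p (E (F x)) = ad p (F (E x)) + d \<star> (ad p (T x) - ad p (T' x))"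
      using x by (simp add: EF linD adD sub)
    then show ?thesis using x by (simp add: IH linD algebra_simps)
  qed
  have "F (ad (Suc p) x) = F (E (ad p x)) - ?w \<star> F (ad p (E x))"
    using x by (simp add: linD adD sub)
  also have "\<dots> = ad (Suc p) (F x) + \<gamma> p \<star> (E (G x) - ?w \<star> G (E x))
      + (- d * (?w - inverse ?w)) \<star> ad p (T' x)"
    unfolding 1 2 using w0 by (auto simp: fun_eq_iff algebra_simps)
  also have "\<dots> = ad (Suc p) (F x) + \<gamma> (Suc p) \<star> ad p (T' x)"
    unfolding EG[OF x] g by (auto simp: fun_eq_iff algebra_simps)
  finally show "F (ad (Suc p) x) = ad (Suc p) (F x) + \<gamma> (Suc p) \<star> (case Suc p of 0 \<Rightarrow> 0 | Suc p' \<Rightarrow> ad p' (T' x))"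
    by simp
  qed
qed

lemma raising_ad: "raising D ht (int p) (ad p)"
proof (induction p)
  case 0 then show ?case using raise(2) by (simp add: raising_def)
next
  case (Suc p)
  show ?case unfolding raising_def
  proof (intro ballI allI impI)
    fix x w assume x: "x \<in> Car" and nz: "ad (Suc p) x w \<noteq> 0"
    then consider "E (ad p x) w \<noteq> 0" | "ad p (E x) w \<noteq> 0" by fastforce
    then show "\<exists>w'. x w' \<noteq> 0 \<and> ht w' + int (Suc p) \<le> ht w"
    proof cases
      case 1
      then obtain w' where "ad p x w' \<noteq> 0" "ht w' + 1 \<le> ht w"
        using raise(1) adD(1)[OF x] unfolding raising_def by blast
      moreover from this obtain w'' where "x w'' \<noteq> 0" "ht w'' + p \<le> ht w'"
        using Suc x unfolding raising_def by blast
      ultimately show ?thesis by force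
    next
      case 2
      then obtain w' where "E x w' \<noteq> 0" "ht w' + p \<le> ht w"
        using Suc linD(1)[OF x] unfolding raising_def by blast
      moreover from this obtain w'' where "x w'' \<noteq> 0" "ht w'' + 1 \<le> ht w'"
        using raise(1) x unfolding raising_def by blast
      ultimately show ?thesis by force
    qed
  qed
qed

text \<open>\<open>ad p\<close> raises the height by at least p, but heights on the finite set
  \<open>D\<close> are bounded.\<close>

lemma ad_large: "\<exists>p. \<forall>q\<ge>p. \<forall>x\<in>Car. ad q x = 0"
proof -
  have "\<exists>b. \<forall>w\<in>D. \<bar>ht w\<bar> \<le> b"
    using finD by (intro exI[of _ "Max ((\<lambda>w. \<bar>ht w\<bar>) ` D)"]) simp
  then obtain b where b: "\<And>w. w \<in> D \<Longrightarrow> \<bar>ht w\<bar> \<le> b" by blast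
  have "ad q x w = 0" if h: "q \<ge> nat (2 * b + 1)" "x \<in> Car" for q x w
  proof (rule ccontr)
    assume nz: "ad q x w \<noteq> 0"
    then have w: "w \<in> D" using adD(1)[OF h(2), of q] supportedD[of _ D w] by blast
    obtain w' where w': "x w' \<noteq> 0" "ht w \<ge> ht w' + int q"
      using raising_ad[of q] nz h(2) unfolding raising_def by blast
    then have "w' \<in> D" using h(2) supportedD by metis
    then show False using w' b[OF w] b[of w'] h(1) by linarith
  qed
  then have "ad q x = 0" if "q \<ge> nat (2 * b + 1)" "x \<in> Car" for q x
    using that by (simp add: fun_eq_iff)
  then show ?thesis by blast
qed

text \<open>By antisymmetry the sum defining \<open>\<gamma> (Suc N)\<close> vanishes, and later terms are positive.\<close>

lemma \<gamma>_nz: "p > Suc N \<Longrightarrow> \<gamma> p \<noteq> 0"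
proof -
  assume p: "p > Suc N"
  define h where "h l = r * s ^ l - inverse (r * s ^ l)" for l
  have inv: "inverse (r * s ^ l) = r * s ^ (N - l)" if le: "l \<le> N" for l
  proof -
    have "(r * s ^ l) * (r * s ^ (N - l)) = 1"
    proof -
      have "(r * s ^ l) * (r * s ^ (N - l)) = r * r * (s ^ l * s ^ (N - l))" by (simp only: ac_simps)
      then show ?thesis using rN le by (simp flip: power_add)
    qed
    then show ?thesis by (metis inverse_unique)
  qed
  have "(\<Sum>l\<le>N. r * s ^ (N - l)) = (\<Sum>l\<le>N. r * s ^ l)"
    by (rule sum.reindex_bij_witness[of _ "\<lambda>l. N - l" "\<lambda>l. N - l"]) auto
  then have 0: "(\<Sum>l\<le>N. h l) = 0"
    unfolding h_def sum_subtractf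
    using sum.cong[of "{..N}" "{..N}" "\<lambda>l. inverse (r * s ^ l)" "\<lambda>l. r * s ^ (N - l)"] inv
    by (simp del: inverse_mult_distrib)
  have pos: "h l > 0" if "l > N" for l
  proof -
    have "(r * s ^ l)\<^sup>2 = s ^ (2 * l - N)"
    proof -
      have "(r * s ^ l)\<^sup>2 = r * r * s ^ N * s ^ (2 * l - N)"
        using that by (simp add: power2_eq_square algebra_simps flip: power_add mult_2)
      then show ?thesis using rN by simp
    qed
    moreover have "s ^ (2 * l - N) > 1" using s_pos that by (intro one_less_power) auto
    ultimately have "(r * s ^ l)\<^sup>2 > 1\<^sup>2" by simp
    then have "r * s ^ l > 1" using r_pos s_pos by (intro power_less_imp_less_base[of 1 2]) auto
    then show ?thesis unfolding h_def using inverse_less_1_iff[of "r * s ^ l"] by linarith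
  qed
  have eq: "{..<p} = {..N} \<union> {N<..<p}" and dis: "{..N} \<inter> {N<..<p} = {}" using p by auto
  have "(\<Sum>l<p. h l) = (\<Sum>l\<le>N. h l) + (\<Sum>l\<in>{N<..<p}. h l)"
    unfolding eq by (rule sum.union_disjoint[OF _ _ dis]) simp_all
  also have "\<dots> > 0"
  proof -
    have "Suc N \<in> {N<..<p}" using p by simp
    then have "(\<Sum>l\<in>{N<..<p}. h l) > 0" by (intro sum_pos) (fast, blast, simp add: pos)
    then show ?thesis unfolding 0 by simp
  qed
  finally show ?thesis using d0 by (simp add: \<gamma>_def h_def)
qed

text \<open>Descending induction from \<open>ad_large\<close>: if \<open>ad (Suc p)\<close>
  vanishes, \<open>F_ad\<close> leaves \<open>\<gamma> (Suc p)\<close> times \<open>ad p\<close>,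
  and the factor is nonzero as long as p > N. The descent stops exactly at the Serre
  relation.\<close>

lemma ad_vanish: "x \<in> Car \<Longrightarrow> ad (Suc N) x = 0"
proof -
  assume x: "x \<in> Car"
  obtain p0 where p0: "\<And>q x. q \<ge> p0 \<Longrightarrow> x \<in> Car \<Longrightarrow> ad q x = 0" using ad_large by blast
  have down: "\<forall>x\<in>Car. ad p x = 0" if "\<forall>x\<in>Car. ad (Suc p) x = 0" "p \<ge> Suc N" for p
  proof
    fix x assume x: "x \<in> Car"
    have "F (ad (Suc p) (T x)) = ad (Suc p) (F (T x)) + \<gamma> (Suc p) \<star> ad p (T' (T x))"
      using x F_ad[of "Suc p"] by (simp add: linD)
    then have "\<gamma> (Suc p) \<star> ad p x = 0"
      using that(1) x lin(2)[THEN lin_onD(5)] by (simp add: linD T'T del: ad.simps)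
    then show "ad p x = 0" using \<gamma>_nz[of "Suc p"] that(2) by (auto simp: fun_eq_iff)
  qed
  have "\<forall>x\<in>Car. ad p x = 0" if "p \<ge> Suc N" for p
  proof (cases "p \<ge> p0")
    case False
    then have "p \<le> p0" by simp
    then show ?thesis using that
    proof (induction rule: inc_induct)
      case base then show ?case using p0 by auto
    next
      case (step m)
      have "\<forall>x\<in>Car. ad (Suc m) x = 0" by (rule step.IH) (use step.prems in simp)
      then show ?case by (rule down) (rule step.prems)
    qed
  qed (use p0 in auto)
  then show ?thesis using x by (simp del: ad.simps)
qed

lemma ad1: "x \<in> Car \<Longrightarrow> ad 1 x = E (J x) - r \<star> J (E x)"
  by simp

lemma ad2: "x \<in> Car \<Longrightarrow> ad 2 x = E (E (J x)) - (r + r * s) \<star> E (J (E x)) + (r * r * s) \<star> J (E (E x))"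
  by (simp add: numeral_2_eq_2 linD sub smul_distribs algebra_simps)

lemma ad3: "x \<in> Car \<Longrightarrow> ad 3 x = E (E (E (J x))) - (r + r * s + r * s\<^sup>2) \<star> E (E (J (E x)))
    + (r * r * (s + s ^ 2 + s ^ 3)) \<star> E (J (E (E x))) - (r * r * r * s ^ 3) \<star> J (E (E (E x)))"
  by (simp add: numeral_3_eq_3 linD sub) (auto simp: fun_eq_iff algebra_simps power2_eq_square power3_eq_cube)

end

subsection \<open>Highest weight theory for unitary representations\<close>

declare plus_fun_apply [simp del] minus_apply [simp del] smul_apply [simp del] zero_fun_apply [simp del]

lemmas fun_apply = plus_fun_apply minus_apply smul_apply uminus_apply zero_fun_apply

text \<open>By \<open>adj\<close>, the adjoint of \<open>E i\<close> is a positive multiple of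
  \<open>F i\<close> after \<open>T' i\<close>, and the diagonal operators are self-adjoint. Weights
  are recorded by the values \<open>chi\<close> rather than by exponents, so that positivity of
  weights becomes comparison with 1 in the ordered field. \<open>ht\<close> makes the
  \<open>E i\<close> nilpotent.\<close>

locale unitary_rep = weighted_space D g
  for D :: "'w set" and g :: "'w \<Rightarrow> 'k::linordered_field" +
  fixes I :: "nat set" and E F T T' :: "nat \<Rightarrow> ('w \<Rightarrow> 'k) \<Rightarrow> 'w \<Rightarrow> 'k"
    and chi :: "nat \<Rightarrow> 'w \<Rightarrow> 'k" and c d :: "nat \<Rightarrow> 'k" and r :: "nat \<Rightarrow> nat \<Rightarrow> 'k" and ht :: "'w \<Rightarrow> int"
  assumes linE: "i \<in> I \<Longrightarrow> lin_on D (E i)" and linF: "i \<in> I \<Longrightarrow> lin_on D (F i)"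
    and T_eq: "i \<in> I \<Longrightarrow> x \<in> supported D \<Longrightarrow> T i x = (\<lambda>w. chi i w * x w)"
    and T'_eq: "i \<in> I \<Longrightarrow> x \<in> supported D \<Longrightarrow> T' i x = (\<lambda>w. inverse (chi i w) * x w)"
    and chi_pos: "chi i w > 0" and c_pos: "i \<in> I \<Longrightarrow> c i > 0" and d_pos: "i \<in> I \<Longrightarrow> d i > 0"
    and adj: "i \<in> I \<Longrightarrow> x \<in> supported D \<Longrightarrow> y \<in> supported D \<Longrightarrow>
      wip D g (E i x) y = c i * wip D g x (F i (T' i y))"
    and TE: "i \<in> I \<Longrightarrow> j \<in> I \<Longrightarrow> x \<in> supported D \<Longrightarrow> T i (E j x) = r i j \<star> E j (T i x)"
    and TF: "i \<in> I \<Longrightarrow> j \<in> I \<Longrightarrow> x \<in> supported D \<Longrightarrow> T i (F j x) = inverse (r i j) \<star> F j (T i x)"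
    and EF: "i \<in> I \<Longrightarrow> x \<in> supported D \<Longrightarrow> E i (F i x) = F i (E i x) + d i \<star> (T i x - T' i x)"
    and EF': "i \<in> I \<Longrightarrow> j \<in> I \<Longrightarrow> i \<noteq> j \<Longrightarrow> x \<in> supported D \<Longrightarrow> E i (F j x) = F j (E i x)"
    and raise: "i \<in> I \<Longrightarrow> raising D ht 1 (E i)"
    and r_nz: "r i j \<noteq> 0"
begin

lemmas car = subspD[OF subsp_supported[of D]]
lemmas linD = linE[THEN lin_onD(1)] linE[THEN lin_onD(2)] linE[THEN lin_onD(3)] linE[THEN lin_onD(4)]
  linF[THEN lin_onD(1)] linF[THEN lin_onD(2)] linF[THEN lin_onD(3)] linF[THEN lin_onD(4)]

lemma T_car [simp]: "i \<in> I \<Longrightarrow> x \<in> Car \<Longrightarrow> T i x \<in> Car" "i \<in> I \<Longrightarrow> x \<in> Car \<Longrightarrow> T' i x \<in> Car"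
  by (auto simp: T_eq T'_eq supported_def)

lemma TT': "i \<in> I \<Longrightarrow> x \<in> Car \<Longrightarrow> T i (T' i x) = x" "i \<in> I \<Longrightarrow> x \<in> Car \<Longrightarrow> T' i (T i x) = x"
  using T_car chi_pos[of i] by (auto simp: T_eq T'_eq fun_eq_iff less_imp_neq[symmetric])

lemma T_lin:
  assumes "i \<in> I" "x \<in> Car" "y \<in> Car"
  shows "T i (x + y) = T i x + T i y" "T' i (x + y) = T' i x + T' i y"
    "T i (a \<star> x) = a \<star> T i x" "T' i (a \<star> x) = a \<star> T' i x"
  using assms car(2)[OF assms(2,3)] car(3)[OF assms(2)]
  by (auto simp: T_eq T'_eq fun_eq_iff algebra_simps fun_apply)

lemma T_self_adjoint:
  assumes "i \<in> I" "x \<in> Car" "y \<in> Car"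
  shows "ip (T i x) y = ip x (T i y)" "ip (T' i x) y = ip x (T' i y)"
  using assms by (auto simp: wip_def T_eq T'_eq algebra_simps intro!: sum.cong)

lemma T'_rel:
  assumes "i \<in> I" "j \<in> I" "x \<in> Car"
  shows "T' i (E j x) = inverse (r i j) \<star> E j (T' i x)" "T' i (F j x) = r i j \<star> F j (T' i x)"
proof -
  have "T i (inverse (r i j) \<star> E j (T' i x)) = E j x"
    using assms r_nz[of i j] by (simp add: T_lin linD TE TT' car)
  then show "T' i (E j x) = inverse (r i j) \<star> E j (T' i x)"
    using TT'(2)[of i "inverse (r i j) \<star> E j (T' i x)"] assms by (simp add: linD car)
  have "T i (r i j \<star> F j (T' i x)) = F j x"
    using assms r_nz[of i j] by (simp add: T_lin linD TF TT' car)
  then show "T' i (F j x) = r i j \<star> F j (T' i x)"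
    using TT'(2)[of i "r i j \<star> F j (T' i x)"] assms by (simp add: linD car)
qed

lemma adjF:
  assumes "i \<in> I" "x \<in> Car" "y \<in> Car"
  shows "ip y (F i x) = inverse (c i) * ip (E i y) (T i x)"
  using adj[of i y "T i x"] c_pos[OF assms(1)] assms by (simp add: TT')

section \<open>Submodules, primitive vectors and dominance\<close>

definition submod :: "('w \<Rightarrow> 'k) set \<Rightarrow> bool" where
  "submod P \<longleftrightarrow> subsp P \<and> P \<subseteq> Car \<and>
     (\<forall>i\<in>I. \<forall>x\<in>P. E i x \<in> P \<and> F i x \<in> P \<and> T i x \<in> P \<and> T' i x \<in> P)"

definition prim :: "('w \<Rightarrow> 'k) \<Rightarrow> bool" where
  "prim x \<longleftrightarrow> x \<in> Car \<and> (\<forall>i\<in>I. E i x = 0)"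

definition homog :: "(nat \<Rightarrow> 'k) \<Rightarrow> ('w \<Rightarrow> 'k) \<Rightarrow> bool" where
  "homog a x \<longleftrightarrow> x \<in> Car \<and> (\<forall>i\<in>I. T i x = a i \<star> x)"

text \<open>The adjoint of each generator is, up to a scalar, a product of generators, and P is
  closed under these.\<close>

lemma submod_perp: "submod P \<Longrightarrow> submod (perp P)"
  unfolding submod_def
proof (intro conjI ballI)
  assume P: "subsp P \<and> P \<subseteq> Car \<and> (\<forall>i\<in>I. \<forall>x\<in>P. E i x \<in> P \<and> F i x \<in> P \<and> T i x \<in> P \<and> T' i x \<in> P)"
  fix i x assume i: "i \<in> I" and x: "x \<in> perp P"
  then have xC: "x \<in> Car" by (simp add: perp_def)
  have PC: "y \<in> P \<Longrightarrow> y \<in> Car" for y using P by blast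
  have x0: "y \<in> P \<Longrightarrow> ip x y = 0" for y using x by (simp add: perp_def)
  show "E i x \<in> perp P"
    using i xC P PC by (auto simp: perp_def linD adj x0)
  show "T i x \<in> perp P" "T' i x \<in> perp P"
    using i xC P PC by (auto simp: perp_def T_self_adjoint x0)
  show "F i x \<in> perp P"
  proof -
    have "ip (F i x) y = 0" if y: "y \<in> P" for y
    proof -
      have "ip y (F i x) = inverse (c i) * ip (T i (E i y)) x"
        using i xC y PC by (simp add: adjF T_self_adjoint linD)
      then show ?thesis using x0[of "T i (E i y)"] i y P by (simp add: wip_commute)
    qed
    then show ?thesis using i xC by (simp add: perp_def linD)
  qed
qed (auto simp: subsp_perp perp_sub[THEN subsetD])

lemma submodD:
  assumes "submod P"
  shows "subsp P" "P \<subseteq> Car" "x \<in> P \<Longrightarrow> x \<in> Car"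
    "i \<in> I \<Longrightarrow> x \<in> P \<Longrightarrow> E i x \<in> P" "i \<in> I \<Longrightarrow> x \<in> P \<Longrightarrow> F i x \<in> P"
    "i \<in> I \<Longrightarrow> x \<in> P \<Longrightarrow> T i x \<in> P" "i \<in> I \<Longrightarrow> x \<in> P \<Longrightarrow> T' i x \<in> P"
  using assms by (auto simp: submod_def)

lemma submod_Int: "submod P \<Longrightarrow> submod Q \<Longrightarrow> submod (P \<inter> Q)"
  by (auto simp: submod_def subsp_def)

lemma submod_INT: "(\<And>\<mu>. \<mu> \<in> L \<Longrightarrow> submod (P \<mu>)) \<Longrightarrow> submod Q \<Longrightarrow> submod (Q \<inter> (\<Inter>\<mu>\<in>L. P \<mu>))"
  by (auto simp: submod_def subsp_def)

text \<open>A nonzero vector of P with the smallest support is homogeneous: otherwise subtracting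
  \<open>chi i w0\<close> times it from its image under \<open>T i\<close> removes \<open>w0\<close>
  from the support and stays nonzero in P.\<close>

lemma homog_ex:
  assumes "submod P" "P \<noteq> {0}"
  shows "\<exists>x\<in>P. x \<noteq> 0 \<and> (\<exists>a. homog a x)"
proof -
  define N where "N x = card {w \<in> D. x w \<noteq> 0}" for x :: "'w \<Rightarrow> 'k"
  have "\<exists>x. x \<in> P \<and> x \<noteq> 0" using assms subspD(1)[OF submodD(1)] by blast
  then obtain x where x: "x \<in> P" "x \<noteq> 0" and min: "\<And>y. y \<in> P \<Longrightarrow> y \<noteq> 0 \<Longrightarrow> N x \<le> N y"
    using ex_has_least_nat[of "\<lambda>x. x \<in> P \<and> x \<noteq> 0" _ N] by blast
  then have xC: "x \<in> Car" using submodD[OF assms(1)] by blast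
  obtain w0 where w0: "x w0 \<noteq> 0" using x(2) by (auto simp: fun_eq_iff fun_apply)
  have "T i x = chi i w0 \<star> x" if i: "i \<in> I" for i
  proof (rule ccontr)
    assume ne: "T i x \<noteq> chi i w0 \<star> x"
    define y where "y = T i x - chi i w0 \<star> x"
    have yw: "y w = (chi i w - chi i w0) * x w" for w
      using i xC by (simp add: y_def T_eq algebra_simps fun_apply)
    have yP: "y \<in> P" "y \<noteq> 0"
      using x(1) i submodD(6)[OF assms(1)] subspD[OF submodD(1)[OF assms(1)]] ne by (auto simp: y_def)
    have "{w \<in> D. y w \<noteq> 0} \<subset> {w \<in> D. x w \<noteq> 0}"
    proof
      show "{w \<in> D. y w \<noteq> 0} \<subseteq> {w \<in> D. x w \<noteq> 0}" by (auto simp: yw)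
      have "w0 \<in> {w \<in> D. x w \<noteq> 0}" using w0 xC supportedD[of x D w0] by auto
      moreover have "w0 \<notin> {w \<in> D. y w \<noteq> 0}" by (simp add: yw)
      ultimately show "{w \<in> D. y w \<noteq> 0} \<noteq> {w \<in> D. x w \<noteq> 0}" by blast
    qed
    then have "N y < N x" unfolding N_def by (intro psubset_card_mono) (use finD in auto)
    then show False using min[OF yP] by simp
  qed
  then have "homog (\<lambda>i. chi i w0) x" using xC by (simp add: homog_def)
  then show ?thesis using x by blast
qed

lemma homog_E: "homog a x \<Longrightarrow> j \<in> I \<Longrightarrow> homog (\<lambda>i. r i j * a i) (E j x)"
  by (simp add: homog_def linD TE)

text \<open>Take a nonzero homogeneous vector of P supported in heights as large as possible.
  Applying \<open>E i\<close> keeps it homogeneous and raises the heights, so the result must be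
  0.\<close>

lemma homog_prim_ex:
  assumes "submod P" "P \<noteq> {0}"
  shows "\<exists>x\<in>P. x \<noteq> 0 \<and> prim x \<and> (\<exists>a. homog a x)"
proof -
  have "\<forall>w\<in>D. \<bar>ht w\<bar> \<le> Max ((\<lambda>w. \<bar>ht w\<bar>) ` D)" using finD by simp
  then obtain b where b: "\<And>w. w \<in> D \<Longrightarrow> \<bar>ht w\<bar> \<le> b" by blast
  \<comment> \<open>Heights lie between -b and b; the shift by b lets a natural number m measure the
    lower bound, so that a greatest m exists.\<close>
  define Q where "Q m x \<longleftrightarrow> x \<in> P \<and> x \<noteq> 0 \<and> (\<exists>a. homog a x) \<and> (\<forall>w. x w \<noteq> 0 \<longrightarrow> ht w \<ge> int m - b)"
    for m :: nat and x :: "'w \<Rightarrow> 'k"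
  have "\<exists>x. Q 0 x"
  proof -
    obtain x a where x: "x \<in> P" "x \<noteq> 0" "homog a x" using homog_ex[OF assms] by blast
    have "ht w \<ge> - b" if "x w \<noteq> 0" for w
      using b[of w] that supportedD[of x D w] x(3) by (force simp: homog_def)
    then show ?thesis using x by (auto simp: Q_def)
  qed
  moreover have bound: "m \<le> nat (2 * b)" if "\<exists>x. Q m x" for m
  proof -
    obtain x where x: "Q m x" using \<open>\<exists>x. Q m x\<close> by blast
    then obtain w where w: "x w \<noteq> 0" by (auto simp: Q_def fun_eq_iff fun_apply)
    then have "w \<in> D" using x supportedD[of x D w] submodD(3)[OF assms(1)] by (auto simp: Q_def)
    then show ?thesis using w x b[of w] by (force simp: Q_def)
  qed
  ultimately obtain m where m: "\<exists>x. Q m x" "\<And>m'. \<exists>x. Q m' x \<Longrightarrow> m' \<le> m"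
    using Greatest_le_nat[of "\<lambda>m. \<exists>x. Q m x" _ "nat (2 * b)"] GreatestI_nat[of "\<lambda>m. \<exists>x. Q m x" 0 "nat (2 * b)"]
    by blast
  then obtain x a where x: "Q m x" "homog a x" by (auto simp: Q_def)
  have "E i x = 0" if i: "i \<in> I" for i
  proof (rule ccontr)
    assume nz: "E i x \<noteq> 0"
    have "Q (Suc m) (E i x)"
      unfolding Q_def
    proof (intro conjI allI impI)
      show "E i x \<in> P" using x(1) i submodD[OF assms(1)] by (auto simp: Q_def)
      show "\<exists>a. homog a (E i x)" using homog_E[OF x(2) i] by blast
      fix w assume "E i x w \<noteq> 0"
      moreover have "x \<in> Car" using x(2) by (simp add: homog_def)
      ultimately obtain w' where "x w' \<noteq> 0" "ht w' + 1 \<le> ht w"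
        using raise[OF i] unfolding raising_def by blast
      then show "int (Suc m) - b \<le> ht w" using x(1) by (force simp: Q_def)
    qed (rule nz)
    then show False using m(2)[of "Suc m"] by auto
  qed
  then show ?thesis using x by (auto simp: Q_def prim_def homog_def)
qed

text \<open>For primitive x the square norm of \<open>F i x\<close> is a positive multiple of
  \<open>a i - inverse (a i)\<close>. It cannot be negative.\<close>

lemma prim_dominant:
  assumes "prim x" "homog a x" "x \<noteq> 0" "i \<in> I"
  shows "a i \<ge> 1"
proof -
  have xC: "x \<in> Car" and Ex: "E i x = 0" and Tx: "T i x = a i \<star> x" using assms by (auto simp: prim_def homog_def)
  obtain w where w: "x w \<noteq> 0" using assms(3) by (auto simp: fun_eq_iff fun_apply)
  have "a i * x w = chi i w * x w" using Tx T_eq[OF assms(4) xC] by (metis smul_apply)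
  then have a: "a i > 0" using w chi_pos[of i w] by simp
  have T'x: "T' i x = inverse (a i) \<star> x"
  proof -
    have "x = a i \<star> T' i x" using TT'(2)[OF assms(4) xC] T_lin(4)[OF assms(4) xC xC] Tx by simp
    then have "inverse (a i) \<star> x = (inverse (a i) * a i) \<star> T' i x" by (metis smul_simps(4))
    then show ?thesis using a by simp
  qed
  have pos: "ip x x > 0"
    using ip_definite[OF xC] assms(3) wip_nonneg[of g D x] g_pos by (simp add: less_le)
  have "ip (F i x) (F i x) = inverse (c i) * ip (E i (F i x)) (T i x)"
    using assms(4) xC by (simp add: adjF linD)
  also have "E i (F i x) = (d i * (a i - inverse (a i))) \<star> x"
    using EF[OF assms(4) xC] linF[OF assms(4), THEN lin_onD(5)]
    by (simp add: Ex Tx T'x) (simp add: fun_eq_iff algebra_simps fun_apply)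
  also have "inverse (c i) * ip ((d i * (a i - inverse (a i))) \<star> x) (T i x)
      = (inverse (c i) * d i * a i * ip x x) * (a i - inverse (a i))"
    by (simp add: Tx wip_linear algebra_simps)
  finally have "(inverse (c i) * d i * a i * ip x x) * (a i - inverse (a i)) \<ge> 0"
    using wip_nonneg[of g D "F i x"] g_pos by simp
  moreover have "inverse (c i) * d i * a i * ip x x > 0"
    using a pos c_pos[OF assms(4)] d_pos[OF assms(4)] by simp
  ultimately have "a i \<ge> inverse (a i)" by (simp add: zero_le_mult_iff)
  then show ?thesis using a one_less_inverse[of "a i"] by linarith
qed

text \<open>The span of all products of lowering operators applied to u. For a primitive homogeneous
  u it is the generated submodule, but closing under \<open>F\<close> alone allows inductions in
  which only \<open>F\<close> has to be paired with primitive vectors.\<close>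

inductive_set fspan :: "('w \<Rightarrow> 'k) \<Rightarrow> ('w \<Rightarrow> 'k) set" for u where
  base: "u \<in> fspan u"
| fs_F: "x \<in> fspan u \<Longrightarrow> i \<in> I \<Longrightarrow> F i x \<in> fspan u"
| fs_add: "x \<in> fspan u \<Longrightarrow> y \<in> fspan u \<Longrightarrow> x + y \<in> fspan u"
| fs_smul: "x \<in> fspan u \<Longrightarrow> a \<star> x \<in> fspan u"

context
  fixes u a assumes u: "prim u" "homog a u" "u \<noteq> 0"
begin

lemma u_car: "u \<in> Car" using u by (simp add: prim_def)

lemma fspan_car: "x \<in> fspan u \<Longrightarrow> x \<in> Car"
  by (induction rule: fspan.induct) (auto intro: u_car car(2,3) linD)

lemma fspan_0: "0 \<in> fspan u"
  using fs_smul[OF base, of 0] by simp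

lemma subsp_fspan: "subsp (fspan u)"
  by (auto simp: subsp_def fspan_0 intro: fspan.intros)

lemma a_nz: "i \<in> I \<Longrightarrow> a i > 0"
  using prim_dominant[OF u] by (meson less_le_trans zero_less_one)

lemma fspan_T: "x \<in> fspan u \<Longrightarrow> i \<in> I \<Longrightarrow> T i x \<in> fspan u \<and> T' i x \<in> fspan u"
proof (induction rule: fspan.induct)
  case base
  have 1: "T i u = a i \<star> u" using u base by (simp add: homog_def)
  moreover have "T' i u = inverse (a i) \<star> u"
  proof -
    have "u = T' i (a i \<star> u)" using TT'(2)[OF base u_car] 1 by simp
    then have "u = a i \<star> T' i u" using T_lin(4)[OF base u_car u_car] by simp
    then have "inverse (a i) \<star> u = (inverse (a i) * a i) \<star> T' i u" by (metis smul_simps(4))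
    then show ?thesis using a_nz[OF base] by simp
  qed
  ultimately show ?case by (simp add: fspan.intros)
next
  case (fs_F x j)
  then show ?case using fspan_car by (simp add: TF T'_rel fspan.intros)
next
  case (fs_add x y)
  then show ?case using fspan_car by (simp add: T_lin fspan.intros)
next
  case (fs_smul x b)
  then show ?case using fspan_car[OF fs_smul(1)] by (simp add: T_lin[where y = x] fspan.intros)
qed

lemma fspan_E: "x \<in> fspan u \<Longrightarrow> i \<in> I \<Longrightarrow> E i x \<in> fspan u"
proof (induction rule: fspan.induct)
  case base
  then show ?case using u by (simp add: prim_def fspan_0)
next
  case (fs_F x j)
  note sf = subspD[OF subsp_fspan]
  show ?case
  proof (cases "i = j")
    case True
    then show ?thesis using fs_F fspan_car[OF fs_F(1)] fspan_T[OF fs_F(1) fs_F(2)]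
      by (auto simp: EF intro!: sf(2,3,5) fspan.intros(2))
  next
    case False
    then show ?thesis using fs_F fspan_car[OF fs_F(1)] by (simp add: EF' fspan.intros)
  qed
next
  case (fs_add x y)
  then show ?case using fspan_car by (simp add: linD fspan.intros)
next
  case (fs_smul x b)
  then show ?case using fspan_car by (simp add: linD fspan.intros)
qed

lemma submod_fspan: "submod (fspan u)"
  using subsp_fspan fspan_E fspan_T fspan_car by (auto simp: submod_def intro: fspan.intros)

lemma fspan_least: "submod P \<Longrightarrow> u \<in> P \<Longrightarrow> fspan u \<subseteq> P"
proof
  fix x assume P: "submod P" "u \<in> P"
  show "x \<in> fspan u \<Longrightarrow> x \<in> P"
    by (induction rule: fspan.induct) (auto intro: P submodD[OF P(1)] subspD[OF submodD(1)[OF P(1)]])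
qed

text \<open>Primitive vectors are orthogonal to all images of the \<open>F i\<close>.\<close>

lemma fspan_ip_prim: "x \<in> fspan u \<Longrightarrow> \<exists>b. \<forall>p. prim p \<longrightarrow> ip p x = b * ip p u"
proof (induction rule: fspan.induct)
  case base
  then show ?case by (intro exI[of _ 1]) simp
next
  case (fs_F x i)
  then have "\<forall>p. prim p \<longrightarrow> ip p (F i x) = 0 * ip p u"
    using fspan_car[OF fs_F(1)] by (simp add: adjF prim_def wip_linear)
  then show ?case by blast
next
  case (fs_add x y)
  then obtain b b' where "\<forall>p. prim p \<longrightarrow> ip p x = b * ip p u" "\<forall>p. prim p \<longrightarrow> ip p y = b' * ip p u" by blast
  then show ?case by (intro exI[of _ "b + b'"]) (simp add: wip_linear algebra_simps)
next
  case (fs_smul x e)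
  then obtain b where "\<forall>p. prim p \<longrightarrow> ip p x = b * ip p u" by blast
  then show ?case by (intro exI[of _ "e * b"]) (simp add: wip_linear algebra_simps)
qed

text \<open>The difference of x and the right multiple of u is primitive, so by
  \<open>fspan_ip_prim\<close> it is orthogonal to itself.\<close>

lemma fspan_prim: assumes "x \<in> fspan u" "prim x" shows "\<exists>b. x = b \<star> u"
proof -
  obtain b where b: "\<And>p. prim p \<Longrightarrow> ip p x = b * ip p u" using fspan_ip_prim[OF assms(1)] by blast
  have C: "x \<in> Car" "b \<star> u \<in> Car" "x - b \<star> u \<in> Car" using u_car assms(2) car(5)[of x "b \<star> u"] car(3)[of u b] by (auto simp: prim_def)
  have p: "prim (x - b \<star> u)"
    using assms(2) u C u_car by (simp add: prim_def linD)
  have "ip (x - b \<star> u) (x - b \<star> u) = 0"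
    using b[OF p] wip_linear(4)[of D g "x - b \<star> u" x "b \<star> u"] wip_linear(6)[of D g "x - b \<star> u" b u] by simp
  then have "x - b \<star> u = 0" using ip_definite[OF C(3)] by simp
  then show ?thesis by auto
qed

text \<open>A nonzero submodule contains a nonzero primitive vector, which is a multiple of u, hence
  u itself.\<close>

lemma fspan_irreducible: assumes "submod P" "P \<subseteq> fspan u" "P \<noteq> {0}" shows "P = fspan u"
proof -
  obtain x where x: "x \<in> P" "x \<noteq> 0" "prim x" using homog_prim_ex[OF assms(1,3)] by blast
  then obtain b where b: "x = b \<star> u" using fspan_prim assms(2) by blast
  then have "b \<noteq> 0" using x(2) by auto
  then have "u = inverse b \<star> x" using b by simp
  then have "u \<in> P" using x(1) subspD(3)[OF submodD(1)[OF assms(1)]] by simp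
  then show ?thesis using fspan_least[OF assms(1)] assms(2) by blast
qed

end

lemma homog_orthogonal:
  assumes "homog a x" "homog b y" "i \<in> I" "a i \<noteq> b i"
  shows "ip x y = 0"
proof -
  have "a i * ip x y = b i * ip x y"
    using T_self_adjoint(1)[OF assms(3), of x y] assms(1,2,3) by (simp add: homog_def wip_linear)
  then show ?thesis using assms(4) by simp
qed

lemma fspan_orthogonal:
  assumes u: "prim u" "homog a u" "u \<noteq> 0" and v: "prim v" "homog b v" "v \<noteq> 0"
    and "i \<in> I" "a i \<noteq> b i" "x \<in> fspan u" "y \<in> fspan v"
  shows "ip x y = 0"
proof -
  have "u \<in> perp (fspan v)"
  proof -
    have "ip u y = 0" if y: "y \<in> fspan v" for y
      using fspan_ip_prim[OF v y] u(1) homog_orthogonal[OF u(2) v(2) assms(7,8)] by force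
    then show ?thesis using u(1) by (simp add: perp_def prim_def)
  qed
  then have "fspan u \<subseteq> perp (fspan v)"
    using fspan_least[OF u submod_perp[OF submod_fspan[OF v]]] by simp
  then show ?thesis using assms(9,10) by (auto simp: perp_def)
qed

text \<open>This is the dual form of the statement that A is the sum of the submodules generated by
  the \<open>u \<mu>\<close>. A nonzero part of A orthogonal to all of them would contain a
  primitive vector; by \<open>complete\<close> it is a multiple of some \<open>u \<mu>\<close>,
  hence orthogonal to itself.\<close>

lemma perp_decomposition:
  assumes A: "submod A" and u: "\<And>\<mu>. \<mu> \<in> L \<Longrightarrow> prim (u \<mu>) \<and> homog (a \<mu>) (u \<mu>) \<and> u \<mu> \<noteq> 0 \<and> u \<mu> \<in> A"
    and complete: "\<And>x b. x \<in> A \<Longrightarrow> prim x \<Longrightarrow> homog b x \<Longrightarrow> x \<noteq> 0 \<Longrightarrow> \<exists>\<mu>\<in>L. \<exists>e. x = e \<star> u \<mu>"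
    and ne: "L \<noteq> {}"
  shows "(\<Inter>\<mu>\<in>L. perp (fspan (u \<mu>))) = perp A"
proof
  have fA: "fspan (u \<mu>) \<subseteq> A" if "\<mu> \<in> L" for \<mu>
    using u[OF that] fspan_least[of "u \<mu>" "a \<mu>" A] A by blast
  show "perp A \<subseteq> (\<Inter>\<mu>\<in>L. perp (fspan (u \<mu>)))" using perp_anti[OF fA] by blast
  define P where "P = A \<inter> (\<Inter>\<mu>\<in>L. perp (fspan (u \<mu>)))"
  have P: "submod P"
    unfolding P_def using u submod_fspan submod_perp A by (intro submod_INT) blast+
  have P0: "P = {0}"
  proof (rule ccontr)
    assume "P \<noteq> {0}"
    then obtain x b where x: "x \<in> P" "x \<noteq> 0" "prim x" "homog b x" using homog_prim_ex[OF P] by blast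
    then obtain \<mu> e where \<mu>: "\<mu> \<in> L" "x = e \<star> u \<mu>" using complete[of x b] by (auto simp: P_def)
    then have "x \<in> fspan (u \<mu>)" by (simp add: fspan.intros)
    moreover have "x \<in> perp (fspan (u \<mu>))" using x(1) \<mu>(1) by (auto simp: P_def)
    ultimately have "ip x x = 0" by (simp add: perp_def)
    then show False using x(2,3) ip_definite[of x] by (simp add: prim_def)
  qed
  show "(\<Inter>\<mu>\<in>L. perp (fspan (u \<mu>))) \<subseteq> perp A"
  proof
    fix x assume x: "x \<in> (\<Inter>\<mu>\<in>L. perp (fspan (u \<mu>)))"
    then have xC: "x \<in> Car" using ne by (auto simp: perp_def)
    obtain p where p: "p \<in> A" "\<And>y. y \<in> A \<Longrightarrow> ip (x - p) y = 0"
      using projection[OF submodD(1,2)[OF A]] by blast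
    have r: "x - p \<in> perp A" using p xC submodD(3)[OF A p(1)] car by (simp add: perp_def)
    have "p \<in> P"
    proof -
      have "p \<in> perp (fspan (u \<mu>))" if "\<mu> \<in> L" for \<mu>
      proof -
        have "x \<in> perp (fspan (u \<mu>))" "x - p \<in> perp (fspan (u \<mu>))"
          using x r perp_anti[OF fA[OF that]] that by auto
        then have "x - (x - p) \<in> perp (fspan (u \<mu>))" using subspD(5)[OF subsp_perp] by blast
        then show ?thesis by simp
      qed
      then show ?thesis using p(1) by (simp add: P_def)
    qed
    then have "p = 0" using P0 by simp
    then show "x \<in> perp A" using r by simp
  qed
qed

end

subsection \<open>The vector representation\<close>

text \<open>A polynomial is positive if its leading coefficient is; here it is X - 1.\<close>

lemma indet_gt_1: "indet > 1"
  unfolding indet_def One_fract_def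
  by (simp add: less_fract less_poly_def pos_poly_def one_pCons)

lemma q_gt_1: "q tp > 1"
  using indet_gt_1 by (simp add: q_def one_less_power)

lemma powi_pos: "q tp powi m > 0"
  using q_gt_1[of tp] by (intro zero_less_power_int) simp

lemma q_nz [simp]: "q tp \<noteq> 0"
  using q_gt_1[of tp] by auto

lemma indet_nz [simp]: "indet \<noteq> 0"
  using indet_gt_1 by auto

lemma idx_0 [simp]: "0 \<in> idx tp n \<longleftrightarrow> tp = A2_even"
  by (simp add: idx_def)

lemma idx_iff: "j \<in> idx tp n \<longleftrightarrow> (1 \<le> \<bar>j\<bar> \<and> \<bar>j\<bar> \<le> int n) \<or> (j = 0 \<and> tp = A2_even)"
  by (auto simp: idx_def)

lemma finite_idx [simp]: "finite (idx tp n)"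
  by (rule finite_subset[of _ "{- int n..int n}"]) (auto simp: idx_def)

definition lwt :: "affine_type \<Rightarrow> nat \<Rightarrow> nat \<Rightarrow> int \<Rightarrow> int" where
  "lwt tp n i a = inner_wt n (simple_root tp n i) (idx_wt a)"

definition wwt :: "affine_type \<Rightarrow> nat \<Rightarrow> nat \<Rightarrow> int list \<Rightarrow> int" where
  "wwt tp n i w = (\<Sum>a\<leftarrow>w. lwt tp n i a)"

lemma wwt_simps [simp]: "wwt tp n i [] = 0" "wwt tp n i (a # u) = lwt tp n i a + wwt tp n i u"
  "wwt tp n i (u @ v) = wwt tp n i u + wwt tp n i v"
  by (simp_all add: wwt_def)

lemma inner_wt_simple_root:
  assumes "1 \<le> i" "i \<le> n" "1 < n"
  shows "inner_wt n (simple_root tp n i) y =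
    (if i < n then y i - y (i + 1) else case tp of A2_even \<Rightarrow> y n | A2_odd \<Rightarrow> 2 * y n
       | A2_odd_dagger \<Rightarrow> y (n - 1) + y n | C1 \<Rightarrow> 2 * y n)"
proof -
  have e: "(\<Sum>m\<in>{1..n}. eps_wt j m * y m) = y j" if "1 \<le> j" "j \<le> n" for j
  proof -
    have "(\<Sum>m\<in>{1..n}. eps_wt j m * y m) = (\<Sum>m\<in>{1..n}. if m = j then y m else 0)"
      by (intro sum.cong) (auto simp: eps_wt_def)
    then show ?thesis using that by simp
  qed
  have "(\<Sum>m\<in>{1..n}. 2 * eps_wt n m * y m) = 2 * y n"
    using e[of n] assms by (simp add: mult.assoc flip: sum_distrib_left)
  then show ?thesis using assms e[of i] e[of "i + 1"] e[of n] e[of "n - 1"]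
    by (auto simp: inner_wt_def simple_root_def left_diff_distrib distrib_right sum_subtractf
        sum.distrib split: affine_type.split)
qed

lemma lwt_eq:
  assumes "1 \<le> i" "i \<le> n" "1 < n"
  shows "lwt tp n i a =
    (if i < n then (if \<bar>a\<bar> = int i then sgn a else 0) - (if \<bar>a\<bar> = int i + 1 then sgn a else 0)
     else case tp of A2_even \<Rightarrow> (if \<bar>a\<bar> = int n then sgn a else 0)
       | A2_odd_dagger \<Rightarrow> (if \<bar>a\<bar> = int n - 1 then sgn a else 0) + (if \<bar>a\<bar> = int n then sgn a else 0)
       | _ \<Rightarrow> 2 * (if \<bar>a\<bar> = int n then sgn a else 0))"
  using assms unfolding lwt_def inner_wt_simple_root[OF assms]
  by (cases tp) (auto simp: idx_wt_def)

lemma root_ip_eq: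
  assumes "1 \<le> i" "i \<le> n" "1 \<le> j" "j \<le> n" "1 < n"
  shows "root_ip tp n i j =
    (if i < n \<and> j < n then (if i = j then 2 else if i = j + 1 \<or> j = i + 1 then - 1 else 0)
     else if i = n \<and> j = n then (case tp of A2_even \<Rightarrow> 1 | A2_odd \<Rightarrow> 4 | A2_odd_dagger \<Rightarrow> 2 | C1 \<Rightarrow> 4)
     else case tp of A2_even \<Rightarrow> (if min i j = n - 1 then - 1 else 0)
       | A2_odd_dagger \<Rightarrow> (if min i j = n - 2 then - 1 else 0)
       | _ \<Rightarrow> (if min i j = n - 1 then - 2 else 0))"
  using assms unfolding root_ip_def inner_wt_simple_root[OF assms(1,2,5)]
  by (cases tp) (auto simp: simple_root_def eps_wt_def)

lemma root_ip_commute: "root_ip tp n i j = root_ip tp n j i"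
  by (simp add: root_ip_def inner_wt_def mult.commute)

lemma q_i_eq:
  assumes "1 \<le> i" "i \<le> n" "1 < n"
  shows "q_i tp n i = (if i < n then q tp else case tp of A2_even \<Rightarrow> indet | A2_odd_dagger \<Rightarrow> q tp | _ \<Rightarrow> q tp ^ 2)"
  using assms by (cases tp) (auto simp: q_i_def root_ip_eq q_half_def q_def power2_eq_square)

lemma q_i_gt_1:
  assumes "1 \<le> i" "i \<le> n" "1 < n"
  shows "q_i tp n i > 1"
  using assms q_gt_1[of tp] indet_gt_1
  by (cases tp) (auto simp: q_i_eq one_less_power)

lemma q_i_square:
  assumes "1 \<le> i" "i \<le> n" "1 < n"
  shows "q_i tp n i ^ 2 = q tp powi root_ip tp n i i"
  using assms by (cases tp) (auto simp: q_i_eq root_ip_eq power_int_def q_def simp flip: power_mult)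

lemma sum_EE:
  assumes "finite B"
  shows "(\<Sum>b\<in>B. EE i j a b * h b) = (if a = i \<and> j \<in> B then h j else 0)"
proof -
  have "(\<Sum>b\<in>B. EE i j a b * h b) = (\<Sum>b\<in>B. if b = j then (if a = i then h j else 0) else 0)"
    by (intro sum.cong) (auto simp: EE_def)
  then show ?thesis using assms by simp
qed

lemma sum_EE':
  assumes "finite B"
  shows "(\<Sum>b\<in>B. EE j i b a * h b) = (if a = i \<and> j \<in> B then h j else 0)"
  using sum_EE[OF assms, of i j a h] by (simp add: EE_def conj_commute)

definition eV :: "affine_type \<Rightarrow> nat \<Rightarrow> nat \<Rightarrow> (int \<Rightarrow> K) \<Rightarrow> int \<Rightarrow> K" where
  "eV tp n i h a = (\<Sum>b\<in>idx tp n. vec_e tp n i a b * h b)"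

definition fV :: "affine_type \<Rightarrow> nat \<Rightarrow> nat \<Rightarrow> (int \<Rightarrow> K) \<Rightarrow> int \<Rightarrow> K" where
  "fV tp n i h a = (\<Sum>b\<in>idx tp n. vec_f tp n i a b * h b)"

lemma eV_eq:
  assumes "1 \<le> i" "i \<le> n" "1 < n"
  shows "eV tp n i h a =
    (if i < n then (if a = int i then h (int i + 1) else 0) + (if a = - int i - 1 then h (- int i) else 0)
     else case tp of
       A2_even \<Rightarrow> (if a = int n then qint tp n n 2 * h 0 else 0) + (if a = 0 then h (- int n) else 0)
     | A2_odd_dagger \<Rightarrow> (if a = int n - 1 then h (- int n) else 0) + (if a = int n then h (- int n + 1) else 0)
     | _ \<Rightarrow> (if a = int n then h (- int n) else 0))"
  using assms unfolding eV_def vec_e_def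
  by (cases tp) (simp_all add: distrib_right sum.distrib sum_EE sum_EE[where h = h] mult.assoc
      sum_distrib_left[symmetric] idx_iff)

lemma fV_eq:
  assumes "1 \<le> i" "i \<le> n" "1 < n"
  shows "fV tp n i h a =
    (if i < n then (if a = int i + 1 then h (int i) else 0) + (if a = - int i then h (- int i - 1) else 0)
     else case tp of
       A2_even \<Rightarrow> (if a = 0 then h (int n) else 0) + (if a = - int n then qint tp n n 2 * h 0 else 0)
     | A2_odd_dagger \<Rightarrow> (if a = - int n then h (int n - 1) else 0) + (if a = - int n + 1 then h (int n) else 0)
     | _ \<Rightarrow> (if a = - int n then h (int n) else 0))"
  using assms unfolding fV_def vec_f_def vec_e_def
  by (cases tp) (simp_all add: distrib_right sum.distrib sum_EE sum_EE' mult.assoc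
      sum_distrib_left[symmetric] idx_iff)

lemma vec_e_nz:
  assumes "1 \<le> i" "i \<le> n" "1 < n" "vec_e tp n i a b \<noteq> 0"
  shows "(i < n \<and> (a = int i \<and> b = int i + 1 \<or> a = - int i - 1 \<and> b = - int i)) \<or>
    (i = n \<and> (case tp of A2_even \<Rightarrow> a = int n \<and> b = 0 \<or> a = 0 \<and> b = - int n
      | A2_odd_dagger \<Rightarrow> a = int n - 1 \<and> b = - int n \<or> a = int n \<and> b = - int n + 1
      | _ \<Rightarrow> a = int n \<and> b = - int n))"
  using assms by (cases tp) (auto simp: vec_e_def EE_def split: if_splits)

text \<open>Negating all letters exchanges raising and lowering, so facts about \<open>vec_f\<close>
  are read off from those about \<open>vec_e\<close>.\<close>

lemma vec_f_eq_vec_e: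
  assumes "1 \<le> i" "i \<le> n"
  shows "vec_f tp n i a b = vec_e tp n i (- a) (- b)"
  using assms by (cases tp) (auto simp: vec_f_def vec_e_def EE_def)

lemma lwt_uminus: "1 \<le> i \<Longrightarrow> i \<le> n \<Longrightarrow> 1 < n \<Longrightarrow> lwt tp n i (- a) = - lwt tp n i a"
  by (cases tp) (simp_all add: lwt_eq sgn_minus)

text \<open>A height that falls from n at the letter 1 through 0 at the letter 0 to -n at the letter
  -1, strictly along the order of letters.\<close>

definition lht :: "nat \<Rightarrow> int \<Rightarrow> int" where
  "lht n a = sgn a * (int n + 1 - \<bar>a\<bar>)"

lemma vec_e_lht:
  assumes "1 \<le> i" "i \<le> n" "1 < n" "vec_e tp n i a b \<noteq> 0"
  shows "lht n a \<ge> lht n b + 1"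
  using vec_e_nz[OF assms] assms(1-3) by (cases tp) (auto simp: lht_def)

lemma vec_f_lht:
  assumes "1 \<le> i" "i \<le> n" "1 < n" "vec_f tp n i a b \<noteq> 0"
  shows "- lht n a \<ge> - lht n b + 1"
  using vec_e_lht[of i n tp "- a" "- b"] assms by (simp add: vec_f_eq_vec_e lht_def sgn_minus)

lemma vec_e_idx:
  assumes "1 \<le> i" "i \<le> n" "1 < n" "vec_e tp n i a b \<noteq> 0"
  shows "a \<in> idx tp n"
  using vec_e_nz[OF assms] assms(1-3) by (cases tp) (auto simp: idx_iff)

lemma vec_f_idx:
  assumes "1 \<le> i" "i \<le> n" "1 < n" "vec_f tp n i a b \<noteq> 0"
  shows "a \<in> idx tp n"
  using vec_e_idx[of i n tp "- a" "- b"] assms by (simp add: vec_f_eq_vec_e idx_iff)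

lemma idx_wt_int:
  "idx_wt (int i) = eps_wt i" if "1 \<le> i"
  using that by (auto simp: idx_wt_def eps_wt_def fun_eq_iff)

lemma idx_wt_uminus: "idx_wt (- a) m = - idx_wt a m"
  by (simp add: idx_wt_def sgn_minus)

lemma idx_wt_0: "idx_wt 0 m = 0"
  by (simp add: idx_wt_def)

lemma vec_e_lwt:
  assumes "1 \<le> i" "i \<le> n" "1 \<le> j" "j \<le> n" "1 < n" "vec_e tp n i a b \<noteq> 0"
  shows "lwt tp n j a = lwt tp n j b + root_ip tp n j i"
proof -
  have 1: "idx_wt (int i + 1) = eps_wt (i + 1)" "idx_wt (int n - 1) = eps_wt (n - 1)"
    using idx_wt_int[of "i + 1"] idx_wt_int[of "n - 1"] assms(1,5) by (simp_all add: add.commute of_nat_diff)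
  have 2: "idx_wt (- int i - 1) m = - eps_wt (i + 1) m" "idx_wt (- int n + 1) m = - eps_wt (n - 1) m"
    "idx_wt (1 - int n) m = - eps_wt (n - 1) m" for m
    using idx_wt_uminus[of "int i + 1" m] idx_wt_uminus[of "int n - 1" m] 1 by simp_all
  have "idx_wt a m = idx_wt b m + simple_root tp n i m" for m
  proof -
    have w: "idx_wt (int i) = eps_wt i" "idx_wt (int n) = eps_wt n" using assms(1,5) by (simp_all add: idx_wt_int)
    consider "i < n" "a = int i" "b = int i + 1" | "i < n" "a = - int i - 1" "b = - int i"
      | "i = n" "tp = A2_even" "a = int n" "b = 0" | "i = n" "tp = A2_even" "a = 0" "b = - int n"
      | "i = n" "tp = A2_odd_dagger" "a = int n - 1" "b = - int n"
      | "i = n" "tp = A2_odd_dagger" "a = int n" "b = - int n + 1"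
      | "i = n" "tp = A2_odd \<or> tp = C1" "a = int n" "b = - int n"
      using vec_e_nz[OF assms(1,2,5,6)] by (cases tp; simp; blast)
    then show ?thesis
      by cases (simp_all only: 1 2 w idx_wt_uminus idx_wt_0 simple_root_def, auto)
  qed
  then show ?thesis
    by (simp add: lwt_def root_ip_def inner_wt_def distrib_left sum.distrib)
qed

lemma vec_f_lwt:
  assumes "1 \<le> i" "i \<le> n" "1 \<le> j" "j \<le> n" "1 < n" "vec_f tp n i a b \<noteq> 0"
  shows "lwt tp n j a = lwt tp n j b - root_ip tp n j i"
  using vec_e_lwt[of i n j tp "- a" "- b"] assms by (simp add: vec_f_eq_vec_e lwt_uminus)

lemma qint_2:
  assumes "1 \<le> i" "i \<le> n" "1 < n"
  shows "qint tp n i 2 = q_i tp n i + inverse (q_i tp n i)"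
proof -
  let ?x = "q_i tp n i"
  have "?x > 1" by (rule q_i_gt_1[OF assms])
  moreover from this have "inverse ?x < 1" by (simp add: inverse_less_1_iff)
  ultimately have "?x - inverse ?x \<noteq> 0" by auto
  moreover have "?x\<^sup>2 - (inverse ?x)\<^sup>2 = (?x + inverse ?x) * (?x - inverse ?x)"
    by (simp add: power2_eq_square algebra_simps)
  ultimately show ?thesis by (simp add: qint_def del: power_inverse)
qed

definition dd :: "affine_type \<Rightarrow> nat \<Rightarrow> nat \<Rightarrow> K" where
  "dd tp n i = inverse (q_i tp n i - inverse (q_i tp n i))"

lemma dd_pos: "1 \<le> i \<Longrightarrow> i \<le> n \<Longrightarrow> 1 < n \<Longrightarrow> dd tp n i > 0"
  using q_i_gt_1[of i n tp] inverse_less_1_iff[of "q_i tp n i"] by (simp add: dd_def)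

lemma dd_eq:
  assumes "1 \<le> i" "i \<le> n" "1 < n"
  shows "dd tp n i * (q_i tp n i - inverse (q_i tp n i)) = 1"
    "dd tp n i * ((q_i tp n i)\<^sup>2 - (inverse (q_i tp n i))\<^sup>2) = qint tp n i 2"
  using dd_pos[OF assms, of tp] by (auto simp: dd_def qint_def divide_inverse mult.commute)

lemma eV_fV_diag:
  assumes "1 \<le> i" "i \<le> n" "1 < n"
  shows "eV tp n i (fV tp n i h) a - fV tp n i (eV tp n i h) a =
     dd tp n i * (q tp powi lwt tp n i a - q tp powi (- lwt tp n i a)) * h a"
proof (cases "i < n")
  case True
  then have "q_i tp n i = q tp" using assms by (simp add: q_i_eq)
  then have 1: "dd tp n i * (q tp - inverse (q tp)) = 1" using dd_eq[OF assms, of tp] by simp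
  then have 2: "dd tp n i * (inverse (q tp) - q tp) = - 1" by (simp add: algebra_simps)
  show ?thesis using True assms 1 2
    by (auto simp: eV_eq fV_eq lwt_eq)
next
  case False
  then have i: "i = n" using assms by simp
  note [simp] = i
  show ?thesis
  proof (cases tp)
    case A2_even
    have 1: "q tp = (q_i tp n n)\<^sup>2"
      using A2_even assms by (simp add: q_i_eq q_def)
    \<comment> \<open>Since q is the square of \<open>q_i tp n n\<close>, the letters n and -n of
      weight 1 and -1 produce the quantum integer 2; this is the coefficient built into
      \<open>e_n\<close> and \<open>f_n\<close>.\<close>
    have "dd tp n n * (q tp - inverse (q tp)) = qint tp n n 2" "dd tp n n * (inverse (q tp) - q tp) = - qint tp n n 2"
      using dd_eq(2)[OF assms, of tp] unfolding 1 by (simp_all add: algebra_simps power_inverse)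
    then show ?thesis using A2_even assms
      by (auto simp: eV_eq fV_eq lwt_eq)
  next
    case A2_odd
    have q2: "q_i tp n n = q tp ^ 2" using A2_odd assms by (simp add: q_i_eq)
    have 1: "dd tp n n * ((q tp)\<^sup>2 - (inverse (q tp))\<^sup>2) = 1"
      using dd_eq(1)[OF assms, of tp] by (simp add: q2 power_inverse)
    then have 2: "dd tp n n * ((inverse (q tp))\<^sup>2 - (q tp)\<^sup>2) = - 1" by (simp add: algebra_simps)
    show ?thesis using A2_odd assms 1 2
      by (auto simp: eV_eq fV_eq lwt_eq power_int_minus power_inverse)
  next
    case A2_odd_dagger
    then have "q_i tp n n = q tp" using assms by (simp add: q_i_eq)
    then have 1: "dd tp n n * (q tp - inverse (q tp)) = 1" using dd_eq(1)[OF assms, of tp] by simp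
    then have 2: "dd tp n n * (inverse (q tp) - q tp) = - 1" by (simp add: algebra_simps)
    show ?thesis using A2_odd_dagger assms 1 2
      by (auto simp: eV_eq fV_eq lwt_eq)
  next
    case C1
    have q2: "q_i tp n n = q tp ^ 2" using C1 assms by (simp add: q_i_eq)
    have 1: "dd tp n n * ((q tp)\<^sup>2 - (inverse (q tp))\<^sup>2) = 1"
      using dd_eq(1)[OF assms, of tp] by (simp add: q2 power_inverse)
    then have 2: "dd tp n n * ((inverse (q tp))\<^sup>2 - (q tp)\<^sup>2) = - 1" by (simp add: algebra_simps)
    show ?thesis using C1 assms 1 2
      by (auto simp: eV_eq fV_eq lwt_eq power_int_minus power_inverse)
  qed
qed

lemma eV_fV_comm:
  assumes "1 \<le> i" "i \<le> n" "1 \<le> j" "j \<le> n" "1 < n" "i \<noteq> j"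
  shows "eV tp n i (fV tp n j h) a = fV tp n j (eV tp n i h) a"
proof (cases "i < n")
  case True
  have [simp]: "(int n - 1 = int l) = (n = Suc l)" "(int l = int n - 1) = (n = Suc l)" "- 1 - int l = - int l - 1"
    "(- int l - 1 = - int n) = (n = Suc l)" "(- int n = - int l - 1) = (n = Suc l)" for l by auto
  show ?thesis
  proof (cases "j < n")
    assume "j < n"
    then show ?thesis using True assms by (auto simp: eV_eq fV_eq)
  next
    assume "\<not> j < n"
    then show ?thesis using True assms by (cases tp) (auto simp: eV_eq fV_eq add.commute)
  qed
next
  case False
  have [simp]: "(int n - 1 = int l) = (n = Suc l)" "(int l = int n - 1) = (n = Suc l)" "- 1 - int l = - int l - 1"
    "(- int l - 1 = - int n) = (n = Suc l)" "(- int n = - int l - 1) = (n = Suc l)" for l by auto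
  show ?thesis using False assms by (cases tp) (auto simp: eV_eq fV_eq add.commute)
qed

text \<open>The weight of a letter in the invariant form. In type \<open>A2_even\<close> the
  matrices of \<open>e_n\<close> and \<open>f_n\<close> are not transposes of each other at the
  letter 0, and adjointness forces the value \<open>q_i tp n n * qint tp n n 2\<close>, which is 1 +
  q.\<close>

definition lg :: "affine_type \<Rightarrow> int \<Rightarrow> K" where
  "lg tp a = (if a = 0 then 1 + q tp else 1)"

lemma lg_pos: "lg tp a > 0"
  using q_gt_1[of tp] by (simp add: lg_def)

lemma vec_adjoint:
  assumes "1 \<le> i" "i \<le> n" "1 < n"
  shows "lg tp a * vec_e tp n i a b = q_i tp n i * lg tp b * vec_f tp n i b a * q tp powi (- lwt tp n i a)"
proof (cases "vec_e tp n i a b = 0 \<and> vec_f tp n i b a = 0")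
  case False
  have A: "qint tp n n 2 = indet + inverse indet" if "tp = A2_even"
    using that assms by (simp add: qint_2 q_i_eq)
  have "tp = A2_even \<Longrightarrow> qint tp n n 2 > 0" using A indet_gt_1 by (simp add: add_pos_pos)
  then have "vec_e tp n i a b \<noteq> 0" using False assms by (cases tp) (auto simp: vec_f_def A split: if_splits simp: vec_e_def EE_def)
  from vec_e_nz[OF assms this] show ?thesis using assms A
    by (cases tp)
      (auto simp: vec_f_def vec_e_def EE_def q_i_eq lwt_eq lg_def q_def power2_eq_square power_int_minus
        distrib_left field_simps)
qed simp

subsection \<open>Tensor powers\<close>

definition words :: "affine_type \<Rightarrow> nat \<Rightarrow> nat \<Rightarrow> int list set" where
  "words tp n k = {w. length w = k \<and> set w \<subseteq> idx tp n}"

lemma carrier_tpow: "carrier (tpow tp n k) = supported (words tp n k)"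
  by (simp add: tpow_def supported_def words_def)

lemma finite_words: "finite (words tp n k)"
  using finite_lists_length_eq[OF finite_idx, of tp n k] by (simp add: words_def conj_commute)

lemma words_0 [simp]: "words tp n 0 = {[]}"
  by (auto simp: words_def)

lemma words_Suc: "words tp n (Suc k) = (\<lambda>(a, u). a # u) ` (idx tp n \<times> words tp n k)"
  by (auto simp: words_def length_Suc_conv image_iff)

lemma Cons_in_words [simp]: "a # u \<in> words tp n (Suc k) \<longleftrightarrow> a \<in> idx tp n \<and> u \<in> words tp n k"
  by (auto simp: words_def)

lemma sum_words_Suc:
  "(\<Sum>w\<in>words tp n (Suc k). h w) = (\<Sum>a\<in>idx tp n. \<Sum>u\<in>words tp n k. h (a # u))"
proof -
  have "inj_on (\<lambda>(a, u). a # u) (idx tp n \<times> words tp n k)" by (auto simp: inj_on_def)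
  then show ?thesis
    unfolding words_Suc by (simp add: sum.reindex sum.cartesian_product case_prod_unfold)
qed

text \<open>The operator \<open>\<Sum> l \<otimes> \<dots> \<otimes> l \<otimes> M \<otimes> r \<otimes> \<dots> \<otimes> r\<close> with diagonal \<open>l\<close> and \<open>r\<close>; the iterated
  coproducts of \<open>e\<^sub>i\<close> and \<open>f\<^sub>i\<close> are of this form.\<close>

primrec cop :: "int set \<Rightarrow> (int \<Rightarrow> int \<Rightarrow> K) \<Rightarrow> (int \<Rightarrow> K) \<Rightarrow> (int \<Rightarrow> K) \<Rightarrow> (int list \<Rightarrow> K) \<Rightarrow> int list \<Rightarrow> K" where
  "cop B M l r x [] = 0"
| "cop B M l r x (a # u) = (\<Sum>b\<in>B. M a b * (prod_list (map r u) * x (b # u)))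
     + l a * cop B M l r (\<lambda>u'. x (a # u')) u"


lemma cop_add: "cop B M l r (\<lambda>w. x w + y w) u = cop B M l r x u + cop B M l r y u"
  by (induction u arbitrary: x y) (simp_all add: sum.distrib algebra_simps)

lemma cop_smul: "cop B M l r (\<lambda>w. c * x w) u = c * cop B M l r x u"
  by (induction u arbitrary: x) (simp_all add: sum_distrib_left algebra_simps)

lemma cop_zero: "cop B M l r (\<lambda>w. 0) u = 0"
  using cop_smul[of B M l r 0 "\<lambda>w. 0" u] by simp

lemma cop_sum: "cop B M l r (\<lambda>w. \<Sum>c\<in>C. k c * y c w) u = (\<Sum>c\<in>C. k c * cop B M l r (y c) u)"
  by (induction C rule: infinite_finite_induct) (simp_all add: cop_zero cop_add cop_smul)

text \<open>Coassociativity: either the operator acts inside u and v is scaled by r, or it acts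
  inside v and u is scaled by l.\<close>

lemma cop_append:
  "cop B M l r x (u @ v) = prod_list (map r v) * cop B M l r (\<lambda>u'. x (u' @ v)) u
     + prod_list (map l u) * cop B M l r (\<lambda>v'. x (u @ v')) v"
  by (induction u arbitrary: x) (simp_all add: sum_distrib_left algebra_simps)

text \<open>The parameter z stands for the tensor positions on which the operator does not act:
  linear conditions there are preserved.\<close>

lemma cop_closed:
  assumes S: "subsp S" and "\<And>w. F w \<in> S"
  shows "(\<lambda>z. cop B M l r (\<lambda>w. F w z) u) \<in> S"
  using assms(2)
proof (induction u arbitrary: F)
  case Nil
  then show ?case using subspD(1)[OF S] by (simp add: zero_fun_def)
next
  case (Cons a u)
  have "(\<lambda>z. cop B M l r (\<lambda>w. F w z) (a # u)) =
      (\<Sum>b\<in>B. (M a b * prod_list (map r u)) \<star> F (b # u)) + l a \<star> (\<lambda>z. cop B M l r (\<lambda>u'. F (a # u') z) u)"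
    by (auto simp: fun_eq_iff fun_apply sum_fun_apply mult.assoc)
  also have "\<dots> \<in> S"
    by (intro subspD(2,3)[OF S] subsp_sum[OF S] Cons.IH Cons.prems)
  finally show ?case .
qed

lemma cop_char:
  assumes "\<And>a b. M a b \<noteq> 0 \<Longrightarrow> chi a = \<rho> * chi b"
  shows "prod_list (map chi w) * cop B M l r x w = \<rho> * cop B M l r (\<lambda>w. prod_list (map chi w) * x w) w"
proof (induction w arbitrary: x)
  case (Cons a u)
  have M: "chi a * M a b = \<rho> * chi b * M a b" for a b using assms[of a b] by (cases "M a b = 0") auto
  have "prod_list (map chi (a # u)) * cop B M l r x (a # u) =
    (\<Sum>b\<in>B. (chi a * M a b) * (prod_list (map chi u) * prod_list (map r u) * x (b # u)))
     + l a * chi a * (prod_list (map chi u) * cop B M l r (\<lambda>u'. x (a # u')) u)"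
    by (simp add: sum_distrib_left algebra_simps)
  also have "\<dots> = (\<Sum>b\<in>B. (\<rho> * chi b * M a b) * (prod_list (map chi u) * prod_list (map r u) * x (b # u)))
     + l a * chi a * (\<rho> * cop B M l r (\<lambda>w. prod_list (map chi w) * x (a # w)) u)"
    by (simp only: M Cons.IH)
  also have "\<dots> = \<rho> * cop B M l r (\<lambda>w. prod_list (map chi w) * x w) (a # u)"
    by (simp add: sum_distrib_left cop_smul mult.assoc algebra_simps flip: cop_smul)
  finally show ?case .
qed simp

lemma cop_raising:
  assumes "\<And>a b. M a b \<noteq> 0 \<Longrightarrow> h a \<ge> h b + (1::int)" "cop B M l r x w \<noteq> 0"
  shows "\<exists>w'. x w' \<noteq> 0 \<and> sum_list (map h w) \<ge> sum_list (map h w') + 1"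
  using assms(2)
proof (induction w arbitrary: x)
  case (Cons a u)
  then consider "(\<Sum>b\<in>B. M a b * (prod_list (map r u) * x (b # u))) \<noteq> 0"
    | "cop B M l r (\<lambda>u'. x (a # u')) u \<noteq> 0" by fastforce
  then show ?case
  proof cases
    case 1
    then obtain b where "M a b * (prod_list (map r u) * x (b # u)) \<noteq> 0"
      by (meson sum.not_neutral_contains_not_neutral)
    then have "x (b # u) \<noteq> 0" "h a \<ge> h b + 1" using assms(1)[of a b] by auto
    then show ?thesis by (intro exI[of _ "b # u"]) simp
  next
    case 2
    from Cons.IH[OF this] obtain u' where "x (a # u') \<noteq> 0" "sum_list (map h u') + 1 \<le> sum_list (map h u)" by blast
    then show ?thesis by (intro exI[of _ "a # u'"]) simp
  qed
qed simp

lemma slice_supported: "x \<in> supported (words tp n (Suc k)) \<Longrightarrow> (\<lambda>u. x (a # u)) \<in> supported (words tp n k)"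
  by (auto simp: supported_def)

lemma cop_supported:
  assumes "\<And>a b. M a b \<noteq> 0 \<Longrightarrow> a \<in> idx tp n" "x \<in> supported (words tp n k)"
  shows "cop (idx tp n) M l r x \<in> supported (words tp n k)"
proof -
  have "w \<in> words tp n k" if "cop (idx tp n) M l r x w \<noteq> 0" for w
    using that assms(2)
  proof (induction w arbitrary: x k)
    case (Cons a u)
    then consider "(\<Sum>b\<in>idx tp n. M a b * (prod_list (map r u) * x (b # u))) \<noteq> 0"
      | "cop (idx tp n) M l r (\<lambda>u'. x (a # u')) u \<noteq> 0" by fastforce
    then show ?case
    proof cases
      case 1
      then obtain b where "M a b * (prod_list (map r u) * x (b # u)) \<noteq> 0"
        by (meson sum.not_neutral_contains_not_neutral)
      then have "x (b # u) \<noteq> 0" "a \<in> idx tp n" using assms(1)[of a b] by auto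
      then show ?thesis using Cons.prems(2) by (fastforce simp: supported_def words_def)
    next
      case 2
      then have "(\<lambda>u'. x (a # u')) \<noteq> (\<lambda>u'. 0)" by (auto simp: cop_zero)
      then obtain u' where u': "x (a # u') \<noteq> 0" by (auto simp: fun_eq_iff)
      then obtain k' where k: "k = Suc k'" and a: "a \<in> idx tp n" using Cons.prems(2) by (auto simp: supported_def words_def)
      have "u \<in> words tp n k'"
        using Cons.IH[OF 2] Cons.prems(2) slice_supported[of x tp n k' a] by (simp add: k)
      then show ?thesis using a by (simp add: k)
    qed
  qed simp
  then show ?thesis by (auto simp: supported_def)
qed

text \<open>Covers both commutators at once. For i = j the characters \<sigma> and \<tau> coincide
  and \<delta> is the inverse of the difference of \<open>q_i\<close> and its inverse; for distinct
  indices \<delta> is 0. Induction on the word uses the commutator on one letter and on the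
  rest.\<close>

lemma cop_commutator:
  assumes Me: "\<And>a b. Me a b \<noteq> 0 \<Longrightarrow> \<sigma> a = \<rho> * \<sigma> b" and Mf: "\<And>a b. Mf a b \<noteq> 0 \<Longrightarrow> \<tau> b = \<rho> * \<tau> a"
    and nz: "\<And>a. \<tau> a \<noteq> 0" "\<rho> \<noteq> 0"
    and comm: "\<And>h a. (\<Sum>b\<in>B. Me a b * (\<Sum>c\<in>B. Mf b c * h c)) - (\<Sum>b\<in>B. Mf a b * (\<Sum>c\<in>B. Me b c * h c))
        = \<delta> * (\<tau> a - inverse (\<tau> a)) * h a"
    and st: "\<delta> = 0 \<or> \<sigma> = \<tau>"
  defines "eo \<equiv> cop B Me (\<lambda>_. 1) (\<lambda>a. inverse (\<tau> a))" and "fo \<equiv> cop B Mf \<sigma> (\<lambda>_. 1)"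
  shows "eo (fo x) w - fo (eo x) w = \<delta> * (prod_list (map \<tau> w) - inverse (prod_list (map \<tau> w))) * x w"
proof (induction w arbitrary: x)
  case Nil
  then show ?case by (simp add: eo_def fo_def)
next
  case (Cons a u)
  define R where "R u = prod_list (map (\<lambda>a. inverse (\<tau> a)) u)" for u
  have R: "R u = inverse (prod_list (map \<tau> u))" for u
    by (induction u) (simp_all add: R_def)
  have prod1: "prod_list (map (\<lambda>_. 1) v) = (1 :: K)" for v :: "int list" by (induction v) auto
  have eoC: "eo y (a # u) = (\<Sum>b\<in>B. Me a b * (R u * y (b # u))) + eo (\<lambda>u'. y (a # u')) u" for y a u
    by (simp add: eo_def R_def)
  have foC: "fo y (a # u) = (\<Sum>b\<in>B. Mf a b * y (b # u)) + \<sigma> a * fo (\<lambda>u'. y (a # u')) u" for y a u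
    by (simp add: fo_def prod1)
  have fR: "fo (\<lambda>u'. R u' * y u') u = inverse \<rho> * (R u * fo y u)" for y u
    using cop_char[of Mf "\<lambda>a. inverse (\<tau> a)" \<rho> u B \<sigma> "\<lambda>_. 1" y] Mf nz
    by (simp add: fo_def R_def)
  let ?x = "\<lambda>a u. x (a # u)"
  have 1: "eo (fo x) (a # u) = R u * (\<Sum>b\<in>B. Me a b * (\<Sum>c\<in>B. Mf b c * x (c # u)))
      + (\<Sum>b\<in>B. Me a b * \<sigma> b * (R u * fo (?x b) u)) + (\<Sum>c\<in>B. Mf a c * eo (?x c) u) + \<sigma> a * eo (fo (?x a)) u"
  proof -
    have "eo (\<lambda>u'. fo x (a # u')) u = (\<Sum>c\<in>B. Mf a c * eo (?x c) u) + \<sigma> a * eo (fo (?x a)) u"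
      unfolding foC eo_def cop_add cop_sum cop_smul ..
    then show ?thesis
      unfolding eoC by (simp add: foC sum.distrib sum_distrib_left algebra_simps)
  qed
  have 2: "fo (eo x) (a # u) = R u * (\<Sum>b\<in>B. Mf a b * (\<Sum>c\<in>B. Me b c * x (c # u)))
      + (\<Sum>b\<in>B. Mf a b * eo (?x b) u) + (\<Sum>b\<in>B. \<sigma> a * Me a b * (inverse \<rho> * (R u * fo (?x b) u))) + \<sigma> a * fo (eo (?x a)) u"
  proof -
    have "fo (\<lambda>u'. eo x (a # u')) u = (\<Sum>b\<in>B. Me a b * fo (\<lambda>u'. R u' * x (b # u')) u) + fo (eo (?x a)) u"
      unfolding eoC fo_def cop_add cop_sum by simp
    then show ?thesis
      unfolding foC[of "eo x"] fR
      by (simp add: eoC sum.distrib sum_distrib_left algebra_simps)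
  qed
  \<comment> \<open>The mixed terms, raising the first letter and lowering a later one, agree in
    both orders, because \<sigma> and the remaining product of inverses of \<tau> change by the same
    factor \<rho>.\<close>
  have 3: "Me a b * \<sigma> b = \<sigma> a * Me a b * inverse \<rho>" for b
    using Me[of a b] nz by (cases "Me a b = 0") auto
  have "eo (fo x) (a # u) - fo (eo x) (a # u)
      = R u * ((\<Sum>b\<in>B. Me a b * (\<Sum>c\<in>B. Mf b c * x (c # u))) - (\<Sum>b\<in>B. Mf a b * (\<Sum>c\<in>B. Me b c * x (c # u))))
      + \<sigma> a * (eo (fo (?x a)) u - fo (eo (?x a)) u)"
    unfolding 1 2 3 by (simp add: algebra_simps)
  also have "\<dots> = R u * (\<delta> * (\<tau> a - inverse (\<tau> a)) * x (a # u))
      + \<sigma> a * (\<delta> * (prod_list (map \<tau> u) - R u) * x (a # u))"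
    unfolding comm Cons.IH R ..
  also have "\<dots> = \<delta> * (prod_list (map \<tau> (a # u)) - R (a # u)) * x (a # u)"
    using st nz by (auto simp: R_def algebra_simps)
  finally show ?case by (simp add: R)
qed

text \<open>Composing the coproduct of f with the inverse of t in both factors turns f \<otimes> 1 +
  t \<otimes> f into f t' \<otimes> t' + 1 \<otimes> f t', with t' the inverse of t. Factor by
  factor this is, up to c, the adjoint of e \<otimes> t' + 1 \<otimes> e.\<close>

lemma cop_adjoint:
  assumes "\<And>a b. lg tp a * Me a b = c * lg tp b * Mf b a * inverse (\<tau> a)" "\<And>a. \<tau> a \<noteq> 0"
  shows "wip (words tp n k) (\<lambda>w. prod_list (map (lg tp) w)) (cop (idx tp n) Me (\<lambda>_. 1) (\<lambda>a. inverse (\<tau> a)) x) y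
    = c * wip (words tp n k) (\<lambda>w. prod_list (map (lg tp) w)) x
        (cop (idx tp n) Mf \<tau> (\<lambda>_. 1) (\<lambda>w. inverse (prod_list (map \<tau> w)) * y w))"
proof (induction k arbitrary: x y)
  case 0
  then show ?case by (simp add: wip_def)
next
  case (Suc k)
  define R where "R u = inverse (prod_list (map \<tau> u))" for u
  have R: "prod_list (map (\<lambda>a. inverse (\<tau> a)) u) = R u" for u
    by (induction u) (simp_all add: R_def)
  have prod1: "prod_list (map (\<lambda>_. 1) v) = (1 :: K)" for v :: "int list" by (induction v) auto
  let ?J = "idx tp n" and ?eo = "cop (idx tp n) Me (\<lambda>_. 1) (\<lambda>a. inverse (\<tau> a))"
    and ?fo = "cop (idx tp n) Mf \<tau> (\<lambda>_. 1)" and ?g = "\<lambda>w. prod_list (map (lg tp) w)"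
  have "wip (words tp n (Suc k)) ?g (?eo x) y
    = (\<Sum>a\<in>?J. \<Sum>u\<in>words tp n k. \<Sum>b\<in>?J. (lg tp a * Me a b) * (?g u * R u * x (b # u) * y (a # u)))
    + (\<Sum>a\<in>?J. lg tp a * wip (words tp n k) ?g (?eo (\<lambda>u. x (a # u))) (\<lambda>u. y (a # u)))"
    by (simp add: wip_def sum_words_Suc R sum.distrib sum_distrib_left sum_distrib_right algebra_simps)
  also have "(\<Sum>a\<in>?J. \<Sum>u\<in>words tp n k. \<Sum>b\<in>?J. (lg tp a * Me a b) * (?g u * R u * x (b # u) * y (a # u)))
    = (\<Sum>b\<in>?J. \<Sum>u\<in>words tp n k. \<Sum>a\<in>?J. (lg tp a * Me a b) * (?g u * R u * x (b # u) * y (a # u)))"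
    by (subst (1 2) sum.swap) (rule sum.cong[OF refl], rule sum.swap)
  also have "\<dots> = (\<Sum>b\<in>?J. \<Sum>u\<in>words tp n k. \<Sum>a\<in>?J. (c * lg tp b * Mf b a * inverse (\<tau> a)) * (?g u * R u * x (b # u) * y (a # u)))"
    by (simp only: assms(1))
  also have "(\<Sum>a\<in>?J. lg tp a * wip (words tp n k) ?g (?eo (\<lambda>u. x (a # u))) (\<lambda>u. y (a # u)))
     = (\<Sum>a\<in>?J. lg tp a * (c * wip (words tp n k) ?g (\<lambda>u. x (a # u)) (?fo (\<lambda>w. R w * y (a # w)))))"
    by (simp only: Suc.IH R_def)
  also have "(\<Sum>b\<in>?J. \<Sum>u\<in>words tp n k. \<Sum>a\<in>?J. (c * lg tp b * Mf b a * inverse (\<tau> a)) * (?g u * R u * x (b # u) * y (a # u)))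
      + \<dots> = c * wip (words tp n (Suc k)) ?g x (?fo (\<lambda>w. R w * y w))"
  proof -
    have "?fo (\<lambda>w. R w * y w) (b # u) = (\<Sum>a\<in>?J. Mf b a * (inverse (\<tau> a) * R u * y (a # u)))
        + ?fo (\<lambda>u'. R u' * y (b # u')) u" for b u
    proof -
      have "?fo (\<lambda>u'. R (b # u') * y (b # u')) u = inverse (\<tau> b) * ?fo (\<lambda>u'. R u' * y (b # u')) u"
        by (simp add: R_def mult.assoc flip: cop_smul)
      then show ?thesis using assms(2)[of b] by (simp add: prod1 R_def)
    qed
    then show ?thesis
      by (simp add: wip_def sum_words_Suc sum.distrib sum_distrib_left algebra_simps)
  qed
  finally show ?case by (simp add: R_def)
qed

section \<open>The generators as operators on functions of words\<close>

definition tl_wt :: "affine_type \<Rightarrow> nat \<Rightarrow> nat \<Rightarrow> int \<Rightarrow> K" where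
  "tl_wt tp n i a = q tp powi lwt tp n i a"

definition ch :: "affine_type \<Rightarrow> nat \<Rightarrow> nat \<Rightarrow> int list \<Rightarrow> K" where
  "ch tp n i w = prod_list (map (tl_wt tp n i) w)"

definition Eo :: "affine_type \<Rightarrow> nat \<Rightarrow> nat \<Rightarrow> (int list \<Rightarrow> K) \<Rightarrow> int list \<Rightarrow> K" where
  "Eo tp n i = cop (idx tp n) (vec_e tp n i) (\<lambda>_. 1) (\<lambda>a. inverse (tl_wt tp n i a))"

definition Fo :: "affine_type \<Rightarrow> nat \<Rightarrow> nat \<Rightarrow> (int list \<Rightarrow> K) \<Rightarrow> int list \<Rightarrow> K" where
  "Fo tp n i = cop (idx tp n) (vec_f tp n i) (tl_wt tp n i) (\<lambda>_. 1)"

definition To :: "affine_type \<Rightarrow> nat \<Rightarrow> nat \<Rightarrow> (int list \<Rightarrow> K) \<Rightarrow> int list \<Rightarrow> K" where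
  "To tp n i x = (\<lambda>w. ch tp n i w * x w)"

definition To' :: "affine_type \<Rightarrow> nat \<Rightarrow> nat \<Rightarrow> (int list \<Rightarrow> K) \<Rightarrow> int list \<Rightarrow> K" where
  "To' tp n i x = (\<lambda>w. inverse (ch tp n i w) * x w)"

lemma tl_wt_pos: "tl_wt tp n i a > 0"
  by (simp add: tl_wt_def powi_pos)

lemma tl_wt_nz [simp]: "tl_wt tp n i a \<noteq> 0"
  using tl_wt_pos[of tp n i a] by auto

lemma ch_simps [simp]: "ch tp n i [] = 1" "ch tp n i (a # u) = tl_wt tp n i a * ch tp n i u"
  "ch tp n i (u @ v) = ch tp n i u * ch tp n i v"
  by (simp_all add: ch_def)

lemma ch_pos: "ch tp n i w > 0"
  by (induction w) (simp_all add: tl_wt_pos)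

lemma ch_nz [simp]: "ch tp n i w \<noteq> 0"
  using ch_pos[of tp n i w] by auto

lemma ch_wwt: "ch tp n i w = q tp powi wwt tp n i w"
  by (induction w) (simp_all add: tl_wt_def power_int_add)

lemma prod_inverse_tl: "prod_list (map (\<lambda>a. inverse (tl_wt tp n i a)) u) = inverse (ch tp n i u)"
  by (induction u) simp_all

lemma prod_const_1: "prod_list (map (\<lambda>_. 1) v) = (1 :: K)"
  by (induction v) auto

lemma tpow_act_t: "x \<in> supported (words tp n k) \<Longrightarrow> tpow_act tp n k (gen_t i) x = To tp n i x"
proof (induction k arbitrary: x)
  case (Suc k)
  have 0: "x [] = 0" using Suc.prems by (auto simp: supported_def words_def)
  show ?case
  proof
    fix w show "tpow_act tp n (Suc k) (gen_t i) x w = To tp n i x w"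
      using 0 Suc.IH[OF slice_supported[OF Suc.prems]] by (cases w)
        (simp_all add: op_tensor_def To_def tl_wt_def lwt_def)
  qed
qed (auto simp: To_def supported_def fun_eq_iff)

lemma tpow_act_tinv: "x \<in> supported (words tp n k) \<Longrightarrow> tpow_act tp n k (gen_tinv i) x = To' tp n i x"
proof (induction k arbitrary: x)
  case (Suc k)
  have 0: "x [] = 0" using Suc.prems by (auto simp: supported_def words_def)
  show ?case
  proof
    fix w show "tpow_act tp n (Suc k) (gen_tinv i) x w = To' tp n i x w"
      using 0 Suc.IH[OF slice_supported[OF Suc.prems]] by (cases w)
        (simp_all add: op_tensor_def To'_def tl_wt_def lwt_def power_int_minus)
  qed
qed (auto simp: To'_def supported_def fun_eq_iff)

lemma tpow_act_e: "x \<in> supported (words tp n k) \<Longrightarrow> tpow_act tp n k (gen_e i) x = Eo tp n i x"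
proof (induction k arbitrary: x)
  case 0
  then have x: "x (b # u) = 0" for b u by (auto simp: supported_def)
  have "Eo tp n i x w = 0" for w
    by (cases w) (simp_all add: Eo_def x cop_zero)
  then show ?case by (simp add: fun_eq_iff)
next
  case (Suc k)
  show ?case
  proof
    fix w show "tpow_act tp n (Suc k) (gen_e i) x w = Eo tp n i x w"
      using Suc slice_supported[OF Suc.prems] by (cases w)
        (simp_all add: op_tensor_def Eo_def tpow_act_tinv To'_def mat_op_def prod_inverse_tl)
  qed
qed

lemma tpow_act_f: "x \<in> supported (words tp n k) \<Longrightarrow> tpow_act tp n k (gen_f i) x = Fo tp n i x"
proof (induction k arbitrary: x)
  case 0
  then have x: "x (b # u) = 0" for b u by (auto simp: supported_def)
  have "Fo tp n i x w = 0" for w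
    by (cases w) (simp_all add: Fo_def x cop_zero)
  then show ?case by (simp add: fun_eq_iff)
next
  case (Suc k)
  show ?case
  proof
    fix w show "tpow_act tp n (Suc k) (gen_f i) x w = Fo tp n i x w"
      using Suc slice_supported[OF Suc.prems] by (cases w)
        (simp_all add: op_tensor_def Fo_def mat_op_def prod_const_1 tl_wt_def lwt_def)
  qed
qed

definition lgw :: "affine_type \<Rightarrow> int list \<Rightarrow> K" where
  "lgw tp w = prod_list (map (lg tp) w)"

definition htw :: "nat \<Rightarrow> int list \<Rightarrow> int" where
  "htw n w = sum_list (map (lht n) w)"

locale tensor_power =
  fixes tp :: affine_type and n k :: nat
  assumes n1: "1 < n"
begin

lemma lin_cop:
  assumes "\<And>a b. M a b \<noteq> 0 \<Longrightarrow> a \<in> idx tp n"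
  shows "lin_on (words tp n k) (cop (idx tp n) M l r)"
  using cop_supported[OF assms]
  by (auto simp: lin_on_def fun_eq_iff fun_apply cop_add cop_smul smul_def plus_fun_def)

lemma Eo_char:
  assumes "i \<in> {1..n}" "j \<in> {1..n}"
  shows "To tp n i (Eo tp n j x) = (q tp powi root_ip tp n i j) \<star> Eo tp n j (To tp n i x)"
    "To tp n i (Fo tp n j x) = inverse (q tp powi root_ip tp n i j) \<star> Fo tp n j (To tp n i x)"
proof -
  have "vec_e tp n j a b \<noteq> 0 \<Longrightarrow> tl_wt tp n i a = (q tp powi root_ip tp n i j) * tl_wt tp n i b" for a b
    using vec_e_lwt[of j n i tp a b] assms n1 by (simp add: tl_wt_def power_int_add)
  from cop_char[of _ "tl_wt tp n i", OF this] show "To tp n i (Eo tp n j x) = (q tp powi root_ip tp n i j) \<star> Eo tp n j (To tp n i x)"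
    by (simp add: To_def Eo_def ch_def fun_eq_iff fun_apply)
  have "vec_f tp n j a b \<noteq> 0 \<Longrightarrow> tl_wt tp n i a = inverse (q tp powi root_ip tp n i j) * tl_wt tp n i b" for a b
    using vec_f_lwt[of j n i tp a b] assms n1 by (simp add: tl_wt_def power_int_diff divide_inverse mult.commute)
  from cop_char[of _ "tl_wt tp n i", OF this] show "To tp n i (Fo tp n j x) = inverse (q tp powi root_ip tp n i j) \<star> Fo tp n j (To tp n i x)"
    by (simp add: To_def Fo_def ch_def fun_eq_iff fun_apply)
qed

lemma Eo_Fo:
  assumes i: "i \<in> {1..n}" and j: "j \<in> {1..n}"
  shows "Eo tp n i (Fo tp n j x) w - Fo tp n j (Eo tp n i x) w
     = (if i = j then dd tp n i else 0) * (ch tp n i w - inverse (ch tp n i w)) * x w"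
  unfolding Eo_def Fo_def ch_def
proof (rule cop_commutator[where \<rho> = "q tp powi root_ip tp n i j"])
  fix a b
  show "vec_e tp n i a b \<noteq> 0 \<Longrightarrow> tl_wt tp n j a = (q tp powi root_ip tp n i j) * tl_wt tp n j b"
    using vec_e_lwt[of i n j tp a b] i j n1 by (simp add: tl_wt_def power_int_add root_ip_commute)
  show "vec_f tp n j a b \<noteq> 0 \<Longrightarrow> tl_wt tp n i b = (q tp powi root_ip tp n i j) * tl_wt tp n i a"
    using vec_f_lwt[of j n i tp a b] i j n1 by (simp add: tl_wt_def power_int_diff)
next
  fix h a
  show "(\<Sum>b\<in>idx tp n. vec_e tp n i a b * (\<Sum>c\<in>idx tp n. vec_f tp n j b c * h c))
      - (\<Sum>b\<in>idx tp n. vec_f tp n j a b * (\<Sum>c\<in>idx tp n. vec_e tp n i b c * h c))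
      = (if i = j then dd tp n i else 0) * (tl_wt tp n i a - inverse (tl_wt tp n i a)) * h a"
    using eV_fV_diag[of i n tp h a] eV_fV_comm[of i n j tp h a] i j n1
    by (auto simp: eV_def fV_def tl_wt_def power_int_minus)
qed auto

sublocale unitary_rep "words tp n k" "lgw tp" "{1..n}" "Eo tp n" "Fo tp n" "To tp n" "To' tp n"
  "ch tp n" "q_i tp n" "dd tp n" "\<lambda>i j. q tp powi root_ip tp n i j" "htw n"
proof
  show "finite (words tp n k)" by (rule finite_words)
  show "lgw tp w > 0" for w by (induction w) (simp_all add: lgw_def lg_pos)
  show "ch tp n i w > 0" for i w by (rule ch_pos)
  show "q tp powi root_ip tp n i j \<noteq> 0" for i j by simp
  fix i assume i: "i \<in> {1..n}"
  show "lin_on (words tp n k) (Eo tp n i)" unfolding Eo_def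
    by (rule lin_cop) (use vec_e_idx i n1 in auto)
  show "lin_on (words tp n k) (Fo tp n i)" unfolding Fo_def
    by (rule lin_cop) (use vec_f_idx i n1 in auto)
  show "q_i tp n i > 0" using q_i_gt_1[of i n tp] i n1 by (simp add: less_trans[OF zero_less_one])
  show "dd tp n i > 0" using dd_pos i n1 by simp
  show "raising (words tp n k) (htw n) 1 (Eo tp n i)"
    unfolding raising_def
  proof (intro ballI allI impI)
    fix x w assume "Eo tp n i x w \<noteq> 0"
    then show "\<exists>w'. x w' \<noteq> 0 \<and> htw n w' + 1 \<le> htw n w"
      using cop_raising[of "vec_e tp n i" "lht n"] vec_e_lht[of i n tp] i n1 by (simp add: Eo_def htw_def)
  qed
  fix x :: "int list \<Rightarrow> K" assume x: "x \<in> supported (words tp n k)"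
  show "To tp n i x = (\<lambda>w. ch tp n i w * x w)" "To' tp n i x = (\<lambda>w. inverse (ch tp n i w) * x w)"
    by (simp_all add: To_def To'_def)
  show "Eo tp n i (Fo tp n i x) = Fo tp n i (Eo tp n i x) + dd tp n i \<star> (To tp n i x - To' tp n i x)"
    using Eo_Fo[OF i i, of x] by (auto simp: fun_eq_iff fun_apply To_def To'_def algebra_simps)
  show "wip (words tp n k) (lgw tp) (Eo tp n i x) y = q_i tp n i * wip (words tp n k) (lgw tp) x (Fo tp n i (To' tp n i y))" for y :: "int list \<Rightarrow> K"
    using cop_adjoint[of tp "vec_e tp n i" "q_i tp n i" "vec_f tp n i" "tl_wt tp n i" n k x y] vec_adjoint[of i n tp] i n1
    by (simp add: lgw_def[abs_def] Eo_def Fo_def To'_def ch_def tl_wt_def power_int_minus)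
  fix j assume j: "j \<in> {1..n}"
  show "To tp n i (Eo tp n j x) = (q tp powi root_ip tp n i j) \<star> Eo tp n j (To tp n i x)"
    "To tp n i (Fo tp n j x) = inverse (q tp powi root_ip tp n i j) \<star> Fo tp n j (To tp n i x)"
    using Eo_char[OF i j] by blast+
  show "i \<noteq> j \<Longrightarrow> Eo tp n i (Fo tp n j x) = Fo tp n j (Eo tp n i x)"
    using Eo_Fo[OF i j, of x] by (auto simp: fun_eq_iff)
qed

text \<open>Only the Cartan integers 0, -1, -2 occur, so Serre relations of order at most three are
  needed. The last property says that the integer division in \<open>cartan\<close> is
  exact.\<close>

lemma cartan_cases:
  assumes "i \<in> {1..n}" "j \<in> {1..n}" "i \<noteq> j"
  obtains N :: nat where "N \<in> {0, 1, 2}" "cartan tp n i j = - int N" "2 * root_ip tp n i j = - int N * root_ip tp n i i"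
proof -
  have "(cartan tp n i j = 0 \<or> cartan tp n i j = - 1 \<or> cartan tp n i j = - 2)
     \<and> 2 * root_ip tp n i j = cartan tp n i j * root_ip tp n i i"
  proof -
    consider "i < n" "j < n" | "i = n" "j < n" | "i < n" "j = n" using assms by fastforce
    then show ?thesis
    proof cases
      case 1
      then have "root_ip tp n i i = 2" "root_ip tp n i j = 0 \<or> root_ip tp n i j = - 1"
        using assms n1 by (simp_all add: root_ip_eq)
      then show ?thesis by (auto simp: cartan_def)
    next
      case 2
      then have "root_ip tp n i i = (case tp of A2_even \<Rightarrow> 1 | A2_odd \<Rightarrow> 4 | A2_odd_dagger \<Rightarrow> 2 | C1 \<Rightarrow> 4)"
        "root_ip tp n i j = 0 \<or> root_ip tp n i j = (if tp = A2_odd \<or> tp = C1 then - 2 else - 1)"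
        using assms n1 by (cases tp; simp add: root_ip_eq)+
      then show ?thesis by (cases tp) (auto simp: cartan_def)
    next
      case 3
      then have "root_ip tp n i i = 2"
        "root_ip tp n i j = 0 \<or> root_ip tp n i j = (if tp = A2_odd \<or> tp = C1 then - 2 else - 1)"
        using assms n1 by (cases tp; simp add: root_ip_eq)+
      then show ?thesis by (cases tp) (auto simp: cartan_def)
    qed
  qed
  then show ?thesis using that[of 0] that[of 1] that[of 2] by auto
qed

end

lemma qfact_simps:
  assumes "i \<in> {1..n}" and n1: "1 < n"
  shows "qfact tp n i 0 = 1" "qfact tp n i 1 = 1" "qfact tp n i 2 = qint tp n i 2"
    "qfact tp n i 3 = qint tp n i 2 * qint tp n i 3" "qint tp n i 2 > 0"
    "qint tp n i 3 = (q_i tp n i)\<^sup>2 + 1 + inverse ((q_i tp n i)\<^sup>2)" "qint tp n i 3 > 0"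
proof -
  let ?Q = "q_i tp n i"
  have Q: "?Q > 1" using q_i_gt_1[of i n tp] assms n1 by simp
  have nz: "?Q - inverse ?Q \<noteq> 0" using Q inverse_less_1_iff[of ?Q] by auto
  have 1: "qint tp n i 1 = 1" using nz by (simp add: qint_def)
  show "qfact tp n i 0 = 1" "qfact tp n i 1 = 1" "qfact tp n i 2 = qint tp n i 2"
    "qfact tp n i 3 = qint tp n i 2 * qint tp n i 3"
    using 1 by (simp_all add: qfact_def numeral_2_eq_2 numeral_3_eq_3)
  show "qint tp n i 2 > 0" using Q qint_2[of i n tp] assms n1 by (simp add: add_pos_pos)
  have "?Q ^ 3 - inverse ?Q ^ 3 = (?Q\<^sup>2 + 1 + inverse (?Q\<^sup>2)) * (?Q - inverse ?Q)"
    using Q by (simp add: field_simps power2_eq_square power3_eq_cube)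
  then show 3: "qint tp n i 3 = ?Q\<^sup>2 + 1 + inverse (?Q\<^sup>2)" using nz by (simp add: qint_def)
  show "qint tp n i 3 > 0" unfolding 3 using Q by (simp add: add_pos_pos)
qed

text \<open>Expanding \<open>ad 1\<close>, \<open>ad 2\<close>, \<open>ad 3\<close> gives
  coefficients in r and s; with r equal to \<open>q_i\<close> to the power -N and s to its square
  they become the quantum binomials.\<close>

lemma serre_sum:
  assumes "sl2_ad (words tp n k) h e f t t' e' (dd tp n i) (q tp powi root_ip tp n i i) (q tp powi root_ip tp n i j) N"
    and n1: "1 < n" and i: "i \<in> {1..n}" and N: "N \<in> {0, 1, 2}" and x: "x \<in> supported (words tp n k)"
    and root: "2 * root_ip tp n i j = - int N * root_ip tp n i i"
  shows "(\<Sum>m\<le>Suc N. ((- 1) ^ m * qbinom tp n i (Suc N) m) \<star> (e ^^ (Suc N - m)) (e' ((e ^^ m) x))) = 0"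
proof -
  interpret sl2_ad "words tp n k" h e f t t' e' "dd tp n i" "q tp powi root_ip tp n i i" "q tp powi root_ip tp n i j" N
    by fact
  let ?Q = "q_i tp n i" and ?r = "q tp powi root_ip tp n i j"
  have Q: "?Q > 1" using q_i_gt_1[of i n tp] i n1 by simp
  have s: "q tp powi root_ip tp n i i = ?Q\<^sup>2" using q_i_square[of i n tp] i n1 by simp
  \<comment> \<open>The relation \<open>rN\<close> determines r only up to sign; positivity selects
    the root.\<close>
  have sq: "(?r * ?Q ^ N)\<^sup>2 = 1\<^sup>2"
    using rN s by (simp add: power2_eq_square power_mult_distrib algebra_simps)
  have "?r * ?Q ^ N > 0" using Q powi_pos[of tp "root_ip tp n i j"] by simp
  then have "?r * ?Q ^ N = 1" by (intro power2_eq_imp_eq[OF sq]) simp_all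
  then have r: "?r = inverse (?Q ^ N)" using inverse_unique[of "?Q ^ N" ?r] by (simp add: mult.commute)
  note qf = qfact_simps[OF i n1, of tp]
  have S2: "(\<Sum>m\<le>2. f m) = f 0 + f 1 + f 2" and S3: "(\<Sum>m\<le>3. f m) = f 0 + f 1 + f 2 + f 3"
    for f :: "nat \<Rightarrow> int list \<Rightarrow> K"
    by (simp_all add: numeral_2_eq_2 numeral_3_eq_3)
  have P2: "(e ^^ (2 - 0)) y = e (e y)" "(e ^^ (2 - 1)) y = e y" "(e ^^ (2 - 2)) y = y" "(e ^^ 0) y = y"
    "(e ^^ 1) y = e y" "(e ^^ 2) y = e (e y)" "(e ^^ 3) y = e (e (e y))" "(e ^^ (3 - 0)) y = e (e (e y))"
    "(e ^^ (3 - 1)) y = e (e y)" "(e ^^ (3 - 2)) y = e y" "(e ^^ (3 - 3)) y = y" for y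
    by (simp_all add: numeral_2_eq_2 numeral_3_eq_3)
  consider "N = 0" | "N = 1" | "N = 2" using N by auto
  then show ?thesis
  proof cases
    case 1
    have "ad 1 x = 0" using ad_vanish[OF x] 1 by simp
    then have "e (e' x) - e' (e x) = 0" unfolding ad1[OF x] using r 1 by simp
    then show ?thesis using 1 qf by (simp add: qbinom_def smul_distribs)
  next
    case 2
    have "ad 2 x = 0" using ad_vanish[OF x] 2 by (simp add: numeral_2_eq_2)
    then have "e (e (e' x)) - qint tp n i 2 \<star> e (e' (e x)) + e' (e (e x)) = 0"
    proof -
      have r': "?r = inverse ?Q" using r 2 by simp
      have "?r + ?r * ?Q\<^sup>2 = qint tp n i 2" "?r * ?r * ?Q\<^sup>2 = 1"
        unfolding r' using Q qint_2[of i n tp] i n1 by (simp_all add: field_simps power2_eq_square)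
      then show ?thesis using trans[OF sym[OF ad2[OF x]] \<open>ad 2 x = 0\<close>] unfolding s by simp
    qed
    moreover have "Suc N = 2" using 2 by simp
    ultimately show ?thesis using qf by (simp only: S2 P2) (simp add: qbinom_def smul_distribs)
  next
    case 3
    have "ad 3 x = 0" using ad_vanish[OF x] 3 by (simp add: numeral_3_eq_3 numeral_2_eq_2)
    then have "e (e (e (e' x))) - qint tp n i 3 \<star> e (e (e' (e x))) + qint tp n i 3 \<star> e (e' (e (e x))) - e' (e (e (e x))) = 0"
    proof -
      have r': "?r = inverse (?Q\<^sup>2)" using r 3 by simp
      have "?r + ?r * ?Q\<^sup>2 + ?r * (?Q\<^sup>2)\<^sup>2 = qint tp n i 3"
        "?r * ?r * (?Q\<^sup>2 + (?Q\<^sup>2)\<^sup>2 + (?Q\<^sup>2) ^ 3) = qint tp n i 3"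
        "?r * ?r * ?r * (?Q\<^sup>2) ^ 3 = 1"
        unfolding r' qf(6) using Q by (simp_all add: field_simps power2_eq_square power3_eq_cube)
      then show ?thesis using trans[OF sym[OF ad3[OF x]] \<open>ad 3 x = 0\<close>] unfolding s by simp
    qed
    moreover have "Suc N = 3" using 3 by simp
    ultimately show ?thesis using qf(1-5,7) by (simp only: S3 P2) (simp add: qbinom_def smul_distribs)
  qed
qed

subsection \<open>Quotients of tensor powers\<close>

context tensor_power
begin

lemma rN_eq:
  assumes "2 * root_ip tp n i j = - int N * root_ip tp n i i"
  shows "(q tp powi root_ip tp n i j) * (q tp powi root_ip tp n i j) * (q tp powi root_ip tp n i i) ^ N = 1"
proof -
  have "(q tp powi root_ip tp n i j) * (q tp powi root_ip tp n i j) * (q tp powi root_ip tp n i i) ^ N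
    = q tp powi (root_ip tp n i j + root_ip tp n i j + root_ip tp n i i * int N)"
    by (simp add: power_int_add power_int_mult power2_eq_square power_int_mult_distrib)
  also have "root_ip tp n i j + root_ip tp n i j + root_ip tp n i i * int N = 0" using assms by (simp add: algebra_simps)
  finally show ?thesis by simp
qed

lemma powi_root_gt_1: "i \<in> {1..n} \<Longrightarrow> q tp powi root_ip tp n i i > 1"
  using q_i_square[of i n tp] q_i_gt_1[of i n tp] n1 by (metis atLeastAtMost_iff one_less_power zero_less_numeral)

lemma raising_Fo:
  assumes i: "i \<in> {1..n}"
  shows "raising (words tp n k) (\<lambda>w. - htw n w) 1 (Fo tp n i)"
  unfolding raising_def
proof (intro ballI allI impI)
  fix x w assume "Fo tp n i x w \<noteq> 0"
  moreover have "- htw n w = sum_list (map (\<lambda>a. - lht n a) w)" for w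
    unfolding htw_def by (induction w) auto
  ultimately show "\<exists>w'. x w' \<noteq> 0 \<and> - htw n w' + 1 \<le> - htw n w"
    using cop_raising[of "vec_f tp n i" "\<lambda>a. - lht n a"] vec_f_lht[of i n tp] i n1 by (simp add: Fo_def)
qed

lemma raising_mono: "raising D h d A \<Longrightarrow> d' \<le> d \<Longrightarrow> raising D h d' A"
  unfolding raising_def by (meson add_left_mono order_trans)

lemma lin_To: "i \<in> {1..n} \<Longrightarrow> lin_on (words tp n k) (To tp n i)" "i \<in> {1..n} \<Longrightarrow> lin_on (words tp n k) (To' tp n i)"
  using T_lin T_car by (auto simp: lin_on_def)

lemma serre:
  assumes i: "i \<in> {1..n}" and j: "j \<in> {1..n}" and ij: "i \<noteq> j" and x: "x \<in> Car" and r: "r = nat (1 - cartan tp n i j)"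
  shows "(\<Sum>m\<le>r. ((- 1) ^ m * qbinom tp n i r m) \<star> (Eo tp n i ^^ (r - m)) (Eo tp n j ((Eo tp n i ^^ m) x))) = 0"
    "(\<Sum>m\<le>r. ((- 1) ^ m * qbinom tp n i r m) \<star> (Fo tp n i ^^ (r - m)) (Fo tp n j ((Fo tp n i ^^ m) x))) = 0"
proof -
  obtain N :: nat where N: "N \<in> {0, 1, 2}" "cartan tp n i j = - int N" "2 * root_ip tp n i j = - int N * root_ip tp n i i"
    using cartan_cases[OF i j ij] by blast
  have rN: "r = Suc N" using N(2) r by simp
  have 1: "sl2_ad (words tp n k) (htw n) (Eo tp n i) (Fo tp n i) (To tp n i) (To' tp n i) (Eo tp n j)
      (dd tp n i) (q tp powi root_ip tp n i i) (q tp powi root_ip tp n i j) N"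
    using i j ij linE linF lin_To TT' TE EF EF' finD powi_root_gt_1[OF i] powi_pos d_pos[OF i] raise
      raising_mono[OF raise[OF j], of 0] rN_eq[OF N(3)]
    by unfold_locales simp_all
  \<comment> \<open>The relations for the lowering operators come from the same argument with
    \<open>E\<close>, \<open>F\<close> and \<open>T\<close>, \<open>T'\<close> exchanged and the
    height reversed.\<close>
  have 2: "sl2_ad (words tp n k) (\<lambda>w. - htw n w) (Fo tp n i) (Eo tp n i) (To' tp n i) (To tp n i) (Fo tp n j)
      (dd tp n i) (q tp powi root_ip tp n i i) (q tp powi root_ip tp n i j) N"
    using i j ij linE linF lin_To TT' T'_rel EF EF' finD powi_root_gt_1[OF i] powi_pos d_pos[OF i] raising_Fo
      raising_mono[OF raising_Fo[OF j], of 0] rN_eq[OF N(3)]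
    by unfold_locales (simp_all add: EF' smul_distribs)
  show "(\<Sum>m\<le>r. ((- 1) ^ m * qbinom tp n i r m) \<star> (Eo tp n i ^^ (r - m)) (Eo tp n j ((Eo tp n i ^^ m) x))) = 0"
    unfolding rN by (rule serre_sum[OF 1 n1 i N(1) x N(3)])
  show "(\<Sum>m\<le>r. ((- 1) ^ m * qbinom tp n i r m) \<star> (Fo tp n i ^^ (r - m)) (Fo tp n j ((Fo tp n i ^^ m) x))) = 0"
    unfolding rN by (rule serre_sum[OF 2 n1 i N(1) x N(3)])
qed

abbreviation TP :: "(K, int list \<Rightarrow> K) uq_rep" where "TP \<equiv> tpow tp n k"

lemma TP_simps [simp]: "carrier TP = Car" "add TP = (\<lambda>x y. x + y)" "ring.zero TP = 0" "module.smult TP = (\<lambda>c x. c \<star> x)"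
  by (simp_all add: carrier_tpow) (simp_all add: tpow_def fun_eq_iff fun_apply)

lemma TP_act:
  assumes "x \<in> Car"
  shows "act TP (gen_e i) x = Eo tp n i x" "act TP (gen_f i) x = Fo tp n i x"
    "act TP (gen_t i) x = To tp n i x" "act TP (gen_tinv i) x = To' tp n i x"
  using assms by (simp_all add: tpow_def tpow_act_e tpow_act_f tpow_act_t tpow_act_tinv)

lemma gens_cases:
  assumes "h \<in> uq_gens n"
  obtains i where "i \<in> {1..n}" "h = gen_e i" | i where "i \<in> {1..n}" "h = gen_f i"
    | i where "i \<in> {1..n}" "h = gen_t i" | i where "i \<in> {1..n}" "h = gen_tinv i"
  using assms by (auto simp: uq_gens_def)

lemma gens_in: "i \<in> {1..n} \<Longrightarrow> gen_e i \<in> uq_gens n" "i \<in> {1..n} \<Longrightarrow> gen_f i \<in> uq_gens n"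
  "i \<in> {1..n} \<Longrightarrow> gen_t i \<in> uq_gens n" "i \<in> {1..n} \<Longrightarrow> gen_tinv i \<in> uq_gens n"
  by (auto simp: uq_gens_def)

lemma act_lin: "h \<in> uq_gens n \<Longrightarrow> lin_on (words tp n k) (act TP h)"
  by (erule gens_cases) (use linE linF lin_To in \<open>auto simp: lin_on_def TP_act car\<close>)

lemma submod_act: "submod P \<longleftrightarrow> subsp P \<and> P \<subseteq> Car \<and> (\<forall>h\<in>uq_gens n. \<forall>x\<in>P. act TP h x \<in> P)"
proof
  assume P: "submod P"
  then show "subsp P \<and> P \<subseteq> Car \<and> (\<forall>h\<in>uq_gens n. \<forall>x\<in>P. act TP h x \<in> P)"
    using submodD[OF P] by (auto elim!: gens_cases simp: TP_act)
next
  assume P: "subsp P \<and> P \<subseteq> Car \<and> (\<forall>h\<in>uq_gens n. \<forall>x\<in>P. act TP h x \<in> P)"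
  then have "x \<in> P \<Longrightarrow> x \<in> Car" for x by blast
  with P show "submod P" unfolding submod_def by (metis TP_act gens_in)
qed

end

section \<open>The quotient of a tensor power by a submodule\<close>

locale tensor_quotient = tensor_power +
  fixes S :: "(int list \<Rightarrow> K) set"
  assumes S: "submod S"
begin

definition pr :: "(int list \<Rightarrow> K) \<Rightarrow> (int list \<Rightarrow> K) set" where
  "pr x = S +>\<^bsub>TP\<^esub> x"

abbreviation "Qt \<equiv> uq_quotient TP S"

lemmas Ss = subspD[OF submodD(1)[OF S]]

lemma pr_eq: "pr x = {s + x | s. s \<in> S}"
  by (auto simp: pr_def a_r_coset_def' )

lemma mem_pr: "y \<in> pr x \<longleftrightarrow> y - x \<in> S"
  unfolding pr_eq by (auto simp: algebra_simps) (metis add.commute diff_add_cancel)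

lemma pr_cong: "pr x = pr y \<longleftrightarrow> x - y \<in> S"
proof
  assume "pr x = pr y"
  then have "x \<in> pr y" using mem_pr[of x x] Ss(1) by simp
  then show "x - y \<in> S" by (simp add: mem_pr)
next
  assume xy: "x - y \<in> S"
  have "z - x \<in> S \<longleftrightarrow> z - y \<in> S" for z
    using Ss(2)[OF _ xy, of "z - x"] Ss(5)[OF _ xy, of "z - y"] by auto
  then show "pr x = pr y" by (auto simp: mem_pr)
qed

lemma self_pr: "x \<in> pr x"
  using Ss(1) by (simp add: mem_pr)

text \<open>The union over representatives in the definition of the quotient collapses to one coset
  if the operation respects congruence modulo S.\<close>

lemma pr_union:
  assumes "\<And>y. y - x \<in> S \<Longrightarrow> f y - f x \<in> S"
  shows "(\<Union>y\<in>pr x. S +>\<^bsub>TP\<^esub> f y) = pr (f x)"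
proof -
  have "S +>\<^bsub>TP\<^esub> f y = pr (f x)" if "y \<in> pr x" for y
  proof -
    have "f y - f x \<in> S" using assms that by (simp add: mem_pr)
    then show ?thesis using pr_cong[of "f y" "f x"] by (simp add: pr_def)
  qed
  then show ?thesis using self_pr[of x] by auto
qed

lemma carrier_Qt: "carrier Qt = pr ` Car"
  by (auto simp: uq_quotient_def A_RCOSETS_def' pr_def)

lemma zero_Qt: "\<zero>\<^bsub>Qt\<^esub> = pr 0"
  by (simp add: uq_quotient_def pr_eq)

lemma add_Qt: "pr x \<oplus>\<^bsub>Qt\<^esub> pr y = pr (x + y)"
proof -
  have "pr x \<oplus>\<^bsub>Qt\<^esub> pr y = {a + b | a b. a \<in> pr x \<and> b \<in> pr y}"
    by (auto simp: uq_quotient_def set_add_def')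
  also have "\<dots> = pr (x + y)"
  proof (rule Set.set_eqI, rule iffI)
    fix z assume "z \<in> {a + b | a b. a \<in> pr x \<and> b \<in> pr y}"
    then obtain a b where "z = a + b" "a - x \<in> S" "b - y \<in> S" by (auto simp: mem_pr)
    then show "z \<in> pr (x + y)" using Ss(2)[of "a - x" "b - y"] by (simp add: mem_pr algebra_simps)
  next
    fix z assume "z \<in> pr (x + y)"
    then have "z - y \<in> pr x" by (simp add: mem_pr algebra_simps)
    moreover have "z = (z - y) + y" by simp
    ultimately show "z \<in> {a + b | a b. a \<in> pr x \<and> b \<in> pr y}" using self_pr[of y] by blast
  qed
  finally show ?thesis .
qed

lemma smult_Qt: "c \<odot>\<^bsub>Qt\<^esub> pr x = pr (c \<star> x)"
proof -
  have "c \<odot>\<^bsub>Qt\<^esub> pr x = (\<Union>y\<in>pr x. S +>\<^bsub>TP\<^esub> (c \<star> y))"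
    by (simp add: uq_quotient_def)
  also have "\<dots> = pr (c \<star> x)"
    by (rule pr_union) (metis Ss(3) smul_distribs(2))
  finally show ?thesis .
qed

lemma act_Qt: assumes "h \<in> uq_gens n" "x \<in> Car" shows "act Qt h (pr x) = pr (act TP h x)"
proof -
  have "act Qt h (pr x) = (\<Union>y\<in>pr x. S +>\<^bsub>TP\<^esub> (act TP h y))"
    by (simp add: uq_quotient_def)
  also have "\<dots> = pr (act TP h x)"
  proof (rule pr_union)
    fix y assume yx: "y - x \<in> S"
    then have "y - x \<in> Car" using submodD(3)[OF S] by blast
    then have y: "y \<in> Car" using car(2)[of "y - x" x] assms(2) by simp
    then have "act TP h (y - x) = act TP h y - act TP h x"
      using lin_onD(4)[OF act_lin[OF assms(1)]] assms(2) by blast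
    moreover have "act TP h (y - x) \<in> S" using S yx assms(1) unfolding submod_act by blast
    ultimately show "act TP h y - act TP h x \<in> S" by simp
  qed
  finally show ?thesis .
qed

lemma act_car: "h \<in> uq_gens n \<Longrightarrow> x \<in> Car \<Longrightarrow> act TP h x \<in> Car"
  using act_lin lin_onD(1) by blast

lemma module_Qt: "module Kring Qt"
proof (rule moduleI)
  show "cring Kring" by (rule cring_from_type_algebra)
  show "abelian_group Qt"
  proof (rule abelian_groupI)
    fix x assume "x \<in> carrier Qt"
    then obtain x' where x: "x = pr x'" "x' \<in> Car" by (auto simp: carrier_Qt)
    then show "\<exists>y\<in>carrier Qt. y \<oplus>\<^bsub>Qt\<^esub> x = \<zero>\<^bsub>Qt\<^esub>"
      using car(4)[OF x(2)] by (intro bexI[of _ "pr (- x')"]) (auto simp: carrier_Qt add_Qt zero_Qt)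
  qed (auto simp: carrier_Qt add_Qt zero_Qt car add.assoc add.commute add.left_commute)
qed (auto simp: carrier_Qt add_Qt smult_Qt car smul_distribs ring_of_type_algebra_def)

lemma minus_Qt: assumes "x \<in> Car" "y \<in> Car" shows "pr x \<ominus>\<^bsub>Qt\<^esub> pr y = pr (x - y)"
proof -
  interpret module Kring Qt by (rule module_Qt)
  have "\<ominus>\<^bsub>Qt\<^esub> pr y = pr (- y)"
    by (rule M.minus_equality) (use assms car(4)[OF assms(2)] in \<open>auto simp: add_Qt zero_Qt carrier_Qt\<close>)
  then show ?thesis using assms by (simp add: a_minus_def add_Qt)
qed

lemma finsum_Qt:
  assumes "finite I" "\<And>i. i \<in> I \<Longrightarrow> f i \<in> Car"
  shows "(\<Oplus>\<^bsub>Qt\<^esub>i\<in>I. pr (f i)) = pr (\<Sum>i\<in>I. f i)"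
proof -
  interpret module Kring Qt by (rule module_Qt)
  show ?thesis using assms
  proof (induction I rule: finite_induct)
    case (insert i I)
    then have "(\<lambda>i. pr (f i)) \<in> I \<rightarrow> carrier Qt" "pr (f i) \<in> carrier Qt" by (auto simp: carrier_Qt)
    then show ?case using insert by (simp add: add_Qt)
  qed (simp add: zero_Qt)
qed

lemma act_Qt_simps:
  assumes "i \<in> {1..n}" "x \<in> Car"
  shows "act Qt (gen_e i) (pr x) = pr (Eo tp n i x)" "act Qt (gen_f i) (pr x) = pr (Fo tp n i x)"
    "act Qt (gen_t i) (pr x) = pr (To tp n i x)" "act Qt (gen_tinv i) (pr x) = pr (To' tp n i x)"
  using assms act_Qt gens_in by (auto simp: TP_act)

lemma pow_Eo: "i \<in> {1..n} \<Longrightarrow> x \<in> Car \<Longrightarrow> (Eo tp n i ^^ m) x \<in> Car \<and> (act Qt (gen_e i) ^^ m) (pr x) = pr ((Eo tp n i ^^ m) x)"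
  by (induction m) (auto simp: act_Qt_simps linD)

lemma pow_Fo: "i \<in> {1..n} \<Longrightarrow> x \<in> Car \<Longrightarrow> (Fo tp n i ^^ m) x \<in> Car \<and> (act Qt (gen_f i) ^^ m) (pr x) = pr ((Fo tp n i ^^ m) x)"
  by (induction m) (auto simp: act_Qt_simps linD)

lemma uq_module_Qt: "uq_module tp n Qt"
proof -
  interpret module Kring Qt by (rule module_Qt)
  show ?thesis
  proof
    fix h x assume h: "h \<in> uq_gens n" and "x \<in> carrier Qt"
    then obtain x' where x: "x = pr x'" "x' \<in> Car" by (auto simp: carrier_Qt)
    show "act Qt h x \<in> carrier Qt" using h x act_car by (auto simp: act_Qt carrier_Qt)
    show "act Qt h (c \<odot>\<^bsub>Qt\<^esub> x) = c \<odot>\<^bsub>Qt\<^esub> act Qt h x" for c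
      using h x by (simp add: smult_Qt act_Qt car lin_onD(2)[OF act_lin[OF h]])
    fix y assume "y \<in> carrier Qt"
    then obtain y' where y: "y = pr y'" "y' \<in> Car" by (auto simp: carrier_Qt)
    show "act Qt h (x \<oplus>\<^bsub>Qt\<^esub> y) = act Qt h x \<oplus>\<^bsub>Qt\<^esub> act Qt h y"
      using h x y by (simp add: add_Qt act_Qt car lin_onD(3)[OF act_lin[OF h]])
  next
    fix i x assume i: "i \<in> {1..n}" and "x \<in> carrier Qt"
    then obtain x' where x: "x = pr x'" "x' \<in> Car" by (auto simp: carrier_Qt)
    show "act Qt (gen_t i) (act Qt (gen_tinv i) x) = x" "act Qt (gen_tinv i) (act Qt (gen_t i) x) = x"
      using i x by (simp_all add: act_Qt_simps TT')
    fix j assume j: "j \<in> {1..n}"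
    show "act Qt (gen_t i) (act Qt (gen_t j) x) = act Qt (gen_t j) (act Qt (gen_t i) x)"
      using i j x by (simp add: act_Qt_simps) (simp add: To_def mult.left_commute)
    show "act Qt (gen_t i) (act Qt (gen_e j) (act Qt (gen_tinv i) x)) = (q tp powi root_ip tp n i j) \<odot>\<^bsub>Qt\<^esub> act Qt (gen_e j) x"
      using i j x by (simp add: act_Qt_simps linD TE TT' smult_Qt)
    show "act Qt (gen_t i) (act Qt (gen_f j) (act Qt (gen_tinv i) x)) = (q tp powi (- root_ip tp n i j)) \<odot>\<^bsub>Qt\<^esub> act Qt (gen_f j) x"
      using i j x by (simp add: act_Qt_simps linD TF TT' smult_Qt power_int_minus)
    show "act Qt (gen_e i) (act Qt (gen_f j) x) \<ominus>\<^bsub>Qt\<^esub> act Qt (gen_f j) (act Qt (gen_e i) x)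
        = (if i = j then inverse (q_i tp n i - inverse (q_i tp n i)) \<odot>\<^bsub>Qt\<^esub> (act Qt (gen_t i) x \<ominus>\<^bsub>Qt\<^esub> act Qt (gen_tinv i) x)
           else \<zero>\<^bsub>Qt\<^esub>)"
      using i j x by (auto simp: act_Qt_simps linD minus_Qt EF EF' smult_Qt zero_Qt dd_def)
    fix r assume ij: "i \<noteq> j" and r: "r = nat (1 - cartan tp n i j)"
    have Ce: "((- 1) ^ m * qbinom tp n i r m) \<star> (Eo tp n i ^^ (r - m)) (Eo tp n j ((Eo tp n i ^^ m) x')) \<in> Car" for m
    proof -
      have "Eo tp n j ((Eo tp n i ^^ m) x') \<in> Car" using pow_Eo[OF i x(2)] j by (simp add: linD)
      then show ?thesis using pow_Eo[OF i] by (intro car(3)) blast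
    qed
    have e: "((- 1) ^ m * qbinom tp n i r m) \<odot>\<^bsub>Qt\<^esub> (act Qt (gen_e i) ^^ (r - m)) (act Qt (gen_e j) ((act Qt (gen_e i) ^^ m) x))
       = pr (((- 1) ^ m * qbinom tp n i r m) \<star> (Eo tp n i ^^ (r - m)) (Eo tp n j ((Eo tp n i ^^ m) x')))" for m
      using i j x pow_Eo by (simp add: act_Qt_simps linD smult_Qt)
    have Cf: "((- 1) ^ m * qbinom tp n i r m) \<star> (Fo tp n i ^^ (r - m)) (Fo tp n j ((Fo tp n i ^^ m) x')) \<in> Car" for m
    proof -
      have "Fo tp n j ((Fo tp n i ^^ m) x') \<in> Car" using pow_Fo[OF i x(2)] j by (simp add: linD)
      then show ?thesis using pow_Fo[OF i] by (intro car(3)) blast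
    qed
    have f: "((- 1) ^ m * qbinom tp n i r m) \<odot>\<^bsub>Qt\<^esub> (act Qt (gen_f i) ^^ (r - m)) (act Qt (gen_f j) ((act Qt (gen_f i) ^^ m) x))
       = pr (((- 1) ^ m * qbinom tp n i r m) \<star> (Fo tp n i ^^ (r - m)) (Fo tp n j ((Fo tp n i ^^ m) x')))" for m
      using i j x pow_Fo by (simp add: act_Qt_simps linD smult_Qt)
    show "(\<Oplus>\<^bsub>Qt\<^esub>m\<in>{..r}. ((- 1) ^ m * qbinom tp n i r m) \<odot>\<^bsub>Qt\<^esub>
        (act Qt (gen_e i) ^^ (r - m)) (act Qt (gen_e j) ((act Qt (gen_e i) ^^ m) x))) = \<zero>\<^bsub>Qt\<^esub>"
      unfolding e using Ce by (subst finsum_Qt) (simp_all add: zero_Qt serre(1)[OF i j ij x(2) r])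
    show "(\<Oplus>\<^bsub>Qt\<^esub>m\<in>{..r}. ((- 1) ^ m * qbinom tp n i r m) \<odot>\<^bsub>Qt\<^esub>
        (act Qt (gen_f i) ^^ (r - m)) (act Qt (gen_f j) ((act Qt (gen_f i) ^^ m) x))) = \<zero>\<^bsub>Qt\<^esub>"
      unfolding f using Cf by (subst finsum_Qt) (simp_all add: zero_Qt serre(2)[OF i j ij x(2) r])
  qed
qed

end

declare One_nat_def [simp del]

lemma powi_inject: "q tp powi a = q tp powi b \<longleftrightarrow> a = b"
  using power_int_strict_increasing[of a b "q tp"] power_int_strict_increasing[of b a "q tp"] q_gt_1[of tp]
  by (cases a b rule: linorder_cases) auto

context tensor_power
begin

definition delta :: "int list \<Rightarrow> int list \<Rightarrow> K" where
  "delta w = (\<lambda>v. if v = w then 1 else 0)"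

lemma delta_Car: "w \<in> words tp n k \<Longrightarrow> delta w \<in> Car"
  by (auto simp: delta_def supported_def)

lemma Car_eq_sum_delta: "x \<in> Car \<Longrightarrow> x = (\<Sum>w\<in>words tp n k. x w \<star> delta w)"
proof
  fix v assume x: "x \<in> Car"
  have "(\<Sum>w\<in>words tp n k. x w \<star> delta w) v = (\<Sum>w\<in>words tp n k. if w = v then x w else 0)"
    unfolding sum_fun_apply by (intro sum.cong) (auto simp: fun_apply delta_def)
  also have "\<dots> = x v" using x finD by (auto simp: supported_def)
  finally show "x v = (\<Sum>w\<in>words tp n k. x w \<star> delta w) v" by simp
qed

lemma Car_subset: "subsp P \<Longrightarrow> (\<And>w. w \<in> words tp n k \<Longrightarrow> delta w \<in> P) \<Longrightarrow> Car \<subseteq> P"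
proof
  fix x assume P: "subsp P" "\<And>w. w \<in> words tp n k \<Longrightarrow> delta w \<in> P" and "x \<in> Car"
  have "(\<Sum>w\<in>words tp n k. x w \<star> delta w) \<in> P" by (intro subsp_sum subspD(3) P)
  then show "x \<in> P" using Car_eq_sum_delta[OF \<open>x \<in> Car\<close>] by simp
qed

end

context tensor_quotient
begin

text \<open>A subspace of the quotient corresponds to its preimage, which contains S.\<close>

lemma submodule_Qt:
  assumes "submodule N Kring Qt"
  shows "subsp {x \<in> Car. pr x \<in> N}" "S \<subseteq> {x \<in> Car. pr x \<in> N}" "N = pr ` {x \<in> Car. pr x \<in> N}"
proof -
  interpret module Kring Qt by (rule module_Qt)
  note N = submoduleE[OF assms]
  have 0: "pr 0 \<in> N"
  proof -
    obtain y where "y \<in> N" using N(2) by blast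
    then have "0 \<odot>\<^bsub>Qt\<^esub> y \<in> N" "y \<in> carrier Qt"
      using N(1) N(4)[of 0 y] by (auto simp: ring_of_type_algebra_def)
    then show ?thesis by (auto simp: carrier_Qt smult_Qt)
  qed
  show "subsp {x \<in> Car. pr x \<in> N}"
    unfolding subsp_def using 0 N(5) N(4)
    by (auto simp: car ring_of_type_algebra_def simp flip: add_Qt smult_Qt)
  show "S \<subseteq> {x \<in> Car. pr x \<in> N}"
  proof
    fix x assume x: "x \<in> S"
    then have "pr x = pr 0" by (simp add: pr_cong)
    then show "x \<in> {x \<in> Car. pr x \<in> N}" using 0 submodD(3)[OF S x] by simp
  qed
  show "N = pr ` {x \<in> Car. pr x \<in> N}" using N(1) by (auto simp: carrier_Qt)
qed

lemma carrier_submodule: "submodule (carrier Qt) Kring Qt"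
  using module.carrier_is_submodule[OF module_Qt] .

lemma finite_dimensional_Qt: "finite_dimensional Qt"
  unfolding finite_dimensional_def
proof (intro exI conjI)
  show "finite (pr ` delta ` words tp n k)" using finD by simp
  show sub: "pr ` delta ` words tp n k \<subseteq> carrier Qt" using delta_Car by (auto simp: carrier_Qt)
  show "K_span Qt (pr ` delta ` words tp n k) = carrier Qt"
    unfolding K_span_def
  proof (rule hull_unique)
    show "pr ` delta ` words tp n k \<subseteq> carrier Qt" by (rule sub)
    show "submodule (carrier Qt) Kring Qt" by (rule carrier_submodule)
    fix N assume N: "pr ` delta ` words tp n k \<subseteq> N" "submodule N Kring Qt"
    have "Car \<subseteq> {x \<in> Car. pr x \<in> N}"
      using N(1) delta_Car by (intro Car_subset submodule_Qt(1)[OF N(2)]) auto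
    then show "carrier Qt \<subseteq> N" by (auto simp: carrier_Qt)
  qed
qed

text \<open>The tensor power is the orthogonal sum of \<open>fspan u\<close> and S. The preimage P
  of a submodule contains S, so it is determined by its intersection with \<open>fspan u\<close>,
  which is zero or everything by irreducibility.\<close>

lemma is_V_Qt:
  assumes u: "prim u" "homog a u" "u \<noteq> 0" and Su: "S = perp (fspan u)"
    and a: "\<And>i. i \<in> {1..n} \<Longrightarrow> a i = q tp powi inner_wt n (simple_root tp n i) \<mu>"
  shows "is_V tp n \<mu> Qt"
proof -
  have fs: "submod (fspan u)" by (rule submod_fspan[OF u])
  have uC: "u \<in> Car" using u by (simp add: prim_def)
  have u_fs: "u \<in> fspan u" by (rule fspan.base)
  have ip_u: "ip u u \<noteq> 0" using ip_definite[OF uC] u(3) by simp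
  have uS: "u \<notin> S" using ip_u u_fs by (auto simp: Su perp_def)
  have dec: "\<exists>p\<in>fspan u. x - p \<in> S" if "x \<in> Car" for x
  proof -
    obtain p where p: "p \<in> fspan u" "\<And>y. y \<in> fspan u \<Longrightarrow> ip (x - p) y = 0"
      using projection[OF submodD(1,2)[OF fs]] by blast
    moreover have "x - p \<in> Car" using car(5)[OF that submodD(3)[OF fs p(1)]] .
    ultimately show ?thesis by (auto simp: Su perp_def)
  qed
  have irr: "N = {pr 0} \<or> N = carrier Qt" if N: "uq_submodule n N Qt" for N
  proof -
    define P where "P = {x \<in> Car. pr x \<in> N}"
    have sN: "submodule N Kring Qt" and gN: "\<And>h x. h \<in> uq_gens n \<Longrightarrow> x \<in> N \<Longrightarrow> act Qt h x \<in> N"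
      using N by (auto simp: uq_submodule_def)
    note sP = submodule_Qt[OF sN, folded P_def]
    have P: "submod P"
      unfolding submod_act using sP(1) act_car gN by (auto simp: P_def act_Qt[symmetric])
    have Q: "submod (P \<inter> fspan u)" by (rule submod_Int[OF P fs])
    show ?thesis
    proof (cases "P \<inter> fspan u = {0}")
      case True
      have "x \<in> S" if x: "x \<in> P" for x
      proof -
        obtain p where p: "p \<in> fspan u" "x - p \<in> S" using dec[of x] x submodD(3)[OF P] by blast
        have "x - (x - p) \<in> P" using subspD(5)[OF sP(1) x] p(2) sP(2) by blast
        then have "p = 0" using True p(1) by auto
        then show ?thesis using p(2) by simp
      qed
      then have "P = S" using sP(2) by blast
      then have "N = pr ` S" using sP(3) by simp
      also have "\<dots> = {pr 0}" using Ss(1) pr_cong by fastforce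
      finally show ?thesis by simp
    next
      case False
      then have "P \<inter> fspan u = fspan u" using fspan_irreducible[OF u Q] by blast
      then have "x \<in> P" if "x \<in> Car" for x
        using dec[OF that] subspD(2)[OF sP(1)] sP(2) by (metis IntD1 diff_add_cancel subsetD)
      then show ?thesis using sP(3) submodD(2)[OF P] by (auto simp: carrier_Qt)
    qed
  qed
  have nz: "pr u \<noteq> pr 0" using uS by (simp add: pr_cong)
  have carr: "pr u \<in> carrier Qt" using uC by (simp add: carrier_Qt)
  have cs: "uq_submodule n (carrier Qt) Qt"
    using carrier_submodule act_car by (auto simp: uq_submodule_def act_Qt carrier_Qt)
  show ?thesis
    unfolding is_V_def uq_irreducible_def
  proof (intro conjI bexI[of _ "pr u"] ballI allI impI)
    show "uq_module tp n Qt" by (rule uq_module_Qt)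
    show "finite_dimensional Qt" by (rule finite_dimensional_Qt)
    show "carrier Qt \<noteq> {\<zero>\<^bsub>Qt\<^esub>}" using nz carr by (auto simp: zero_Qt)
    show "N = {\<zero>\<^bsub>Qt\<^esub>} \<or> N = carrier Qt" if "uq_submodule n N Qt" for N
      using irr[OF that] by (simp add: zero_Qt)
    show "(\<lambda>N. uq_submodule n N Qt) hull {pr u} = carrier Qt"
    proof (rule hull_unique)
      show "{pr u} \<subseteq> carrier Qt" using carr by simp
      show "uq_submodule n (carrier Qt) Qt" by (rule cs)
      fix N assume "{pr u} \<subseteq> N" "uq_submodule n N Qt"
      then show "carrier Qt \<subseteq> N" using irr[of N] nz by auto
    qed
    show "pr u \<in> carrier Qt" by (rule carr)
    fix i assume i: "i \<in> {1..n}"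
    show "act Qt (gen_e i) (pr u) = \<zero>\<^bsub>Qt\<^esub>" using u i uC by (simp add: act_Qt_simps zero_Qt prim_def)
    show "act Qt (gen_t i) (pr u) = (q tp powi inner_wt n (simple_root tp n i) \<mu>) \<odot>\<^bsub>Qt\<^esub> pr u"
      using u(2) i uC a[OF i] by (simp add: act_Qt_simps smult_Qt homog_def)
  qed
qed

end

context tensor_power
begin

text \<open>The map of the Chinese remainder theorem: the diagonal projection has kernel R, and
  \<open>surj\<close> is the assumption that simultaneous congruences can be solved.\<close>

lemma iso_direct_sum:
  assumes S: "\<And>\<mu>. \<mu> \<in> L \<Longrightarrow> submod (S \<mu>)" and R: "submod R" "(\<Inter>\<mu>\<in>L. S \<mu>) = R" and ne: "L \<noteq> {}"
    and surj: "\<And>y. (\<And>\<mu>. \<mu> \<in> L \<Longrightarrow> y \<mu> \<in> Car) \<Longrightarrow> \<exists>x\<in>Car. \<forall>\<mu>\<in>L. x - y \<mu> \<in> S \<mu>"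
  shows "uq_iso n (uq_quotient TP R) (uq_direct_sum L (\<lambda>\<mu>. uq_quotient TP (S \<mu>)))"
proof -
  interpret R: tensor_quotient tp n k R using R(1) by unfold_locales
  have tq: "tensor_quotient tp n k (S \<mu>)" if "\<mu> \<in> L" for \<mu> using S[OF that] by unfold_locales
  let ?pr = "\<lambda>\<mu> x. S \<mu> +>\<^bsub>TP\<^esub> x" and ?Q = "\<lambda>\<mu>. uq_quotient TP (S \<mu>)"
  note prS = tensor_quotient.pr_def[OF tq, symmetric]
  \<comment> \<open>The coset C refines each coset modulo \<open>S \<mu>\<close>, so the union is a
    single coset; this avoids choosing a representative.\<close>
  define h where "h C = (\<lambda>\<mu>\<in>L. \<Union>x\<in>C. ?pr \<mu> x)" for C
  have h: "h (R.pr x) = (\<lambda>\<mu>\<in>L. ?pr \<mu> x)" for x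
  proof -
    have "(\<Union>y\<in>R.pr x. ?pr \<mu> y) = ?pr \<mu> x" if \<mu>: "\<mu> \<in> L" for \<mu>
    proof -
      have "?pr \<mu> y = ?pr \<mu> x" if "y \<in> R.pr x" for y
        using that R(2) \<mu> unfolding R.mem_pr prS[OF \<mu>] tensor_quotient.pr_cong[OF tq[OF \<mu>]] by blast
      then show ?thesis using R.self_pr[of x] by blast
    qed
    then show ?thesis by (auto simp: h_def restrict_def fun_eq_iff)
  qed
  let ?D = "uq_direct_sum L ?Q"
  have D: "carrier ?D = (\<Pi>\<^sub>E \<mu>\<in>L. carrier (?Q \<mu>))" "x \<oplus>\<^bsub>?D\<^esub> y = (\<lambda>\<mu>\<in>L. x \<mu> \<oplus>\<^bsub>?Q \<mu>\<^esub> y \<mu>)"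
    "c \<odot>\<^bsub>?D\<^esub> x = (\<lambda>\<mu>\<in>L. c \<odot>\<^bsub>?Q \<mu>\<^esub> x \<mu>)" "act ?D g x = (\<lambda>\<mu>\<in>L. act (?Q \<mu>) g (x \<mu>))" for x y c g
    by (simp_all add: uq_direct_sum_def)
  have hC: "h (R.pr x) \<in> carrier ?D" if "x \<in> Car" for x
    using that by (auto simp: h D prS tensor_quotient.carrier_Qt[OF tq])
  have hom: "h \<in> uq_hom n (uq_quotient TP R) ?D"
    unfolding uq_hom_def
  proof (intro CollectI conjI ballI allI)
    show "h \<in> carrier (uq_quotient TP R) \<rightarrow> carrier ?D" using hC by (auto simp: R.carrier_Qt)
    fix c x assume "x \<in> carrier (uq_quotient TP R)"
    then obtain x' where x: "x = R.pr x'" "x' \<in> Car" by (auto simp: R.carrier_Qt)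
    show "h (c \<odot>\<^bsub>uq_quotient TP R\<^esub> x) = c \<odot>\<^bsub>?D\<^esub> h x"
      by (simp add: x R.smult_Qt h D) (auto simp: restrict_def fun_eq_iff prS tensor_quotient.smult_Qt[OF tq])
    show "h (act (uq_quotient TP R) g x) = act ?D g (h x)" if "g \<in> uq_gens n" for g
      using x(2) that
      by (simp add: x(1) R.act_Qt h D) (auto simp: restrict_def fun_eq_iff prS tensor_quotient.act_Qt[OF tq])
    fix y assume "y \<in> carrier (uq_quotient TP R)"
    then obtain y' where y: "y = R.pr y'" "y' \<in> Car" by (auto simp: R.carrier_Qt)
    show "h (x \<oplus>\<^bsub>uq_quotient TP R\<^esub> y) = h x \<oplus>\<^bsub>?D\<^esub> h y"
      by (simp add: x y R.add_Qt h D) (auto simp: restrict_def fun_eq_iff prS tensor_quotient.add_Qt[OF tq])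
  qed
  have "inj_on h (carrier (uq_quotient TP R))"
  proof (rule inj_onI)
    fix x y assume "x \<in> carrier (uq_quotient TP R)" "y \<in> carrier (uq_quotient TP R)" and eq: "h x = h y"
    then obtain x' y' where x: "x = R.pr x'" and y: "y = R.pr y'" by (auto simp: R.carrier_Qt)
    have "x' - y' \<in> S \<mu>" if \<mu>: "\<mu> \<in> L" for \<mu>
    proof -
      have "?pr \<mu> x' = ?pr \<mu> y'" using fun_cong[OF eq, of \<mu>] \<mu> by (simp add: x y h)
      then show ?thesis unfolding prS[OF \<mu>] tensor_quotient.pr_cong[OF tq[OF \<mu>]] .
    qed
    then show "x = y" using R(2) by (auto simp: x y R.pr_cong)
  qed
  moreover have "h ` carrier (uq_quotient TP R) = carrier ?D"
  proof
    show "h ` carrier (uq_quotient TP R) \<subseteq> carrier ?D" using hC by (auto simp: R.carrier_Qt)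
    show "carrier ?D \<subseteq> h ` carrier (uq_quotient TP R)"
    proof
      fix f assume f: "f \<in> carrier ?D"
      have "\<exists>y. y \<in> Car \<and> f \<mu> = ?pr \<mu> y" if \<mu>: "\<mu> \<in> L" for \<mu>
      proof -
        have "f \<mu> \<in> carrier (?Q \<mu>)" using f \<mu> unfolding D by (rule PiE_mem)
        then show ?thesis by (auto simp: prS[OF \<mu>] tensor_quotient.carrier_Qt[OF tq[OF \<mu>]])
      qed
      then obtain y where y: "\<And>\<mu>. \<mu> \<in> L \<Longrightarrow> y \<mu> \<in> Car" "\<And>\<mu>. \<mu> \<in> L \<Longrightarrow> f \<mu> = ?pr \<mu> (y \<mu>)" by metis
      obtain x where x: "x \<in> Car" "\<And>\<mu>. \<mu> \<in> L \<Longrightarrow> x - y \<mu> \<in> S \<mu>" using surj[of y] y(1) by blast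
      have "f = h (R.pr x)"
      proof
        fix \<mu> show "f \<mu> = h (R.pr x) \<mu>"
        proof (cases "\<mu> \<in> L")
          case True
          have "?pr \<mu> x = ?pr \<mu> (y \<mu>)"
            using x(2)[OF True] unfolding prS[OF True] tensor_quotient.pr_cong[OF tq[OF True]] .
          then show ?thesis using y(2)[OF True] True by (simp add: h)
        next
          case False
          then show ?thesis using f by (auto simp: h D PiE_def extensional_def)
        qed
      qed
      then show "f \<in> h ` carrier (uq_quotient TP R)" using x(1) by (auto simp: R.carrier_Qt)
    qed
  qed
  ultimately show ?thesis unfolding uq_iso_def using hom by (auto simp: bij_betw_def)
qed

text \<open>Primitive vectors of different weights generate orthogonal submodules, as some
  \<open>t_i\<close> has different eigenvalues. Each quotient by one orthogonal complement is
  irreducible, and \<open>perp_decomposition\<close> identifies the common kernel.\<close>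

lemma quotient_decomposition:
  assumes A: "submod A"
    and u: "\<And>\<mu>. \<mu> \<in> L \<Longrightarrow> prim (u \<mu>) \<and> homog (\<lambda>i. q tp powi inner_wt n (simple_root tp n i) \<mu>) (u \<mu>) \<and> u \<mu> \<noteq> 0 \<and> u \<mu> \<in> A"
    and complete: "\<And>x b. x \<in> A \<Longrightarrow> prim x \<Longrightarrow> homog b x \<Longrightarrow> x \<noteq> 0 \<Longrightarrow> \<exists>\<mu>\<in>L. \<exists>e. x = e \<star> u \<mu>"
    and L: "finite L" "L \<noteq> {}"
    and dist: "\<And>\<mu> \<nu>. \<mu> \<in> L \<Longrightarrow> \<nu> \<in> L \<Longrightarrow> \<mu> \<noteq> \<nu> \<Longrightarrow>
      \<exists>i\<in>{1..n}. inner_wt n (simple_root tp n i) \<mu> \<noteq> inner_wt n (simple_root tp n i) \<nu>"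
  shows "iso_sum_V tp n (uq_quotient TP (perp A)) L"
    "L = {\<mu>} \<Longrightarrow> is_V tp n \<mu> (uq_quotient TP (perp A))"
proof -
  define S where "S \<mu> = perp (fspan (u \<mu>))" for \<mu>
  define a where "a \<mu> i = q tp powi inner_wt n (simple_root tp n i) \<mu>" for \<mu> i
  have ua: "prim (u \<mu>)" "homog (a \<mu>) (u \<mu>)" "u \<mu> \<noteq> 0" "u \<mu> \<in> A" if "\<mu> \<in> L" for \<mu>
    using u[OF that] by (auto simp: a_def[abs_def])
  have fs: "submod (fspan (u \<mu>))" if "\<mu> \<in> L" for \<mu> using submod_fspan ua that by blast
  have Sm: "submod (S \<mu>)" if "\<mu> \<in> L" for \<mu> using fs[OF that] by (simp add: S_def submod_perp)
  have int: "(\<Inter>\<mu>\<in>L. S \<mu>) = perp A"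
    unfolding S_def by (rule perp_decomposition[OF A _ _ L(2), where a = a]) (use ua complete in auto)
  have V: "is_V tp n \<mu> (uq_quotient TP (S \<mu>))" if "\<mu> \<in> L" for \<mu>
  proof -
    interpret Q: tensor_quotient tp n k "S \<mu>" using Sm[OF that] by unfold_locales
    show ?thesis by (rule Q.is_V_Qt[OF ua(1-3)[OF that] S_def]) (simp add: a_def)
  qed
  have ad: "\<exists>i\<in>{1..n}. a \<mu> i \<noteq> a \<nu> i" if "\<mu> \<in> L" "\<nu> \<in> L" "\<mu> \<noteq> \<nu>" for \<mu> \<nu>
    using dist[OF that] by (auto simp: a_def powi_inject)
  have orth: "ip x y = 0" if "\<mu> \<in> L" "\<nu> \<in> L" "\<mu> \<noteq> \<nu>" "x \<in> fspan (u \<mu>)" "y \<in> fspan (u \<nu>)" for \<mu> \<nu> x y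
    using ad[OF that(1-3)] fspan_orthogonal[OF ua(1-3)[OF that(1)] ua(1-3)[OF that(2)] _ _ that(4,5)] by blast
  show "iso_sum_V tp n (uq_quotient TP (perp A)) L"
    unfolding iso_sum_V_def
  proof (intro exI[of _ "\<lambda>\<mu>. uq_quotient TP (S \<mu>)"] conjI ballI)
    show "uq_iso n (uq_quotient TP (perp A)) (uq_direct_sum L (\<lambda>\<mu>. uq_quotient TP (S \<mu>)))"
    proof (rule iso_direct_sum[OF Sm submod_perp[OF A] int L(2)])
      fix y assume y: "\<And>\<mu>. \<mu> \<in> L \<Longrightarrow> y \<mu> \<in> Car"
      have "\<exists>p. p \<in> fspan (u \<mu>) \<and> (\<forall>z\<in>fspan (u \<mu>). ip (y \<mu> - p) z = 0)" if "\<mu> \<in> L" for \<mu>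
        using projection[OF submodD(1,2)[OF fs[OF that]]] by metis
      then obtain p where p: "\<And>\<mu>. \<mu> \<in> L \<Longrightarrow> p \<mu> \<in> fspan (u \<mu>)"
        "\<And>\<mu> z. \<mu> \<in> L \<Longrightarrow> z \<in> fspan (u \<mu>) \<Longrightarrow> ip (y \<mu> - p \<mu>) z = 0" by metis
      \<comment> \<open>Modulo \<open>S \<mu>\<close> only the summand \<open>p \<mu>\<close>
        matters, by orthogonality; so this x solves all congruences.\<close>
      define x where "x = (\<Sum>\<mu>\<in>L. p \<mu>)"
      have pC: "p \<mu> \<in> Car" if "\<mu> \<in> L" for \<mu> using submodD(3)[OF fs[OF that] p(1)[OF that]] .
      have xC: "x \<in> Car" unfolding x_def by (intro subsp_sum subsp_supported pC)
      have "x - y \<mu> \<in> S \<mu>" if \<mu>: "\<mu> \<in> L" for \<mu>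
      proof -
        have "ip (x - y \<mu>) z = 0" if z: "z \<in> fspan (u \<mu>)" for z
        proof -
          have "ip x z = (\<Sum>\<nu>\<in>L. ip (p \<nu>) z)"
            unfolding x_def using L(1) by (induction L rule: finite_induct) (simp_all add: wip_linear)
          also have "\<dots> = (\<Sum>\<nu>\<in>L. if \<nu> = \<mu> then ip (p \<mu>) z else 0)"
            using orth p(1) \<mu> z by (intro sum.cong) auto
          also have "\<dots> = ip (y \<mu>) z" using p(2)[OF \<mu> z] L(1) \<mu> by (simp add: wip_linear)
          finally show ?thesis by (simp add: wip_linear)
        qed
        then show ?thesis using car(5)[OF xC y[OF \<mu>]] by (simp add: S_def perp_def)
      qed
      then show "\<exists>x\<in>Car. \<forall>\<mu>\<in>L. x - y \<mu> \<in> S \<mu>" using xC by blast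
    qed
  qed (rule V)
  show "is_V tp n \<mu> (uq_quotient TP (perp A))" if "L = {\<mu>}"
    using V[of \<mu>] int that by simp
qed

end

subsection \<open>The orthogonal complement of the relations\<close>

text \<open>The linear conditions that cut out the orthogonal complement of \<open>W\<close> in the tensor square.\<close>

definition anti :: "affine_type \<Rightarrow> nat \<Rightarrow> (int \<Rightarrow> int \<Rightarrow> K) \<Rightarrow> bool" where
  "anti tp n y \<longleftrightarrow>
     (\<forall>c\<in>idx tp n. c \<noteq> 0 \<longrightarrow> y c c = 0) \<and>
     (\<forall>c\<in>idx tp n. \<forall>d\<in>idx tp n. prec n c d \<and> c \<noteq> - d \<longrightarrow> y d c = - q tp * y c d) \<and>
     (\<forall>j. 1 \<le> j \<and> j < int n \<longrightarrow>
        y (- j) j + q tp ^ 2 * y j (- j) = - q tp * (y (- j - 1) (j + 1) + y (j + 1) (- j - 1))) \<and>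
     (tp = A2_odd \<or> tp = C1 \<longrightarrow> y (- int n) (int n) + q tp ^ 2 * y (int n) (- int n) = 0) \<and>
     (tp \<noteq> A2_odd \<longrightarrow> y (- 1) 1 + y 1 (- 1) = 0) \<and>
     (tp = A2_even \<longrightarrow> (1 + q tp)\<^sup>2 * indet * y 0 0 = - (y (- int n) (int n) + q tp ^ 2 * y (int n) (- int n)))"

lemma antiD:
  assumes "anti tp n y"
  shows "c \<in> idx tp n \<Longrightarrow> c \<noteq> 0 \<Longrightarrow> y c c = 0"
    "c \<in> idx tp n \<Longrightarrow> d \<in> idx tp n \<Longrightarrow> prec n c d \<Longrightarrow> c \<noteq> - d \<Longrightarrow> y d c = - q tp * y c d"
    "1 \<le> j \<Longrightarrow> j < int n \<Longrightarrow>
      y (- j) j + q tp ^ 2 * y j (- j) = - q tp * (y (- j - 1) (j + 1) + y (j + 1) (- j - 1))"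
    "tp = A2_odd \<or> tp = C1 \<Longrightarrow> y (- int n) (int n) + q tp ^ 2 * y (int n) (- int n) = 0"
    "tp \<noteq> A2_odd \<Longrightarrow> y (- 1) 1 + y 1 (- 1) = 0"
    "tp = A2_even \<Longrightarrow> (1 + q tp)\<^sup>2 * indet * y 0 0 = - (y (- int n) (int n) + q tp ^ 2 * y (int n) (- int n))"
  using assms by (auto simp: anti_def)

section \<open>Stability of the antisymmetry conditions under raising operators\<close>

definition e2 :: "affine_type \<Rightarrow> nat \<Rightarrow> nat \<Rightarrow> (int \<Rightarrow> int \<Rightarrow> K) \<Rightarrow> int \<Rightarrow> int \<Rightarrow> K" where
  "e2 tp n i y a b = eV tp n i (\<lambda>c. inverse (tl_wt tp n i b) * y c b) a + eV tp n i (\<lambda>c. y a c) b"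

lemma idx_pos_inject:
  assumes "\<bar>c\<bar> \<le> int n" "\<bar>d\<bar> \<le> int n"
  shows "idx_pos n c = idx_pos n d \<longleftrightarrow> c = d"
proof
  assume eq: "idx_pos n c = idx_pos n d"
  have b: "- int n \<le> c" "c \<le> int n" "- int n \<le> d" "d \<le> int n" using assms by auto
  have "c > 0 \<and> idx_pos n c = c \<or> c = 0 \<and> idx_pos n c = int n + 1 \<or> c < 0 \<and> idx_pos n c = 2 * int n + 2 + c"
    by (cases c "0::int" rule: linorder_cases) (auto simp: idx_pos_def)
  moreover have "d > 0 \<and> idx_pos n d = d \<or> d = 0 \<and> idx_pos n d = int n + 1 \<or> d < 0 \<and> idx_pos n d = 2 * int n + 2 + d"
    by (cases d "0::int" rule: linorder_cases) (auto simp: idx_pos_def)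
  ultimately show "c = d" using eq b by (elim disjE; linarith)
qed simp

lemma idx_abs: "c \<in> idx tp n \<Longrightarrow> \<bar>c\<bar> \<le> int n"
  by (auto simp: idx_iff)

lemma prec_adjacent:
  assumes "idx_pos n b = idx_pos n a + 1" "d \<in> idx tp n" "a \<in> idx tp n" "b \<in> idx tp n" "d \<noteq> a" "d \<noteq> b"
  shows "prec n a d \<longleftrightarrow> prec n b d" "prec n d a \<longleftrightarrow> prec n d b"
proof -
  have "idx_pos n d \<noteq> idx_pos n a" using idx_pos_inject idx_abs assms(2,3,5) by blast
  moreover have "idx_pos n d \<noteq> idx_pos n a + 1" using idx_pos_inject idx_abs assms(1,2,4,6) by metis
  ultimately show "prec n a d \<longleftrightarrow> prec n b d" "prec n d a \<longleftrightarrow> prec n d b"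
    unfolding prec_def assms(1) by presburger+
qed

text \<open>Away from the letters i, i+1, -i-1, -i nothing changes, and a letter outside this set
  compares equally with two neighbours, so q-antisymmetry is passed on. The chain relation of y is
  needed exactly for the result at (i, -i-1), which comes from zero weight.\<close>

lemma anti_e2_lt:
  assumes y: "anti tp n y" and i: "1 \<le> i" "i < n"
  shows "anti tp n (e2 tp n i y)"
proof -
  define I where "I = int i"
  have I: "1 \<le> I" "I < int n" using i by (auto simp: I_def)
  define r where "r b = inverse (tl_wt tp n i b)" for b
  define Q where "Q = q tp"
  have Q0: "Q \<noteq> 0" by (simp add: Q_def)
  have w: "lwt tp n i b = (if \<bar>b\<bar> = I then sgn b else 0) - (if \<bar>b\<bar> = I + 1 then sgn b else 0)" for b
    using lwt_eq[of i n tp b] i by (simp add: I_def)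
  have r: "r I = inverse Q" "r (I + 1) = Q" "r (- I - 1) = inverse Q" "r (- I) = Q"
    using I by (simp_all add: r_def tl_wt_def w Q_def)
  have r1: "r b = 1" if "b \<noteq> I" "b \<noteq> I + 1" "b \<noteq> - I - 1" "b \<noteq> - I" for b
  proof -
    have "\<bar>b\<bar> \<noteq> I" "\<bar>b\<bar> \<noteq> I + 1" using that by auto
    then show ?thesis by (simp add: r_def tl_wt_def w)
  qed
  define u where "u = e2 tp n i y"
  have u: "u a b = (if a = I then r b * y (I + 1) b else 0) + (if a = - I - 1 then r b * y (- I) b else 0)
      + (if b = I then y a (I + 1) else 0) + (if b = - I - 1 then y a (- I) else 0)" for a b
    using i eV_eq[of i n tp] by (simp add: u_def e2_def I_def r_def)
  have J: "I \<in> idx tp n" "I + 1 \<in> idx tp n" "- I - 1 \<in> idx tp n" "- I \<in> idx tp n"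
    using I by (auto simp: idx_iff)
  note sw = antiD(2)[OF y, folded Q_def]
  have y0: "y (I + 1) (I + 1) = 0" "y (- I) (- I) = 0" "y I I = 0" "y (- I - 1) (- I - 1) = 0"
    using antiD(1)[OF y] J I by auto
  have s: "y (I + 1) I = - Q * y I (I + 1)" "y (- I) (- I - 1) = - Q * y (- I - 1) (- I)"
    "y (- I) (I + 1) = - Q * y (I + 1) (- I)" "y (- I - 1) I = - Q * y I (- I - 1)"
    using sw J I by (auto simp: prec_def idx_pos_def)
  have chain: "y (- I) I + Q\<^sup>2 * y I (- I) = - Q * (y (- I - 1) (I + 1) + y (I + 1) (- I - 1))"
    using antiD(3)[OF y, of I] I by (simp add: Q_def)
  have opp: "u (- j) j = (if j = I then y (- I) (I + 1) else if j = I + 1 then Q * y (- I) (I + 1) else 0)"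
    "u j (- j) = (if j = I then Q * y (I + 1) (- I) else if j = I + 1 then y (I + 1) (- I) else 0)" if "j \<ge> 0" for j
    using that I r by (auto simp: u)
  \<comment> \<open>\<open>h\<close> and \<open>g\<close> evaluate the two sides of the chain
    relation. Each vanishes with one exception, I+1 for \<open>h\<close> and I for \<open>g\<close>,
    so only the relation at j = I remains to be computed.\<close>
  have h: "u (- j) j + u j (- j) = 0" if "j \<ge> 0" "j \<noteq> I + 1" for j
    using that by (simp add: opp s)
  have g: "u (- j) j + Q\<^sup>2 * u j (- j) = 0" if "j \<ge> 0" "j \<noteq> I" for j
    using that by (simp add: opp s power2_eq_square)
  have "u d c = - Q * u c d" if cd: "c \<in> idx tp n" "d \<in> idx tp n" "prec n c d" "c \<noteq> - d" for c d
  proof -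
    let ?o = "\<lambda>b. b \<noteq> I \<and> b \<noteq> I + 1 \<and> b \<noteq> - I - 1 \<and> b \<noteq> - I"
    have adj: "prec n I d' \<longleftrightarrow> prec n (I + 1) d'" "prec n d' I \<longleftrightarrow> prec n d' (I + 1)"
      "prec n (- I - 1) d' \<longleftrightarrow> prec n (- I) d'" "prec n d' (- I - 1) \<longleftrightarrow> prec n d' (- I)"
      if "?o d'" "d' \<in> idx tp n" for d'
    proof -
      have 1: "idx_pos n (I + 1) = idx_pos n I + 1" "idx_pos n (- I) = idx_pos n (- I - 1) + 1"
        using I by (simp_all add: idx_pos_def)
      show "prec n I d' \<longleftrightarrow> prec n (I + 1) d'" "prec n d' I \<longleftrightarrow> prec n d' (I + 1)"
        using prec_adjacent[OF 1(1), of d' tp] that J by auto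
      show "prec n (- I - 1) d' \<longleftrightarrow> prec n (- I) d'" "prec n d' (- I - 1) \<longleftrightarrow> prec n d' (- I)"
        using prec_adjacent[OF 1(2), of d' tp] that J by auto
    qed
    have "\<not> (c = I \<and> d = - I)" "\<not> (c = I + 1 \<and> d = - I - 1)" "\<not> (c = - I - 1 \<and> d = I + 1)" "\<not> (c = - I \<and> d = I)"
      using cd(4) by auto
    moreover have "\<not> (c = I + 1 \<and> d = I)" "\<not> (c = - I \<and> d = - I - 1)" "\<not> (c = - I - 1 \<and> d = I)" "\<not> (c = - I \<and> d = I + 1)"
      using cd(3) I by (auto simp: prec_def idx_pos_def)
    moreover have "\<not> (c = I \<and> d = I)" "\<not> (c = I + 1 \<and> d = I + 1)" "\<not> (c = - I - 1 \<and> d = - I - 1)" "\<not> (c = - I \<and> d = - I)"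
      using cd(3) by (auto simp: prec_def)
    ultimately have "?o c \<and> ?o d \<or> c = I \<and> ?o d \<or> c = - I - 1 \<and> ?o d \<or> ?o c \<and> d = I \<or> ?o c \<and> d = - I - 1
       \<or> c = I \<and> d = I + 1 \<or> c = I \<and> d = - I - 1 \<or> c = I + 1 \<and> d = - I \<or> c = - I - 1 \<and> d = - I
       \<or> (c = I + 1 \<or> c = - I) \<and> ?o d \<or> ?o c \<and> (d = I + 1 \<or> d = - I)"
      by satx
    then consider (oo) "?o c" "?o d" | (a1o) "c = I" "?o d" | (a2o) "c = - I - 1" "?o d"
      | (oa1) "?o c" "d = I" | (oa2) "?o c" "d = - I - 1"
      | (a1b1) "c = I" "d = I + 1" | (a1a2) "c = I" "d = - I - 1" | (bb) "c = I + 1" "d = - I"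
      | (a2b2) "c = - I - 1" "d = - I" | (bo) "c = I + 1 \<or> c = - I" "?o d" | (ob) "?o c" "d = I + 1 \<or> d = - I"
      by satx
    then show ?thesis
    proof cases
      case a1o
      then have "y d (I + 1) = - Q * y (I + 1) d" using sw[of "I + 1" d] J cd adj(1)[of d] by simp
      then show ?thesis using a1o r1[of d] I by (simp add: u)
    next
      case a2o
      then have "y d (- I) = - Q * y (- I) d" using sw[of "- I" d] J cd adj(3)[of d] by simp
      then show ?thesis using a2o r1[of d] I by (simp add: u)
    next
      case oa1
      then have "y (I + 1) c = - Q * y c (I + 1)" using sw[of c "I + 1"] J cd adj(2)[of c] by simp
      then show ?thesis using oa1 r1[of c] I by (simp add: u)
    next
      case oa2
      then have "y (- I) c = - Q * y c (- I)" using sw[of c "- I"] J cd adj(4)[of c] by simp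
      then show ?thesis using oa2 r1[of c] I by (simp add: u)
    next
      \<comment> \<open>Both orders of the pair receive terms from zero weight; multiplied by Q they
        combine to the chain relation at I.\<close>
      case a1a2
      have "Q * (u d c + Q * u c d) = y (- I) I + Q\<^sup>2 * y I (- I) + Q * (y (- I - 1) (I + 1) + y (I + 1) (- I - 1))"
      proof -
        have "u (- I - 1) I = inverse Q * y (- I) I + y (- I - 1) (I + 1)"
          "u I (- I - 1) = inverse Q * y (I + 1) (- I - 1) + y I (- I)"
          using I by (simp_all add: u r)
        then show ?thesis unfolding a1a2 using Q0 by (simp add: field_simps power2_eq_square)
      qed
      also have "\<dots> = 0" using chain by simp
      finally have "u d c + Q * u c d = 0" using Q0 by simp
      then show ?thesis by (simp add: add_eq_0_iff)
    qed (use I y0 in \<open>auto simp: u\<close>)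
  qed
  moreover have "u c c = 0" if "c \<in> idx tp n" "c \<noteq> 0" for c
    using that I Q0 by (auto simp: u r s)
  moreover have "u (- j) j + Q\<^sup>2 * u j (- j) = - Q * (u (- j - 1) (j + 1) + u (j + 1) (- j - 1))"
    if "1 \<le> j" "j < int n" for j
  proof (cases "j = I")
    case True
    have e: "- j - 1 = - (j + 1)" by simp
    have "u (- (j + 1)) (j + 1) = Q * y (- I) (I + 1)" "u (j + 1) (- (j + 1)) = y (I + 1) (- I)"
      "u (- j) j = y (- I) (I + 1)" "u j (- j) = Q * y (I + 1) (- I)"
      unfolding opp[OF order_trans[OF zero_le_one that(1)]] using opp[of "j + 1"] True I by simp_all
    then show ?thesis unfolding e by (simp only: s) (simp add: algebra_simps power2_eq_square)
  next
    case False
    then show ?thesis using g[of j] h[of "j + 1"] that by simp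
  qed
  moreover have "u (- int n) (int n) + Q\<^sup>2 * u (int n) (- int n) = 0"
    using g[of "int n"] I by simp
  moreover have "u (- 1) 1 + u 1 (- 1) = 0" using h[of 1] I by simp
  moreover have "u 0 0 = 0" using I by (simp add: u)
  ultimately show ?thesis unfolding anti_def u_def[symmetric] Q_def[symmetric] by simp
qed

text \<open>Here \<open>e_n\<close> turns -n into n. Zero weight results come from y at (-n,-n) and
  vanish, and the relation at n,-n is what annihilates the result at (n,n).\<close>

lemma anti_e2_C:
  assumes y: "anti tp n y" and tp: "tp = A2_odd \<or> tp = C1" and n: "1 < n"
  shows "anti tp n (e2 tp n n y)"
proof -
  define N where "N = int n"
  have N: "1 < N" using n by (auto simp: N_def)
  define r where "r b = inverse (tl_wt tp n n b)" for b
  define Q where "Q = q tp"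
  have Q0: "Q \<noteq> 0" by (simp add: Q_def)
  have w: "lwt tp n n b = 2 * (if \<bar>b\<bar> = N then sgn b else 0)" for b
    using lwt_eq[of n n tp b] n tp by (auto simp: N_def)
  have r: "r N = inverse (Q\<^sup>2)" "r (- N) = Q\<^sup>2"
    using N by (simp_all add: r_def tl_wt_def w Q_def power_int_minus)
  have r1: "r b = 1" if "b \<noteq> N" "b \<noteq> - N" for b
  proof -
    have "\<bar>b\<bar> \<noteq> N" using that by auto
    then show ?thesis by (simp add: r_def tl_wt_def w)
  qed
  define u where "u = e2 tp n n y"
  have u: "u a b = (if a = N then r b * y (- N) b else 0) + (if b = N then y a (- N) else 0)" for a b
    using n eV_eq[of n n tp] tp by (auto simp: u_def e2_def N_def r_def)
  have J: "N \<in> idx tp n" "- N \<in> idx tp n" "0 \<notin> idx tp n" using N tp by (auto simp: idx_iff N_def)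
  note sw = antiD(2)[OF y, folded Q_def]
  have y0: "y (- N) (- N) = 0" using antiD(1)[OF y] J N by auto
  have base: "y (- N) N + Q\<^sup>2 * y N (- N) = 0" using antiD(4)[OF y tp] by (simp add: N_def Q_def)
  have opp: "u (- j) j = 0" "u j (- j) = 0" if "j \<ge> 0" for j
    using that N r y0 by (auto simp: u)
  have "u d c = - Q * u c d" if cd: "c \<in> idx tp n" "d \<in> idx tp n" "prec n c d" "c \<noteq> - d" for c d
  proof -
    have adj: "prec n N d' \<longleftrightarrow> prec n (- N) d'" "prec n d' N \<longleftrightarrow> prec n d' (- N)"
      if "d' \<noteq> N" "d' \<noteq> - N" "d' \<in> idx tp n" for d'
    proof -
      have d': "d' \<noteq> 0" "\<bar>d'\<bar> \<noteq> N" using that J by auto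
      then show "prec n N d' \<longleftrightarrow> prec n (- N) d'" "prec n d' N \<longleftrightarrow> prec n d' (- N)"
        using idx_abs[OF that(3)] N by (cases "d' > 0"; simp add: prec_def idx_pos_def N_def; linarith)+
    qed
    consider (o) "c \<noteq> N" "d \<noteq> N" | (a) "c = N" "d \<noteq> N" "d \<noteq> - N" | (b) "d = N" "c \<noteq> N" "c \<noteq> - N"
      using cd(3,4) by (auto simp: prec_def)
    then show ?thesis
    proof cases
      case a
      then have "y d (- N) = - Q * y (- N) d" using sw[of "- N" d] J cd adj(1)[of d] by simp
      then show ?thesis using a r1[of d] by (simp add: u)
    next
      case b
      then have "y (- N) c = - Q * y c (- N)" using sw[of c "- N"] J cd adj(2)[of c] by simp
      then show ?thesis using b r1[of c] by (simp add: u)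
    qed (simp add: u)
  qed
  moreover have "u c c = 0" for c
  proof -
    have "Q\<^sup>2 * (r N * y (- N) N + y N (- N)) = 0" using base Q0 by (simp add: r distrib_left flip: mult.assoc)
    then show ?thesis using Q0 by (simp add: u)
  qed
  moreover have "u (- j) j + Q\<^sup>2 * u j (- j) = - Q * (u (- j - 1) (j + 1) + u (j + 1) (- j - 1))"
    if "1 \<le> j" for j using opp[of j] opp[of "j + 1"] that by simp
  ultimately show ?thesis unfolding anti_def u_def[symmetric] Q_def[symmetric]
    using opp[of N] opp[of 1] N tp by (auto simp: N_def)
qed

text \<open>Here \<open>e_n\<close> moves -n to 0 and 0 to n. The relation involving (0,0) is needed
  for the result at the letters n and 0, and it is reproduced because \<open>h * t\<close> is 1 +
  Q.\<close>

lemma anti_e2_B: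
  assumes y: "anti tp n y" and tp: "tp = A2_even" and n: "1 < n"
  shows "anti tp n (e2 tp n n y)"
proof -
  define N where "N = int n"
  have N: "1 < N" using n by (auto simp: N_def)
  define r where "r b = inverse (tl_wt tp n n b)" for b
  define Q where "Q = q tp"
  define h where "h = indet"
  define t where "t = qint tp n n 2"
  have Q0: "Q \<noteq> 0" "h \<noteq> 0" "h * h = Q" using tp by (simp_all add: Q_def h_def q_def power2_eq_square)
  have t: "h * t = 1 + Q"
    using qint_2[of n n tp] n tp Q0 by (simp add: t_def q_i_eq h_def[symmetric] distrib_left)
  have w: "lwt tp n n b = (if \<bar>b\<bar> = N then sgn b else 0)" for b
    using lwt_eq[of n n tp b] n tp by (auto simp: N_def)
  have r: "r N = inverse Q" "r (- N) = Q" "r 0 = 1"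
    using N by (simp_all add: r_def tl_wt_def w Q_def)
  have r1: "r b = 1" if "b \<noteq> N" "b \<noteq> - N" for b
  proof -
    have "\<bar>b\<bar> \<noteq> N" using that by auto
    then show ?thesis by (simp add: r_def tl_wt_def w)
  qed
  define u where "u = e2 tp n n y"
  have u: "u a b = (if a = N then t * (r b * y 0 b) else 0) + (if a = 0 then r b * y (- N) b else 0)
      + (if b = N then t * y a 0 else 0) + (if b = 0 then y a (- N) else 0)" for a b
    using n eV_eq[of n n tp] tp by (simp add: u_def e2_def N_def r_def t_def)
  have J: "N \<in> idx tp n" "- N \<in> idx tp n" "0 \<in> idx tp n" using N tp by (auto simp: idx_iff N_def)
  note sw = antiD(2)[OF y, folded Q_def]
  have y0: "y (- N) (- N) = 0" using antiD(1)[OF y] J N by auto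
  have s: "y 0 N = - Q * y N 0" "y (- N) 0 = - Q * y 0 (- N)"
    using sw J N by (auto simp: prec_def idx_pos_def N_def)
  have base: "(1 + Q)\<^sup>2 * h * y 0 0 = - (y (- N) N + Q\<^sup>2 * y N (- N))"
    using antiD(6)[OF y tp] by (simp add: N_def Q_def h_def)
  have opp: "u (- j) j = (if j = N then t * y (- N) 0 else 0)"
    "u j (- j) = (if j = N then t * (Q * y 0 (- N)) else 0)" if "j > 0" for j
    using that N r y0 by (auto simp: u)
  have zz: "u 0 0 = (1 - Q) * y 0 (- N)" using N r by (simp add: u s algebra_simps)
  have "u d c = - Q * u c d" if cd: "c \<in> idx tp n" "d \<in> idx tp n" "prec n c d" "c \<noteq> - d" for c d
  proof -
    have adj: "prec n N d' \<longleftrightarrow> prec n 0 d'" "prec n d' N \<longleftrightarrow> prec n d' 0"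
      "prec n (- N) d' \<longleftrightarrow> prec n 0 d'" "prec n d' (- N) \<longleftrightarrow> prec n d' 0"
      if "d' \<noteq> N" "d' \<noteq> - N" "d' \<noteq> 0" "d' \<in> idx tp n" for d'
    proof -
      have 1: "idx_pos n 0 = idx_pos n N + 1" "idx_pos n (- N) = idx_pos n 0 + 1"
        using N by (simp_all add: idx_pos_def N_def)
      show "prec n N d' \<longleftrightarrow> prec n 0 d'" "prec n d' N \<longleftrightarrow> prec n d' 0"
        using prec_adjacent[OF 1(1), of d' tp] that J by auto
      show "prec n (- N) d' \<longleftrightarrow> prec n 0 d'" "prec n d' (- N) \<longleftrightarrow> prec n d' 0"
        using prec_adjacent[OF 1(2), of d' tp] that J by auto
    qed
    have "\<not> (c = N \<and> d = - N)" "\<not> (c = - N \<and> d = N)" "\<not> (c = 0 \<and> d = 0)" using cd(4) by auto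
    moreover have "\<not> (c = 0 \<and> d = N)" "\<not> (c = - N \<and> d = 0)"
      using cd(3) N by (auto simp: prec_def idx_pos_def N_def)
    moreover have "\<not> (c = N \<and> d = N)" "\<not> (c = - N \<and> d = - N)"
      using cd(3) by (auto simp: prec_def)
    ultimately consider (o) "c \<noteq> N" "c \<noteq> 0" "d \<noteq> N" "d \<noteq> 0" | (a) "c = N" "d \<noteq> N" "d \<noteq> - N" "d \<noteq> 0"
      | (b) "d = N" "c \<noteq> N" "c \<noteq> - N" "c \<noteq> 0" | (a') "c = 0" "d \<noteq> N" "d \<noteq> - N" "d \<noteq> 0"
      | (b') "d = 0" "c \<noteq> N" "c \<noteq> - N" "c \<noteq> 0" | (n0) "c = N" "d = 0" | (n0') "c = 0" "d = - N"
      using N by satx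
    then show ?thesis
    proof cases
      case a
      then have "y d 0 = - Q * y 0 d" using sw[of 0 d] J cd adj(1)[of d] by simp
      then show ?thesis using a r1[of d] N by (simp add: u)
    next
      case b
      then have "y 0 c = - Q * y c 0" using sw[of c 0] J cd adj(2)[of c] by simp
      then show ?thesis using b r1[of c] N by (simp add: u)
    next
      case a'
      then have "y d (- N) = - Q * y (- N) d" using sw[of "- N" d] J cd adj(3)[of d] by simp
      then show ?thesis using a' r1[of d] N by (simp add: u)
    next
      case b'
      then have "y (- N) c = - Q * y c (- N)" using sw[of c "- N"] J cd adj(4)[of c] by simp
      then show ?thesis using b' r1[of c] N by (simp add: u)
    next
      case n0
      have "Q * h * (u d c + Q * u c d) = h * (y (- N) N + Q\<^sup>2 * y N (- N)) + Q * (h * t) * (1 + Q) * y 0 0"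
        using n0 N Q0 by (simp add: u r algebra_simps power2_eq_square)
      also have "\<dots> = h * (y (- N) N + Q\<^sup>2 * y N (- N) + (1 + Q)\<^sup>2 * h * y 0 0)"
        unfolding t Q0(3)[symmetric] by (simp add: algebra_simps power2_eq_square)
      also have "\<dots> = 0" unfolding base by simp
      finally have "u d c + Q * u c d = 0" using Q0 by simp
      then show ?thesis by (simp add: add_eq_0_iff)
    next
      case n0'
      then show ?thesis using N y0 by (simp add: u)
    qed (simp add: u)
  qed
  moreover have "u c c = 0" if "c \<in> idx tp n" "c \<noteq> 0" for c
    using that N Q0 by (simp add: u r s)
  moreover have hn: "u (- j) j + u j (- j) = 0" if "j > 0" for j using opp[OF that] by (simp add: s)
  moreover have "u (- j) j + Q\<^sup>2 * u j (- j) = - Q * (u (- j - 1) (j + 1) + u (j + 1) (- j - 1))"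
    if "1 \<le> j" "j < int n" for j
    using opp[of j] hn[of "j + 1"] that by (simp add: N_def)
  moreover have "(1 + Q)\<^sup>2 * h * u 0 0 = - (u (- N) N + Q\<^sup>2 * u N (- N))"
  proof -
    have "h * ((1 + Q)\<^sup>2 * h * u 0 0 + (u (- N) N + Q\<^sup>2 * u N (- N)))
       = (h * h) * (1 + Q)\<^sup>2 * (1 - Q) * y 0 (- N) + (h * t) * (Q\<^sup>2 * Q - Q) * y 0 (- N)"
      using opp[of N] N by (simp add: zz s algebra_simps)
    also have "\<dots> = 0" unfolding t Q0 by (simp add: algebra_simps power2_eq_square)
    finally show ?thesis using Q0(2) by (simp add: eq_neg_iff_add_eq_0)
  qed
  ultimately show ?thesis unfolding anti_def u_def[symmetric] Q_def[symmetric] h_def[symmetric] N_def[symmetric]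
    using tp by (simp add: N_def)
qed

text \<open>In type \<open>D\<close>, exchanging \<open>n\<close> and \<open>-n\<close> exchanges \<open>e\<^bsub>n-1\<^esub>\<close> and \<open>e\<^sub>n\<close>.\<close>

definition flipn :: "nat \<Rightarrow> int \<Rightarrow> int" where
  "flipn n a = (if \<bar>a\<bar> = int n then - a else a)"

text \<open>The pair n, -n is opposite and so never subject to q-antisymmetry, type D has no
  separate condition at n, and the chain relation at n-1 is symmetric in its last two terms.\<close>

lemma anti_flipn:
  assumes "anti A2_odd_dagger n y" "2 < n"
  shows "anti A2_odd_dagger n (\<lambda>a b. y (flipn n a) (flipn n b))"
proof -
  have J: "flipn n a \<in> idx A2_odd_dagger n \<longleftrightarrow> a \<in> idx A2_odd_dagger n" for a by (auto simp: flipn_def idx_iff)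
  have p: "prec n (flipn n c) (flipn n d)" if "prec n c d" "c \<noteq> - d" "c \<in> idx A2_odd_dagger n" "d \<in> idx A2_odd_dagger n" for c d
  proof -
    have e: "idx_pos n (flipn n e) = idx_pos n e \<and> (idx_pos n e < int n \<or> idx_pos n e > int n + 2)"
      if "e \<in> idx A2_odd_dagger n" "\<bar>e\<bar> \<noteq> int n" for e
      using that by (cases "e > 0") (auto simp: flipn_def idx_pos_def idx_iff)
    have m: "idx_pos n (flipn n e) \<in> {int n, int n + 2} \<and> idx_pos n e \<in> {int n, int n + 2}" if "\<bar>e\<bar> = int n" for e
      using that assms(2) by (cases "e > 0") (auto simp: flipn_def idx_pos_def)
    have "c \<noteq> d" using that(1) by (auto simp: prec_def)
    then have "\<not> (\<bar>c\<bar> = int n \<and> \<bar>d\<bar> = int n)" using that(2) by arith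
    then show ?thesis
      using that(1) e[OF that(3)] e[OF that(4)] m[of c] m[of d] unfolding prec_def
      by (cases "\<bar>c\<bar> = int n"; cases "\<bar>d\<bar> = int n") auto
  qed
  have f: "flipn n c \<noteq> - flipn n d" if "c \<noteq> - d" for c d using that by (auto simp: flipn_def split: if_splits)
  have lt: "flipn n j = j" if "\<bar>j\<bar> < int n" for j using that by (simp add: flipn_def)
  have nn: "flipn n (int n) = - int n" "flipn n (- int n) = int n" by (simp_all add: flipn_def)
  show ?thesis
    unfolding anti_def
  proof (intro conjI ballI allI impI)
    fix c assume c: "c \<in> idx A2_odd_dagger n" "c \<noteq> 0"
    have "flipn n c \<noteq> 0" using c by (auto simp: flipn_def)
    then show "y (flipn n c) (flipn n c) = 0" using antiD(1)[OF assms(1)] J c by blast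
  next
    fix c d assume "c \<in> idx A2_odd_dagger n" "d \<in> idx A2_odd_dagger n" "prec n c d \<and> c \<noteq> - d"
    then show "y (flipn n d) (flipn n c) = - q A2_odd_dagger * y (flipn n c) (flipn n d)"
      using antiD(2)[OF assms(1), of "flipn n c" "flipn n d"] J p f by blast
  next
    fix j assume j: "1 \<le> j \<and> j < int n"
    show "y (flipn n (- j)) (flipn n j) + (q A2_odd_dagger)\<^sup>2 * y (flipn n j) (flipn n (- j)) =
      - q A2_odd_dagger * (y (flipn n (- j - 1)) (flipn n (j + 1)) + y (flipn n (j + 1)) (flipn n (- j - 1)))"
    proof (cases "j + 1 = int n")
      case True
      then have e: "- j - 1 = - int n" by simp
      show ?thesis unfolding True e nn using antiD(3)[OF assms(1), of j] j lt[of j] lt[of "- j"]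
        unfolding True e by (simp add: add.commute)
    next
      case False
      then show ?thesis using antiD(3)[OF assms(1), of j] j lt[of j] lt[of "- j"] lt[of "j + 1"] lt[of "- j - 1"] by simp
    qed
  next
    show "y (flipn n (- 1)) (flipn n 1) + y (flipn n 1) (flipn n (- 1)) = 0"
      using antiD(5)[OF assms(1)] lt[of 1] lt[of "- 1"] assms(2) by simp
  qed auto
qed

lemma anti_e2_D:
  assumes y: "anti A2_odd_dagger n y" and n: "2 < n"
  shows "anti A2_odd_dagger n (e2 A2_odd_dagger n n y)"
proof -
  have l: "lwt A2_odd_dagger n n b = lwt A2_odd_dagger n (n - 1) (flipn n b)" for b
    using n lwt_eq[of n n A2_odd_dagger b] lwt_eq[of "n - 1" n A2_odd_dagger "flipn n b"]
    by (auto simp: flipn_def sgn_minus of_nat_diff)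
  have e: "eV A2_odd_dagger n n h a = eV A2_odd_dagger n (n - 1) (\<lambda>c. h (flipn n c)) (flipn n a)" for h a
    using n eV_eq[of n n A2_odd_dagger h a] eV_eq[of "n - 1" n A2_odd_dagger "\<lambda>c. h (flipn n c)" "flipn n a"]
    by (auto simp: flipn_def of_nat_diff)
  have ff: "flipn n (flipn n a) = a" for a by (auto simp: flipn_def)
  have "e2 A2_odd_dagger n n y = (\<lambda>a b. e2 A2_odd_dagger n (n - 1) (\<lambda>a b. y (flipn n a) (flipn n b)) (flipn n a) (flipn n b))"
    by (intro ext) (simp add: e2_def e tl_wt_def l ff)
  moreover have "anti A2_odd_dagger n (e2 A2_odd_dagger n (n - 1) (\<lambda>a b. y (flipn n a) (flipn n b)))"
    using n by (intro anti_e2_lt anti_flipn y) auto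
  ultimately show ?thesis using anti_flipn n by simp
qed

lemma sum_idx:
  "(\<Sum>i\<in>idx tp n. h i) = (\<Sum>j\<in>{1..n}. h (int j)) + (if tp = A2_even then h 0 else 0) + (\<Sum>j\<in>{1..n}. h (- int j))"
proof -
  have 1: "idx tp n = int ` {1..n} \<union> (if tp = A2_even then {0} else {}) \<union> (\<lambda>j. - int j) ` {1..n}" (is "_ = ?A \<union> ?B \<union> ?C")
  proof (intro Set.set_eqI iffI)
    fix c assume "c \<in> idx tp n"
    then consider "c > 0" "nat c \<in> {1..n}" | "c = 0" "tp = A2_even" | "c < 0" "nat (- c) \<in> {1..n}"
      unfolding idx_iff by force
    then show "c \<in> ?A \<union> ?B \<union> ?C"
    proof cases
      case 1
      then have "int (nat c) \<in> int ` {1..n}" by blast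
      then show ?thesis using 1 by simp
    next
      case 3
      then have "- int (nat (- c)) \<in> (\<lambda>j. - int j) ` {1..n}" by blast
      then show ?thesis using 3 by simp
    qed simp
  qed (auto simp: idx_iff split: if_splits)
  have "(\<Sum>i\<in>idx tp n. h i) = (\<Sum>i\<in>?A. h i) + (\<Sum>i\<in>?B. h i) + (\<Sum>i\<in>?C. h i)"
    unfolding 1 by (subst sum.union_disjoint, simp, simp, force)+ simp
  moreover have "(\<Sum>i\<in>?A. h i) = (\<Sum>j\<in>{1..n}. h (int j))" by (subst sum.reindex) (auto simp: inj_on_def)
  moreover have "(\<Sum>i\<in>?C. h i) = (\<Sum>j\<in>{1..n}. h (- int j))" by (subst sum.reindex) (auto simp: inj_on_def)
  ultimately show ?thesis by simp
qed

lemma sum_split_at: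
  fixes h :: "nat \<Rightarrow> 'a::ab_group_add"
  assumes "m \<in> {1..n}"
  shows "(\<Sum>j\<in>{1..n}. h j) = (\<Sum>j\<in>{1..<m}. h j) + h m + (\<Sum>j\<in>{m<..n}. h j)"
proof -
  have "{1..n} = insert m ({1..<m} \<union> {m<..n})" using assms by auto
  moreover have "(\<Sum>j\<in>{1..<m} \<union> {m<..n}. h j) = (\<Sum>j\<in>{1..<m}. h j) + (\<Sum>j\<in>{m<..n}. h j)"
    by (rule sum.union_disjoint) auto
  ultimately show ?thesis by simp
qed

text \<open>The zero weight part of the equations for the kernel, with \<open>Y\<close>, \<open>Z\<close>, \<open>y\<close> the normalized
  coordinates at \<open>(-j,j)\<close>, \<open>(j,-j)\<close> and \<open>(0,0)\<close>; \<open>ep\<close>, \<open>e0\<close>, \<open>en\<close> are the equations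
  for the columns \<open>(m,-m)\<close>, \<open>(0,0)\<close>, \<open>(-m,m)\<close>.  Differences of neighbouring equations are short, and one
  remaining equation telescopes.\<close>

locale zero_weight_system =
  fixes n :: nat and Q \<xi> y :: K and Y Z \<kappa> :: "nat \<Rightarrow> K"
  assumes n: "1 \<le> n" and Q: "Q \<noteq> 0" and \<xi>: "1 - \<xi> * Q\<^sup>2 \<noteq> 0"
    and \<kappa>: "\<And>j. \<kappa> j \<noteq> 0" "\<And>j. 1 \<le> j \<Longrightarrow> j < n \<Longrightarrow> \<kappa> j = Q\<^sup>2 * \<kappa> (Suc j)"
begin

text \<open>The coordinate at (j,-j) scaled by the letter -j instead of the letter j.\<close>

definition V :: "nat \<Rightarrow> K" where "V j = Z j / \<kappa> j"

definition ep :: "nat \<Rightarrow> K" where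
  "ep m = (Q\<^sup>2 - 1) * (\<Sum>j\<in>{1..<m}. Y j) + Q\<^sup>2 * (1 - \<xi>) * Y m
     + Q\<^sup>2 * \<xi> * (Q\<^sup>2 - 1) * ((\<Sum>j\<in>{m<..n}. Y j) + y + (\<Sum>j\<in>{1..n}. V j)) + Q\<^sup>2 * (1 - \<xi> * Q\<^sup>2) * Z m"

definition e0 :: K where
  "e0 = (Q\<^sup>2 - 1) * (\<Sum>j\<in>{1..n}. Y j) + (Q\<^sup>2 * (1 - \<xi>) + Q * (1 - \<xi> * Q\<^sup>2)) * y
     + Q\<^sup>2 * \<xi> * (Q\<^sup>2 - 1) * (\<Sum>j\<in>{1..n}. V j)"

definition en :: "nat \<Rightarrow> K" where
  "en m = (Q\<^sup>2 - 1) * ((\<Sum>j\<in>{1..n}. Y j) + y + (\<Sum>j\<in>{m<..n}. V j)) + Q\<^sup>2 * (1 - \<xi>) * V m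
     + Q\<^sup>2 * \<xi> * (Q\<^sup>2 - 1) * (\<Sum>j\<in>{1..<m}. V j) + (1 - \<xi> * Q\<^sup>2) * (Y m / \<kappa> m)"

abbreviation "chain m \<equiv> Y m + Q\<^sup>2 * Z m = Q\<^sup>2 * (Y (Suc m) + Z (Suc m))"

lemma sum_gt: "m < n \<Longrightarrow> (\<Sum>j\<in>{m<..n}. h j) = h (Suc m) + (\<Sum>j\<in>{Suc m<..n}. h j)" for h :: "nat \<Rightarrow> K"
proof -
  assume "m < n"
  then have "{m<..n} = insert (Suc m) {Suc m<..n}" by auto
  then show ?thesis by simp
qed

lemma sum_lt: "1 \<le> m \<Longrightarrow> (\<Sum>j\<in>{1..<Suc m}. h j) = (\<Sum>j\<in>{1..<m}. h j) + h m" for h :: "nat \<Rightarrow> K"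
  by (simp add: atLeastLessThanSuc)

lemma ep_diff:
  assumes "1 \<le> m" "m < n"
  shows "ep (Suc m) - ep m = (1 - \<xi> * Q\<^sup>2) * (Q\<^sup>2 * (Y (Suc m) + Z (Suc m)) - (Y m + Q\<^sup>2 * Z m))"
  unfolding ep_def sum_lt[OF assms(1)] sum_gt[OF assms(2)]
  by (simp add: algebra_simps power2_eq_square)

lemma en_diff:
  assumes "1 \<le> m" "m < n"
  shows "en m - en (Suc m) = (1 - \<xi> * Q\<^sup>2) * ((Y m + Q\<^sup>2 * Z m) - Q\<^sup>2 * (Y (Suc m) + Z (Suc m))) / \<kappa> m"
proof -
  have V: "V m * \<kappa> m = Z m" "V (Suc m) * \<kappa> m = Q\<^sup>2 * Z (Suc m)" "Y (Suc m) / \<kappa> (Suc m) * \<kappa> m = Q\<^sup>2 * Y (Suc m)"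
    using \<kappa>(1)[of m] \<kappa>(1)[of "Suc m"] \<kappa>(2)[OF assms] by (simp_all add: V_def)
  have "en m - en (Suc m) = (1 - \<xi> * Q\<^sup>2) * (Q\<^sup>2 * V m - V (Suc m) + Y m / \<kappa> m - Y (Suc m) / \<kappa> (Suc m))"
    unfolding en_def sum_lt[OF assms(1)] sum_gt[OF assms(2)]
    by (simp add: algebra_simps power2_eq_square)
  also have "\<dots> = (1 - \<xi> * Q\<^sup>2) * (Q\<^sup>2 * (V m * \<kappa> m) - V (Suc m) * \<kappa> m + Y m - Y (Suc m) / \<kappa> (Suc m) * \<kappa> m) / \<kappa> m"
    using \<kappa>(1)[of m] by (simp add: field_simps)
  finally show ?thesis unfolding V by (simp add: algebra_simps)
qed

lemma mid_diff: "y = 0 \<Longrightarrow> en n - ep n = (1 - \<xi> * Q\<^sup>2) * (inverse (\<kappa> n) - 1) * (Y n + Q\<^sup>2 * Z n)"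
  unfolding en_def ep_def sum_split_at[of n n Y, simplified, OF n] sum_split_at[of n n V, simplified, OF n]
  using n by (simp add: V_def divide_inverse algebra_simps power2_eq_square)

lemma mid_diff0:
  "e0 - ep n = (1 - \<xi> * Q\<^sup>2) * ((Q\<^sup>2 + Q) * y - (Y n + Q\<^sup>2 * Z n))"
  "\<kappa> n = Q \<Longrightarrow> en n - e0 = (1 - \<xi> * Q\<^sup>2) * ((Y n + Q\<^sup>2 * Z n) - (Q\<^sup>2 + Q) * y) / Q"
proof -
  have s: "sum h {1..n} = sum h {1..<n} + h n" for h :: "nat \<Rightarrow> K" using sum_split_at[of n n h] n by simp
  show "e0 - ep n = (1 - \<xi> * Q\<^sup>2) * ((Q\<^sup>2 + Q) * y - (Y n + Q\<^sup>2 * Z n))"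
    unfolding e0_def ep_def s by (simp add: algebra_simps power2_eq_square)
  show "\<kappa> n = Q \<Longrightarrow> en n - e0 = (1 - \<xi> * Q\<^sup>2) * ((Y n + Q\<^sup>2 * Z n) - (Q\<^sup>2 + Q) * y) / Q"
    unfolding e0_def en_def s using Q by (simp add: V_def field_simps power2_eq_square)
qed

text \<open>By the chain relation every summand is the increment of
  \<open>(c * Q ^ (2 * m) - Q\<^sup>2) * (Y m + Z m)\<close>.\<close>

lemma telescope:
  assumes chain: "\<And>m. 1 \<le> m \<Longrightarrow> m < n \<Longrightarrow> chain m" and m: "1 \<le> m" "m \<le> n"
  shows "(\<Sum>j\<in>{1..<m}. (Q\<^sup>2 - 1) * (Y j + c * Q ^ (2 * j) * Z j))
    = (c * Q ^ (2 * m) - Q\<^sup>2) * (Y m + Z m) - (c * Q\<^sup>2 - Q\<^sup>2) * (Y 1 + Z 1)"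
  using m
proof (induction m rule: dec_induct)
  case base
  then show ?case by simp
next
  case (step m)
  have "(\<Sum>j\<in>{1..<Suc m}. (Q\<^sup>2 - 1) * (Y j + c * Q ^ (2 * j) * Z j))
    = (Q\<^sup>2 - 1) * (Y m + c * Q ^ (2 * m) * Z m) + (c * Q ^ (2 * m) - Q\<^sup>2) * (Y m + Z m) - (c * Q\<^sup>2 - Q\<^sup>2) * (Y 1 + Z 1)"
    unfolding sum_lt[OF step(1)] using step by simp
  also have "\<dots> = (c * Q ^ (2 * m) - 1) * (Y m + Q\<^sup>2 * Z m) - (c * Q\<^sup>2 - Q\<^sup>2) * (Y 1 + Z 1)"
    by (simp add: algebra_simps)
  also have "\<dots> = (c * Q ^ (2 * m) - 1) * (Q\<^sup>2 * (Y (Suc m) + Z (Suc m))) - (c * Q\<^sup>2 - Q\<^sup>2) * (Y 1 + Z 1)"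
    using chain[of m] step by simp
  finally show ?case by (simp add: algebra_simps power2_eq_square)
qed

lemma \<kappa>_eq: "j \<le> n \<Longrightarrow> 1 \<le> j \<Longrightarrow> \<kappa> j * Q ^ (2 * j) = \<kappa> n * Q ^ (2 * n)"
proof (induction j rule: inc_induct)
  case (step m)
  then show ?case using \<kappa>(2)[of m] by (simp add: power2_eq_square algebra_simps)
qed simp

text \<open>The product \<open>\<kappa> j * Q ^ (2 * j)\<close> does not depend on j. Hence the
  single constant c replaces all \<open>V j\<close> by multiples of \<open>Z j\<close>, and the sum
  becomes the telescoping one.\<close>

lemma ep_n:
  assumes chain: "\<And>m. 1 \<le> m \<Longrightarrow> m < n \<Longrightarrow> chain m"
    and c: "Q\<^sup>2 * \<xi> = c * Q ^ (2 * n) * \<kappa> n"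
  shows "ep n = (c * Q ^ (2 * n) - Q\<^sup>2 * \<xi>) * (Y n + Q\<^sup>2 * Z n) + Q\<^sup>2 * \<xi> * (Q\<^sup>2 - 1) * y
    - (c * Q\<^sup>2 - Q\<^sup>2) * (Y 1 + Z 1)"
proof -
  have V: "Q\<^sup>2 * \<xi> * V j = c * Q ^ (2 * j) * Z j" if "1 \<le> j" "j \<le> n" for j
  proof -
    have "Q\<^sup>2 * \<xi> * V j = c * (\<kappa> j * Q ^ (2 * j)) * (Z j / \<kappa> j)"
      unfolding \<kappa>_eq[OF that(2,1)] c V_def by (simp add: mult.assoc mult.left_commute)
    then show ?thesis using \<kappa>(1)[of j] by simp
  qed
  have "ep n = (\<Sum>j\<in>{1..<n}. (Q\<^sup>2 - 1) * (Y j + Q\<^sup>2 * \<xi> * V j)) + Q\<^sup>2 * (1 - \<xi>) * Y n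
      + (Q\<^sup>2 - 1) * (Q\<^sup>2 * \<xi> * V n) + Q\<^sup>2 * \<xi> * (Q\<^sup>2 - 1) * y + Q\<^sup>2 * (1 - \<xi> * Q\<^sup>2) * Z n"
  proof -
    have "(\<Sum>j\<in>{1..<n}. (Q\<^sup>2 - 1) * (Y j + Q\<^sup>2 * \<xi> * V j))
      = (Q\<^sup>2 - 1) * (\<Sum>j\<in>{1..<n}. Y j) + (Q\<^sup>2 - 1) * (Q\<^sup>2 * \<xi> * (\<Sum>j\<in>{1..<n}. V j))"
      by (simp only: sum_distrib_left[symmetric] sum.distrib distrib_left)
    then show ?thesis
      unfolding ep_def sum_split_at[of n n V, simplified, OF n] using n by (simp add: algebra_simps)
  qed
  also have "(\<Sum>j\<in>{1..<n}. (Q\<^sup>2 - 1) * (Y j + Q\<^sup>2 * \<xi> * V j)) = (\<Sum>j\<in>{1..<n}. (Q\<^sup>2 - 1) * (Y j + c * Q ^ (2 * j) * Z j))"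
    using V by (intro sum.cong) auto
  also have "\<dots> = (c * Q ^ (2 * n) - Q\<^sup>2) * (Y n + Z n) - (c * Q\<^sup>2 - Q\<^sup>2) * (Y 1 + Z 1)"
    by (rule telescope[OF chain n]) simp_all
  finally show ?thesis unfolding V[OF n order_refl] by (simp add: algebra_simps power2_eq_square)
qed

lemma ep_all: "(\<And>m. 1 \<le> m \<Longrightarrow> m < n \<Longrightarrow> chain m) \<Longrightarrow> ep n = 0 \<Longrightarrow> 1 \<le> m \<Longrightarrow> m \<le> n \<Longrightarrow> ep m = 0"
proof -
  assume chain: "\<And>m. 1 \<le> m \<Longrightarrow> m < n \<Longrightarrow> chain m" and "ep n = 0" "1 \<le> m" "m \<le> n"
  from \<open>m \<le> n\<close> show "ep m = 0" using \<open>1 \<le> m\<close>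
  proof (induction m rule: inc_induct)
    case (step m)
    then show ?case using ep_diff[of m] chain[of m] by simp
  qed (rule \<open>ep n = 0\<close>)
qed

lemma en_all: "(\<And>m. 1 \<le> m \<Longrightarrow> m < n \<Longrightarrow> chain m) \<Longrightarrow> en n = 0 \<Longrightarrow> 1 \<le> m \<Longrightarrow> m \<le> n \<Longrightarrow> en m = 0"
proof -
  assume chain: "\<And>m. 1 \<le> m \<Longrightarrow> m < n \<Longrightarrow> chain m" and "en n = 0" "1 \<le> m" "m \<le> n"
  from \<open>m \<le> n\<close> show "en m = 0" using \<open>1 \<le> m\<close>
  proof (induction m rule: inc_induct)
    case (step m)
    then show ?case using en_diff[of m] chain[of m] by simp
  qed (rule \<open>en n = 0\<close>)
qed

lemma chain_from_ep: "(\<And>m. 1 \<le> m \<Longrightarrow> m \<le> n \<Longrightarrow> ep m = 0) \<Longrightarrow> 1 \<le> m \<Longrightarrow> m < n \<Longrightarrow> chain m"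
  using ep_diff[of m] \<xi> by simp

text \<open>B says that the letter 0 is present. Neighbouring differences give the chain relations,
  the difference across the middle gives the relation at n or at 0, and then \<open>ep n\<close> is
  \<open>- (c - 1) * Q\<^sup>2 * (Y 1 + Z 1)\<close>. Conversely these relations make one equation
  hold and all others equal to it up to factors.\<close>

theorem solutions:
  assumes c: "Q\<^sup>2 * \<xi> = c * Q ^ (2 * n) * \<kappa> n"
    and middle: "\<not> B \<Longrightarrow> y = 0" "B \<Longrightarrow> \<kappa> n = Q" "B \<Longrightarrow> \<xi> = - (Q * Q ^ (2 * n))"
    and t: "\<not> B \<Longrightarrow> \<kappa> n = 1 \<longleftrightarrow> c * Q ^ (2 * n) = Q\<^sup>2 * \<xi>"
  shows "(\<forall>m. 1 \<le> m \<and> m \<le> n \<longrightarrow> ep m = 0 \<and> en m = 0) \<and> (B \<longrightarrow> e0 = 0) \<longleftrightarrow>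
    (\<forall>m. 1 \<le> m \<and> m < n \<longrightarrow> chain m) \<and> (\<not> B \<and> \<kappa> n \<noteq> 1 \<longrightarrow> Y n + Q\<^sup>2 * Z n = 0) \<and>
    (c \<noteq> 1 \<longrightarrow> Y 1 + Z 1 = 0) \<and> (B \<longrightarrow> (Q\<^sup>2 + Q) * y = Y n + Q\<^sup>2 * Z n)"
    (is "?L \<longleftrightarrow> ?R")
proof -
  have cB: "c = - (Q\<^sup>2)" if B
  proof -
    define P where "P = Q ^ (2 * n)"
    have "Q\<^sup>2 * (- (Q * P)) = c * P * Q" using c unfolding middle(2)[OF that] middle(3)[OF that] P_def .
    then have "c * (Q * P) = - (Q\<^sup>2) * (Q * P)" by (simp add: mult_ac)
    moreover have "Q * P \<noteq> 0" using Q by (simp add: P_def)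
    ultimately show ?thesis using mult_right_cancel[of "Q * P" c "- (Q\<^sup>2)"] by blast
  qed
  have base: "ep n = - (c - 1) * Q\<^sup>2 * (Y 1 + Z 1)"
    if "\<And>m. 1 \<le> m \<Longrightarrow> m < n \<Longrightarrow> chain m" "\<not> B \<and> \<kappa> n \<noteq> 1 \<longrightarrow> Y n + Q\<^sup>2 * Z n = 0"
      "B \<longrightarrow> (Q\<^sup>2 + Q) * y = Y n + Q\<^sup>2 * Z n"
  proof (cases B)
    case True
    have eq: "ep n = (c * Q ^ (2 * n) - Q\<^sup>2 * \<xi>) * ((Q\<^sup>2 + Q) * y) + Q\<^sup>2 * \<xi> * (Q\<^sup>2 - 1) * y - (c * Q\<^sup>2 - Q\<^sup>2) * (Y 1 + Z 1)"
      using ep_n[OF that(1) c] that(3) True by simp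
    have "(c * Q ^ (2 * n) - Q\<^sup>2 * \<xi>) * ((Q\<^sup>2 + Q) * y) + Q\<^sup>2 * \<xi> * (Q\<^sup>2 - 1) * y = 0"
      unfolding cB[OF True] middle(3)[OF True] by (simp add: algebra_simps power2_eq_square)
    then show ?thesis unfolding eq by (simp add: algebra_simps)
  next
    case False
    then have "(c * Q ^ (2 * n) - Q\<^sup>2 * \<xi>) * (Y n + Q\<^sup>2 * Z n) = 0" using that(2) t by auto
    then show ?thesis using ep_n[OF that(1) c] middle(1) False by (simp add: algebra_simps)
  qed
  show ?thesis
  proof
    assume L: ?L
    then have chain: "chain m" if "1 \<le> m" "m < n" for m using chain_from_ep that by blast
    have enn: "ep n = 0" "en n = 0" using L n by auto
    have g: "\<not> B \<and> \<kappa> n \<noteq> 1 \<longrightarrow> Y n + Q\<^sup>2 * Z n = 0" using mid_diff middle(1) enn \<xi> \<kappa>(1)[of n] by auto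
    have b: "B \<longrightarrow> (Q\<^sup>2 + Q) * y = Y n + Q\<^sup>2 * Z n" using mid_diff0(1) L enn \<xi> by auto
    have "c \<noteq> 1 \<longrightarrow> Y 1 + Z 1 = 0" using base[OF chain g b] enn Q by auto
    then show ?R using chain g b by blast
  next
    assume R: ?R
    then have chain: "chain m" if "1 \<le> m" "m < n" for m using that by blast
    have epn: "ep n = 0" using base[OF chain] R by auto
    have e0: "e0 = 0" if B using mid_diff0(1) epn R that by auto
    have "en n = 0"
    proof (cases B)
      case True
      then show ?thesis using mid_diff0(2) middle(2) e0 R by auto
    next
      case False
      then show ?thesis using mid_diff middle(1) epn R by (cases "\<kappa> n = 1") auto
    qed
    then show ?L using ep_all[OF chain epn] en_all[OF chain] e0 by blast
  qed
qed

end

section \<open>The kernel of the transposed R-matrix\<close>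

definition letter_scale :: "affine_type \<Rightarrow> nat \<Rightarrow> int \<Rightarrow> K" where
  "letter_scale tp n j = idx_sign tp n j * (- q tp) powi idx_bar tp n j"

lemma neg_q_nz: "- q tp \<noteq> 0" by simp

lemma qint_n_pos: "1 < n \<Longrightarrow> qint tp n n 2 > 0"
  using qfact_simps(5)[of n n tp] by simp

lemma idx_sign_nz: "1 < n \<Longrightarrow> idx_sign tp n j \<noteq> 0"
  using qint_n_pos[of n tp] by (auto simp: idx_sign_def)

lemma letter_scale_nz: "1 < n \<Longrightarrow> letter_scale tp n j \<noteq> 0"
  by (simp add: letter_scale_def idx_sign_nz)

lemma xi_nz: "1 - xi tp n * q tp ^ 2 \<noteq> 0"
proof -
  have p: "q tp ^ m * q tp ^ 2 > 1" if "m > 0" for m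
    using q_gt_1[of tp] that by (metis less_1_mult one_less_power zero_less_numeral)
  have "q tp ^ m * q tp ^ 2 > 0" for m using q_gt_1[of tp] by simp
  then have "1 + q tp ^ m * q tp ^ 2 > 0" for m by (simp add: add_pos_pos)
  then have "1 + q tp ^ m * q tp ^ 2 \<noteq> 0" for m by (metis less_irrefl)
  moreover have "1 - q tp ^ (2 * n + 2) * q tp ^ 2 \<noteq> 0" using p[of "2 * n + 2"] by auto
  ultimately show ?thesis by (cases tp) (simp_all add: xi_def)
qed

text \<open>In the coefficients of the R-matrix, signs and powers of -q enter through quotients of
  \<open>letter_scale\<close>. After rescaling coordinates and dividing by
  \<open>1 - q\<^sup>2\<close>, only the comparison of the two letters matters, except for opposite
  letters.\<close>

definition Rcf :: "affine_type \<Rightarrow> nat \<Rightarrow> int \<Rightarrow> int \<Rightarrow> K" where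
  "Rcf tp n i c = (let Q = q tp; \<xi> = xi tp n; r = letter_scale tp n i / letter_scale tp n c in
     if i = c then Q\<^sup>2 * (1 - \<xi>) + of_bool (i = 0) * (Q * (1 - \<xi> * Q\<^sup>2))
     else if prec n i c then (Q\<^sup>2 - 1) + of_bool (i = - c) * ((1 - \<xi> * Q\<^sup>2) * r)
     else Q\<^sup>2 * (\<xi> * (Q\<^sup>2 - 1) + of_bool (i = - c) * ((1 - \<xi> * Q\<^sup>2) * r)))"

lemma R_coeff_eq:
  assumes "1 < n"
  shows "R_coeff tp n (q tp ^ 2) i c
    = (1 - q tp ^ 2) * letter_scale tp n c * (Rcf tp n i c / letter_scale tp n i)"
proof -
  let ?s = "letter_scale tp n"
  have sc: "?s c \<noteq> 0" "?s i \<noteq> 0" using letter_scale_nz[OF assms] by auto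
  have ratio: "idx_sign tp n c * inverse (idx_sign tp n i) * (- q tp) powi (idx_bar tp n c - idx_bar tp n i) = ?s c / ?s i"
    by (simp add: letter_scale_def power_int_diff divide_inverse)
  show ?thesis
  proof (cases "i = c")
    case True
    then show ?thesis using sc
      by (simp add: R_coeff_def Rcf_def Let_def) (auto simp: algebra_simps power2_eq_square)
  next
    case False
    have 1: "idx_sign tp n c * inverse (idx_sign tp n i) * (- q tp) powi (idx_bar tp n c - idx_bar tp n i) * (q tp ^ 2 - 1)
      = ?s c / ?s i * (q tp ^ 2 - 1)"
      "idx_sign tp n c * inverse (idx_sign tp n i) * xi tp n * (- q tp) powi (idx_bar tp n c - idx_bar tp n i) * (q tp ^ 2 - 1)
      = ?s c / ?s i * (xi tp n * (q tp ^ 2 - 1))"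
      using ratio by (simp_all add: mult.assoc mult.left_commute mult.commute[of _ "xi tp n"]) 
    show ?thesis
      using False sc unfolding R_coeff_def Rcf_def Let_def 1 by (simp add: field_simps)
  qed
qed

text \<open>The pairing of x with the image of the tensor of the basis vectors at c and d; x is
  orthogonal to W if all these vanish.\<close>

definition dual_R :: "affine_type \<Rightarrow> nat \<Rightarrow> (int \<Rightarrow> int \<Rightarrow> K) \<Rightarrow> int \<Rightarrow> int \<Rightarrow> K" where
  "dual_R tp n x c d = (\<Sum>a\<in>idx tp n. \<Sum>b\<in>idx tp n. lg tp a * lg tp b * R_matrix tp n (q tp ^ 2) a b c d * x a b)"

lemma sum_EE_pairs:
  assumes J: "finite J" and P: "P \<subseteq> J \<times> J" and f: "\<And>i j. (i, j) \<in> P \<Longrightarrow> f i j \<in> J \<and> g i j \<in> J"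
  shows "(\<Sum>a\<in>J. \<Sum>b\<in>J. h a b * (\<Sum>(i, j)\<in>P. k i j * (EE (f i j) (f' i j) a c * EE (g i j) (g' i j) b d)))
    = (\<Sum>(i, j)\<in>P. if f' i j = c \<and> g' i j = d then k i j * h (f i j) (g i j) else 0)"
proof -
  have "(\<Sum>a\<in>J. \<Sum>b\<in>J. h a b * (\<Sum>(i, j)\<in>P. k i j * (EE (f i j) (f' i j) a c * EE (g i j) (g' i j) b d)))
    = (\<Sum>a\<in>J. \<Sum>b\<in>J. \<Sum>p\<in>P. (case p of (i, j) \<Rightarrow> h a b * (k i j * (EE (f i j) (f' i j) a c * EE (g i j) (g' i j) b d))))"
    by (simp add: sum_distrib_left case_prod_unfold)
  also have "\<dots> = (\<Sum>p\<in>P. \<Sum>a\<in>J. \<Sum>b\<in>J. (case p of (i, j) \<Rightarrow> h a b * (k i j * (EE (f i j) (f' i j) a c * EE (g i j) (g' i j) b d))))"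
    by (subst (2) sum.swap) (subst sum.swap, rule refl)
  also have "\<dots> = (\<Sum>(i, j)\<in>P. if f' i j = c \<and> g' i j = d then k i j * h (f i j) (g i j) else 0)"
  proof (rule sum.cong[OF refl], clarify)
    fix i j assume ij: "(i, j) \<in> P"
    have "(\<Sum>a\<in>J. \<Sum>b\<in>J. h a b * (k i j * (EE (f i j) (f' i j) a c * EE (g i j) (g' i j) b d)))
      = (\<Sum>a\<in>J. if a = f i j then (\<Sum>b\<in>J. if b = g i j then (if f' i j = c \<and> g' i j = d then k i j * h a b else 0) else 0) else 0)"
      by (intro sum.cong refl) (auto simp: EE_def intro!: sum.neutral sum.cong)
    also have "\<dots> = (if f' i j = c \<and> g' i j = d then k i j * h (f i j) (g i j) else 0)"
      using f[OF ij] J by simp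
    finally show "(\<Sum>a\<in>J. \<Sum>b\<in>J. h a b * (k i j * (EE (f i j) (f' i j) a c * EE (g i j) (g' i j) b d)))
      = (if f' i j = c \<and> g' i j = d then k i j * h (f i j) (g i j) else 0)" .
  qed
  finally show ?thesis .
qed

lemma sum_pair_single:
  assumes "finite P"
  shows "(\<Sum>(i, j)\<in>P. if i = c \<and> j = d then h i j else 0) = (if (c, d) \<in> P then h c d else 0)"
proof -
  have "(\<Sum>(i, j)\<in>P. if i = c \<and> j = d then h i j else 0) = (\<Sum>p\<in>P. if p = (c, d) then h c d else 0)"
    by (intro sum.cong) (auto split: if_splits)
  then show ?thesis using assms by simp
qed

lemma dual_R_eq:
  assumes c: "c \<in> idx tp n" and d: "d \<in> idx tp n"
  defines "Q \<equiv> q tp" and "\<xi> \<equiv> xi tp n"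
  shows "dual_R tp n x c d =
    (1 - Q\<^sup>2 * Q\<^sup>2) * (1 - \<xi> * Q\<^sup>2) * (if c = d \<and> c \<noteq> 0 then x c c else 0)
    + Q * (1 - Q\<^sup>2) * (1 - \<xi> * Q\<^sup>2) * (if c \<noteq> d \<and> c \<noteq> - d then lg tp d * lg tp c * x d c else 0)
    + (1 - Q\<^sup>2) * (1 - \<xi> * Q\<^sup>2) * ((if prec n d c \<and> c \<noteq> - d then lg tp c * lg tp d * x c d else 0)
       + Q\<^sup>2 * (if prec n c d \<and> c \<noteq> - d then lg tp c * lg tp d * x c d else 0))
    + (if d = - c then (\<Sum>i\<in>idx tp n. R_coeff tp n (Q\<^sup>2) i c * (lg tp i * lg tp i * x (- i) i)) else 0)"
proof -
  let ?J = "idx tp n"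
  let ?h = "\<lambda>a b. lg tp a * lg tp b * x a b"
  let ?S = "\<lambda>m. \<Sum>a\<in>?J. \<Sum>b\<in>?J. ?h a b * m a b"
  let ?P2 = "{(i, j) \<in> ?J \<times> ?J. i \<noteq> j \<and> i \<noteq> - j}" and ?P3 = "{(i, j) \<in> ?J \<times> ?J. prec n j i \<and> i \<noteq> - j}"
    and ?P4 = "{(i, j) \<in> ?J \<times> ?J. prec n i j \<and> i \<noteq> - j}"
  have fin: "finite {(i, j) \<in> ?J \<times> ?J. Pr i j}" for Pr
    by (rule finite_subset[of _ "?J \<times> ?J"]) auto
  have t1: "?S (\<lambda>a b. \<Sum>i\<in>?J - {0}. EE i i a c * EE i i b d) = (if c = d \<and> c \<noteq> 0 then x c c else 0)"
  proof -
    have "?S (\<lambda>a b. \<Sum>i\<in>?J - {0}. EE i i a c * EE i i b d)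
      = ?S (\<lambda>a b. \<Sum>(i, j)\<in>{(i, j) \<in> ?J \<times> ?J. i = j \<and> i \<noteq> 0}. 1 * (EE i i a c * EE i i b d))"
    proof -
      have "{(i, j) \<in> ?J \<times> ?J. i = j \<and> i \<noteq> 0} = (\<lambda>i. (i, i)) ` (?J - {0})" by auto
      then show ?thesis by (simp add: sum.reindex inj_on_def)
    qed
    also have "\<dots> = (\<Sum>(i, j)\<in>{(i, j) \<in> ?J \<times> ?J. i = j \<and> i \<noteq> 0}. if i = c \<and> i = d then 1 * ?h i i else 0)"
      by (rule sum_EE_pairs) auto
    also have "\<dots> = (\<Sum>(i, j)\<in>{(i, j) \<in> ?J \<times> ?J. i = j \<and> i \<noteq> 0}. if i = c \<and> j = d then ?h i j else 0)"
      by (intro sum.cong) auto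
    also have "\<dots> = (if c = d \<and> c \<noteq> 0 then x c c else 0)"
      unfolding sum_pair_single[OF fin] using c d by (auto simp: lg_def)
    finally show ?thesis .
  qed
  have t2: "?S (\<lambda>a b. \<Sum>(i, j)\<in>?P2. EE i j a c * EE j i b d) = (if c \<noteq> d \<and> c \<noteq> - d then ?h d c else 0)"
  proof -
    have "?S (\<lambda>a b. \<Sum>(i, j)\<in>?P2. 1 * (EE i j a c * EE j i b d)) = (\<Sum>(i, j)\<in>?P2. if j = c \<and> i = d then 1 * ?h i j else 0)"
      by (rule sum_EE_pairs) auto
    also have "\<dots> = (\<Sum>(i, j)\<in>?P2. if i = d \<and> j = c then ?h i j else 0)" by (intro sum.cong) auto
    finally show ?thesis unfolding sum_pair_single[OF fin] using c d by (auto split: if_splits)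
  qed
  have t3: "?S (\<lambda>a b. \<Sum>(i, j)\<in>{(i, j) \<in> ?J \<times> ?J. Pr i j}. EE i i a c * EE j j b d) = (if Pr c d then ?h c d else 0)" for Pr
  proof -
    have "?S (\<lambda>a b. \<Sum>(i, j)\<in>{(i, j) \<in> ?J \<times> ?J. Pr i j}. 1 * (EE i i a c * EE j j b d))
      = (\<Sum>(i, j)\<in>{(i, j) \<in> ?J \<times> ?J. Pr i j}. if i = c \<and> j = d then 1 * ?h i j else 0)"
      by (rule sum_EE_pairs) auto
    then show ?thesis using c d unfolding sum_pair_single[OF fin] by auto
  qed
  have t5: "?S (\<lambda>a b. \<Sum>(i, j)\<in>?J \<times> ?J. R_coeff tp n (Q\<^sup>2) i j * (EE (- i) j a c * EE i (- j) b d))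
    = (if d = - c then (\<Sum>i\<in>?J. R_coeff tp n (Q\<^sup>2) i c * (lg tp i * lg tp i * x (- i) i)) else 0)"
  proof -
    have "?S (\<lambda>a b. \<Sum>(i, j)\<in>?J \<times> ?J. R_coeff tp n (Q\<^sup>2) i j * (EE (- i) j a c * EE i (- j) b d))
      = (\<Sum>(i, j)\<in>?J \<times> ?J. if j = c \<and> - j = d then R_coeff tp n (Q\<^sup>2) i j * ?h (- i) i else 0)"
      by (rule sum_EE_pairs) (auto simp: idx_iff)
    also have "\<dots> = (\<Sum>i\<in>?J. \<Sum>j\<in>?J. if j = c then (if d = - c then R_coeff tp n (Q\<^sup>2) i c * ?h (- i) i else 0) else 0)"
      by (subst sum.cartesian_product[symmetric]) (intro sum.cong, auto)
    also have "\<dots> = (if d = - c then (\<Sum>i\<in>?J. R_coeff tp n (Q\<^sup>2) i c * ?h (- i) i) else 0)"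
      using c by simp
    finally show ?thesis by (simp add: lg_def if_distrib cong: if_cong)
  qed
  have "dual_R tp n x c d = ?S (\<lambda>a b. R_matrix tp n (Q\<^sup>2) a b c d)"
    unfolding dual_R_def Q_def by (intro sum.cong refl) (simp add: mult_ac)
  also have "\<dots> = (1 - Q\<^sup>2 * Q\<^sup>2) * (1 - \<xi> * Q\<^sup>2) * ?S (\<lambda>a b. \<Sum>i\<in>?J - {0}. EE i i a c * EE i i b d)
      + Q * (1 - Q\<^sup>2) * (1 - \<xi> * Q\<^sup>2) * ?S (\<lambda>a b. \<Sum>(i, j)\<in>?P2. EE i j a c * EE j i b d)
      + (1 - Q\<^sup>2) * (1 - \<xi> * Q\<^sup>2) * (?S (\<lambda>a b. \<Sum>(i, j)\<in>?P3. EE i i a c * EE j j b d)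
          + Q\<^sup>2 * ?S (\<lambda>a b. \<Sum>(i, j)\<in>?P4. EE i i a c * EE j j b d))
      + ?S (\<lambda>a b. \<Sum>(i, j)\<in>?J \<times> ?J. R_coeff tp n (Q\<^sup>2) i j * (EE (- i) j a c * EE i (- j) b d))"
    unfolding R_matrix_def Let_def Q_def[symmetric] \<xi>_def[symmetric] sum_distrib_left[of "_ :: K" "\<lambda>a. \<Sum>b\<in>?J. _ a b" ?J]
      sum.distrib[symmetric]
    by (simp add: sum_distrib_left[of _ _ ?J] sum.distrib distrib_left mult.left_commute)
  finally show ?thesis unfolding t1 t2 t3 t5 by simp
qed

text \<open>For distinct c, d that are not opposite, the columns (c,d) and (d,c) give the same
  equation, q-antisymmetry; the column (c,c) gives vanishing for nonzero c. The columns (c,-c) form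
  the zero weight system.\<close>

lemma dual_R_anti:
  assumes n1: "1 < n"
  shows "(\<forall>c\<in>idx tp n. \<forall>d\<in>idx tp n. dual_R tp n x c d = 0) \<longleftrightarrow> anti tp n x"
proof -
  define Q where "Q = q tp"
  define \<xi> where "\<xi> = xi tp n"
  define s where "s = letter_scale tp n"
  define Y where "Y j = x (- int j) (int j) / s (int j)" for j
  define Z where "Z j = x (int j) (- int j) / s (int j)" for j
  define \<kappa> where "\<kappa> j = s (- int j) / s (int j)" for j
  define B where "B \<longleftrightarrow> tp = A2_even"
  \<comment> \<open>The factor \<open>(1 + Q)\<^sup>2\<close> is the square of
    \<open>lg tp 0\<close>, so that y is the normalized coordinate \<open>yv 0\<close>.\<close>
  define y where "y = (if B then (1 + Q)\<^sup>2 * x 0 0 / s 0 else 0)"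
  have neg_ne: "- a \<noteq> b" if "a > 0" "b > 0" for a b :: K
  proof
    assume "- a = b"
    then have "a + b = 0" by (auto simp: add_eq_0_iff)
    then show False using add_pos_pos[OF that] by simp
  qed
  define yv where "yv i = lg tp i * lg tp i * x (- i) i / s i" for i
  have Q1: "Q > 1" using q_gt_1 by (simp add: Q_def)
  then have Q0: "Q \<noteq> 0" by auto
  have Qq: "1 - Q\<^sup>2 \<noteq> 0" using one_less_power[OF Q1, of 2] by auto
  have Qq4: "1 - Q\<^sup>2 * Q\<^sup>2 \<noteq> 0" using one_less_power[OF Q1, of 4] by (auto simp flip: power_add)
  have xi0: "1 - \<xi> * Q\<^sup>2 \<noteq> 0" using xi_nz by (simp add: Q_def \<xi>_def)
  have s0: "s j \<noteq> 0" for j using letter_scale_nz[OF n1] by (simp add: s_def)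
  have sp: "s (int j) = (- Q) ^ j" if "1 \<le> j" for j
    using that by (simp add: s_def letter_scale_def idx_sign_def idx_bar_def Q_def power_int_of_nat)
  have sn: "s (- int j) = (if tp = A2_odd_dagger then 1 else - 1) * (- Q) powi (shift_N tp n - int j)" if "1 \<le> j" for j
    using that by (simp add: s_def letter_scale_def idx_sign_def idx_bar_def Q_def add.commute)
  have \<kappa>_eq: "\<kappa> j = (if tp = A2_odd_dagger then 1 else - 1) * (- Q) powi (shift_N tp n - 2 * int j)" if "1 \<le> j" for j
  proof -
    have "(- Q) powi (shift_N tp n - int j) / (- Q) ^ j = (- Q) powi (shift_N tp n - int j - int j)"
      using Q0 by (subst power_int_diff[of "- Q" _ "int j"]) (simp_all add: power_int_of_nat)
    also have "shift_N tp n - int j - int j = shift_N tp n - 2 * int j" by simp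
    finally show ?thesis unfolding \<kappa>_def sp[OF that] sn[OF that] by (simp only: times_divide_eq_right[symmetric])
  qed
  have \<kappa>n: "\<kappa> n = (case tp of A2_even \<Rightarrow> Q | A2_odd_dagger \<Rightarrow> 1 | _ \<Rightarrow> - (Q\<^sup>2))"
    using \<kappa>_eq[of n] n1 by (cases tp) (simp_all add: shift_N_def power_int_numeral)
  have \<kappa>S: "\<kappa> j = Q\<^sup>2 * \<kappa> (Suc j)" if "1 \<le> j" for j
  proof -
    have "(- Q) powi (shift_N tp n - 2 * int j) = (- Q) powi (2 + (shift_N tp n - 2 * int (Suc j)))" by simp
    also have "\<dots> = Q\<^sup>2 * (- Q) powi (shift_N tp n - 2 * int (Suc j))"
      using Q0 by (subst power_int_add) (simp_all add: power_int_numeral)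
    finally show ?thesis using that by (simp add: \<kappa>_eq)
  qed
  interpret zero_weight_system n Q \<xi> y Y Z \<kappa>
    using n1 Q0 xi0 s0 \<kappa>S by unfold_locales (auto simp: \<kappa>_def)
  have yv: "yv (int j) = Y j" "yv (- int j) = V j" if "1 \<le> j" for j
    using that s0 by (auto simp: yv_def Y_def V_def Z_def \<kappa>_def lg_def)
  have yv0: "(if tp = A2_even then k * yv 0 else 0) = k * y" for k
    by (simp add: y_def B_def yv_def lg_def Q_def power2_eq_square)
  have pr: "prec n (int j) (int m) \<longleftrightarrow> j < m" "prec n (int j) (- int m)" "\<not> prec n (- int m) (int j)"
    "prec n (- int j) (- int m) \<longleftrightarrow> m < j" "prec n (int j) 0" "\<not> prec n 0 (int j)" "prec n 0 (- int j)" "\<not> prec n (- int j) 0"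
    if "1 \<le> j" "j \<le> n" "1 \<le> m" "m \<le> n" for j m
    using that by (auto simp: prec_def idx_pos_def)
  have split: "(\<Sum>j\<in>{1..n}. h j) = (\<Sum>j\<in>{1..<m}. h j) + h m + (\<Sum>j\<in>{m<..n}. h j)" if "1 \<le> m" "m \<le> n" for h :: "nat \<Rightarrow> K" and m
    by (rule sum_split_at) (use that in simp)
  have sum_ep: "(\<Sum>i\<in>idx tp n. Rcf tp n i (int m) * yv i) = ep m" if m: "1 \<le> m" "m \<le> n" for m
  proof -
    have 1: "(\<Sum>j\<in>{1..n}. Rcf tp n (int j) (int m) * yv (int j))
      = (Q\<^sup>2 - 1) * (\<Sum>j\<in>{1..<m}. Y j) + Q\<^sup>2 * (1 - \<xi>) * Y m + Q\<^sup>2 * \<xi> * (Q\<^sup>2 - 1) * (\<Sum>j\<in>{m<..n}. Y j)"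
      unfolding split[OF m] sum_distrib_left using m
      by (intro arg_cong2[where f = "(+)"] sum.cong)
        (auto simp: Rcf_def Let_def pr yv Q_def[symmetric] \<xi>_def[symmetric])
    have 2: "(\<Sum>j\<in>{1..n}. Rcf tp n (- int j) (int m) * yv (- int j))
      = Q\<^sup>2 * \<xi> * (Q\<^sup>2 - 1) * (\<Sum>j\<in>{1..n}. V j) + Q\<^sup>2 * (1 - \<xi> * Q\<^sup>2) * Z m"
    proof -
      have "(\<Sum>j\<in>{1..n}. Rcf tp n (- int j) (int m) * yv (- int j))
        = (\<Sum>j\<in>{1..n}. Q\<^sup>2 * \<xi> * (Q\<^sup>2 - 1) * V j + (if j = m then Q\<^sup>2 * (1 - \<xi> * Q\<^sup>2) * Z m else 0))"
        using m s0 by (intro sum.cong)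
          (auto simp: Rcf_def Let_def pr yv Q_def[symmetric] \<xi>_def[symmetric] s_def[symmetric] V_def \<kappa>_def algebra_simps)
      then show ?thesis using m by (simp add: sum.distrib sum_distrib_left)
    qed
    have 3: "Rcf tp n 0 (int m) = Q\<^sup>2 * \<xi> * (Q\<^sup>2 - 1)"
      using m by (simp add: Rcf_def Let_def pr Q_def[symmetric] \<xi>_def[symmetric])
    show ?thesis unfolding sum_idx 1 2 3 yv0 ep_def by (simp add: algebra_simps)
  qed
  have sum_en: "(\<Sum>i\<in>idx tp n. Rcf tp n i (- int m) * yv i) = en m" if m: "1 \<le> m" "m \<le> n" for m
  proof -
    have 1: "(\<Sum>j\<in>{1..n}. Rcf tp n (int j) (- int m) * yv (int j))
      = (Q\<^sup>2 - 1) * (\<Sum>j\<in>{1..n}. Y j) + (1 - \<xi> * Q\<^sup>2) * (Y m / \<kappa> m)"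
    proof -
      have "(\<Sum>j\<in>{1..n}. Rcf tp n (int j) (- int m) * yv (int j))
        = (\<Sum>j\<in>{1..n}. (Q\<^sup>2 - 1) * Y j + (if j = m then (1 - \<xi> * Q\<^sup>2) * (Y m / \<kappa> m) else 0))"
        using m s0 by (intro sum.cong)
          (auto simp: Rcf_def Let_def pr yv Q_def[symmetric] \<xi>_def[symmetric] s_def[symmetric] \<kappa>_def algebra_simps diff_divide_distrib)
      then show ?thesis using m by (simp add: sum.distrib sum_distrib_left)
    qed
    have 2: "(\<Sum>j\<in>{1..n}. Rcf tp n (- int j) (- int m) * yv (- int j))
      = Q\<^sup>2 * \<xi> * (Q\<^sup>2 - 1) * (\<Sum>j\<in>{1..<m}. V j) + Q\<^sup>2 * (1 - \<xi>) * V m + (Q\<^sup>2 - 1) * (\<Sum>j\<in>{m<..n}. V j)"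
      unfolding split[OF m] sum_distrib_left using m
      by (intro arg_cong2[where f = "(+)"] sum.cong)
        (auto simp: Rcf_def Let_def pr yv Q_def[symmetric] \<xi>_def[symmetric])
    have 3: "Rcf tp n 0 (- int m) = Q\<^sup>2 - 1"
      using m by (simp add: Rcf_def Let_def pr Q_def[symmetric] \<xi>_def[symmetric])
    show ?thesis unfolding sum_idx 1 2 3 yv0 en_def by (simp add: algebra_simps)
  qed
  have sum_e0: "(\<Sum>i\<in>idx tp n. Rcf tp n i 0 * yv i) = e0"
  proof -
    have 1: "(\<Sum>j\<in>{1..n}. Rcf tp n (int j) 0 * yv (int j)) = (Q\<^sup>2 - 1) * (\<Sum>j\<in>{1..n}. Y j)"
      unfolding sum_distrib_left using n1
      by (intro sum.cong) (auto simp: Rcf_def Let_def pr yv Q_def[symmetric] \<xi>_def[symmetric])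
    have 2: "(\<Sum>j\<in>{1..n}. Rcf tp n (- int j) 0 * yv (- int j)) = Q\<^sup>2 * \<xi> * (Q\<^sup>2 - 1) * (\<Sum>j\<in>{1..n}. V j)"
      unfolding sum_distrib_left using n1
      by (intro sum.cong) (auto simp: Rcf_def Let_def pr yv Q_def[symmetric] \<xi>_def[symmetric])
    have 3: "Rcf tp n 0 0 = Q\<^sup>2 * (1 - \<xi>) + Q * (1 - \<xi> * Q\<^sup>2)"
      by (simp add: Rcf_def Let_def Q_def \<xi>_def)
    show ?thesis unfolding sum_idx 1 2 3 yv0 e0_def by simp
  qed
  have opp: "dual_R tp n x c (- c) = (1 - Q\<^sup>2) * s c * (\<Sum>i\<in>idx tp n. Rcf tp n i c * yv i)" if c: "c \<in> idx tp n" for c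
  proof -
    have c': "- c \<in> idx tp n" using c by (simp add: idx_iff)
    have "dual_R tp n x c (- c) = (\<Sum>i\<in>idx tp n. R_coeff tp n (Q\<^sup>2) i c * (lg tp i * lg tp i * x (- i) i))"
      unfolding dual_R_eq[OF c c'] by (auto simp: Q_def)
    also have "\<dots> = (\<Sum>i\<in>idx tp n. (1 - Q\<^sup>2) * s c * (Rcf tp n i c * yv i))"
      unfolding Q_def R_coeff_eq[OF n1] by (intro sum.cong) (simp_all add: yv_def s_def)
    finally show ?thesis by (simp add: sum_distrib_left)
  qed
  have opp_iff: "(\<forall>c\<in>idx tp n. dual_R tp n x c (- c) = 0) \<longleftrightarrow>
    (\<forall>m. 1 \<le> m \<and> m \<le> n \<longrightarrow> ep m = 0 \<and> en m = 0) \<and> (B \<longrightarrow> e0 = 0)" (is "?L \<longleftrightarrow> ?R")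
  proof
    assume L: ?L
    have nz: "(\<Sum>i\<in>idx tp n. Rcf tp n i c * yv i) = 0" if "c \<in> idx tp n" for c
      using opp[OF that] L that Qq s0[of c] by auto
    show ?R using nz sum_ep sum_en sum_e0 n1 by (auto simp: idx_iff B_def)
  next
    assume R: ?R
    have "(\<Sum>i\<in>idx tp n. Rcf tp n i c * yv i) = 0" if cJ: "c \<in> idx tp n" for c
    proof -
      consider "c > 0" | "c = 0" "B" | "c < 0"
        using cJ by (cases c "0::int" rule: linorder_cases) (auto simp: idx_iff B_def)
      then show ?thesis
      proof cases
        case 1
        then show ?thesis using sum_ep[of "nat c"] R cJ by (auto simp: idx_iff)
      next
        case 2
        then show ?thesis using sum_e0 R by simp
      next
        case 3
        then show ?thesis using sum_en[of "nat (- c)"] R cJ by (auto simp: idx_iff)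
      qed
    qed
    then show ?L using opp by simp
  qed
  \<comment> \<open>The solution of \<open>Q\<^sup>2 * \<xi> = c * Q ^ (2 * n) * \<kappa> n\<close>.
    In type \<open>A2_odd\<close> both \<xi> and \<open>\<kappa> n\<close> carry a sign and the
    powers cancel to 1; in each other type exactly one of the two is negative.\<close>
  define c where "c = (if tp = A2_odd then 1 else - (Q\<^sup>2))"
  have QP: "Q ^ (2 * n) > 0" "Q ^ (2 * n) * Q\<^sup>2 > 0" "Q ^ (2 * n) * (Q\<^sup>2 * Q\<^sup>2) > 0" using Q1 by simp_all
  have c_eq: "Q\<^sup>2 * \<xi> = c * Q ^ (2 * n) * \<kappa> n"
    unfolding \<kappa>n c_def \<xi>_def xi_def Q_def[symmetric] by (cases tp) (simp_all add: power_add power2_eq_square)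
  have c1: "c \<noteq> 1 \<longleftrightarrow> tp \<noteq> A2_odd"
    using neg_ne[of "Q\<^sup>2" 1] Q1 by (simp add: c_def)
  have t: "\<kappa> n = 1 \<longleftrightarrow> c * Q ^ (2 * n) = Q\<^sup>2 * \<xi>" if "\<not> B"
  proof -
    have "- (Q\<^sup>2) \<noteq> 1" using neg_ne[of "Q\<^sup>2" 1] Q1 by simp
    moreover have "Q ^ (2 * n) \<noteq> - (Q ^ (2 * n) * Q\<^sup>2)" using neg_ne[OF QP(2,1)] by (rule not_sym)
    moreover have "- (Q ^ (2 * n) * Q\<^sup>2) \<noteq> Q ^ (2 * n) * (Q\<^sup>2 * Q\<^sup>2)" using neg_ne[OF QP(2,3)] .
    ultimately show ?thesis using that unfolding \<kappa>n c_def \<xi>_def xi_def Q_def[symmetric] B_def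
      by (cases tp) (simp_all add: power_add mult_ac power2_eq_square power4_eq_xxxx)
  qed
  have sol: "(\<forall>c\<in>idx tp n. dual_R tp n x c (- c) = 0) \<longleftrightarrow>
    (\<forall>m. 1 \<le> m \<and> m < n \<longrightarrow> Y m + Q\<^sup>2 * Z m = Q\<^sup>2 * (Y (Suc m) + Z (Suc m))) \<and>
    (\<not> B \<and> \<kappa> n \<noteq> 1 \<longrightarrow> Y n + Q\<^sup>2 * Z n = 0) \<and>
    (tp \<noteq> A2_odd \<longrightarrow> Y 1 + Z 1 = 0) \<and> (B \<longrightarrow> (Q\<^sup>2 + Q) * y = Y n + Q\<^sup>2 * Z n)"
    unfolding opp_iff c1[symmetric]
    by (rule solutions[OF c_eq _ _ _ t]) (auto simp: y_def B_def \<kappa>n \<xi>_def xi_def Q_def power_add)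
  have chain_iff: "Y m + Q\<^sup>2 * Z m = Q\<^sup>2 * (Y (Suc m) + Z (Suc m)) \<longleftrightarrow>
    x (- int m) (int m) + Q\<^sup>2 * x (int m) (- int m)
      = - Q * (x (- int m - 1) (int m + 1) + x (int m + 1) (- int m - 1))" if "1 \<le> m" for m
  proof -
    have e: "- int (Suc m) = - int m - 1" "int (Suc m) = int m + 1" by simp_all
    have Sm: "s (int m + 1) = - Q * (- Q) ^ m" using sp[of "Suc m"] unfolding e by simp
    have "Y m + Q\<^sup>2 * Z m = (x (- int m) (int m) + Q\<^sup>2 * x (int m) (- int m)) / (- Q) ^ m"
      using that by (simp add: Y_def Z_def sp add_divide_distrib)
    moreover have "Q\<^sup>2 * (Y (Suc m) + Z (Suc m)) = (- Q * (x (- int m - 1) (int m + 1) + x (int m + 1) (- int m - 1))) / (- Q) ^ m"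
    proof -
      have "Q\<^sup>2 * (u / (- Q * (- Q) ^ m) + v / (- Q * (- Q) ^ m)) = (- Q * (u + v)) / (- Q) ^ m" for u v
        using Q0 by (simp add: field_simps power2_eq_square)
      moreover have "- (int m + 1) = - int m - 1" by simp
      ultimately show ?thesis unfolding Y_def Z_def e Sm by metis
    qed
    ultimately show ?thesis using Q0 by (simp only: divide_cancel_right) simp
  qed
  have gn_iff: "Y n + Q\<^sup>2 * Z n = 0 \<longleftrightarrow> x (- int n) (int n) + Q\<^sup>2 * x (int n) (- int n) = 0"
    using s0[of "int n"] by (simp add: Y_def Z_def flip: add_divide_distrib)
  have h1_iff: "Y 1 + Z 1 = 0 \<longleftrightarrow> x (- 1) 1 + x 1 (- 1) = 0"
    using s0[of 1] by (simp add: Y_def Z_def flip: add_divide_distrib)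
  have B_iff: "(Q\<^sup>2 + Q) * y = Y n + Q\<^sup>2 * Z n \<longleftrightarrow>
      (1 + Q)\<^sup>2 * indet * x 0 0 = - (x (- int n) (int n) + Q\<^sup>2 * x (int n) (- int n))" if B
  proof -
    have tp: "tp = A2_even" using that by (simp add: B_def)
    define t where "t = qint tp n n 2"
    define h where "h = indet"
    have h: "h \<noteq> 0" "h * h = Q" by (simp_all add: h_def Q_def q_def tp power2_eq_square)
    have t: "t * h = 1 + Q"
      using qint_2[of n n tp] n1 h by (simp add: t_def tp q_i_eq h_def[symmetric] distrib_right)
    have Q1': "1 + Q \<noteq> 0" using neg_ne[of 1 Q] Q1 by (auto simp: add_eq_0_iff)
    then have t0: "t \<noteq> 0" using t by auto
    have s00: "s 0 = t * ((- Q) * (- Q) ^ n)"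
    proof -
      have "idx_sign tp n 0 = t" by (simp add: idx_sign_def tp t_def)
      moreover have "idx_bar tp n 0 = int (Suc n)" by (simp add: idx_bar_def)
      ultimately show ?thesis
        by (simp only: s_def letter_scale_def Q_def[symmetric] power_int_of_nat power_Suc)
    qed
    have "(Q\<^sup>2 + Q) * y = - ((1 + Q)\<^sup>2 * (1 + Q) / t * x 0 0) / (- Q) ^ n"
      using that Q0 t0 by (simp add: y_def s00 field_simps power2_eq_square)
    also have "(1 + Q)\<^sup>2 * (1 + Q) / t = (1 + Q)\<^sup>2 * h"
    proof -
      have "(1 + Q) / t = h" using t t0 by (simp flip: t)
      then show ?thesis by (metis times_divide_eq_right)
    qed
    finally have 1: "(Q\<^sup>2 + Q) * y = - ((1 + Q)\<^sup>2 * h * x 0 0) / (- Q) ^ n" .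
    have 2: "Y n + Q\<^sup>2 * Z n = (x (- int n) (int n) + Q\<^sup>2 * x (int n) (- int n)) / (- Q) ^ n"
      using n1 by (simp add: Y_def Z_def sp add_divide_distrib)
    have "(- u) / c = v / c \<longleftrightarrow> u = - v" if "c \<noteq> 0" for u v c :: K
      using that by (simp only: divide_cancel_right) auto
    then show ?thesis unfolding 1 2 h_def[symmetric] using Q0 by simp
  qed
  have chains: "(\<forall>m. 1 \<le> m \<and> m < n \<longrightarrow> Y m + Q\<^sup>2 * Z m = Q\<^sup>2 * (Y (Suc m) + Z (Suc m))) \<longleftrightarrow>
    (\<forall>j. 1 \<le> j \<and> j < int n \<longrightarrow> x (- j) j + Q\<^sup>2 * x j (- j) = - Q * (x (- j - 1) (j + 1) + x (j + 1) (- j - 1)))"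
    (is "?L \<longleftrightarrow> ?R")
  proof
    assume L: ?L
    show ?R
    proof (intro allI impI)
      fix j assume j: "1 \<le> j \<and> j < int n"
      then have "1 \<le> nat j" "nat j < n" "int (nat j) = j" by auto
      then show "x (- j) j + Q\<^sup>2 * x j (- j) = - Q * (x (- j - 1) (j + 1) + x (j + 1) (- j - 1))"
        using L chain_iff[of "nat j"] by metis
    qed
  qed (use chain_iff in force)
  have rest: "(\<forall>c\<in>idx tp n. \<forall>d\<in>idx tp n. c \<noteq> - d \<longrightarrow> dual_R tp n x c d = 0) \<longleftrightarrow>
    (\<forall>c\<in>idx tp n. c \<noteq> 0 \<longrightarrow> x c c = 0) \<and>
    (\<forall>c\<in>idx tp n. \<forall>d\<in>idx tp n. prec n c d \<and> c \<noteq> - d \<longrightarrow> x d c = - Q * x c d)" (is "?L \<longleftrightarrow> ?R")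
  proof -
    have diag: "dual_R tp n x c c = 0 \<longleftrightarrow> x c c = 0" if "c \<in> idx tp n" "c \<noteq> 0" for c
      unfolding dual_R_eq[OF that(1) that(1)] Q_def[symmetric] \<xi>_def[symmetric]
      using that(2) Qq4 xi0 by (auto simp: prec_def)
    have lgn: "lg tp a \<noteq> 0" for a using lg_pos[of tp a] by auto
    have up: "dual_R tp n x c d = 0 \<longleftrightarrow> x d c = - Q * x c d" if "c \<in> idx tp n" "d \<in> idx tp n" "prec n c d" "c \<noteq> - d" for c d
    proof -
      have ne: "c \<noteq> d" "\<not> prec n d c" "d \<noteq> - c" using that(3,4) by (auto simp: prec_def)
      have "dual_R tp n x c d = Q * (1 - Q\<^sup>2) * (1 - \<xi> * Q\<^sup>2) * (lg tp c * lg tp d) * (x d c + Q * x c d)"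
        unfolding dual_R_eq[OF that(1,2)] Q_def[symmetric] \<xi>_def[symmetric]
        using ne that by (simp add: algebra_simps power2_eq_square)
      then show ?thesis using Q0 Qq xi0 lgn by (simp add: eq_neg_iff_add_eq_0)
    qed
    have down: "dual_R tp n x d c = 0 \<longleftrightarrow> x d c = - Q * x c d" if "c \<in> idx tp n" "d \<in> idx tp n" "prec n c d" "c \<noteq> - d" for c d
    proof -
      have ne: "c \<noteq> d" "\<not> prec n d c" "d \<noteq> - c" using that(3,4) by (auto simp: prec_def)
      have "dual_R tp n x d c = (1 - Q\<^sup>2) * (1 - \<xi> * Q\<^sup>2) * (lg tp c * lg tp d) * (x d c + Q * x c d)"
        unfolding dual_R_eq[OF that(2,1)] Q_def[symmetric] \<xi>_def[symmetric]
        using ne that by (simp add: algebra_simps power2_eq_square)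
      then show ?thesis using Qq xi0 lgn by (simp add: eq_neg_iff_add_eq_0)
    qed
    show ?thesis
    proof
      assume ?L
      then have L: "dual_R tp n x c d = 0" if "c \<in> idx tp n" "d \<in> idx tp n" "c \<noteq> - d" for c d using that by blast
      show ?R
      proof (intro conjI ballI impI)
        fix c assume c: "c \<in> idx tp n" "c \<noteq> 0"
        then have "c \<noteq> - c" by simp
        then show "x c c = 0" using diag[OF c] L[OF c(1) c(1)] by blast
      next
        fix c d assume "c \<in> idx tp n" "d \<in> idx tp n" "prec n c d \<and> c \<noteq> - d"
        then show "x d c = - Q * x c d" using up L by blast
      qed
    next
      assume R: ?R
      show ?L
      proof (intro ballI impI)
        fix c d assume cd: "c \<in> idx tp n" "d \<in> idx tp n" "c \<noteq> - d"
        have "idx_pos n c = idx_pos n d \<longleftrightarrow> c = d" using cd idx_pos_inject idx_abs by blast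
        then consider "c = d" | "prec n c d" | "prec n d c" unfolding prec_def by linarith
        then show "dual_R tp n x c d = 0"
        proof cases
          case 1
          then show ?thesis using diag[of c] R cd by auto
        next
          case 2
          then show ?thesis using up[of c d] R cd by auto
        next
          case 3
          then show ?thesis using down[of d c] R cd by auto
        qed
      qed
    qed
  qed
  have "(\<forall>c\<in>idx tp n. \<forall>d\<in>idx tp n. dual_R tp n x c d = 0) \<longleftrightarrow>
    (\<forall>c\<in>idx tp n. \<forall>d\<in>idx tp n. c \<noteq> - d \<longrightarrow> dual_R tp n x c d = 0) \<and> (\<forall>c\<in>idx tp n. dual_R tp n x c (- c) = 0)"
  proof -
    have "- c \<in> idx tp n" if "c \<in> idx tp n" for c using that by (simp add: idx_iff)
    then show ?thesis by (metis minus_minus)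
  qed
  also have "\<dots> \<longleftrightarrow> anti tp n x"
  proof -
    have "\<not> B \<and> \<kappa> n \<noteq> 1 \<longleftrightarrow> tp = A2_odd \<or> tp = C1"
    proof -
      have "- (Q\<^sup>2) \<noteq> 1" using neg_ne[of "Q\<^sup>2" 1] Q1 by simp
      then show ?thesis unfolding \<kappa>n B_def by (cases tp) auto
    qed
    then show ?thesis unfolding anti_def rest sol chains gn_iff h1_iff Q_def[symmetric]
      using B_iff by (auto simp: B_def)
  qed
  finally show ?thesis .
qed

section \<open>Linearity and symmetries of the antisymmetry conditions\<close>

lemma anti_zero: "anti tp n (\<lambda>a b. 0)"
  by (simp add: anti_def)

lemma anti_add: "anti tp n y \<Longrightarrow> anti tp n z \<Longrightarrow> anti tp n (\<lambda>a b. y a b + z a b)"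
proof -
  assume y: "anti tp n y" and z: "anti tp n z"
  have add: "(a + a') + k * (b + b') = (a + k * b) + (a' + k * b')" for a a' b b' k :: K
    by (simp add: algebra_simps)
  show ?thesis
    unfolding anti_def
  proof (intro conjI ballI allI impI)
    fix j assume j: "1 \<le> j \<and> j < int n"
    show "y (- j) j + z (- j) j + (q tp)\<^sup>2 * (y j (- j) + z j (- j))
      = - q tp * (y (- j - 1) (j + 1) + z (- j - 1) (j + 1) + (y (j + 1) (- j - 1) + z (j + 1) (- j - 1)))"
      unfolding add using antiD(3)[OF y, of j] antiD(3)[OF z, of j] j by (simp add: algebra_simps)
  next
    assume "tp = A2_odd \<or> tp = C1"
    then show "y (- int n) (int n) + z (- int n) (int n) + (q tp)\<^sup>2 * (y (int n) (- int n) + z (int n) (- int n)) = 0"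
      unfolding add using antiD(4)[OF y] antiD(4)[OF z] by simp
  next
    assume t: "tp \<noteq> A2_odd"
    have "y (- 1) 1 + z (- 1) 1 + (y 1 (- 1) + z 1 (- 1)) = (y (- 1) 1 + y 1 (- 1)) + (z (- 1) 1 + z 1 (- 1))" by simp
    then show "y (- 1) 1 + z (- 1) 1 + (y 1 (- 1) + z 1 (- 1)) = 0"
      using antiD(5)[OF y t] antiD(5)[OF z t] by simp
  next
    assume t: "tp = A2_even"
    show "(1 + q tp)\<^sup>2 * indet * (y 0 0 + z 0 0)
      = - (y (- int n) (int n) + z (- int n) (int n) + (q tp)\<^sup>2 * (y (int n) (- int n) + z (int n) (- int n)))"
      unfolding add distrib_left[of "(1 + q tp)\<^sup>2 * indet"] antiD(6)[OF y t] antiD(6)[OF z t] by simp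
  qed (use antiD(1,2)[OF y] antiD(1,2)[OF z] in \<open>auto simp: algebra_simps\<close>)
qed

lemma anti_smul: "anti tp n y \<Longrightarrow> anti tp n (\<lambda>a b. c * y a b)"
proof -
  assume y: "anti tp n y"
  show ?thesis
    unfolding anti_def
  proof (intro conjI ballI allI impI)
    fix j assume "1 \<le> j \<and> j < int n"
    then have "c * (y (- j) j + (q tp)\<^sup>2 * y j (- j)) = c * (- q tp * (y (- j - 1) (j + 1) + y (j + 1) (- j - 1)))"
      using antiD(3)[OF y, of j] by simp
    then show "c * y (- j) j + (q tp)\<^sup>2 * (c * y j (- j)) = - q tp * (c * y (- j - 1) (j + 1) + c * y (j + 1) (- j - 1))"
      by (simp add: algebra_simps)
  next
    assume "tp = A2_odd \<or> tp = C1"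
    then have "c * (y (- int n) (int n) + (q tp)\<^sup>2 * y (int n) (- int n)) = 0" using antiD(4)[OF y] by simp
    then show "c * y (- int n) (int n) + (q tp)\<^sup>2 * (c * y (int n) (- int n)) = 0" by (simp add: algebra_simps)
  next
    assume "tp \<noteq> A2_odd"
    then have "c * (y (- 1) 1 + y 1 (- 1)) = 0" using antiD(5)[OF y] by simp
    then show "c * y (- 1) 1 + c * y 1 (- 1) = 0" by (simp add: algebra_simps)
  next
    assume "tp = A2_even"
    then have "c * ((1 + q tp)\<^sup>2 * indet * y 0 0) = c * (- (y (- int n) (int n) + (q tp)\<^sup>2 * y (int n) (- int n)))"
      using antiD(6)[OF y] by simp
    then show "(1 + q tp)\<^sup>2 * indet * (c * y 0 0) = - (c * y (- int n) (int n) + (q tp)\<^sup>2 * (c * y (int n) (- int n)))"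
      by (simp add: algebra_simps)
  qed (use antiD(1,2)[OF y] in auto)
qed

text \<open>Each condition relates pairs of one weight only, so multiplying by a character of the
  weight preserves it.\<close>

lemma anti_char:
  assumes y: "anti tp n y" and w: "\<And>a. \<omega> a * \<omega> (- a) = 1"
  shows "anti tp n (\<lambda>a b. \<omega> a * \<omega> b * y a b)"
proof -
  have w': "\<omega> (- a) * \<omega> a = 1" "\<omega> (- a - 1) * \<omega> (a + 1) = 1" "\<omega> (a + 1) * \<omega> (- a - 1) = 1" for a
    using w[of a] w[of "a + 1"] by (simp_all add: mult.commute)
  have w1: "\<omega> (- 1) * \<omega> 1 = 1" "\<omega> 1 * \<omega> (- 1) = 1" "\<omega> 0 * \<omega> 0 = 1" using w[of 1] w[of 0] by (simp_all add: mult.commute)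
  show ?thesis
    unfolding anti_def w w' w1 mult_1
    using y unfolding anti_def by (auto simp: mult.commute mult.left_commute)
qed

text \<open>Negating both letters and exchanging them preserves the order of the pair. Since
  negation exchanges e and f, this symmetry yields stability under the lowering operators.\<close>

lemma anti_uminus: "anti tp n y \<Longrightarrow> anti tp n (\<lambda>a b. y (- b) (- a))"
proof -
  assume y: "anti tp n y"
  have p: "prec n (- d) (- c)" if "prec n c d" for c d
    using that by (auto simp: prec_def idx_pos_def split: if_splits)
  have J: "- c \<in> idx tp n \<longleftrightarrow> c \<in> idx tp n" for c by (simp add: idx_iff)
  show ?thesis
    unfolding anti_def
  proof (intro conjI ballI allI impI)
    fix c d assume cd: "c \<in> idx tp n" "d \<in> idx tp n" "prec n c d \<and> c \<noteq> - d"
    then have "- d \<in> idx tp n" "- c \<in> idx tp n" "prec n (- d) (- c)" "- d \<noteq> - (- c)" using p J by auto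
    then show "y (- c) (- d) = - q tp * y (- d) (- c)" using antiD(2)[OF y] by blast
  next
    fix j assume "1 \<le> j \<and> j < int n"
    then show "y (- j) (- (- j)) + (q tp)\<^sup>2 * y (- (- j)) (- j) = - q tp * (y (- (j + 1)) (- (- j - 1)) + y (- (- j - 1)) (- (j + 1)))"
      using antiD(3)[OF y, of j] by (simp add: minus_diff_commute)
  qed (use y J in \<open>auto simp: anti_def\<close>)
qed

context tensor_power
begin

definition Anti :: "(int list \<Rightarrow> K) set" where
  "Anti = {x \<in> Car. \<forall>p s. anti tp n (\<lambda>a b. x (p @ [a, b] @ s))}"

lemma subsp_anti: "subsp {m :: int list \<Rightarrow> K. anti tp n (\<lambda>a b. m [a, b])}"
  unfolding subsp_def by (auto simp: fun_apply anti_zero anti_add anti_smul)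

lemma tl_wt_uminus: "i \<in> {1..n} \<Longrightarrow> tl_wt tp n i a * tl_wt tp n i (- a) = 1"
  using lwt_uminus[of i n tp a] n1 by (simp add: tl_wt_def power_int_minus)

lemma fV_eV: "i \<in> {1..n} \<Longrightarrow> fV tp n i h a = eV tp n i (\<lambda>c. h (- c)) (- a)"
proof -
  assume i: "i \<in> {1..n}"
  have "(\<Sum>b\<in>idx tp n. vec_f tp n i a b * h b) = (\<Sum>b\<in>idx tp n. vec_e tp n i (- a) b * h (- b))"
    by (rule sum.reindex_bij_witness[of _ uminus uminus]) (use i vec_f_eq_vec_e[of i n tp] in \<open>auto simp: idx_iff\<close>)
  then show ?thesis by (simp add: fV_def eV_def)
qed

lemma anti_e2:
  assumes y: "anti tp n y" and i: "i \<in> {1..n}" and D: "tp = A2_odd_dagger \<Longrightarrow> 2 < n"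
  shows "anti tp n (e2 tp n i y)"
proof (cases "i < n")
  case True
  then show ?thesis using anti_e2_lt[OF y, of i] i by simp
next
  case False
  then have "i = n" using i by simp
  then show ?thesis using anti_e2_C[OF y] anti_e2_B[OF y] anti_e2_D[of n y] y D n1 by (cases tp) auto
qed

text \<open>Splitting the word as prefix, pair, suffix splits the operator into three terms. When it
  acts on prefix or suffix, the pair is only scaled by a character; so only the action on the pair
  itself needs checking.\<close>

lemma Anti_slices:
  assumes x: "x \<in> Car" and M: "\<And>a b. M a b \<noteq> 0 \<Longrightarrow> a \<in> idx tp n"
    and sl: "\<And>p s. anti tp n (\<lambda>a b. x (p @ [a, b] @ s))"
    and l: "\<And>a. l a * l (- a) = 1" and r: "\<And>a. r a * r (- a) = 1"
    and mid: "\<And>y. anti tp n y \<Longrightarrow> anti tp n (\<lambda>a b. cop (idx tp n) M l r (\<lambda>m. y (m ! 0) (m ! 1)) [a, b])"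
  shows "anti tp n (\<lambda>a b. cop (idx tp n) M l r x (p @ [a, b] @ s))"
proof -
  let ?c = "cop (idx tp n) M l r"
  have memb: "anti tp n (\<lambda>a b. f [a, b])" if "f \<in> {m :: int list \<Rightarrow> K. anti tp n (\<lambda>a b. m [a, b])}" for f using that by simp
  have 1: "anti tp n (\<lambda>a b. ?c (\<lambda>p'. x (p' @ [a, b] @ s)) p)"
    using memb[OF cop_closed[OF subsp_anti, of "\<lambda>p' m. x (p' @ m @ s)" "idx tp n" M l r p]] sl by simp
  have 3: "anti tp n (\<lambda>a b. ?c (\<lambda>s'. x (p @ [a, b] @ s')) s)"
    using memb[OF cop_closed[OF subsp_anti, of "\<lambda>s' m. x (p @ m @ s')" "idx tp n" M l r s]] sl by simp
  have 2: "anti tp n (\<lambda>a b. ?c (\<lambda>m. x (p @ m @ s)) [a, b])"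
    using mid[OF sl[of p s]] by simp
  let ?P = "\<lambda>h w. prod_list (map h w) :: K"
  have eq: "?c x (p @ [a, b] @ s) = ?P r s * (r a * r b * ?c (\<lambda>p'. x (p' @ [a, b] @ s)) p)
      + (?P l p * ?P r s * ?c (\<lambda>m. x (p @ m @ s)) [a, b] + ?P l p * (l a * l b * ?c (\<lambda>s'. x (p @ [a, b] @ s')) s))" for a b
  proof -
    have "?c x (p @ ([a, b] @ s)) = ?P r ([a, b] @ s) * ?c (\<lambda>p'. x (p' @ [a, b] @ s)) p + ?P l p * ?c (\<lambda>v. x (p @ v)) ([a, b] @ s)"
      by (rule cop_append)
    also have "?c (\<lambda>v. x (p @ v)) ([a, b] @ s) = ?P r s * ?c (\<lambda>m. x (p @ m @ s)) [a, b] + ?P l [a, b] * ?c (\<lambda>s'. x (p @ [a, b] @ s')) s"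
      by (rule cop_append)
    finally show ?thesis by (simp add: algebra_simps)
  qed
  show ?thesis unfolding eq
    by (intro anti_add anti_smul anti_char 1 2 3 l r) (use 2 anti_smul in \<open>simp add: anti_smul\<close>)?
qed

lemma submod_Anti:
  assumes D: "tp = A2_odd_dagger \<Longrightarrow> 2 < n"
  shows "submod Anti"
  unfolding submod_def
proof (intro conjI ballI)
  show "subsp Anti"
    using car(1,2,3) unfolding subsp_def Anti_def by (auto simp: fun_apply anti_zero anti_add anti_smul)
  show "Anti \<subseteq> Car" by (auto simp: Anti_def)
  fix i x assume i: "i \<in> {1..n}" and x: "x \<in> Anti"
  then have xC: "x \<in> Car" and sl: "\<And>p s. anti tp n (\<lambda>a b. x (p @ [a, b] @ s))" by (auto simp: Anti_def)
  have il: "inverse (tl_wt tp n i a) * inverse (tl_wt tp n i (- a)) = 1" for a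
    using tl_wt_uminus[OF i, of a] by (metis inverse_1 inverse_mult_distrib)
  show "Eo tp n i x \<in> Anti"
  proof -
    have "anti tp n (\<lambda>a b. Eo tp n i x (p @ [a, b] @ s))" for p s
      unfolding Eo_def
    proof (rule Anti_slices[OF xC _ sl])
      show "vec_e tp n i a b \<noteq> 0 \<Longrightarrow> a \<in> idx tp n" for a b using vec_e_idx i n1 by auto
      fix y assume "anti tp n y"
      moreover have "(\<lambda>a b. cop (idx tp n) (vec_e tp n i) (\<lambda>_. 1) (\<lambda>a. inverse (tl_wt tp n i a)) (\<lambda>m. y (m ! 0) (m ! 1)) [a, b]) = e2 tp n i y"
        by (intro ext) (simp add: e2_def eV_def)
      ultimately show "anti tp n (\<lambda>a b. cop (idx tp n) (vec_e tp n i) (\<lambda>_. 1) (\<lambda>a. inverse (tl_wt tp n i a)) (\<lambda>m. y (m ! 0) (m ! 1)) [a, b])"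
        using anti_e2[OF _ i D] by simp
    qed (use il in auto)
    then show ?thesis using xC i by (simp add: Anti_def linD)
  qed
  show "Fo tp n i x \<in> Anti"
  proof -
    have "anti tp n (\<lambda>a b. Fo tp n i x (p @ [a, b] @ s))" for p s
      unfolding Fo_def
    proof (rule Anti_slices[OF xC _ sl])
      show "vec_f tp n i a b \<noteq> 0 \<Longrightarrow> a \<in> idx tp n" for a b using vec_f_idx i n1 by auto
      fix y assume y: "anti tp n y"
      have inv: "inverse (tl_wt tp n i (- a)) = tl_wt tp n i a" for a
        using tl_wt_uminus[OF i, of a] by (metis inverse_unique mult.commute)
      \<comment> \<open>The lowering operator on two letters is the raising operator conjugated by
        negation and exchange, because the coproducts of e and f treat the two factors in opposite
        ways.\<close>
      have "(\<lambda>a b. cop (idx tp n) (vec_f tp n i) (tl_wt tp n i) (\<lambda>_. 1) (\<lambda>m. y (m ! 0) (m ! 1)) [a, b])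
          = (\<lambda>a b. e2 tp n i (\<lambda>a b. y (- b) (- a)) (- b) (- a))"
      proof (intro ext)
        fix a b
        have "eV tp n i (\<lambda>c. tl_wt tp n i a * y a (- c)) (- b) = tl_wt tp n i a * fV tp n i (\<lambda>c. y a c) b"
          by (simp add: fV_eV[OF i]) (simp add: eV_def sum_distrib_left mult.left_commute)
        moreover have "eV tp n i (\<lambda>c. y (- c) b) (- a) = fV tp n i (\<lambda>c. y c b) a"
          by (simp add: fV_eV[OF i])
        ultimately show "cop (idx tp n) (vec_f tp n i) (tl_wt tp n i) (\<lambda>_. 1) (\<lambda>m. y (m ! 0) (m ! 1)) [a, b]
          = e2 tp n i (\<lambda>a b. y (- b) (- a)) (- b) (- a)"
          by (simp add: e2_def inv) (simp add: fV_def)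
      qed
      then show "anti tp n (\<lambda>a b. cop (idx tp n) (vec_f tp n i) (tl_wt tp n i) (\<lambda>_. 1) (\<lambda>m. y (m ! 0) (m ! 1)) [a, b])"
        using anti_uminus[OF anti_e2[OF anti_uminus[OF y] i D]] by simp
    qed (use tl_wt_uminus[OF i] in auto)
    then show ?thesis using xC i by (simp add: Anti_def linD)
  qed
  have "anti tp n (\<lambda>a b. To tp n i x (p @ [a, b] @ s))" for p s
  proof -
    have eq: "(\<lambda>a b. To tp n i x (p @ [a, b] @ s))
      = (\<lambda>a b. (ch tp n i p * ch tp n i s) * (tl_wt tp n i a * tl_wt tp n i b * x (p @ [a, b] @ s)))"
      by (simp add: To_def mult_ac)
    show ?thesis unfolding eq by (intro anti_smul anti_char sl tl_wt_uminus[OF i])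
  qed
  then show "To tp n i x \<in> Anti" using xC i by (simp add: Anti_def)
  have "anti tp n (\<lambda>a b. To' tp n i x (p @ [a, b] @ s))" for p s
  proof -
    have eq: "(\<lambda>a b. To' tp n i x (p @ [a, b] @ s))
      = (\<lambda>a b. inverse (ch tp n i p * ch tp n i s) * (inverse (tl_wt tp n i a) * inverse (tl_wt tp n i b) * x (p @ [a, b] @ s)))"
      by (simp add: To'_def mult_ac)
    show ?thesis unfolding eq by (intro anti_smul anti_char[where \<omega> = "\<lambda>a. inverse (tl_wt tp n i a)"] sl il)
  qed
  then show "To' tp n i x \<in> Anti" using xC i by (simp add: Anti_def)
qed

end

section \<open>The relations as an orthogonal complement\<close>

lemma sum_words_append:
  "(\<Sum>w\<in>words tp n (a + b). h w) = (\<Sum>p\<in>words tp n a. \<Sum>s\<in>words tp n b. h (p @ s))"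
  by (induction a arbitrary: h) (simp_all add: sum_words_Suc)

lemma sum_words_2: "(\<Sum>w\<in>words tp n 2. h w) = (\<Sum>a\<in>idx tp n. \<Sum>b\<in>idx tp n. h [a, b])"
  by (simp add: numeral_2_eq_2 sum_words_Suc One_nat_def)

lemma lgw_append: "lgw tp (u @ v) = lgw tp u * lgw tp v"
  by (simp add: lgw_def)

lemma lgw_pos: "lgw tp w > 0"
  by (induction w) (simp_all add: lgw_def lg_pos)

lemma sum_swap4:
  "(\<Sum>a\<in>A. \<Sum>b\<in>B. \<Sum>c\<in>C. \<Sum>d\<in>D. f a b c d) = (\<Sum>c\<in>C. \<Sum>d\<in>D. \<Sum>a\<in>A. \<Sum>b\<in>B. f a b c d)"
proof -
  have "(\<Sum>a\<in>A. \<Sum>b\<in>B. \<Sum>c\<in>C. \<Sum>d\<in>D. f a b c d) = (\<Sum>a\<in>A. \<Sum>c\<in>C. \<Sum>b\<in>B. \<Sum>d\<in>D. f a b c d)"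
    by (rule sum.cong[OF refl], rule sum.swap)
  also have "\<dots> = (\<Sum>c\<in>C. \<Sum>a\<in>A. \<Sum>b\<in>B. \<Sum>d\<in>D. f a b c d)" by (rule sum.swap)
  also have "\<dots> = (\<Sum>c\<in>C. \<Sum>a\<in>A. \<Sum>d\<in>D. \<Sum>b\<in>B. f a b c d)" by (rule sum.cong[OF refl], rule sum.cong[OF refl], rule sum.swap)
  also have "\<dots> = (\<Sum>c\<in>C. \<Sum>d\<in>D. \<Sum>a\<in>A. \<Sum>b\<in>B. f a b c d)" by (rule sum.cong[OF refl], rule sum.swap)
  finally show ?thesis .
qed

lemma wip_R_op:
  "wip (words tp n 2) (lgw tp) x (R_op tp n (q tp ^ 2) y)
    = (\<Sum>c\<in>idx tp n. \<Sum>d\<in>idx tp n. y [c, d] * dual_R tp n (\<lambda>a b. x [a, b]) c d)"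
proof -
  have "wip (words tp n 2) (lgw tp) x (R_op tp n (q tp ^ 2) y)
    = (\<Sum>a\<in>idx tp n. \<Sum>b\<in>idx tp n. \<Sum>c\<in>idx tp n. \<Sum>d\<in>idx tp n.
        y [c, d] * (lg tp a * lg tp b * R_matrix tp n (q tp ^ 2) a b c d * x [a, b]))"
    by (simp add: wip_def sum_words_2 R_op_def lgw_def sum_distrib_left mult_ac)
  also have "\<dots> = (\<Sum>c\<in>idx tp n. \<Sum>d\<in>idx tp n. \<Sum>a\<in>idx tp n. \<Sum>b\<in>idx tp n.
        y [c, d] * (lg tp a * lg tp b * R_matrix tp n (q tp ^ 2) a b c d * x [a, b]))"
    by (rule sum_swap4)
  finally show ?thesis by (simp add: dual_R_def sum_distrib_left)
qed

lemma anti_iff_orthogonal_W: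
  assumes "1 < n"
  shows "(\<forall>w\<in>W tp n. wip (words tp n 2) (lgw tp) x w = 0) \<longleftrightarrow> anti tp n (\<lambda>a b. x [a, b])"
proof -
  have "(\<forall>w\<in>W tp n. wip (words tp n 2) (lgw tp) x w = 0) \<longleftrightarrow>
    (\<forall>c\<in>idx tp n. \<forall>d\<in>idx tp n. dual_R tp n (\<lambda>a b. x [a, b]) c d = 0)"
  proof
    assume L: "\<forall>w\<in>W tp n. wip (words tp n 2) (lgw tp) x w = 0"
    show "\<forall>c\<in>idx tp n. \<forall>d\<in>idx tp n. dual_R tp n (\<lambda>a b. x [a, b]) c d = 0"
    proof (intro ballI)
      fix c d assume cd: "c \<in> idx tp n" "d \<in> idx tp n"
      define y :: "int list \<Rightarrow> K" where "y = (\<lambda>w. if w = [c, d] then 1 else 0)"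
      have "y \<in> carrier (tpow tp n 2)" using cd by (auto simp: tpow_def y_def)
      then have "wip (words tp n 2) (lgw tp) x (R_op tp n (q tp ^ 2) y) = 0" using L by (auto simp: W_def)
      moreover have "(\<Sum>c'\<in>idx tp n. \<Sum>d'\<in>idx tp n. y [c', d'] * dual_R tp n (\<lambda>a b. x [a, b]) c' d')
        = dual_R tp n (\<lambda>a b. x [a, b]) c d"
      proof -
        have "(\<Sum>c'\<in>idx tp n. \<Sum>d'\<in>idx tp n. y [c', d'] * dual_R tp n (\<lambda>a b. x [a, b]) c' d')
          = (\<Sum>(c', d')\<in>idx tp n \<times> idx tp n. if c' = c \<and> d' = d then dual_R tp n (\<lambda>a b. x [a, b]) c' d' else 0)"
          unfolding sum.cartesian_product by (intro sum.cong refl) (auto simp: y_def)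
        then show ?thesis using cd by (simp add: sum_pair_single)
      qed
      ultimately show "dual_R tp n (\<lambda>a b. x [a, b]) c d = 0" by (simp add: wip_R_op)
    qed
  qed (auto simp: W_def wip_R_op)
  then show ?thesis using dual_R_anti[OF assms] by simp
qed

lemma submodule_tpow:
  assumes n: "1 < n"
  shows "submodule N Kring (tpow tp n k) \<longleftrightarrow> subsp N \<and> N \<subseteq> supported (words tp n k)"
proof -
  interpret tensor_power tp n k using n by unfold_locales
  have m: "module Kring TP"
  proof (rule moduleI)
    show "cring Kring" by (rule cring_from_type_algebra)
    show "abelian_group TP"
    proof (rule abelian_groupI)
      fix x assume "x \<in> carrier TP"
      then show "\<exists>y\<in>carrier TP. y \<oplus>\<^bsub>TP\<^esub> x = \<zero>\<^bsub>TP\<^esub>"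
        using car(4)[of x] by (intro bexI[of _ "- x"]) auto
    qed (auto simp: car add.assoc add.commute add.left_commute)
  qed (auto simp: car smul_distribs ring_of_type_algebra_def)
  interpret M: module Kring TP by (rule m)
  have a_inv: "\<ominus>\<^bsub>TP\<^esub> x = - x" if "x \<in> Car" for x
    by (rule M.M.minus_equality) (use that car(4)[OF that] in auto)
  show ?thesis
  proof
    assume "submodule N Kring TP"
    note N = M.submoduleE[OF this]
    obtain x where x: "x \<in> N" using N(2) by blast
    have "0 \<star> x \<in> N" using N(4)[of 0 x] x by (simp add: ring_of_type_algebra_def)
    then show "subsp N \<and> N \<subseteq> Car"
      using N(1) N(4) N(5) by (auto simp: subsp_def ring_of_type_algebra_def)
  next
    assume N: "subsp N \<and> N \<subseteq> Car"
    show "submodule N Kring TP"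
    proof (rule M.submoduleI)
      fix a assume a: "a \<in> N"
      then have "a \<in> Car" using N by blast
      then show "\<ominus>\<^bsub>TP\<^esub> a \<in> N" using a_inv subspD(4)[of N a] N a by simp
    qed (use N subspD[of N] in auto)
  qed
qed

lemma K_span_tpow:
  assumes n: "1 < n" and B: "B \<subseteq> supported (words tp n k)"
  shows "subsp (K_span (tpow tp n k) B)" "K_span (tpow tp n k) B \<subseteq> supported (words tp n k)"
    "B \<subseteq> K_span (tpow tp n k) B" "subsp P \<Longrightarrow> P \<subseteq> supported (words tp n k) \<Longrightarrow> B \<subseteq> P \<Longrightarrow> K_span (tpow tp n k) B \<subseteq> P"
proof -
  have eq: "K_span (tpow tp n k) B = \<Inter>{P. (subsp P \<and> P \<subseteq> supported (words tp n k)) \<and> B \<subseteq> P}"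
    unfolding K_span_def hull_def submodule_tpow[OF n] ..
  show "subsp (K_span (tpow tp n k) B)" unfolding eq subsp_def by auto
  show "K_span (tpow tp n k) B \<subseteq> supported (words tp n k)" unfolding eq using subsp_supported B by blast
  show "B \<subseteq> K_span (tpow tp n k) B" unfolding eq by blast
  show "subsp P \<Longrightarrow> P \<subseteq> supported (words tp n k) \<Longrightarrow> B \<subseteq> P \<Longrightarrow> K_span (tpow tp n k) B \<subseteq> P" unfolding eq by blast
qed

lemma W_supported: "w \<in> W tp n \<Longrightarrow> w \<in> supported (words tp n 2)"
proof -
  assume "w \<in> W tp n"
  then obtain y where w: "w = R_op tp n (q tp ^ 2) y" by (auto simp: W_def)
  have R: "R_matrix tp n z a b c d = 0" if "a \<notin> idx tp n \<or> b \<notin> idx tp n" for z a b c d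
  proof -
    let ?J = "idx tp n"
    have J: "- i \<in> ?J" if "i \<in> ?J" for i using that by (simp add: idx_iff)
    have "(\<Sum>i\<in>?J - {0}. EE i i a c * EE i i b d) = 0"
      by (rule sum.neutral) (use that in \<open>auto simp: EE_def\<close>)
    moreover have "(\<Sum>(i, j)\<in>{(i, j) \<in> ?J \<times> ?J. P i j}. EE i j a c * EE j i b d) = 0" for P
      by (rule sum.neutral) (use that in \<open>auto simp: EE_def\<close>)
    moreover have "(\<Sum>(i, j)\<in>{(i, j) \<in> ?J \<times> ?J. P i j}. EE i i a c * EE j j b d) = 0" for P
      by (rule sum.neutral) (use that in \<open>auto simp: EE_def\<close>)
    moreover have "(\<Sum>(i, j)\<in>?J \<times> ?J. R_coeff tp n z i j * (EE (- i) j a c * EE i (- j) b d)) = 0"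
      by (rule sum.neutral) (use that J in \<open>auto simp: EE_def\<close>)
    ultimately show ?thesis unfolding R_matrix_def Let_def by simp
  qed
  show ?thesis
  proof (rule supportedI)
    fix v assume v: "v \<notin> words tp n 2"
    show "w v = 0"
    proof (cases "\<exists>a b. v = [a, b]")
      case True
      then obtain a b where "v = [a, b]" by blast
      then show ?thesis using v R by (simp add: w R_op_def words_def)
    next
      case False
      then show ?thesis by (auto simp: w R_op_def split: list.splits)
    qed
  qed
qed

lemma wip_vec_tensor:
  assumes "x \<in> supported (words tp n a)" "y \<in> supported (words tp n b)"
  shows "wip (words tp n (a + 2 + b)) (lgw tp) z (vec_tensor a x (vec_tensor 2 w y))
    = (\<Sum>p\<in>words tp n a. \<Sum>s\<in>words tp n b. lgw tp p * lgw tp s * x p * y s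
        * wip (words tp n 2) (lgw tp) (\<lambda>m. z (p @ m @ s)) w)"
proof -
  have "wip (words tp n (a + 2 + b)) (lgw tp) z (vec_tensor a x (vec_tensor 2 w y))
    = (\<Sum>p\<in>words tp n a. \<Sum>m\<in>words tp n 2. \<Sum>s\<in>words tp n b.
        lgw tp (p @ m @ s) * z (p @ m @ s) * vec_tensor a x (vec_tensor 2 w y) (p @ m @ s))"
    by (simp only: wip_def sum_words_append append_assoc)
  also have "\<dots> = (\<Sum>p\<in>words tp n a. \<Sum>m\<in>words tp n 2. \<Sum>s\<in>words tp n b.
        lgw tp p * lgw tp s * x p * y s * (lgw tp m * z (p @ m @ s) * w m))"
    by (intro sum.cong refl) (simp add: vec_tensor_def words_def lgw_append mult_ac)
  also have "\<dots> = (\<Sum>p\<in>words tp n a. \<Sum>s\<in>words tp n b. \<Sum>m\<in>words tp n 2.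
        lgw tp p * lgw tp s * x p * y s * (lgw tp m * z (p @ m @ s) * w m))"
    by (rule sum.cong[OF refl], rule sum.swap)
  finally show ?thesis by (simp add: wip_def sum_distrib_left)
qed

context tensor_power
begin

text \<open>The form on words is multiplicative, so testing against a basis word, an element of W
  and a basis word isolates one slice of z. This gives the complement of the relations, and taking
  complements twice returns the relations.\<close>

lemma relations_eq: "relations tp n k = perp Anti"
proof -
  define G where "G i = {vec_tensor (i - 1) x (vec_tensor 2 w y) | x w y.
      x \<in> carrier (tpow tp n (i - 1)) \<and> w \<in> W tp n \<and> y \<in> carrier (tpow tp n (k - i - 1))}" for i
  have GC: "G i \<subseteq> Car" if i: "i \<in> {1..k - 1}" for i
  proof
    fix v assume "v \<in> G i"
    then obtain x w y where v: "v = vec_tensor (i - 1) x (vec_tensor 2 w y)" and x: "x \<in> supported (words tp n (i - 1))"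
      and w: "w \<in> supported (words tp n 2)" and y: "y \<in> supported (words tp n (k - i - 1))"
      using W_supported by (auto simp: G_def carrier_tpow)
    show "v \<in> Car"
    proof (rule supportedI, rule ccontr)
      fix u assume u: "u \<notin> words tp n k" "v u \<noteq> 0"
      then have "take (i - 1) u \<in> words tp n (i - 1)" "take 2 (drop (i - 1) u) \<in> words tp n 2"
        "drop 2 (drop (i - 1) u) \<in> words tp n (k - i - 1)"
        using x w y by (auto simp: v vec_tensor_def supported_def)
      moreover have "u = take (i - 1) u @ take 2 (drop (i - 1) u) @ drop 2 (drop (i - 1) u)"
        by (metis append_take_drop_id)
      ultimately have "length u = (i - 1) + 2 + (k - i - 1)" "set u \<subseteq> idx tp n"
        unfolding words_def by (metis (mono_tags, lifting) length_append mem_Collect_eq add.assoc, metis (mono_tags, lifting) set_append mem_Collect_eq Un_subset_iff)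
      then show False using u(1) i by (auto simp: words_def)
    qed
  qed
  have ks: "i - 1 + 2 + (k - i - 1) = k" if "i \<in> {1..k - 1}" for i using that by auto
  have tW: "tensor_W tp n (i - 1) (k - i - 1) = K_span TP (G i)" if "i \<in> {1..k - 1}" for i
    unfolding tensor_W_def ks[OF that] G_def ..
  define U where "U = (\<Union>i\<in>{1..k - 1}. K_span TP (G i))"
  have UC: "U \<subseteq> Car" unfolding U_def using K_span_tpow(2)[OF n1 GC] by blast
  have rel: "relations tp n k = K_span TP U"
    unfolding relations_def U_def using tW by (metis (no_types, lifting) SUP_cong)
  note span = K_span_tpow[OF n1 UC, folded rel]
  have "perp (relations tp n k) = Anti"
  proof
    show "perp (relations tp n k) \<subseteq> Anti"
    proof
      fix z assume z: "z \<in> perp (relations tp n k)"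
      then have zC: "z \<in> Car" by (simp add: perp_def)
      have "anti tp n (\<lambda>a b. z (p @ [a, b] @ s))" for p s
      proof (cases "length p + 2 + length s = k \<and> set p \<subseteq> idx tp n \<and> set s \<subseteq> idx tp n")
        case False
        then have "z (p @ [a, b] @ s) = 0" for a b
          using zC by (intro supportedD[of z "words tp n k"]) (auto simp: words_def)
        then show ?thesis by (simp add: anti_zero)
      next
        case True
        define i where "i = length p + 1"
        have i: "i \<in> {1..k - 1}" "i - 1 = length p" "k - i - 1 = length s" using True by (auto simp: i_def)
        have p: "p \<in> words tp n (length p)" "s \<in> words tp n (length s)" using True by (auto simp: words_def)
        define x :: "int list \<Rightarrow> K" where "x = (\<lambda>w. if w = p then 1 else 0)"
        define y :: "int list \<Rightarrow> K" where "y = (\<lambda>w. if w = s then 1 else 0)"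
        have x: "x \<in> supported (words tp n (length p))" and y: "y \<in> supported (words tp n (length s))"
          using p by (auto simp: x_def y_def supported_def)
        have "wip (words tp n 2) (lgw tp) (\<lambda>m. z (p @ m @ s)) w = 0" if w: "w \<in> W tp n" for w
        proof -
          have "vec_tensor (length p) x (vec_tensor 2 w y) \<in> G i"
            unfolding G_def i(2,3) carrier_tpow using x y w by blast
          then have "vec_tensor (length p) x (vec_tensor 2 w y) \<in> relations tp n k"
            using span(3) K_span_tpow(3)[OF n1 GC[OF i(1)]] i(1) unfolding U_def by blast
          then have "wip (words tp n (length p + 2 + length s)) (lgw tp) z (vec_tensor (length p) x (vec_tensor 2 w y)) = 0"
            using z True by (simp add: perp_def)
          moreover have "(\<Sum>p'\<in>words tp n (length p). \<Sum>s'\<in>words tp n (length s). lgw tp p' * lgw tp s' * x p' * y s'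
              * wip (words tp n 2) (lgw tp) (\<lambda>m. z (p' @ m @ s')) w)
            = lgw tp p * lgw tp s * wip (words tp n 2) (lgw tp) (\<lambda>m. z (p @ m @ s)) w"
          proof -
            have "(\<Sum>p'\<in>words tp n (length p). \<Sum>s'\<in>words tp n (length s). lgw tp p' * lgw tp s' * x p' * y s'
                * wip (words tp n 2) (lgw tp) (\<lambda>m. z (p' @ m @ s')) w)
              = (\<Sum>(p', s')\<in>words tp n (length p) \<times> words tp n (length s). if p' = p \<and> s' = s then
                  lgw tp p' * lgw tp s' * wip (words tp n 2) (lgw tp) (\<lambda>m. z (p' @ m @ s')) w else 0)"
              unfolding sum.cartesian_product by (intro sum.cong refl) (auto simp: x_def y_def)
            then show ?thesis using p finite_words by (simp add: sum_pair_single)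
          qed
          ultimately have "lgw tp p * lgw tp s * wip (words tp n 2) (lgw tp) (\<lambda>m. z (p @ m @ s)) w = 0"
            unfolding wip_vec_tensor[OF x y] by simp
          then show ?thesis using lgw_pos[of tp p] lgw_pos[of tp s] by simp
        qed
        then show ?thesis using anti_iff_orthogonal_W[OF n1, of tp "\<lambda>m. z (p @ m @ s)"] by simp
      qed
      then show "z \<in> Anti" using zC by (simp add: Anti_def)
    qed
    show "Anti \<subseteq> perp (relations tp n k)"
    proof
      fix z assume z: "z \<in> Anti"
      then have zC: "z \<in> Car" by (simp add: Anti_def)
      define P where "P = {v \<in> Car. ip z v = 0}"
      have P: "subsp P" "P \<subseteq> Car" using car(1,2,3) by (auto simp: P_def subsp_def wip_linear)
      have "G i \<subseteq> P" if i: "i \<in> {1..k - 1}" for i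
      proof
        fix v assume v: "v \<in> G i"
        then obtain x w y where v': "v = vec_tensor (i - 1) x (vec_tensor 2 w y)" and x: "x \<in> supported (words tp n (i - 1))"
          and w: "w \<in> W tp n" and y: "y \<in> supported (words tp n (k - i - 1))"
          by (auto simp: G_def carrier_tpow)
        have "wip (words tp n 2) (lgw tp) (\<lambda>m. z (p @ m @ s)) w = 0" for p s
          using anti_iff_orthogonal_W[OF n1, of tp "\<lambda>m. z (p @ m @ s)"] z w by (auto simp: Anti_def)
        then have "ip z v = 0" using wip_vec_tensor[OF x y, of z w] unfolding v' ks[OF i] by simp
        then show "v \<in> P" using GC[OF i] v by (auto simp: P_def)
      qed
      then have "U \<subseteq> P" unfolding U_def using K_span_tpow(4)[OF n1 GC P] by blast
      then have "relations tp n k \<subseteq> P" using span(4)[OF P] by blast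
      then show "z \<in> perp (relations tp n k)" using zC by (auto simp: perp_def P_def)
    qed
  qed
  then show ?thesis using perp_perp[OF span(1,2)] by simp
qed

end

subsection \<open>Increasing words\<close>

lemma idx_pos_bounds: "c \<in> idx tp n \<Longrightarrow> 1 \<le> idx_pos n c \<and> idx_pos n c \<le> 2 * int n + 1"
  unfolding idx_iff idx_pos_def by auto

text \<open>A coefficient at a pair that is not increasing is expressed by coefficients with a
  smaller first letter. For opposite letters all coefficients at (i,-i) drop out, and the chain then
  determines those at (-j,j) from one end: from n in type \<open>A2_odd\<close>, from 1
  otherwise.\<close>

lemma anti_straight:
  assumes y: "anti tp n y" and ab: "a \<in> idx tp n" "b \<in> idx tp n" "\<not> prec n a b"
    and z: "\<And>c d. c \<in> idx tp n \<Longrightarrow> d \<in> idx tp n \<Longrightarrow> prec n c a \<Longrightarrow> y c d = 0" and n: "1 < n"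
  shows "y a b = 0"
proof -
  have Q0: "q tp \<noteq> 0" by simp
  have opp0: "y (- int j) (int j) = 0" if X0: "\<And>i. 1 \<le> i \<Longrightarrow> i \<le> n \<Longrightarrow> y (int i) (- int i) = 0" and j: "1 \<le> j" "j \<le> n" for j
  proof -
    have chain: "y (- int i) (int i) = - q tp * y (- int (Suc i)) (int (Suc i))" if i: "1 \<le> i" "i < n" for i
    proof -
      have e: "- int i - 1 = - int (Suc i)" "int i + 1 = int (Suc i)" by simp_all
      show ?thesis using antiD(3)[OF y, of "int i"] i X0[of i] X0[of "Suc i"] unfolding e by simp
    qed
    show ?thesis
    proof (cases "tp = A2_odd")
      case True
      from j(2) show ?thesis using j(1)
      proof (induction j rule: inc_induct)
        case base
        then show ?case using antiD(4)[OF y] True X0[of n] by simp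
      next
        case (step m)
        then show ?case using chain[of m] by simp
      qed
    next
      case False
      from j(1) show ?thesis using j(2)
      proof (induction j rule: dec_induct)
        case base
        then show ?case using antiD(5)[OF y False] X0[of 1] n by simp
      next
        case (step m)
        then show ?case using chain[of m] Q0 by simp
      qed
    qed
  qed
  have neq: "idx_pos n a = idx_pos n b \<longleftrightarrow> a = b" using ab idx_pos_inject idx_abs by blast
  consider (same) "a = b" "a \<noteq> 0" | (zero) "a = 0" "b = 0" | (swap) "prec n b a" "a \<noteq> - b" | (opp) "prec n b a" "a = - b"
    using ab(3) neq unfolding prec_def by fastforce
  then show ?thesis
  proof cases
    case same
    then show ?thesis using antiD(1)[OF y] ab by blast
  next
    case swap
    then show ?thesis using antiD(2)[OF y ab(2,1)] z[OF ab(2,1)] by auto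
  next
    case opp
    then have "b > 0" using ab by (auto simp: prec_def idx_pos_def idx_iff split: if_splits)
    then have b: "1 \<le> nat b" "nat b \<le> n" "b = int (nat b)" using ab(2) by (auto simp: idx_iff)
    have "y (int i) (- int i) = 0" if "1 \<le> i" "i \<le> n" for i
      by (rule z) (use that b opp in \<open>auto simp: idx_iff prec_def idx_pos_def\<close>)
    then have "y (- int (nat b)) (int (nat b)) = 0" using opp0[of "nat b"] b(1,2) by blast
    then show ?thesis using opp b(3) by simp
  next
    case zero
    then have B: "tp = A2_even" using ab by simp
    have X0: "y (int i) (- int i) = 0" if "1 \<le> i" "i \<le> n" for i
      by (rule z) (use that zero in \<open>auto simp: idx_iff prec_def idx_pos_def\<close>)
    have "y (- int n) (int n) = 0" using opp0[of n] X0 n by simp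
    then have "(1 + q tp)\<^sup>2 * indet * y 0 0 = 0" using antiD(6)[OF y B] X0[of n] n by simp
    moreover have "1 + q tp \<noteq> 0" using add_pos_pos[OF zero_less_one, of "q tp"] q_gt_1[of tp] by (metis less_irrefl less_trans zero_less_one)
    ultimately show ?thesis using zero by simp
  qed
qed

text \<open>Positions of letters are at most 2n+1, so in base 2n+2 the value compares words of equal
  length lexicographically.\<close>

fun word_val :: "nat \<Rightarrow> int list \<Rightarrow> nat" where
  "word_val n [] = 0"
| "word_val n (a # u) = nat (idx_pos n a) * (2 * n + 2) ^ length u + word_val n u"

lemma word_val_less: "set u \<subseteq> idx tp n \<Longrightarrow> word_val n u < (2 * n + 2) ^ length u"
proof (induction u)
  case (Cons a u)
  have "nat (idx_pos n a) + 1 \<le> 2 * n + 2" using idx_pos_bounds[of a tp n] Cons.prems by auto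
  then have "(nat (idx_pos n a) + 1) * (2 * n + 2) ^ length u \<le> (2 * n + 2) * (2 * n + 2) ^ length u"
    by (rule mult_le_mono1)
  then show ?case using Cons by (auto simp: algebra_simps)
qed simp

lemma word_val_prefix: "length u = length v \<Longrightarrow> word_val n u < word_val n v \<Longrightarrow> word_val n (p @ u) < word_val n (p @ v)"
  by (induction p) auto

lemma word_val_decrease:
  assumes "prec n c a" "c \<in> idx tp n" "a \<in> idx tp n" "d \<in> idx tp n" "set s \<subseteq> idx tp n"
  shows "word_val n (p @ [c, d] @ s) < word_val n (p @ [a, b] @ s)"
proof (rule word_val_prefix)
  have "nat (idx_pos n c) + 1 \<le> nat (idx_pos n a)"
    using assms(1) idx_pos_bounds[OF assms(2)] idx_pos_bounds[OF assms(3)] unfolding prec_def by linarith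
  then have "(nat (idx_pos n c) + 1) * (2 * n + 2) ^ length (d # s) \<le> nat (idx_pos n a) * (2 * n + 2) ^ length (d # s)"
    by (rule mult_le_mono1)
  moreover have "word_val n (d # s) < (2 * n + 2) ^ length (d # s)"
    by (rule word_val_less) (use assms in auto)
  ultimately show "word_val n ([c, d] @ s) < word_val n ([a, b] @ s)"
    by (simp add: algebra_simps)
qed simp

context tensor_power
begin

text \<open>The lexicographically least word of the support is increasing: at an adjacent pair that
  is not, \<open>anti_straight\<close> would express the coefficient by smaller words, where x
  vanishes.\<close>

lemma Anti_increasing:
  assumes x: "x \<in> Anti" and nz: "x \<noteq> 0"
  shows "\<exists>w. x w \<noteq> 0 \<and> w \<in> words tp n k \<and> sorted_wrt (prec n) w"
proof -
  have xC: "x \<in> Car" using x by (simp add: Anti_def)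
  obtain w0 where "x w0 \<noteq> 0" using nz by (auto simp: fun_eq_iff fun_apply)
  then obtain w where w: "x w \<noteq> 0" and min: "\<And>v. x v \<noteq> 0 \<Longrightarrow> word_val n w \<le> word_val n v"
    using ex_has_least_nat[of "\<lambda>w. x w \<noteq> 0" w0 "word_val n"] by blast
  have ww: "w \<in> words tp n k" using w supportedD[OF xC, of w] by auto
  have "prec n (w ! i) (w ! Suc i)" if i: "Suc i < length w" for i
  proof (rule ccontr)
    assume np: "\<not> prec n (w ! i) (w ! Suc i)"
    let ?a = "w ! i" and ?b = "w ! Suc i"
    define p where "p = take i w"
    define s where "s = drop (Suc (Suc i)) w"
    have dec: "w = p @ [?a, ?b] @ s"
      using append_take_drop_id[of i w] Cons_nth_drop_Suc[of i w] Cons_nth_drop_Suc[of "Suc i" w] i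
      by (simp add: p_def s_def)
    have J: "?a \<in> idx tp n" "?b \<in> idx tp n" "set s \<subseteq> idx tp n"
      using ww i unfolding words_def s_def by (auto dest: in_set_dropD)
    have "x (p @ [?a, ?b] @ s) = 0"
    proof (rule anti_straight[OF _ J(1,2) np _ n1, of "\<lambda>a b. x (p @ [a, b] @ s)"])
      show "anti tp n (\<lambda>a b. x (p @ [a, b] @ s))" using x by (simp add: Anti_def)
      fix c d assume "c \<in> idx tp n" "d \<in> idx tp n" "prec n c ?a"
      then have "word_val n (p @ [c, d] @ s) < word_val n w"
        using word_val_decrease[of n c ?a tp d s p ?b] J dec by simp
      then show "x (p @ [c, d] @ s) = 0" using min[of "p @ [c, d] @ s"] by force
    qed
    then show False using w dec by simp
  qed
  moreover have "transp (prec n)" by (auto simp: transp_def prec_def)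
  ultimately show ?thesis using w ww by (auto simp: sorted_wrt_iff_nth_Suc_transp)
qed

text \<open>Without the letter -j in between, the first j moves to the right by q-antisymmetry until
  it meets the second.\<close>

lemma Anti_repeat:
  assumes x: "x \<in> Anti" and j: "j \<in> idx tp n" "j \<noteq> 0" and m: "set m \<subseteq> idx tp n" "- j \<notin> set m"
  shows "x (p @ [j] @ m @ [j] @ s) = 0"
  using m
proof (induction m arbitrary: p)
  case Nil
  have "anti tp n (\<lambda>a b. x (p @ [a, b] @ s))" using x by (simp add: Anti_def)
  from antiD(1)[OF this j] show ?case by simp
next
  case (Cons c m)
  have a: "anti tp n (\<lambda>a b. x (p @ [a, b] @ m @ [j] @ s))" using x unfolding Anti_def by blast
  have IH: "x ((p @ [c]) @ [j] @ m @ [j] @ s) = 0" using Cons.IH[of "p @ [c]"] Cons.prems by simp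
  have cj: "c \<in> idx tp n" "c \<noteq> - j" using Cons.prems by auto
  have "idx_pos n c = idx_pos n j \<longleftrightarrow> c = j" using cj j idx_pos_inject idx_abs by blast
  then consider "c = j" | "prec n c j" | "prec n j c" unfolding prec_def by linarith
  then show ?case
  proof cases
    case 1
    then show ?thesis using antiD(1)[OF a j] by simp
  next
    case 2
    then show ?thesis using antiD(2)[OF a cj(1) j(1) _ cj(2)] IH by simp
  next
    case 3
    have "j \<noteq> - c" using cj(2) by auto
    then show ?thesis using antiD(2)[OF a j(1) cj(1) 3] IH by simp
  qed
qed

end

text \<open>An increasing word is given by the middle letters \<open>z\<close> (empty or \<open>0\<close>) and, for each
  \<open>j\<close>, the information whether \<open>j\<close> and whether \<open>-j\<close> occurs.\<close>

fun wrd :: "int list \<Rightarrow> int \<Rightarrow> (bool \<times> bool) list \<Rightarrow> int list" where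
  "wrd z j [] = z"
| "wrd z j ((a, b) # \<tau>) = (if a then [j] else []) @ wrd z (j + 1) \<tau> @ (if b then [- j] else [])"

fun lwd :: "int \<Rightarrow> (bool \<times> bool) list \<Rightarrow> int list" where
  "lwd j [] = []"
| "lwd j ((a, b) # \<tau>) = (if a then [j] else []) @ lwd (j + 1) \<tau>"

fun rwd :: "int \<Rightarrow> (bool \<times> bool) list \<Rightarrow> int list" where
  "rwd j [] = []"
| "rwd j ((a, b) # \<tau>) = rwd (j + 1) \<tau> @ (if b then [- j] else [])"

lemma wrd_append: "wrd z j (\<tau> @ \<sigma>) = lwd j \<tau> @ wrd z (j + int (length \<tau>)) \<sigma> @ rwd j \<tau>"
proof (induction \<tau> arbitrary: j)
  case (Cons c \<tau>)
  then show ?case by (cases c) (simp add: add.assoc add.commute add.left_commute)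
qed simp

lemma set_lwd: "set (lwd j \<tau>) = {j + int i | i. i < length \<tau> \<and> fst (\<tau> ! i)}"
proof (induction j \<tau> rule: lwd.induct)
  case (2 j a b \<tau>)
  have "{j + int i | i. i < length ((a, b) # \<tau>) \<and> fst (((a, b) # \<tau>) ! i)}
    = (if a then {j} else {}) \<union> {(j + 1) + int i | i. i < length \<tau> \<and> fst (\<tau> ! i)}"
    (is "?A = ?B")
  proof (intro Set.set_eqI iffI)
    fix c assume "c \<in> ?A"
    then obtain i where i: "c = j + int i" "i < length ((a, b) # \<tau>)" "fst (((a, b) # \<tau>) ! i)" by blast
    then show "c \<in> ?B" by (cases i) auto
  next
    fix c assume "c \<in> ?B"
    then consider "a" "c = j" | i where "c = (j + 1) + int i" "i < length \<tau>" "fst (\<tau> ! i)" by (auto split: if_splits)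
    then show "c \<in> ?A"
    proof cases
      case 1
      then show ?thesis by (auto intro!: exI[of _ 0])
    next
      case 2
      then show ?thesis by (auto intro!: exI[of _ "Suc i"])
    qed
  qed
  then show ?case using 2 by simp
qed simp

lemma lwd_bounds: "a \<in> set (lwd j \<tau>) \<Longrightarrow> j \<le> a \<and> a < j + int (length \<tau>)"
  by (auto simp: set_lwd)

lemma rwd_bounds: "a \<in> set (rwd j \<tau>) \<Longrightarrow> j \<le> - a \<and> - a < j + int (length \<tau>)"
proof (induction \<tau> arbitrary: j)
  case (Cons c \<tau>)
  obtain b b' where c: "c = (b, b')" by fastforce
  from Cons.prems consider "a \<in> set (rwd (j + 1) \<tau>)" | "a = - j" by (auto simp: c split: if_splits)
  then show ?case
  proof cases
    case 1
    from Cons.IH[OF this] show ?thesis by simp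
  qed simp
qed simp

text \<open>Among 0 and the letters of absolute value at least j, the letter j is the first and -j
  the last in the order, so they can be peeled off the two ends.\<close>

lemma increasing_wrd:
  assumes "sorted_wrt (prec n) w" "\<And>a. a \<in> set w \<Longrightarrow> (j \<le> \<bar>a\<bar> \<and> \<bar>a\<bar> \<le> int n) \<or> a = 0"
    and "1 \<le> j" "j + int m = int n + 1"
  shows "\<exists>z \<tau>. w = wrd z j \<tau> \<and> length \<tau> = m \<and> (z = [] \<or> z = [0])"
  using assms
proof (induction m arbitrary: j w)
  case 0
  then have s: "set w \<subseteq> {0}" by force
  have "w = [] \<or> w = [0]"
  proof (cases w)
    case (Cons a u)
    then have "a = 0" "set u \<subseteq> {0}" "\<forall>b\<in>set u. prec n a b" using s 0(1) by auto
    then have "u = []" by (cases u) (auto simp: prec_def)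
    then show ?thesis using Cons \<open>a = 0\<close> by simp
  qed simp
  then show ?case by (intro exI[of _ w] exI[of _ "[]"]) simp
next
  case (Suc m)
  have jn: "j \<le> int n" using Suc.prems(4) by simp
  have first: "\<exists>u. w = (if j \<in> set w then [j] else []) @ u \<and> j \<notin> set u"
  proof (cases "j \<in> set w")
    case True
    then obtain p u where pu: "w = p @ j # u" by (meson split_list)
    have "p = []"
    proof (rule ccontr)
      assume "p \<noteq> []"
      then obtain a where a: "a \<in> set p" by (cases p) auto
      then have "prec n a j" using Suc.prems(1) by (simp add: pu sorted_wrt_append)
      moreover have "(j \<le> \<bar>a\<bar> \<and> \<bar>a\<bar> \<le> int n) \<or> a = 0" using Suc.prems(2) a pu by auto
      ultimately show False using Suc.prems(3) jn by (auto simp: prec_def idx_pos_def split: if_splits)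
    qed
    moreover have "j \<notin> set u" using Suc.prems(1) by (auto simp: pu sorted_wrt_append prec_def)
    ultimately show ?thesis using True pu by auto
  qed auto
  then obtain u where u: "w = (if j \<in> set w then [j] else []) @ u" "j \<notin> set u" by blast
  have "\<exists>v. u = v @ (if - j \<in> set u then [- j] else []) \<and> - j \<notin> set v"
  proof (cases "- j \<in> set u")
    case True
    then obtain v t where vt: "u = v @ (- j) # t" by (meson split_list)
    have su: "sorted_wrt (prec n) u" using Suc.prems(1) u(1) by (metis sorted_wrt_append)
    have "t = []"
    proof (rule ccontr)
      assume "t \<noteq> []"
      then obtain a where a: "a \<in> set t" by (cases t) auto
      then have "prec n (- j) a" using su by (simp add: vt sorted_wrt_append)
      moreover have "(j \<le> \<bar>a\<bar> \<and> \<bar>a\<bar> \<le> int n) \<or> a = 0" using Suc.prems(2)[of a] a vt u(1) by (metis Un_iff list.set_intros(2) set_append)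
      ultimately show False using Suc.prems(3) jn by (auto simp: prec_def idx_pos_def split: if_splits)
    qed
    moreover have "- j \<notin> set v" using su by (auto simp: vt sorted_wrt_append prec_def)
    ultimately show ?thesis using True vt by auto
  qed auto
  then obtain v where v: "u = v @ (if - j \<in> set u then [- j] else [])" "- j \<notin> set v" by blast
  have wv: "w = (if j \<in> set w then [j] else []) @ v @ (if - j \<in> set u then [- j] else [])" using u(1) v(1) by simp
  have sv: "sorted_wrt (prec n) v" using Suc.prems(1) wv by (metis sorted_wrt_append)
  have set_v: "set v \<subseteq> set w" using wv by (metis Un_iff set_append subsetI)
  have jv: "j \<notin> set v" using u(2) v(1) by (metis Un_iff set_append)
  have "(j + 1 \<le> \<bar>a\<bar> \<and> \<bar>a\<bar> \<le> int n) \<or> a = 0" if a: "a \<in> set v" for a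
  proof -
    have "a \<noteq> j" "a \<noteq> - j" using a jv v(2) by auto
    then have "\<bar>a\<bar> \<noteq> j" by auto
    then show ?thesis using Suc.prems(2)[of a] a set_v by force
  qed
  then obtain z \<tau> where "v = wrd z (j + 1) \<tau>" "length \<tau> = m" "z = [] \<or> z = [0]"
    using Suc.IH[OF sv, of "j + 1"] Suc.prems(3,4) by force
  then show ?case using wv by (intro exI[of _ z] exI[of _ "(j \<in> set w, - j \<in> set u) # \<tau>"]) simp
qed

definition blk :: "bool \<times> bool \<Rightarrow> int" where
  "blk c = of_bool (fst c) - of_bool (snd c)"

definition wt :: "int list \<Rightarrow> nat \<Rightarrow> int" where
  "wt w m = (\<Sum>a\<leftarrow>w. idx_wt a m)"

lemma wt_simps [simp]: "wt [] m = 0" "wt (a # w) m = idx_wt a m + wt w m" "wt (u @ v) m = wt u m + wt v m"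
  by (simp_all add: wt_def)

lemma wwt_eq: "wwt tp n i w = inner_wt n (simple_root tp n i) (wt w)"
proof (induction w)
  case Nil
  then show ?case by (simp add: inner_wt_def)
next
  case (Cons a w)
  then show ?case by (simp add: inner_wt_def lwt_def distrib_left sum.distrib)
qed

lemma wt_wrd_lt: "z = [] \<or> z = [0] \<Longrightarrow> m < j \<Longrightarrow> wt (wrd z (int j) \<tau>) m = 0"
proof (induction \<tau> arbitrary: j)
  case (Cons c \<tau>)
  obtain a b where c: "c = (a, b)" by fastforce
  have "wt (wrd z (int (Suc j)) \<tau>) m = 0" by (rule Cons.IH) (use Cons.prems in auto)
  then show ?case using Cons.prems(2) by (simp add: c idx_wt_def add.commute)
qed (auto simp: idx_wt_def)

lemma wt_wrd: "z = [] \<or> z = [0] \<Longrightarrow> 1 \<le> j \<Longrightarrow> i < length \<tau> \<Longrightarrow> wt (wrd z (int j) \<tau>) (j + i) = blk (\<tau> ! i)"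
proof (induction \<tau> arbitrary: j i)
  case (Cons c \<tau>)
  obtain a b where c: "c = (a, b)" by fastforce
  have e: "int j + 1 = int (Suc j)" by simp
  show ?case
  proof (cases i)
    case 0
    have "wt (wrd z (int (Suc j)) \<tau>) j = 0" by (rule wt_wrd_lt) (use Cons.prems in auto)
    then show ?thesis using Cons.prems(2) by (simp add: c 0 e idx_wt_def blk_def del: of_nat_Suc)
  next
    case (Suc i')
    have "wt (wrd z (int (Suc j)) \<tau>) (Suc j + i') = blk (\<tau> ! i')"
      by (rule Cons.IH) (use Cons.prems Suc in auto)
    then show ?thesis using Cons.prems(2) by (simp add: c Suc e idx_wt_def del: of_nat_Suc)
  qed
qed simp

lemma length_wrd: "length (wrd z j \<tau>) = length z + (\<Sum>c\<leftarrow>\<tau>. of_bool (fst c) + of_bool (snd c))"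
  by (induction z j \<tau> rule: wrd.induct) auto

subsection \<open>Classification of the primitive vectors\<close>

context tensor_power
begin

text \<open>The condition is on rows, because the coefficient of the raised vector at w is collected
  from the words that are mapped to w.\<close>

definition inert :: "nat \<Rightarrow> int list \<Rightarrow> bool" where
  "inert i w \<longleftrightarrow> (\<forall>a\<in>set w. (\<forall>b. vec_e tp n i a b = 0) \<and> lwt tp n i a = 0)"

lemma Eo_Nil: "Eo tp n i x [] = 0"
  by (simp add: Eo_def)

lemma Eo_append: "Eo tp n i x (u @ v) = inverse (ch tp n i v) * Eo tp n i (\<lambda>u'. x (u' @ v)) u + Eo tp n i (\<lambda>v'. x (u @ v')) v"
  by (simp add: Eo_def cop_append prod_inverse_tl prod_const_1)

lemma Eo_single: "Eo tp n i x [a] = eV tp n i (\<lambda>b. x [b]) a"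
  by (simp add: Eo_def eV_def)

lemma inert_ch: "inert i w \<Longrightarrow> ch tp n i w = 1"
  by (induction w) (auto simp: inert_def tl_wt_def)

lemma inert_Eo: "inert i w \<Longrightarrow> Eo tp n i x w = 0"
  by (induction w arbitrary: x) (auto simp: inert_def Eo_def)

lemma Eo_inert:
  assumes "inert i p" "inert i s"
  shows "Eo tp n i x (p @ v @ s) = Eo tp n i (\<lambda>v. x (p @ v @ s)) v"
  using assms by (simp add: Eo_append inert_Eo inert_ch)

lemma inert_lt:
  assumes "1 \<le> i" "i < n" "\<And>a. a \<in> set w \<Longrightarrow> \<bar>a\<bar> \<noteq> int i \<and> \<bar>a\<bar> \<noteq> int i + 1"
  shows "inert i w"
  unfolding inert_def
proof
  fix a assume "a \<in> set w"
  then have a: "\<bar>a\<bar> \<noteq> int i" "\<bar>a\<bar> \<noteq> int i + 1" using assms(3) by auto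
  have "vec_e tp n i a b = 0" for b
    using vec_e_nz[of i n tp a b] assms(1,2) n1 a by fastforce
  moreover have "lwt tp n i a = 0" using a assms(1,2) n1 by (simp add: lwt_eq)
  ultimately show "(\<forall>b. vec_e tp n i a b = 0) \<and> lwt tp n i a = 0" by blast
qed

lemma inert_n:
  assumes "\<And>a. a \<in> set w \<Longrightarrow> \<bar>a\<bar> \<noteq> int n \<and> (tp = A2_even \<longrightarrow> a \<noteq> 0) \<and> (tp = A2_odd_dagger \<longrightarrow> \<bar>a\<bar> \<noteq> int n - 1)"
  shows "inert n w"
  unfolding inert_def
proof
  fix a assume "a \<in> set w"
  then have a: "\<bar>a\<bar> \<noteq> int n" "tp = A2_even \<Longrightarrow> a \<noteq> 0" "tp = A2_odd_dagger \<Longrightarrow> \<bar>a\<bar> \<noteq> int n - 1" using assms by auto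
  have "vec_e tp n n a b = 0" for b
    using vec_e_nz[of n n tp a b] n1 a by (cases tp) force+
  moreover have "lwt tp n n a = 0" using a n1 by (cases tp) (simp_all add: lwt_eq)
  ultimately show "(\<forall>b. vec_e tp n n a b = 0) \<and> lwt tp n n a = 0" by blast
qed

end

lemma wrd_bounds: "1 \<le> j \<Longrightarrow> a \<in> set (wrd z j \<tau>) \<Longrightarrow> a \<in> set z \<or> (j \<le> \<bar>a\<bar> \<and> \<bar>a\<bar> < j + int (length \<tau>))"
proof (induction \<tau> arbitrary: j)
  case (Cons c \<tau>)
  obtain b b' where c: "c = (b, b')" by fastforce
  from Cons.prems consider "a \<in> set (wrd z (j + 1) \<tau>)" | "\<bar>a\<bar> = j" by (auto simp: c split: if_splits)
  then show ?case
  proof cases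
    case 1
    from Cons.IH[OF _ this] Cons.prems(1) show ?thesis by auto
  qed simp
qed simp

lemma set_z_wrd: "set z \<subseteq> set (wrd z j \<tau>)"
  by (induction z j \<tau> rule: wrd.induct) auto

lemma wrd_rep_FF [simp]: "wrd z j (replicate a (False, False)) = z"
  "lwd j (replicate a (False, False)) = []" "rwd j (replicate a (False, False)) = []"
  by (induction a arbitrary: j) simp_all

context tensor_power
begin

text \<open>The word with i and -i-1 is reached from i+1 by raising the first of these letters and
  from -i by raising the second. For a primitive vector this relates full pairs at i+1 and at
  i.\<close>

lemma Eo_exchange:
  assumes i: "1 \<le> i" "i < n" "length \<tau>\<^sub>1 + 1 = i" and z: "z = [] \<or> z = [0]"
  shows "Eo tp n i x (wrd z 1 (\<tau>\<^sub>1 @ [(True, False), (False, True)] @ \<tau>\<^sub>2))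
    = inverse (q tp) * x (wrd z 1 (\<tau>\<^sub>1 @ [(False, False), (True, True)] @ \<tau>\<^sub>2))
      + x (wrd z 1 (\<tau>\<^sub>1 @ [(True, True), (False, False)] @ \<tau>\<^sub>2))"
proof -
  define P S M where "P = lwd 1 \<tau>\<^sub>1" and "S = rwd 1 \<tau>\<^sub>1" and "M = wrd z (int i + 2) \<tau>\<^sub>2"
  have e: "1 + int (length \<tau>\<^sub>1) = int i" using i by simp
  have w: "wrd z 1 (\<tau>\<^sub>1 @ [(True, False), (False, True)] @ \<tau>\<^sub>2) = P @ ([int i] @ M @ [- int i - 1]) @ S"
    "wrd z 1 (\<tau>\<^sub>1 @ [(False, False), (True, True)] @ \<tau>\<^sub>2) = P @ ([int i + 1] @ M @ [- int i - 1]) @ S"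
    "wrd z 1 (\<tau>\<^sub>1 @ [(True, True), (False, False)] @ \<tau>\<^sub>2) = P @ ([int i] @ M @ [- int i]) @ S"
    unfolding wrd_append P_def S_def M_def e by (simp_all add: add.assoc)
  have "inert i P" unfolding P_def
    by (rule inert_lt) (use i e lwd_bounds[of _ 1 \<tau>\<^sub>1] in fastforce)+
  moreover have "inert i S" unfolding S_def
    by (rule inert_lt) (use i e rwd_bounds[of _ 1 \<tau>\<^sub>1] in fastforce)+
  ultimately have 1: "Eo tp n i x (P @ ([int i] @ M @ [- int i - 1]) @ S)
      = Eo tp n i (\<lambda>v. x (P @ v @ S)) ([int i] @ M @ [- int i - 1])"
    by (rule Eo_inert)
  have M: "inert i M" unfolding M_def
    by (rule inert_lt) (use i z wrd_bounds[of "int i + 2" _ z \<tau>\<^sub>2] in fastforce)+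
  have c: "ch tp n i (M @ [- int i - 1]) = q tp"
    using i n1 by (simp add: inert_ch[OF M] tl_wt_def lwt_eq)
  have ev: "eV tp n i h (int i) = h (int i + 1)" "eV tp n i h (- int i - 1) = h (- int i)" for h
    using i n1 by (auto simp: eV_eq)
  have 2: "Eo tp n i y ([int i] @ M @ [- int i - 1])
      = inverse (q tp) * y ([int i + 1] @ M @ [- int i - 1]) + y ([int i] @ M @ [- int i])" for y
    unfolding Eo_append[of _ _ "[int i]"] c Eo_single ev
    by (simp add: Eo_append inert_Eo[OF M] Eo_single ev)
  show ?thesis unfolding w 1 2 ..
qed

end

section \<open>Sorting the positions of full pairs\<close>

fun inv_count :: "bool list \<Rightarrow> nat" where
  "inv_count [] = 0"
| "inv_count (e # \<beta>) = (if e then 0 else length (filter id \<beta>)) + inv_count \<beta>"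

lemma inv_count_swap: "inv_count (\<beta>\<^sub>1 @ False # True # \<beta>\<^sub>2) = Suc (inv_count (\<beta>\<^sub>1 @ True # False # \<beta>\<^sub>2))"
  by (induction \<beta>\<^sub>1) auto

lemma inversion_move:
  fixes g :: "bool list \<Rightarrow> 'a::comm_ring_1"
  assumes "\<And>\<beta>\<^sub>1 \<beta>\<^sub>2. length \<beta>\<^sub>1 + length \<beta>\<^sub>2 + 2 = N \<Longrightarrow> g (\<beta>\<^sub>1 @ False # True # \<beta>\<^sub>2) = c * g (\<beta>\<^sub>1 @ True # False # \<beta>\<^sub>2)"
  shows "length p + m + 1 + length r = N \<Longrightarrow> g (p @ False # replicate m True @ r) = c ^ m * g (p @ replicate m True @ False # r)"
proof (induction m arbitrary: p)
  case (Suc m)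
  have "g (p @ False # replicate (Suc m) True @ r) = c * g ((p @ [True]) @ False # replicate m True @ r)"
    using assms[of p "replicate m True @ r"] Suc.prems by simp
  also have "g ((p @ [True]) @ False # replicate m True @ r) = c ^ m * g ((p @ [True]) @ replicate m True @ False # r)"
    by (rule Suc.IH) (use Suc.prems in simp)
  finally show ?case by (simp add: mult.assoc)
qed simp

text \<open>Every exchange of neighbours removes one inversion and contributes one factor c, so all
  values are multiples of the one at the sorted list.\<close>

lemma inversion_sort:
  fixes g :: "bool list \<Rightarrow> 'a::comm_ring_1"
  assumes "\<And>\<beta>\<^sub>1 \<beta>\<^sub>2. length \<beta>\<^sub>1 + length \<beta>\<^sub>2 + 2 = N \<Longrightarrow> g (\<beta>\<^sub>1 @ False # True # \<beta>\<^sub>2) = c * g (\<beta>\<^sub>1 @ True # False # \<beta>\<^sub>2)"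
    and "length \<beta> = N"
  shows "g \<beta> = c ^ inv_count \<beta> * g (replicate (length (filter id \<beta>)) True @ replicate (N - length (filter id \<beta>)) False)"
  using assms
proof (induction \<beta> arbitrary: g N)
  case (Cons e \<beta>)
  define m where "m = length (filter id \<beta>)"
  have m: "m \<le> length \<beta>" by (simp add: m_def)
  have sw: "g (e # \<beta>\<^sub>1 @ False # True # \<beta>\<^sub>2) = c * g (e # \<beta>\<^sub>1 @ True # False # \<beta>\<^sub>2)"
    if "length \<beta>\<^sub>1 + length \<beta>\<^sub>2 + 2 = length \<beta>" for \<beta>\<^sub>1 \<beta>\<^sub>2
    using Cons.prems(1)[of "e # \<beta>\<^sub>1" \<beta>\<^sub>2] that Cons.prems(2) by simp
  have IH: "g (e # \<beta>) = c ^ inv_count \<beta> * g (e # replicate m True @ replicate (length \<beta> - m) False)"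
    using Cons.IH[of "length \<beta>" "\<lambda>\<beta>. g (e # \<beta>)", OF sw] unfolding m_def by blast
  have N: "N = Suc (length \<beta>)" using Cons.prems(2) by simp
  show ?case
  proof (cases e)
    case True
    then show ?thesis using IH by (simp add: N m_def id_def)
  next
    case False
    have "g ([] @ False # replicate m True @ replicate (length \<beta> - m) False)
      = c ^ m * g ([] @ replicate m True @ False # replicate (length \<beta> - m) False)"
      by (rule inversion_move[of N]) (use Cons.prems m in auto)
    moreover have "Suc (length \<beta>) - m = Suc (length \<beta> - m)" using m by simp
    ultimately show ?thesis using IH False by (simp add: N power_add m_def id_def mult_ac)
  qed
qed simp

lemma omega_eq: "omega s m = (if 1 \<le> m \<and> m \<le> s then 1 else 0)"
  by (simp add: omega_def eps_wt_def)

lemma omega_bar_eq: "1 < n \<Longrightarrow> omega_bar n m = (if 1 \<le> m \<and> m < n then 1 else if m = n then - 1 else 0)"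
  by (auto simp: omega_bar_def eps_wt_def)

lemma blk_cases: "blk c = 1 \<longleftrightarrow> c = (True, False)" "blk c = - 1 \<longleftrightarrow> c = (False, True)" "blk c = 0 \<longleftrightarrow> fst c = snd c"
  "- 1 \<le> blk c" "blk c \<le> 1"
  by (cases c; auto simp: blk_def)+

abbreviation dup :: "bool list \<Rightarrow> (bool \<times> bool) list" where
  "dup \<equiv> map (\<lambda>e. (e, e))"

text \<open>A block of weight 1 is \<open>(True, False)\<close>; a block of weight 0 is empty or a
  full pair, and \<beta> records which.\<close>

lemma omega_form:
  assumes l: "length \<tau> = n" and s: "s \<le> n" and b: "\<And>m. m \<in> {1..n} \<Longrightarrow> blk (\<tau> ! (m - 1)) = omega s m"
  shows "\<exists>\<beta>. \<tau> = replicate s (True, False) @ dup \<beta> \<and> length \<beta> = n - s"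
proof -
  have b': "blk (\<tau> ! i) = (if i < s then 1 else 0)" if "i < n" for i
    using b[of "Suc i"] that by (auto simp: omega_eq)
  have "take s \<tau> = replicate s (True, False)"
  proof (rule nth_equalityI)
    fix i assume "i < length (take s \<tau>)"
    then have "i < s" "blk (\<tau> ! i) = 1" using b'[of i] l by auto
    then show "take s \<tau> ! i = replicate s (True, False) ! i" using blk_cases(1)[of "\<tau> ! i"] by simp
  qed (use l s in simp)
  moreover have "drop s \<tau> = dup (map fst (drop s \<tau>))"
  proof (rule nth_equalityI)
    fix i assume "i < length (drop s \<tau>)"
    then have "s + i < n" using l by simp
    then have "fst (\<tau> ! (s + i)) = snd (\<tau> ! (s + i))" using b'[of "s + i"] blk_cases(3)[of "\<tau> ! (s + i)"] by simp
    then show "drop s \<tau> ! i = dup (map fst (drop s \<tau>)) ! i"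
      using \<open>s + i < n\<close> l by (simp add: prod_eq_iff)
  qed simp
  ultimately show ?thesis using l append_take_drop_id[of s \<tau>]
    by (intro exI[of _ "map fst (drop s \<tau>)"]) (metis length_drop length_map)
qed

lemma length_dup_word:
  "length (wrd z j (replicate s (True, False) @ dup \<beta>)) = length z + s + 2 * length (filter id \<beta>)"
proof -
  have "(\<Sum>c\<leftarrow>dup \<beta>. of_bool (fst c) + of_bool (snd c)) = 2 * length (filter id \<beta>)" by (induction \<beta>) auto
  then show ?thesis unfolding length_wrd by (simp add: sum_list_replicate)
qed

lemma antitone_on_interval:
  fixes f :: "nat \<Rightarrow> int"
  assumes "\<And>m. 1 \<le> m \<Longrightarrow> m < N \<Longrightarrow> f (m + 1) \<le> f m" "1 \<le> m" "m \<le> N"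
  shows "f N \<le> f m"
  using assms(3,2)
proof (induction m rule: inc_induct)
  case (step m)
  then show ?case using assms(1)[of m] by (simp add: Suc_eq_plus1)
qed simp

lemma dominant_omega:
  fixes f :: "nat \<Rightarrow> int"
  assumes "\<And>m. m \<in> {1..N} \<Longrightarrow> f m \<le> 1" "\<And>m. 1 \<le> m \<Longrightarrow> m < N \<Longrightarrow> f (m + 1) \<le> f m" "1 \<le> N \<Longrightarrow> 0 \<le> f N"
  shows "\<exists>s\<le>N. \<forall>m\<in>{1..N}. f m = omega s m"
  using assms
proof (induction N)
  case (Suc N)
  show ?case
  proof (cases "f (Suc N) \<ge> 1")
    case True
    have "f m = 1" if "m \<in> {1..Suc N}" for m
      using antitone_on_interval[of "Suc N" f m] Suc.prems(1)[of m] Suc.prems(2) True that by fastforce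
    then show ?thesis by (intro exI[of _ "Suc N"]) (simp add: omega_eq)
  next
    case False
    then have 0: "f (Suc N) = 0" using Suc.prems(3) by simp
    have "0 \<le> f N" if "1 \<le> N" using Suc.prems(2)[OF that] 0 by (simp add: Suc_eq_plus1)
    then obtain s where s: "s \<le> N" "\<forall>m\<in>{1..N}. f m = omega s m"
      using Suc.IH Suc.prems(1,2) by (metis atLeastAtMost_iff le_SucI less_SucI)
    then have "\<forall>m\<in>{1..Suc N}. f m = omega s m" using 0 by (auto simp: omega_eq le_Suc_eq)
    then show ?thesis using s(1) le_SucI by blast
  qed
qed simp

lemma inner_wt_cong: "(\<And>m. m \<in> {1..n} \<Longrightarrow> y m = y' m) \<Longrightarrow> inner_wt n a y = inner_wt n a y'"
  by (simp add: inner_wt_def)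

lemma powi_ge_1: "q tp powi e \<ge> 1 \<Longrightarrow> e \<ge> 0"
  using power_int_strict_increasing[of e 0 "q tp"] q_gt_1[of tp] by (cases "e < 0") auto

context tensor_power
begin

lemma increasing_form:
  assumes "w \<in> words tp n k" "sorted_wrt (prec n) w"
  shows "\<exists>z \<tau>. w = wrd z 1 \<tau> \<and> length \<tau> = n \<and> (z = [] \<or> (z = [0] \<and> tp = A2_even))"
proof -
  have s: "set w \<subseteq> idx tp n" using assms(1) by (simp add: words_def)
  obtain z \<tau> where z: "w = wrd z 1 \<tau>" "length \<tau> = n" "z = [] \<or> z = [0]"
    using increasing_wrd[of n w 1 n] assms(2) s by (force simp: idx_iff)
  moreover have "tp = A2_even" if "z = [0]" using set_z_wrd[of z 1 \<tau>] s z(1) that by auto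
  ultimately show ?thesis by blast
qed

lemma wt_wrd1: "z = [] \<or> z = [0] \<Longrightarrow> length \<tau> = n \<Longrightarrow> m \<in> {1..n} \<Longrightarrow> wt (wrd z 1 \<tau>) m = blk (\<tau> ! (m - 1))"
  using wt_wrd[of z 1 "m - 1" \<tau>] by auto

lemma leading_word:
  assumes x: "x \<in> Anti" "prim x" "homog b x" "x \<noteq> 0"
  obtains z \<tau> where "x (wrd z 1 \<tau>) \<noteq> 0" "length \<tau> = n" "z = [] \<or> (z = [0] \<and> tp = A2_even)"
    "length (wrd z 1 \<tau>) = k"
    "\<And>i. i \<in> {1..n} \<Longrightarrow> b i = q tp powi inner_wt n (simple_root tp n i) (\<lambda>m. blk (\<tau> ! (m - 1)))"
    "\<And>i. i \<in> {1..n} \<Longrightarrow> 0 \<le> inner_wt n (simple_root tp n i) (\<lambda>m. blk (\<tau> ! (m - 1)))"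
proof -
  obtain w where w: "x w \<noteq> 0" "w \<in> words tp n k" "sorted_wrt (prec n) w" using Anti_increasing x(1,4) by blast
  obtain z \<tau> where z: "w = wrd z 1 \<tau>" "length \<tau> = n" "z = [] \<or> (z = [0] \<and> tp = A2_even)"
    using increasing_form[OF w(2,3)] by blast
  have b: "b i = q tp powi inner_wt n (simple_root tp n i) (\<lambda>m. blk (\<tau> ! (m - 1)))" if i: "i \<in> {1..n}" for i
  proof -
    have "To tp n i x = b i \<star> x" using x(3) i by (simp add: homog_def)
    from fun_cong[OF this, of w] have "ch tp n i w = b i" using w(1) by (simp add: To_def fun_apply)
    moreover have "inner_wt n (simple_root tp n i) (wt w) = inner_wt n (simple_root tp n i) (\<lambda>m. blk (\<tau> ! (m - 1)))"
      by (rule inner_wt_cong) (use wt_wrd1[of z \<tau>] z in auto)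
    ultimately show ?thesis by (simp add: ch_wwt wwt_eq)
  qed
  moreover have "0 \<le> inner_wt n (simple_root tp n i) (\<lambda>m. blk (\<tau> ! (m - 1)))" if "i \<in> {1..n}" for i
    using prim_dominant[OF x(2,3,4) that] b[OF that] powi_ge_1 by metis
  moreover have "length (wrd z 1 \<tau>) = k" using w(2) z(1) by (simp add: words_def)
  ultimately show ?thesis using that[of z \<tau>] w z by blast
qed

text \<open>Coordinates are at most 1 and decrease. The last simple root makes the final coordinate
  nonnegative except in type D, where it allows -1 if the one before is 1.\<close>

lemma dominant_blocks:
  assumes "length \<tau> = n" "\<And>i. i \<in> {1..n} \<Longrightarrow> 0 \<le> inner_wt n (simple_root tp n i) (\<lambda>m. blk (\<tau> ! (m - 1)))"
  shows "(\<exists>s\<le>n. \<forall>m\<in>{1..n}. blk (\<tau> ! (m - 1)) = omega s m) \<or>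
    (tp = A2_odd_dagger \<and> (\<forall>m\<in>{1..n}. blk (\<tau> ! (m - 1)) = omega_bar n m))"
proof -
  define f where "f m = blk (\<tau> ! (m - 1))" for m
  have f: "- 1 \<le> f m" "f m \<le> 1" for m by (simp_all add: f_def blk_cases)
  have dom: "0 \<le> inner_wt n (simple_root tp n i) f" if "i \<in> {1..n}" for i
    using assms(2)[OF that] by (simp add: f_def[abs_def])
  have dec: "f (m + 1) \<le> f m" if "1 \<le> m" "m < n" for m
    using dom[of m] inner_wt_simple_root[of m n tp f] that n1 by simp
  have last: "0 \<le> (case tp of A2_even \<Rightarrow> f n | A2_odd \<Rightarrow> 2 * f n | A2_odd_dagger \<Rightarrow> f (n - 1) + f n | C1 \<Rightarrow> 2 * f n)"
    using dom[of n] inner_wt_simple_root[of n n tp f] n1 by simp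
  show ?thesis
  proof (cases "0 \<le> f n")
    case True
    have "\<exists>s\<le>n. \<forall>m\<in>{1..n}. f m = omega s m" by (rule dominant_omega) (use f dec True in auto)
    then show ?thesis by (simp add: f_def)
  next
    case False
    then have fn: "f n = - 1" using f(1)[of n] by simp
    then have D: "tp = A2_odd_dagger" and f1: "f (n - 1) = 1" using last f(2)[of "n - 1"] by (cases tp; simp)+
    have "f m = omega_bar n m" if m: "m \<in> {1..n}" for m
    proof (cases "m = n")
      case False
      then have "f (n - 1) \<le> f m" using antitone_on_interval[of "n - 1" f m] dec m by force
      then show ?thesis using f1 f(2)[of m] m False n1 by (simp add: omega_bar_eq)
    qed (use fn n1 in \<open>simp add: omega_bar_eq\<close>)
    then show ?thesis using D by (simp add: f_def)
  qed
qed

lemma prim_exchange: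
  assumes "prim x" "z = [] \<or> z = [0]" "s + length \<beta>\<^sub>1 + length \<beta>\<^sub>2 + 2 = n"
  shows "x (wrd z 1 (replicate s (True, False) @ dup (\<beta>\<^sub>1 @ False # True # \<beta>\<^sub>2)))
    = - q tp * x (wrd z 1 (replicate s (True, False) @ dup (\<beta>\<^sub>1 @ True # False # \<beta>\<^sub>2)))"
proof -
  let ?i = "s + length \<beta>\<^sub>1 + 1" and ?p = "replicate s (True, False) @ dup \<beta>\<^sub>1"
  have "Eo tp n ?i x = 0" using assms(1,3) by (simp add: prim_def)
  then have "inverse (q tp) * x (wrd z 1 (?p @ [(False, False), (True, True)] @ dup \<beta>\<^sub>2))
      + x (wrd z 1 (?p @ [(True, True), (False, False)] @ dup \<beta>\<^sub>2)) = 0"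
    using Eo_exchange[of ?i ?p z x "dup \<beta>\<^sub>2"] assms(2,3) by (simp add: fun_apply)
  moreover have "a = - q tp * c" if "inverse (q tp) * a + c = 0" for a c
    using that by (simp add: field_simps eq_neg_iff_add_eq_0)
  ultimately show ?thesis by simp
qed

lemma prim_sorted:
  assumes "prim x" "z = [] \<or> z = [0]" "s + length \<beta> = n" "m = length (filter id \<beta>)"
  shows "x (wrd z 1 (replicate s (True, False) @ dup \<beta>)) = (- q tp) ^ inv_count \<beta>
    * x (wrd z 1 (replicate s (True, False) @ dup (replicate m True @ replicate (n - s - m) False)))"
  using inversion_sort[of "n - s" "\<lambda>\<beta>. x (wrd z 1 (replicate s (True, False) @ dup \<beta>))" "- q tp" \<beta>]
    prim_exchange[OF assms(1,2)] assms(3,4) by (simp add: diff_diff_eq)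

lemma no_zero:
  assumes x: "prim x" and B: "tp = A2_even" and s: "s + m < n"
  shows "x (wrd [0] 1 (replicate s (True, False) @ dup (replicate m True @ replicate (n - s - m) False))) = 0"
proof -
  define \<sigma> where "\<sigma> = replicate s (True, False) @ dup (replicate m True)"
  have ls: "length \<sigma> = s + m" by (simp add: \<sigma>_def)
  have w: "wrd [0] 1 (replicate s (True, False) @ dup (replicate m True @ replicate (n - s - m) False)) = lwd 1 \<sigma> @ [0] @ rwd 1 \<sigma>"
    using wrd_append[of "[0]" 1 \<sigma> "replicate (n - s - m) (False, False)"] by (simp add: \<sigma>_def)
  have P: "inert n (lwd 1 \<sigma>)"
    by (rule inert_n) (use lwd_bounds[of _ 1 \<sigma>] B s ls in fastforce)
  have S: "inert n (rwd 1 \<sigma>)"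
    by (rule inert_n) (use rwd_bounds[of _ 1 \<sigma>] B s ls in fastforce)
  have "Eo tp n n x (lwd 1 \<sigma> @ [int n] @ rwd 1 \<sigma>) = qint tp n n 2 * x (lwd 1 \<sigma> @ [0] @ rwd 1 \<sigma>)"
    unfolding Eo_inert[OF P S] Eo_single using n1 B by (simp add: eV_eq)
  moreover have "Eo tp n n x = 0" using x n1 by (simp add: prim_def)
  moreover have "qint tp n n 2 \<noteq> 0"
  proof -
    have "q_i tp n n > 0" using q_i_gt_1[of n n tp] n1 by (simp add: less_trans[OF zero_less_one])
    then have "qint tp n n 2 > 0" using n1 by (simp add: qint_2 add_pos_pos)
    then show ?thesis by simp
  qed
  ultimately show ?thesis unfolding w by (simp add: fun_apply)
qed

text \<open>Fix the single letters and all pairs but the innermost, and let that pair be i,-i in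
  either order. Below t the coefficients \<open>xp\<close> vanish, from t on they form a geometric
  sequence by primitivity; the relation at 1,-1 and the chain then compute the sums h up to n. There
  another relation contradicts the outcome unless \<open>xp t\<close> is 0.\<close>

lemma no_pairs:
  assumes xA: "x \<in> Anti" and x: "prim x" and tp: "tp \<noteq> A2_odd" and s: "s + 2 * m \<le> n" and m: "1 \<le> m"
  shows "x (wrd [] 1 (replicate s (True, False) @ dup (replicate m True @ replicate (n - s - m) False))) = 0"
proof -
  define Q where "Q = q tp"
  have Q: "Q > 1" by (simp add: Q_def q_gt_1)
  define t where "t = s + m"
  have t: "1 \<le> t" "t < n" using s m by (auto simp: t_def)
  define \<sigma> where "\<sigma> = replicate s (True, False) @ dup (replicate (m - 1) True)"
  have ls: "length \<sigma> = t - 1" using m by (simp add: \<sigma>_def t_def)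
  define P S where "P = lwd 1 \<sigma>" and "S = rwd 1 \<sigma>"
  have Pb: "1 \<le> a \<and> a < int t" if "a \<in> set P" for a
    using lwd_bounds[of a 1 \<sigma>] that ls t unfolding P_def by (simp add: of_nat_diff)
  have Sb: "1 \<le> - a \<and> - a < int t" if "a \<in> set S" for a
    using rwd_bounds[of a 1 \<sigma>] that ls t unfolding S_def by (simp add: of_nat_diff)
  define y where "y a b = x (P @ [a, b] @ S)" for a b
  have y: "anti tp n y" using xA by (simp add: Anti_def y_def[abs_def])
  define xp where "xp i = y (int i) (- int i)" for i
  define yp where "yp i = y (- int i) (int i)" for i
  define h where "h i = yp i + xp i" for i
  define g where "g \<beta> = x (wrd [] 1 (replicate s (True, False) @ dup \<beta>))" for \<beta>
  have Xg: "xp i = g (replicate (m - 1) True @ replicate (i - t) False @ True # replicate (n - i) False)" if "t \<le> i" "i \<le> n" for i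
  proof -
    have "wrd [] 1 (\<sigma> @ (replicate (i - t) (False, False) @ (True, True) # replicate (n - i) (False, False))) = P @ [int i, - int i] @ S"
      unfolding wrd_append using ls t that by (simp add: P_def S_def of_nat_diff)
    then show ?thesis by (simp add: xp_def y_def g_def \<sigma>_def)
  qed
  have Xstep: "xp (Suc i) = - Q * xp i" if i: "t \<le> i" "i < n" for i
  proof -
    have 1: "Suc i - t = Suc (i - t)" "n - i = Suc (n - Suc i)" using i by auto
    have "g ((replicate (m - 1) True @ replicate (i - t) False) @ False # True # replicate (n - Suc i) False)
      = - q tp * g ((replicate (m - 1) True @ replicate (i - t) False) @ True # False # replicate (n - Suc i) False)"
      unfolding g_def by (rule prim_exchange[OF x]) (use i m t_def in auto)
    then show ?thesis using Xg[of i] Xg[of "Suc i"] i by (simp add: 1 Q_def replicate_app_Cons_same)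
  qed
  have Xt: "g (replicate m True @ replicate (n - s - m) False) = xp t"
  proof -
    have "replicate m True = replicate (m - 1) True @ [True]" using m by (metis Suc_pred' One_nat_def replicate_Suc replicate_append_same less_eq_Suc_le)
    then show ?thesis using Xg[of t] t by (simp add: t_def diff_diff_eq)
  qed
  \<comment> \<open>For these i the letter i already occurs in P, so it would occur twice, with only
    positive letters in between.\<close>
  have Xz: "xp i = 0" if i: "1 \<le> i" "i < t" for i
  proof -
    have "i - 1 < length \<sigma>" using ls i by simp
    moreover have "fst c" if "c \<in> set \<sigma>" for c using that by (auto simp: \<sigma>_def)
    ultimately have "1 + int (i - 1) \<in> set P" unfolding P_def set_lwd using nth_mem by blast
    then obtain p1 p2 where p: "P = p1 @ int i # p2" using i by (auto simp: of_nat_diff dest!: split_list)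
    have "int i \<in> idx tp n" using i t by (auto simp: idx_iff)
    moreover have "set p2 \<subseteq> idx tp n" "- int i \<notin> set p2" using Pb p t by (force simp: idx_iff)+
    ultimately have "x (p1 @ [int i] @ p2 @ [int i] @ ([- int i] @ S)) = 0"
      using Anti_repeat[OF xA, of "int i" p2 p1 "[- int i] @ S"] i by simp
    then show ?thesis by (simp add: xp_def y_def p)
  qed
  have hstep: "h i + (Q\<^sup>2 - 1) * xp i = - Q * h (Suc i)" if "1 \<le> i" "i < n" for i
  proof -
    have e: "- int i - 1 = - int (Suc i)" "int i + 1 = int (Suc i)" by simp_all
    have "yp i + Q\<^sup>2 * xp i = - Q * (yp (Suc i) + xp (Suc i))"
      using antiD(3)[OF y, of "int i"] that unfolding e by (simp add: xp_def yp_def Q_def)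
    then show ?thesis by (simp add: h_def algebra_simps)
  qed
  have h1: "h 1 = 0" using antiD(5)[OF y tp] by (simp add: h_def xp_def yp_def)
  have h0: "h i = 0" if "1 \<le> i" "i \<le> t" for i
    using that
  proof (induction i rule: dec_induct)
    case base
    then show ?case using h1 by simp
  next
    case (step i)
    then have "h i = 0" "xp i = 0" using Xz by auto
    then show ?case using hstep[of i] step t Q by simp
  qed
  have XX: "xp i = (- Q) ^ (i - t) * xp t" if "t \<le> i" "i \<le> n" for i
    using that
  proof (induction i rule: dec_induct)
    case (step i)
    then show ?case using Xstep[of i] by (simp add: Suc_diff_le)
  qed simp
  \<comment> \<open>Multiplication by this power makes the exponents even and nonnegative, so that
    signs disappear.\<close>
  have XQ: "(- Q) ^ (t + i) * xp i = Q ^ (2 * i) * xp t" if "t \<le> i" "i \<le> n" for i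
  proof -
    have "(- Q) ^ (t + i) * xp i = (- Q) ^ (t + i + (i - t)) * xp t"
      using XX[OF that] by (simp add: power_add mult.assoc)
    also have "t + i + (i - t) = 2 * i" using that by simp
    also have "(- Q) ^ (2 * i) = Q ^ (2 * i)" by simp
    finally show ?thesis .
  qed
  have hQ: "(- Q) ^ (t + i) * h i = (Q ^ (2 * i) - Q ^ (2 * t)) * xp t" if "t \<le> i" "i \<le> n" for i
    using that
  proof (induction i rule: dec_induct)
    case base
    then show ?case using h0 t by simp
  next
    case (step i)
    have "(- Q) ^ (t + Suc i) * h (Suc i) = (- Q) ^ (t + i) * (- Q * h (Suc i))" by simp
    also have "- Q * h (Suc i) = h i + (Q\<^sup>2 - 1) * xp i" using hstep[of i] step t by simp
    also have "(- Q) ^ (t + i) * (h i + (Q\<^sup>2 - 1) * xp i) = (- Q) ^ (t + i) * h i + (Q\<^sup>2 - 1) * ((- Q) ^ (t + i) * xp i)"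
      by (simp add: distrib_left mult.left_commute)
    also have "\<dots> = (Q ^ (2 * i) - Q ^ (2 * t)) * xp t + (Q\<^sup>2 - 1) * (Q ^ (2 * i) * xp t)"
      using step XQ[of i] by simp
    also have "\<dots> = (Q ^ (2 * Suc i) - Q ^ (2 * t)) * xp t" by (simp add: algebra_simps power2_eq_square)
    finally show ?case .
  qed
  define A where "A = Q ^ (2 * n)"
  define B where "B = Q ^ (2 * t)"
  have AB: "A > 0" "B > 0" "B < A" using Q t by (auto simp: A_def B_def intro!: power_strict_increasing zero_less_power)
  have hn: "(- Q) ^ (t + n) * h n = (A - B) * xp t" and Xn: "(- Q) ^ (t + n) * xp n = A * xp t"
    using hQ[of n] XQ[of n] t by (simp_all add: A_def B_def)
  have Sn: "inert n S" "inert n P"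
    by (rule inert_n; use Sb Pb t n1 in force)+
  have En: "Eo tp n n (\<lambda>v. x (P @ v @ S)) v = 0" for v
    using Eo_inert[OF Sn(2,1), of x v] x n1 by (simp add: prim_def fun_apply)
  \<comment> \<open>In each type one further relation between h and xp at n makes a factor times
    \<open>xp t\<close> vanish. The factors \<open>Q\<^sup>2 * A - B\<close>,
    \<open>Q * A + B\<close>, \<open>A + B\<close> are all nonzero because A > B > 0.\<close>
  have "xp t = 0"
  proof (cases tp)
    case C1
    then have "h n + (Q\<^sup>2 - 1) * xp n = 0" using antiD(4)[OF y] by (simp add: h_def xp_def yp_def Q_def algebra_simps)
    then have "(- Q) ^ (t + n) * h n + (Q\<^sup>2 - 1) * ((- Q) ^ (t + n) * xp n) = 0"
      by (metis distrib_left mult.left_commute mult_zero_right)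
    then have "(Q\<^sup>2 * A - B) * xp t = 0" unfolding hn Xn by (simp add: algebra_simps)
    moreover have "A \<le> Q\<^sup>2 * A" using Q AB(1) one_le_power[of Q 2] by simp
    then have "Q\<^sup>2 * A - B \<noteq> 0" using AB(3) by auto
    ultimately show ?thesis by simp
  next
    case A2_even
    define r where "r = indet"
    have r: "r \<noteq> 0" "Q = r\<^sup>2" using A2_even by (simp_all add: r_def Q_def q_def)
    define T where "T = qint tp n n 2"
    have T: "r * T = Q + 1" using A2_even n1 r by (simp add: T_def qint_2 q_i_eq field_simps power2_eq_square flip: r_def)
    \<comment> \<open>The coefficient at the letters n, 0 is reached from 0, 0 and from n, -n; this
      brings in the coefficient at (0,0), which the relation at 0 eliminates.\<close>
    have "Eo tp n n (\<lambda>v. x (P @ v @ S)) ([int n] @ [0]) = T * y 0 0 + xp n"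
      unfolding Eo_append Eo_single using A2_even n1
      by (simp add: eV_eq tl_wt_def lwt_eq T_def y_def xp_def)
    then have 1: "xp n = - (T * y 0 0)" using En by (simp add: eq_neg_iff_add_eq_0 add.commute)
    have 2: "(1 + Q)\<^sup>2 * r * y 0 0 = - (yp n + Q\<^sup>2 * xp n)"
      using antiD(6)[OF y A2_even] by (simp add: Q_def r_def xp_def yp_def)
    have "(1 + Q)\<^sup>2 * r * y 0 0 = (1 + Q) * r * (r * T) * y 0 0" unfolding T by (simp add: power2_eq_square algebra_simps)
    also have "\<dots> = - ((1 + Q) * Q * xp n)" unfolding 1 r(2) by (simp add: power2_eq_square algebra_simps)
    finally have "(1 + Q) * Q * xp n = yp n + Q\<^sup>2 * xp n" using 2 by simp
    then have "h n = (Q + 1) * xp n" by (simp add: h_def algebra_simps power2_eq_square)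
    then have "(A - B) * xp t = (Q + 1) * (A * xp t)" by (metis hn Xn mult.left_commute)
    then have "(Q * A + B) * xp t = 0" by (simp add: algebra_simps)
    moreover have "Q * A + B > 0" using Q AB by (simp add: add_pos_pos)
    ultimately show ?thesis by simp
  next
    case A2_odd_dagger
    have e: "int n - 1 = int (n - 1)" using n1 by simp
    have "inert n S" by (rule Sn)
    \<comment> \<open>The letters n-1, n are reached from -n, n and from n-1, 1-n, so primitivity
      expresses \<open>yp n\<close> by \<open>xp (n - 1)\<close>.\<close>
    have "Eo tp n n (\<lambda>v. x (P @ v @ S)) ([int n - 1] @ [int n]) = inverse Q * yp n + xp (n - 1)"
      unfolding Eo_append Eo_single using A2_odd_dagger n1
      by (simp add: eV_eq tl_wt_def lwt_eq y_def xp_def yp_def Q_def of_nat_diff)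
    then have "inverse Q * yp n + xp (n - 1) = 0" using En by simp
    then have "yp n = - Q * xp (n - 1)" using Q by (simp add: field_simps eq_neg_iff_add_eq_0)
    moreover have "xp n = - Q * xp (n - 1)" using Xstep[of "n - 1"] t n1 by simp
    ultimately have "h n = 2 * xp n" by (simp add: h_def)
    then have "(A - B) * xp t = 2 * (A * xp t)" by (metis hn Xn mult.left_commute)
    then have "(A + B) * xp t = 0" by (simp add: algebra_simps)
    then show ?thesis using AB by (simp add: add_pos_pos less_imp_neq[symmetric])
  qed (use tp in simp)
  then show ?thesis using Xt by (simp add: g_def)
qed

section \<open>The possible highest weights\<close>

definition highest :: "weight set" where
  "highest = (if tp = A2_odd then {omega s | s. s \<le> k \<and> even (k - s)}
     else if tp = A2_odd_dagger \<and> k = n then {omega n, omega_bar n} else {omega k})"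

text \<open>A word at which a primitive vector of the given weight cannot vanish.\<close>

definition base_word :: "weight \<Rightarrow> int list" where
  "base_word \<mu> = wrd [] 1
     (if \<mu> n = - 1 then replicate (n - 1) (True, False) @ [(False, True)]
      else let s = nat (\<Sum>m\<in>{1..n}. \<mu> m); m = (k - s) div 2
        in replicate s (True, False) @ dup (replicate m True @ replicate (n - s - m) False))"

lemma sum_omega: "s \<le> n \<Longrightarrow> (\<Sum>m\<in>{1..n}. omega s m) = int s"
proof -
  assume "s \<le> n"
  then have "(\<Sum>m\<in>{1..n}. omega s m) = (\<Sum>m\<in>{1..s}. 1)"
    by (intro sum.mono_neutral_cong_right) (auto simp: omega_eq)
  then show ?thesis by simp
qed

lemma base_word_omega:
  "s \<le> n \<Longrightarrow> base_word (omega s) = wrd [] 1 (replicate s (True, False) @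
     dup (replicate ((k - s) div 2) True @ replicate (n - s - (k - s) div 2) False))"
  using omega_eq[of s n] by (simp add: base_word_def sum_omega Let_def)

lemma base_word_omega_bar: "base_word (omega_bar n) = wrd [] 1 (replicate (n - 1) (True, False) @ [(False, True)])"
  using n1 by (simp add: base_word_def omega_bar_eq)

text \<open>A dominant increasing word in the support sorts to the base word without changing
  whether the coefficient vanishes. Nonvanishing at this fixed word later shows that primitive
  vectors of one weight are proportional.\<close>

lemma classification:
  assumes x: "x \<in> Anti" "prim x" "homog b x" "x \<noteq> 0" and k: "k \<le> n"
  shows "\<exists>\<mu>\<in>highest. (\<forall>i\<in>{1..n}. b i = q tp powi inner_wt n (simple_root tp n i) \<mu>) \<and> x (base_word \<mu>) \<noteq> 0"
proof -
  obtain z \<tau> where z: "x (wrd z 1 \<tau>) \<noteq> 0" "length \<tau> = n" "z = [] \<or> (z = [0] \<and> tp = A2_even)" "length (wrd z 1 \<tau>) = k"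
    and b: "\<And>i. i \<in> {1..n} \<Longrightarrow> b i = q tp powi inner_wt n (simple_root tp n i) (\<lambda>m. blk (\<tau> ! (m - 1)))"
    and dom: "\<And>i. i \<in> {1..n} \<Longrightarrow> 0 \<le> inner_wt n (simple_root tp n i) (\<lambda>m. blk (\<tau> ! (m - 1)))"
    using leading_word[OF x] by metis
  have z': "z = [] \<or> z = [0]" using z(3) by blast
  from dominant_blocks[OF z(2) dom] consider
    (om) s where "s \<le> n" "\<forall>m\<in>{1..n}. blk (\<tau> ! (m - 1)) = omega s m"
    | (bar) "tp = A2_odd_dagger" "\<forall>m\<in>{1..n}. blk (\<tau> ! (m - 1)) = omega_bar n m" by blast
  then show ?thesis
  proof cases
    case (om s)
    obtain \<beta> where \<beta>: "\<tau> = replicate s (True, False) @ dup \<beta>" "length \<beta> = n - s"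
      using omega_form[OF z(2) om(1)] om(2) by blast
    define m where "m = length (filter id \<beta>)"
    have len: "length z + s + 2 * m = k" using z(4) length_dup_word[of z 1 s \<beta>] by (simp add: \<beta>(1) m_def)
    have nz: "x (wrd z 1 (replicate s (True, False) @ dup (replicate m True @ replicate (n - s - m) False))) \<noteq> 0"
      using prim_sorted[OF x(2) z', of s \<beta> m] z(1) \<beta> om(1) by (auto simp: m_def)
    have z0: "z = []"
    proof (rule ccontr)
      assume "z \<noteq> []"
      then have "z = [0]" "tp = A2_even" using z(3) by auto
      \<comment> \<open>A letter 0 makes k equal to 1 + s + 2m, so k \<le> n leaves the free letter
        that \<open>no_zero\<close> needs.\<close>
      then show False using no_zero[OF x(2), of s m] nz len k by simp
    qed
    have mk: "m = (k - s) div 2" "s \<le> k" "even (k - s)" using len z0 by auto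
    have "omega s \<in> highest"
    proof (cases "tp = A2_odd")
      case True
      then show ?thesis unfolding highest_def using mk by auto
    next
      case False
      have "\<not> 1 \<le> m" using no_pairs[OF x(1,2) False, of s m] nz len k z0 by auto
      then have "s = k" using len z0 by simp
      then show ?thesis unfolding highest_def using False by auto
    qed
    moreover have "x (base_word (omega s)) \<noteq> 0" using nz z0 mk(1) om(1) by (simp add: base_word_omega)
    moreover have "\<forall>i\<in>{1..n}. b i = q tp powi inner_wt n (simple_root tp n i) (omega s)"
      using b inner_wt_cong[of n "\<lambda>m. blk (\<tau> ! (m - 1))" "omega s"] om(2) by metis
    ultimately show ?thesis by blast
  next
    case bar
    have b': "blk (\<tau> ! i) = omega_bar n (Suc i)" if "i < n" for i using bar(2) that by (auto dest: bspec[of _ _ "Suc i"])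
    have \<tau>: "\<tau> = replicate (n - 1) (True, False) @ [(False, True)]"
    proof (rule nth_equalityI)
      fix i assume "i < length \<tau>"
      then have i: "i < n" using z(2) by simp
      show "\<tau> ! i = (replicate (n - 1) (True, False) @ [(False, True)]) ! i"
      proof (cases "i < n - 1")
        case True
        then have "blk (\<tau> ! i) = 1" using b'[OF i] n1 by (simp add: omega_bar_eq)
        then show ?thesis using True by (simp add: blk_cases nth_append)
      next
        case False
        then have "Suc i = n" using i by simp
        then have "blk (\<tau> ! i) = - 1" using b'[OF i] n1 by (simp add: omega_bar_eq)
        moreover have "i = n - 1" using \<open>Suc i = n\<close> by simp
        ultimately show ?thesis by (simp add: blk_cases nth_append)
      qed
    qed (use z(2) n1 in simp)
    have z0: "z = []" using z(3) bar(1) by auto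
    have "k = n" using z(4) n1 unfolding length_wrd z0 \<tau> by (simp add: sum_list_replicate)
    then have "omega_bar n \<in> highest" unfolding highest_def using bar(1) by simp
    moreover have "x (base_word (omega_bar n)) \<noteq> 0" using z(1) z0 \<tau> by (simp add: base_word_omega_bar)
    moreover have "\<forall>i\<in>{1..n}. b i = q tp powi inner_wt n (simple_root tp n i) (omega_bar n)"
      using b inner_wt_cong[of n "\<lambda>m. blk (\<tau> ! (m - 1))" "omega_bar n"] bar(2) by metis
    ultimately show ?thesis by blast
  qed
qed

end

subsection \<open>The quantum exterior algebra\<close>

text \<open>The quantum exterior algebra of type \<open>A2_odd\<close> has a basis indexed by the increasing words,
  here lists of pairs; the letter \<open>a\<close> acts by left multiplication, and \<open>ext_letter\<close> is the
  transposed action on functions of the basis.  Likewise \<open>ext_pairing\<close> stems from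
  \<open>v\<^sub>1 v\<^sub>-\<^sub>1 + v\<^sub>-\<^sub>1 v\<^sub>1\<close>.\<close>

primrec ext_pairing :: "K \<Rightarrow> ((bool \<times> bool) list \<Rightarrow> K) \<Rightarrow> (bool \<times> bool) list \<Rightarrow> K" where
  "ext_pairing Q \<phi> [] = 0"
| "ext_pairing Q \<phi> (c # \<tau>) = (if snd c then inverse Q * inverse Q else 1) * (- Q * ext_pairing Q (\<lambda>\<sigma>. \<phi> (c # \<sigma>)) \<tau>)
     + (if c = (False, False) then (1 - Q * Q) * \<phi> ((True, True) # \<tau>) else 0)"

text \<open>Basis monomials place 1 and -1 side by side in front of the rest, which is a monomial of
  lower rank. A letter a other than 1, -1 picks up -Q on passing 1 and the inverse of -Q on passing
  -1.\<close>

definition ext_factor :: "K \<Rightarrow> bool \<times> bool \<Rightarrow> K" where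
  "ext_factor Q c = (if fst c then - Q else 1) * (if snd c then - inverse Q else 1)"

primrec ext_letter :: "K \<Rightarrow> int \<Rightarrow> ((bool \<times> bool) list \<Rightarrow> K) \<Rightarrow> (bool \<times> bool) list \<Rightarrow> K" where
  "ext_letter Q a \<phi> [] = 0"
| "ext_letter Q a \<phi> (c # \<tau>) =
    (if a = 1 then (if fst c then 0 else \<phi> ((True, snd c) # \<tau>))
     else if a = - 1 then
       (if fst c then
          (if snd c then inverse Q * inverse Q * (- Q * ext_pairing Q (\<lambda>\<sigma>. \<phi> ((False, True) # \<sigma>)) \<tau>)
           else - (Q * Q) * \<phi> ((True, True) # \<tau>) + - Q * ext_pairing Q (\<lambda>\<sigma>. \<phi> ((False, False) # \<sigma>)) \<tau>)
        else if snd c then 0 else \<phi> ((False, True) # \<tau>))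
     else ext_factor Q c * ext_letter Q (a - sgn a) (\<lambda>\<sigma>. \<phi> (c # \<sigma>)) \<tau>)"

lemma ext_pairing_lin:
  "(\<And>\<sigma>. length \<sigma> = length \<tau> \<Longrightarrow> \<phi> \<sigma> = k * \<psi> \<sigma> + l * \<chi> \<sigma>) \<Longrightarrow>
    ext_pairing Q \<phi> \<tau> = k * ext_pairing Q \<psi> \<tau> + l * ext_pairing Q \<chi> \<tau>"
proof (induction \<tau> arbitrary: \<phi> \<psi> \<chi>)
  case (Cons c \<tau>)
  have "ext_pairing Q (\<lambda>\<sigma>. \<phi> (d # \<sigma>)) \<tau> = k * ext_pairing Q (\<lambda>\<sigma>. \<psi> (d # \<sigma>)) \<tau> + l * ext_pairing Q (\<lambda>\<sigma>. \<chi> (d # \<sigma>)) \<tau>" for d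
    by (rule Cons.IH) (use Cons.prems in simp)
  then show ?case using Cons.prems by (simp add: algebra_simps)
qed simp

lemma ext_letter_lin:
  "(\<And>\<sigma>. length \<sigma> = length \<tau> \<Longrightarrow> \<phi> \<sigma> = k * \<psi> \<sigma> + l * \<chi> \<sigma>) \<Longrightarrow>
    ext_letter Q a \<phi> \<tau> = k * ext_letter Q a \<psi> \<tau> + l * ext_letter Q a \<chi> \<tau>"
proof (induction \<tau> arbitrary: a \<phi> \<psi> \<chi>)
  case (Cons c \<tau>)
  have 1: "ext_letter Q a (\<lambda>\<sigma>. \<phi> (d # \<sigma>)) \<tau> = k * ext_letter Q a (\<lambda>\<sigma>. \<psi> (d # \<sigma>)) \<tau> + l * ext_letter Q a (\<lambda>\<sigma>. \<chi> (d # \<sigma>)) \<tau>" for a d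
    by (rule Cons.IH) (use Cons.prems in simp)
  have 2: "ext_pairing Q (\<lambda>\<sigma>. \<phi> (d # \<sigma>)) \<tau> = k * ext_pairing Q (\<lambda>\<sigma>. \<psi> (d # \<sigma>)) \<tau> + l * ext_pairing Q (\<lambda>\<sigma>. \<chi> (d # \<sigma>)) \<tau>" for d
    by (rule ext_pairing_lin) (use Cons.prems in simp)
  show ?case using Cons.prems by (simp add: 1 2 algebra_simps)
qed simp

lemma ext_smul [simp]:
  "ext_pairing Q (\<lambda>\<sigma>. k * \<phi> \<sigma>) \<tau> = k * ext_pairing Q \<phi> \<tau>"
  "ext_letter Q a (\<lambda>\<sigma>. k * \<phi> \<sigma>) \<tau> = k * ext_letter Q a \<phi> \<tau>"
  using ext_pairing_lin[of \<tau> "\<lambda>\<sigma>. k * \<phi> \<sigma>" k \<phi> 0 \<phi> Q] ext_letter_lin[of \<tau> "\<lambda>\<sigma>. k * \<phi> \<sigma>" k \<phi> 0 \<phi> Q a] by simp_all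

lemma ext_zero [simp]: "ext_pairing Q (\<lambda>\<sigma>. 0) \<tau> = 0" "ext_letter Q a (\<lambda>\<sigma>. 0) \<tau> = 0"
  using ext_smul(1)[of Q 0 "\<lambda>_. 0" \<tau>] ext_smul(2)[of Q a 0 "\<lambda>_. 0" \<tau>] by simp_all

lemma ext_add [simp]:
  "ext_pairing Q (\<lambda>\<sigma>. \<phi> \<sigma> + \<psi> \<sigma>) \<tau> = ext_pairing Q \<phi> \<tau> + ext_pairing Q \<psi> \<tau>"
  "ext_letter Q a (\<lambda>\<sigma>. \<phi> \<sigma> + \<psi> \<sigma>) \<tau> = ext_letter Q a \<phi> \<tau> + ext_letter Q a \<psi> \<tau>"
  using ext_pairing_lin[of \<tau> "\<lambda>\<sigma>. \<phi> \<sigma> + \<psi> \<sigma>" 1 \<phi> 1 \<psi> Q] ext_letter_lin[of \<tau> "\<lambda>\<sigma>. \<phi> \<sigma> + \<psi> \<sigma>" 1 \<phi> 1 \<psi> Q a] by simp_all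

lemma ext_uminus [simp]:
  "ext_pairing Q (\<lambda>\<sigma>. - \<phi> \<sigma>) \<tau> = - ext_pairing Q \<phi> \<tau>"
  "ext_letter Q a (\<lambda>\<sigma>. - \<phi> \<sigma>) \<tau> = - ext_letter Q a \<phi> \<tau>"
  using ext_smul(1)[of Q "- 1" \<phi> \<tau>] ext_smul(2)[of Q a "- 1" \<phi> \<tau>] by simp_all

lemma ext_divide [simp]:
  "ext_pairing Q (\<lambda>\<sigma>. \<phi> \<sigma> / k) \<tau> = ext_pairing Q \<phi> \<tau> / k"
  "ext_letter Q a (\<lambda>\<sigma>. \<phi> \<sigma> / k) \<tau> = ext_letter Q a \<phi> \<tau> / k"
  using ext_smul(1)[of Q "inverse k" \<phi> \<tau>] ext_smul(2)[of Q a "inverse k" \<phi> \<tau>]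
  by (simp_all add: divide_inverse mult.commute)

lemma ext_diff [simp]:
  "ext_pairing Q (\<lambda>\<sigma>. \<phi> \<sigma> - \<psi> \<sigma>) \<tau> = ext_pairing Q \<phi> \<tau> - ext_pairing Q \<psi> \<tau>"
  "ext_letter Q a (\<lambda>\<sigma>. \<phi> \<sigma> - \<psi> \<sigma>) \<tau> = ext_letter Q a \<phi> \<tau> - ext_letter Q a \<psi> \<tau>"
  using ext_add(1)[of Q \<phi> "\<lambda>\<sigma>. - \<psi> \<sigma>" \<tau>] ext_add(2)[of Q a \<phi> "\<lambda>\<sigma>. - \<psi> \<sigma>" \<tau>] by simp_all

lemma ext_letter_0 [simp]: "ext_letter Q 0 \<phi> \<tau> = 0"
  by (induction \<tau> arbitrary: \<phi>) simp_all

lemma ext_letter_long: "\<bar>a\<bar> > int (length \<tau>) \<Longrightarrow> ext_letter Q a \<phi> \<tau> = 0"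
proof (induction \<tau> arbitrary: a \<phi>)
  case (Cons c \<tau>)
  then have "\<bar>a - sgn a\<bar> > int (length \<tau>)" by (auto simp: sgn_if)
  moreover have "a \<noteq> 1" "a \<noteq> - 1" using Cons.prems by auto
  ultimately show ?case by (simp add: Cons.IH)
qed simp

text \<open>The element \<open>v\<^sub>1 v\<^sub>-\<^sub>1 + v\<^sub>-\<^sub>1 v\<^sub>1\<close> is
  central; this is the transposed statement.\<close>

lemma ext_pairing_letter:
  assumes "Q \<noteq> 0"
  shows "ext_pairing Q (ext_letter Q a \<phi>) \<tau> = ext_letter Q a (ext_pairing Q \<phi>) \<tau>"
proof (induction \<tau> arbitrary: a \<phi>)
  case (Cons c \<tau>)
  have cases: "c = (False, False) \<or> c = (False, True) \<or> c = (True, False) \<or> c = (True, True)" by (cases c) auto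
  consider "a = 1" | "a = - 1" | "a \<noteq> 1" "a \<noteq> - 1" by blast
  then show ?case
  proof cases
    case 1
    then show ?thesis using cases by (elim disjE) (simp_all add: algebra_simps)
  next
    case 2
    then show ?thesis using cases assms by (elim disjE) (simp_all add: field_simps)
  next
    case 3
    then show ?thesis using cases assms by (elim disjE) (simp_all add: Cons.IH ext_factor_def field_simps)
  qed
qed simp

lemma ext_letter_square:
  assumes "Q \<noteq> 0"
  shows "ext_letter Q a (ext_letter Q a \<phi>) \<tau> = 0"
proof (induction \<tau> arbitrary: a \<phi>)
  case (Cons c \<tau>)
  consider "a = 1" | "a = - 1" | "a \<noteq> 1" "a \<noteq> - 1" by blast
  then show ?case
  proof cases
    case 2
    then show ?thesis using assms by (cases c) (auto simp: field_simps)
  qed (simp_all add: Cons.IH)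
qed simp

text \<open>If neither letter is 1 or -1, the shift reduces to lower rank. A letter 1 is immediate;
  a letter -1 involves the pairing of the tail and needs its centrality.\<close>

lemma ext_letter_commute:
  assumes Q: "Q \<noteq> 0"
  shows "c \<noteq> 0 \<Longrightarrow> d \<noteq> 0 \<Longrightarrow> c \<noteq> - d \<Longrightarrow> (c > 0 \<and> (c < d \<or> d < 0)) \<or> (c < d \<and> d < 0) \<Longrightarrow>
    ext_letter Q c (ext_letter Q d \<phi>) \<tau> = - Q * ext_letter Q d (ext_letter Q c \<phi>) \<tau>"
proof (induction \<tau> arbitrary: c d \<phi>)
  case (Cons b \<tau>)
  have cases: "b = (False, False) \<or> b = (False, True) \<or> b = (True, False) \<or> b = (True, True)" by (cases b) auto
  consider "c = 1" "d \<noteq> 1" "d \<noteq> - 1" | "d = - 1" "c \<noteq> 1" "c \<noteq> - 1" | "c \<noteq> 1" "c \<noteq> - 1" "d \<noteq> 1" "d \<noteq> - 1"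
    using Cons.prems by force
  then show ?case
  proof cases
    case 1
    then show ?thesis using cases Q by (elim disjE) (simp_all add: ext_factor_def field_simps)
  next
    case 2
    then show ?thesis using cases Q
      by (elim disjE) (simp_all add: ext_factor_def ext_pairing_letter[OF Q] field_simps)
  next
    case 3
    have s: "c - sgn c = (if c > 0 then c - 1 else c + 1)" "d - sgn d = (if d > 0 then d - 1 else d + 1)"
      using Cons.prems by (simp_all add: sgn_if)
    have "ext_letter Q (c - sgn c) (ext_letter Q (d - sgn d) \<psi>) \<tau> = - Q * ext_letter Q (d - sgn d) (ext_letter Q (c - sgn c) \<psi>) \<tau>" for \<psi>
      unfolding s by (rule Cons.IH) (use Cons.prems 3 in \<open>auto split: if_splits\<close>)
    then show ?thesis using 3 by simp
  qed
qed simp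

lemma ext_pairing_eq:
  assumes "Q \<noteq> 0"
  shows "ext_letter Q 1 (ext_letter Q (- 1) \<phi>) \<tau> + ext_letter Q (- 1) (ext_letter Q 1 \<phi>) \<tau> = ext_pairing Q \<phi> \<tau>"
proof (cases \<tau>)
  case (Cons c \<sigma>)
  then show ?thesis using assms by (cases c) (auto simp: field_simps)
qed simp

text \<open>At j = 1 the right side contains the pairing of the lower rank, which is how the action
  of -1 on a leading 1 was defined; for larger j the relation is shifted from lower rank.\<close>

lemma ext_letter_chain:
  assumes Q: "Q \<noteq> 0"
  shows "1 \<le> j \<Longrightarrow> ext_letter Q j (ext_letter Q (- j) \<phi>) \<tau> + Q\<^sup>2 * ext_letter Q (- j) (ext_letter Q j \<phi>) \<tau>
    = - Q * (ext_letter Q (j + 1) (ext_letter Q (- j - 1) \<phi>) \<tau> + ext_letter Q (- j - 1) (ext_letter Q (j + 1) \<phi>) \<tau>)"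
proof (induction \<tau> arbitrary: j \<phi>)
  case (Cons c \<tau>)
  have cases: "c = (False, False) \<or> c = (False, True) \<or> c = (True, False) \<or> c = (True, True)" by (cases c) auto
  have up: "ext_letter Q (j + 1) (ext_letter Q (- j - 1) \<phi>) (c # \<tau>) = ext_factor Q c * (ext_factor Q c * ext_letter Q j (ext_letter Q (- j) (\<lambda>\<sigma>. \<phi> (c # \<sigma>))) \<tau>)"
    "ext_letter Q (- j - 1) (ext_letter Q (j + 1) \<phi>) (c # \<tau>) = ext_factor Q c * (ext_factor Q c * ext_letter Q (- j) (ext_letter Q j (\<lambda>\<sigma>. \<phi> (c # \<sigma>))) \<tau>)"
    if "1 \<le> j" for j using that by (simp_all add: sgn_if)
  show ?case
  proof (cases "j = 1")
    case True
    have 1: "- Q * (ext_letter Q (j + 1) (ext_letter Q (- j - 1) \<phi>) (c # \<tau>) + ext_letter Q (- j - 1) (ext_letter Q (j + 1) \<phi>) (c # \<tau>))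
      = - Q * (ext_factor Q c * ext_factor Q c * ext_pairing Q (\<lambda>\<sigma>. \<phi> (c # \<sigma>)) \<tau>)"
      unfolding up[OF Cons.prems] unfolding True ext_pairing_eq[OF Q, symmetric] by (simp add: algebra_simps)
    have 2: "ext_letter Q j (ext_letter Q (- j) \<phi>) (c # \<tau>) + Q\<^sup>2 * ext_letter Q (- j) (ext_letter Q j \<phi>) (c # \<tau>)
      = - Q * (ext_factor Q c * ext_factor Q c * ext_pairing Q (\<lambda>\<sigma>. \<phi> (c # \<sigma>)) \<tau>)"
      unfolding True using cases Q by (elim disjE) (simp_all add: ext_factor_def field_simps power2_eq_square)
    show ?thesis by (rule trans[OF 2 1[symmetric]])
  next
    case False
    then have j: "1 \<le> j - 1" using Cons.prems by simp
    have IH: "ext_letter Q (j - 1) (ext_letter Q (- (j - 1)) (\<lambda>\<sigma>. \<phi> (c # \<sigma>))) \<tau> + Q\<^sup>2 * ext_letter Q (- (j - 1)) (ext_letter Q (j - 1) (\<lambda>\<sigma>. \<phi> (c # \<sigma>))) \<tau>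
      = - Q * (ext_letter Q j (ext_letter Q (- j) (\<lambda>\<sigma>. \<phi> (c # \<sigma>))) \<tau> + ext_letter Q (- j) (ext_letter Q j (\<lambda>\<sigma>. \<phi> (c # \<sigma>))) \<tau>)"
      using Cons.IH[OF j, of "\<lambda>\<sigma>. \<phi> (c # \<sigma>)"] by simp
    have "ext_letter Q j (ext_letter Q (- j) \<phi>) (c # \<tau>) + Q\<^sup>2 * ext_letter Q (- j) (ext_letter Q j \<phi>) (c # \<tau>)
      = ext_factor Q c * ext_factor Q c * (ext_letter Q (j - 1) (ext_letter Q (- (j - 1)) (\<lambda>\<sigma>. \<phi> (c # \<sigma>))) \<tau> + Q\<^sup>2 * ext_letter Q (- (j - 1)) (ext_letter Q (j - 1) (\<lambda>\<sigma>. \<phi> (c # \<sigma>))) \<tau>)"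
      using up[OF j] by (simp add: algebra_simps)
    also have "\<dots> = ext_factor Q c * ext_factor Q c * (- Q * (ext_letter Q j (ext_letter Q (- j) (\<lambda>\<sigma>. \<phi> (c # \<sigma>))) \<tau> + ext_letter Q (- j) (ext_letter Q j (\<lambda>\<sigma>. \<phi> (c # \<sigma>))) \<tau>))"
      unfolding IH ..
    finally show ?thesis unfolding up[OF Cons.prems] by (simp add: algebra_simps)
  qed
qed simp

section \<open>Functionals on the exterior algebra as vectors on words\<close>

definition ext_word :: "K \<Rightarrow> int list \<Rightarrow> ((bool \<times> bool) list \<Rightarrow> K) \<Rightarrow> (bool \<times> bool) list \<Rightarrow> K" where
  "ext_word Q w = fold (ext_letter Q) w"

lemma ext_word_simps [simp]: "ext_word Q [] \<phi> = \<phi>" "ext_word Q (a # w) \<phi> = ext_word Q w (ext_letter Q a \<phi>)"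
  "ext_word Q (u @ w) \<phi> = ext_word Q w (ext_word Q u \<phi>)"
  by (simp_all add: ext_word_def)

lemma ext_word_lin:
  "(\<And>\<sigma>. length \<sigma> = length \<tau> \<Longrightarrow> \<phi> \<sigma> = k * \<psi> \<sigma> + l * \<chi> \<sigma>) \<Longrightarrow>
    ext_word Q w \<phi> \<tau> = k * ext_word Q w \<psi> \<tau> + l * ext_word Q w \<chi> \<tau>"
proof (induction w arbitrary: \<phi> \<psi> \<chi>)
  case (Cons a w)
  have "ext_letter Q a \<phi> \<sigma> = k * ext_letter Q a \<psi> \<sigma> + l * ext_letter Q a \<chi> \<sigma>" if "length \<sigma> = length \<tau>" for \<sigma>
    by (rule ext_letter_lin) (use Cons.prems that in simp)
  from Cons.IH[OF this] show ?case by simp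
qed simp

lemma ext_letter_shift:
  "a \<noteq> 0 \<Longrightarrow> ext_letter Q (a + sgn a) \<phi> (c # \<tau>) = ext_factor Q c * ext_letter Q a (\<lambda>\<sigma>. \<phi> (c # \<sigma>)) \<tau>"
  by (cases "a > 0") simp_all

lemma ext_word_shift:
  "0 \<notin> set w \<Longrightarrow> ext_word Q (map (\<lambda>a. a + sgn a) w) \<phi> (c # \<tau>)
    = ext_factor Q c ^ length w * ext_word Q w (\<lambda>\<sigma>. \<phi> (c # \<sigma>)) \<tau>"
proof (induction w arbitrary: \<phi>)
  case (Cons a w)
  have "ext_word Q w (\<lambda>\<sigma>. ext_letter Q (a + sgn a) \<phi> (c # \<sigma>)) \<tau>
    = ext_factor Q c * ext_word Q w (ext_letter Q a (\<lambda>\<sigma>. \<phi> (c # \<sigma>))) \<tau> + 0 * ext_word Q w \<phi> \<tau>"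
    by (rule ext_word_lin) (use Cons.prems ext_letter_shift in simp)
  then show ?case using Cons by simp
qed simp

lemma wrd_shift: "1 \<le> j \<Longrightarrow> wrd [] (j + 1) \<tau> = map (\<lambda>a. a + sgn a) (wrd [] j \<tau>)"
proof (induction \<tau> arbitrary: j)
  case (Cons c \<tau>)
  have "wrd [] (j + 1 + 1) \<tau> = map (\<lambda>a. a + sgn a) (wrd [] (j + 1) \<tau>)" by (rule Cons.IH) (use Cons.prems in simp)
  then show ?case using Cons.prems by (cases c) simp
qed simp

text \<open>An increasing word has -1 at its end, the basis monomial right behind 1; this is the
  product of the factors from moving the negative letters.\<close>

primrec ext_norm :: "K \<Rightarrow> (bool \<times> bool) list \<Rightarrow> K" where
  "ext_norm Q [] = 1"
| "ext_norm Q (c # \<tau>) = ext_factor Q (False, snd c) ^ length (wrd [] 1 \<tau>) * ext_norm Q \<tau>"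

lemma ext_norm_nz: "Q \<noteq> 0 \<Longrightarrow> ext_norm Q \<tau> \<noteq> 0"
  by (induction \<tau>) (simp_all add: ext_factor_def)

text \<open>Applied to the empty monomial, an increasing word gives a nonzero multiple of its own
  basis monomial. So coefficients at increasing words can be prescribed freely.\<close>

lemma ext_word_wrd: "ext_word Q (wrd [] 1 \<tau>) \<phi> (replicate (length \<tau>) (False, False)) = ext_norm Q \<tau> * \<phi> \<tau>"
proof (induction \<tau> arbitrary: \<phi>)
  case (Cons c \<tau>)
  obtain a b where c: "c = (a, b)" by fastforce
  have z: "0 \<notin> set (wrd [] 1 \<tau>)" using wrd_bounds[of 1 0 "[]" \<tau>] by auto
  let ?r = "replicate (length \<tau>) (False, False)"
  define \<psi> where "\<psi> = ext_word Q (if a then [1] else []) \<phi>"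
  have "ext_word Q (wrd [] 1 (c # \<tau>)) \<phi> (replicate (length (c # \<tau>)) (False, False))
    = ext_word Q (if b then [- 1] else []) (ext_word Q (wrd [] (1 + 1) \<tau>) \<psi>) ((False, False) # ?r)"
    by (simp add: c \<psi>_def)
  also have "\<dots> = ext_word Q (wrd [] (1 + 1) \<tau>) \<psi> ((False, b) # ?r)" by simp
  also have "\<dots> = ext_factor Q (False, b) ^ length (wrd [] 1 \<tau>) * ext_word Q (wrd [] 1 \<tau>) (\<lambda>\<sigma>. \<psi> ((False, b) # \<sigma>)) ?r"
    by (subst wrd_shift) (simp_all only: ext_word_shift[OF z] order_refl)
  also have "\<dots> = ext_norm Q (c # \<tau>) * \<psi> ((False, b) # \<tau>)" by (simp add: Cons.IH c)
  also have "\<psi> ((False, b) # \<tau>) = \<phi> (c # \<tau>)" by (simp add: \<psi>_def c)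
  finally show ?case .
qed simp

context tensor_power
begin

text \<open>The functional on the exterior algebra, cut down to weight \<mu>, whose values at
  increasing words are f; the division compensates \<open>ext_norm\<close>.\<close>

definition ext_vector :: "weight \<Rightarrow> ((bool \<times> bool) list \<Rightarrow> K) \<Rightarrow> int list \<Rightarrow> K" where
  "ext_vector \<mu> f w = (if w \<in> words tp n k \<and> (\<forall>m\<in>{1..n}. wt w m = \<mu> m)
     then ext_word (q tp) w (\<lambda>\<tau>. f \<tau> / ext_norm (q tp) \<tau>) (replicate n (False, False)) else 0)"

lemma ext_vector_wrd:
  assumes "length \<tau> = n"
  shows "ext_vector \<mu> f (wrd [] 1 \<tau>) = (if wrd [] 1 \<tau> \<in> words tp n k \<and> (\<forall>m\<in>{1..n}. wt (wrd [] 1 \<tau>) m = \<mu> m) then f \<tau> else 0)"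
  using ext_word_wrd[of "q tp" \<tau>] ext_norm_nz[of "q tp" \<tau>] assms by (simp add: ext_vector_def)

text \<open>Opposite letters cancel and 0 does not count, so equality excludes both.\<close>

lemma sum_abs_wt: "(\<Sum>m\<in>{1..n}. \<bar>wt w m\<bar>) \<le> int (length w)"
proof (induction w)
  case (Cons a w)
  have "(\<Sum>m\<in>{1..n}. \<bar>idx_wt a m\<bar>) \<le> (\<Sum>m\<in>{1..n}. if m = nat \<bar>a\<bar> then 1 else 0)"
    by (intro sum_mono) (auto simp: idx_wt_def sgn_if)
  moreover have "(\<Sum>m\<in>{1..n}. if m = nat \<bar>a\<bar> then 1 else 0 :: int) \<le> 1" by simp
  ultimately have "(\<Sum>m\<in>{1..n}. \<bar>idx_wt a m\<bar>) \<le> 1" by (rule order_trans)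
  moreover have "(\<Sum>m\<in>{1..n}. \<bar>wt (a # w) m\<bar>) \<le> (\<Sum>m\<in>{1..n}. \<bar>idx_wt a m\<bar> + \<bar>wt w m\<bar>)"
    by (intro sum_mono) simp
  ultimately show ?case using Cons by (simp add: sum.distrib)
qed simp

text \<open>In type \<open>A2_odd\<close> the conditions are the relations of the exterior algebra.
  In the other types the assumption on \<mu> excludes opposite letters and 0, so the conditions at
  opposite pairs hold because every coefficient involved is 0.\<close>

lemma ext_vector_Anti:
  assumes \<mu>: "tp = A2_odd \<or> (\<Sum>m\<in>{1..n}. \<bar>\<mu> m\<bar>) = int k"
  shows "ext_vector \<mu> f \<in> Anti"
proof -
  define Q where "Q = q tp"
  have Q: "Q \<noteq> 0" by (simp add: Q_def)
  have "ext_vector \<mu> f \<in> Car" by (auto simp: supported_def ext_vector_def)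
  moreover have "anti tp n (\<lambda>a b. ext_vector \<mu> f (p @ [a, b] @ s))" for p s
  proof -
    define \<psi> where "\<psi> = ext_word Q p (\<lambda>\<tau>. f \<tau> / ext_norm Q \<tau>)"
    define r where "r = replicate n (False, False)"
    define Y where "Y a b = ext_word Q s (ext_letter Q b (ext_letter Q a \<psi>)) r" for a b
    define A where "A a b \<longleftrightarrow> p @ [a, b] @ s \<in> words tp n k \<and> (\<forall>m\<in>{1..n}. wt (p @ [a, b] @ s) m = \<mu> m)" for a b
    define y where "y a b = ext_vector \<mu> f (p @ [a, b] @ s)" for a b
    have y: "y a b = (if A a b then Y a b else 0)" for a b
      by (simp add: y_def ext_vector_def A_def Y_def \<psi>_def Q_def r_def)
    have Asym: "A a b = A b a" for a b
      unfolding A_def by (simp add: words_def add.left_commute insert_commute)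
    have Aopp: "A (- a) a = A (- b) b" if "a \<in> idx tp n" "b \<in> idx tp n" for a b
    proof -
      have "- a \<in> idx tp n" "- b \<in> idx tp n" using that by (auto simp: idx_iff)
      then show ?thesis using that unfolding A_def by (simp add: words_def idx_wt_uminus)
    qed
    have sq: "Y a a = 0" for a
    proof -
      have "Y a a = 0 * ext_word Q s \<psi> r + 0 * ext_word Q s \<psi> r"
        unfolding Y_def by (rule ext_word_lin) (simp add: ext_letter_square[OF Q])
      then show ?thesis by simp
    qed
    have z0: "Y a 0 = 0" "Y 0 a = 0" for a
    proof -
      have "Y a 0 = 0 * ext_word Q s \<psi> r + 0 * ext_word Q s \<psi> r"
        unfolding Y_def by (rule ext_word_lin) simp
      then show "Y a 0 = 0" by simp
      have "ext_letter Q 0 \<psi> = (\<lambda>_. 0)" by (simp add: fun_eq_iff)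
      then have "Y 0 a = 0 * ext_word Q s \<psi> r + 0 * ext_word Q s \<psi> r"
        unfolding Y_def by (intro ext_word_lin) simp
      then show "Y 0 a = 0" by simp
    qed
    have sw: "Y d c = - Q * Y c d" if cd: "c \<in> idx tp n" "d \<in> idx tp n" "prec n c d" "c \<noteq> - d" for c d
    proof (cases "c = 0 \<or> d = 0")
      case False
      then have "(c > 0 \<and> (c < d \<or> d < 0)) \<or> (c < d \<and> d < 0)"
        using cd by (auto simp: prec_def idx_pos_def idx_iff split: if_splits)
      then have "Y d c = (- Q) * Y c d + 0 * Y c d"
        unfolding Y_def by (intro ext_word_lin) (use ext_letter_commute[OF Q, of c d] False cd(4) in simp)
      then show ?thesis by simp
    qed (auto simp: z0)
    have chain: "Y (- j) j + Q\<^sup>2 * Y j (- j) = - Q * (Y (- j - 1) (j + 1) + Y (j + 1) (- j - 1))" if "1 \<le> j" for j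
    proof -
      let ?L = "\<lambda>a b. ext_letter Q b (ext_letter Q a \<psi>)"
      have 1: "ext_word Q s (\<lambda>\<sigma>. k * \<phi> \<sigma> + l * \<chi> \<sigma>) r = k * ext_word Q s \<phi> r + l * ext_word Q s \<chi> r" for k l \<phi> \<chi>
        by (rule ext_word_lin) simp
      have "(\<lambda>\<sigma>. 1 * ?L (- j) j \<sigma> + Q\<^sup>2 * ?L j (- j) \<sigma>) = (\<lambda>\<sigma>. - Q * ?L (- j - 1) (j + 1) \<sigma> + - Q * ?L (j + 1) (- j - 1) \<sigma>)"
        using ext_letter_chain[OF Q that, of \<psi>] by (simp add: fun_eq_iff algebra_simps)
      from arg_cong[OF this, of "\<lambda>\<phi>. ext_word Q s \<phi> r"] show ?thesis
        unfolding 1 Y_def by (simp add: algebra_simps)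
    qed
    \<comment> \<open>The chain relation at n, in which the letters n+1 and -n-1 act by
      zero.\<close>
    have top: "Y (- int n) (int n) + Q\<^sup>2 * Y (int n) (- int n) = 0"
    proof -
      have "Y (- int n - 1) (int n + 1) = 0 * ext_word Q s \<psi> r + 0 * ext_word Q s \<psi> r"
        unfolding Y_def by (rule ext_word_lin) (simp add: ext_letter_long r_def)
      moreover have "Y (int n + 1) (- int n - 1) = 0 * ext_word Q s \<psi> r + 0 * ext_word Q s \<psi> r"
        unfolding Y_def by (rule ext_word_lin) (simp add: ext_letter_long r_def)
      ultimately show ?thesis using chain[of "int n"] n1 by simp
    qed
    have no: "\<not> A a (- a)" if "tp \<noteq> A2_odd" for a
    proof
      assume A: "A a (- a)"
      have "wt (p @ s) m = \<mu> m" if "m \<in> {1..n}" for m using A that by (simp add: A_def idx_wt_uminus)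
      then have "(\<Sum>m\<in>{1..n}. \<bar>wt (p @ s) m\<bar>) = int k" using \<mu> \<open>tp \<noteq> A2_odd\<close> by (metis (no_types, lifting) sum.cong)
      moreover have "length (p @ s) < k" using A by (auto simp: A_def words_def)
      ultimately show False using sum_abs_wt[of "p @ s"] by simp
    qed
    have no': "\<not> A (- a) a" if "tp \<noteq> A2_odd" for a using no[OF that, of "- a"] by simp
    have no0: "\<not> A (- int n) (int n)" "\<not> A (int n) (- int n)" "\<not> A (- 1) 1" "\<not> A 1 (- 1)" "\<not> A 0 0" if "tp \<noteq> A2_odd"
      using no'[OF that] no[OF that] no[OF that, of 0] by auto
    have "anti tp n y" unfolding anti_def
    proof (intro conjI ballI allI impI)
      show "y c c = 0" for c by (simp add: y sq)
      show "y d c = - q tp * y c d" if "c \<in> idx tp n" "d \<in> idx tp n" "prec n c d \<and> c \<noteq> - d" for c d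
        using sw[OF that(1,2)] that(3) Asym[of c d] by (simp add: y Q_def)
      show "y (- j) j + (q tp)\<^sup>2 * y j (- j) = - q tp * (y (- j - 1) (j + 1) + y (j + 1) (- j - 1))" if j: "1 \<le> j \<and> j < int n" for j
      proof -
        have J: "j \<in> idx tp n" "j + 1 \<in> idx tp n" "- j \<in> idx tp n" using j by (auto simp: idx_iff)
        have "A j (- j) = A (- j) j" "A (- j - 1) (j + 1) = A (- j) j" "A (j + 1) (- j - 1) = A (- j) j"
          using Asym Aopp[OF J(2,1)] by simp_all
        then show ?thesis using chain[of j] j by (simp add: y Q_def)
      qed
      show "y (- int n) (int n) + (q tp)\<^sup>2 * y (int n) (- int n) = 0"
        using top Asym[of "int n" "- int n"] by (simp add: y Q_def)
      show "y (- 1) 1 + y 1 (- 1) = 0" if "tp \<noteq> A2_odd" using no0[OF that] by (simp add: y)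
      show "(1 + q tp)\<^sup>2 * indet * y 0 0 = - (y (- int n) (int n) + (q tp)\<^sup>2 * y (int n) (- int n))" if "tp = A2_even"
        using no0 that by (simp add: y)
    qed
    then show ?thesis by (simp add: y_def[abs_def])
  qed
  ultimately show ?thesis by (simp add: Anti_def)
qed

end

subsection \<open>Existence of the primitive vectors\<close>

context tensor_power
begin

text \<open>The first n-1 simple roots make the difference of the two weights constant, and the last
  one makes the constant zero.\<close>

lemma inner_determines:
  assumes "\<And>i. i \<in> {1..n} \<Longrightarrow> inner_wt n (simple_root tp n i) y = inner_wt n (simple_root tp n i) y'" "m \<in> {1..n}"
  shows "y m = y' m"
proof -
  define d where "d m = y m - y' m" for m
  have stp: "d i = d (Suc i)" if "1 \<le> i" "i < n" for i
    using assms(1)[of i] inner_wt_simple_root[of i n tp y] inner_wt_simple_root[of i n tp y'] that n1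
    by (simp add: d_def Suc_eq_plus1)
  have const: "d i = d n" if "i \<le> n" "1 \<le> i" for i
    using that
  proof (induction i rule: inc_induct)
    case (step i)
    then show ?case using stp[of i] by simp
  qed simp
  have "d n = 0 \<or> d (n - 1) + d n = 0"
    using assms(1)[of n] inner_wt_simple_root[of n n tp y] inner_wt_simple_root[of n n tp y'] n1
    by (cases tp) (simp_all add: d_def)
  then have "d n = 0" using const[of "n - 1"] n1 by auto
  then show ?thesis using const[of m] assms(2) by (simp add: d_def)
qed

lemma highest_cases: "\<mu> \<in> highest \<Longrightarrow> k \<le> n \<Longrightarrow> (\<exists>s\<le>n. \<mu> = omega s) \<or> \<mu> = omega_bar n"
proof -
  assume "\<mu> \<in> highest" "k \<le> n"
  then have "(\<exists>s\<le>k. \<mu> = omega s) \<or> \<mu> = omega_bar n"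
    unfolding highest_def by (auto split: if_splits)
  then show ?thesis using \<open>k \<le> n\<close> order_trans by blast
qed

lemma highest_distinct:
  assumes "\<mu> \<in> highest" "\<nu> \<in> highest" "k \<le> n" "\<mu> \<noteq> \<nu>"
  shows "\<exists>i\<in>{1..n}. inner_wt n (simple_root tp n i) \<mu> \<noteq> inner_wt n (simple_root tp n i) \<nu>"
proof (rule ccontr)
  assume "\<not> ?thesis"
  then have eq: "\<mu> m = \<nu> m" if "m \<in> {1..n}" for m using inner_determines[of \<mu> \<nu>] that by blast
  have bar: "omega_bar n n \<noteq> omega s n" for s using n1 by (simp add: omega_bar_eq omega_eq)
  have "\<mu> n = \<nu> n" using eq n1 by simp
  then consider s s' where "s \<le> n" "s' \<le> n" "\<mu> = omega s" "\<nu> = omega s'" | "\<mu> = \<nu>"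
    using highest_cases[OF assms(1,3)] highest_cases[OF assms(2,3)] bar by metis
  then show False
  proof cases
    case 1
    then have "(\<Sum>m\<in>{1..n}. omega s m) = (\<Sum>m\<in>{1..n}. omega s' m)" using eq by (intro sum.cong) auto
    then show False using sum_omega 1 assms(4) by simp
  qed (use assms(4) in simp)
qed

lemma Eo_support:
  "Eo tp n i x w \<noteq> 0 \<Longrightarrow> \<exists>p a s b. w = p @ [a] @ s \<and> vec_e tp n i a b \<noteq> 0 \<and> x (p @ [b] @ s) \<noteq> 0"
proof (induction w arbitrary: x)
  case (Cons a u)
  have "Eo tp n i x (a # u) = inverse (ch tp n i u) * eV tp n i (\<lambda>b. x (b # u)) a + Eo tp n i (\<lambda>v. x (a # v)) u"
    using Eo_append[of i x "[a]" u] by (simp add: Eo_single)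
  then consider "eV tp n i (\<lambda>b. x (b # u)) a \<noteq> 0" | "Eo tp n i (\<lambda>v. x (a # v)) u \<noteq> 0"
    using Cons.prems by force
  then show ?case
  proof cases
    case 1
    then obtain b where "vec_e tp n i a b * x (b # u) \<noteq> 0"
      unfolding eV_def by (meson sum.not_neutral_contains_not_neutral)
    then show ?thesis by (intro exI[of _ "[]"] exI[of _ a] exI[of _ u] exI[of _ b]) auto
  next
    case 2
    from Cons.IH[OF this] obtain p c s b where
      "u = p @ [c] @ s" "vec_e tp n i c b \<noteq> 0" "x (a # p @ [b] @ s) \<noteq> 0" by blast
    then show ?thesis by (intro exI[of _ "a # p"] exI[of _ c] exI[of _ s] exI[of _ b]) simp
  qed
qed (simp add: Eo_Nil)

lemma vec_e_wt:
  assumes "i \<in> {1..n}" "vec_e tp n i a b \<noteq> 0" "m \<in> {1..n}"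
  shows "idx_wt a m = idx_wt b m + simple_root tp n i m"
proof -
  have w: "idx_wt (int j) m = eps_wt j m" "idx_wt (- int j) m = - eps_wt j m" if "1 \<le> j" for j
    using that by (simp_all add: idx_wt_uminus idx_wt_int)
  have e: "int i + 1 = int (Suc i)" "- int i - 1 = - int (Suc i)" "int n - 1 = int (n - 1)" "- int n + 1 = - int (n - 1)"
    using n1 by (simp_all add: of_nat_diff)
  have i: "1 \<le> i" "i \<le> n" using assms(1) by auto
  show ?thesis
  proof (cases "i < n")
    case True
    have r: "simple_root tp n i m = eps_wt i m - eps_wt (Suc i) m" using True by (simp add: simple_root_def Suc_eq_plus1)
    have "a = int i \<and> b = int (Suc i) \<or> a = - int (Suc i) \<and> b = - int i"
      using vec_e_nz[OF i n1 assms(2)] True unfolding e by (simp del: of_nat_Suc)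
    then show ?thesis
    proof (elim disjE conjE)
      assume "a = int i" "b = int (Suc i)"
      then show ?thesis using w(1)[OF i(1)] w(1)[of "Suc i"] by (simp add: r del: of_nat_Suc)
    next
      assume "a = - int (Suc i)" "b = - int i"
      then show ?thesis using w(2)[OF i(1)] w(2)[of "Suc i"] by (simp add: r del: of_nat_Suc)
    qed
  next
    case False
    then have [simp]: "i = n" using i by simp
    have wn: "idx_wt (int n) m = eps_wt n m" "idx_wt (- int n) m = - eps_wt n m"
      "idx_wt (int (n - 1)) m = eps_wt (n - 1) m" "idx_wt (- int (n - 1)) m = - eps_wt (n - 1) m"
      using w[of n] w[of "n - 1"] n1 by auto
    have nz: "case tp of A2_even \<Rightarrow> a = int n \<and> b = 0 \<or> a = 0 \<and> b = - int n
      | A2_odd_dagger \<Rightarrow> a = int (n - 1) \<and> b = - int n \<or> a = int n \<and> b = - int (n - 1)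
      | _ \<Rightarrow> a = int n \<and> b = - int n"
      using vec_e_nz[OF i n1 assms(2)] unfolding e by simp
    show ?thesis
    proof (cases tp)
      case A2_even
      then show ?thesis using nz wn(1,2) by (auto simp: simple_root_def idx_wt_0)
    next
      case A2_odd
      then show ?thesis using nz wn(1,2) by (auto simp: simple_root_def)
    next
      case C1
      then show ?thesis using nz wn(1,2) by (auto simp: simple_root_def)
    next
      case A2_odd_dagger
      then have "a = int (n - 1) \<and> b = - int n \<or> a = int n \<and> b = - int (n - 1)" using nz by simp
      then have "idx_wt a m = idx_wt b m + (eps_wt (n - 1) m + eps_wt n m)" using wn by (elim disjE conjE) simp_all
      then show ?thesis by (simp add: simple_root_def A2_odd_dagger)
    qed
  qed
qed

lemma ext_vector_homog:
  assumes "ext_vector \<mu> f \<in> Anti"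
  shows "homog (\<lambda>i. q tp powi inner_wt n (simple_root tp n i) \<mu>) (ext_vector \<mu> f)"
  unfolding homog_def
proof (intro conjI ballI)
  show "ext_vector \<mu> f \<in> Car" using assms by (simp add: Anti_def)
  fix i
  show "To tp n i (ext_vector \<mu> f) = (q tp powi inner_wt n (simple_root tp n i) \<mu>) \<star> ext_vector \<mu> f"
  proof
    fix w
    show "To tp n i (ext_vector \<mu> f) w = ((q tp powi inner_wt n (simple_root tp n i) \<mu>) \<star> ext_vector \<mu> f) w"
    proof (cases "\<forall>m\<in>{1..n}. wt w m = \<mu> m")
      case True
      then have "inner_wt n (simple_root tp n i) (wt w) = inner_wt n (simple_root tp n i) \<mu>" by (intro inner_wt_cong) simp
      then show ?thesis by (simp add: To_def fun_apply ch_wwt wwt_eq)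
    next
      case False
      then have "ext_vector \<mu> f w = 0" by (auto simp: ext_vector_def)
      then show ?thesis by (simp add: To_def fun_apply)
    qed
  qed
qed

text \<open>If raising does not annihilate the vector, an increasing word of the raised weight
  occurs in the result. Its blocks bound the coordinates by 1 and its length bounds the sum of their
  absolute values, which rules out most i.\<close>

lemma raised_leading_word:
  assumes SA: "submod Anti" and u: "ext_vector \<mu> f \<in> Anti" and i: "i \<in> {1..n}"
    and nz: "Eo tp n i (ext_vector \<mu> f) \<noteq> 0"
  shows "\<exists>z \<tau>. Eo tp n i (ext_vector \<mu> f) (wrd z 1 \<tau>) \<noteq> 0 \<and> length \<tau> = n \<and> (z = [] \<or> (z = [0] \<and> tp = A2_even)) \<and>
    (\<forall>m\<in>{1..n}. blk (\<tau> ! (m - 1)) = \<mu> m + simple_root tp n i m) \<and>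
    (\<Sum>m\<in>{1..n}. \<bar>\<mu> m + simple_root tp n i m\<bar>) \<le> int k"
proof -
  have "Eo tp n i (ext_vector \<mu> f) \<in> Anti" using submodD(4)[OF SA i u] .
  from Anti_increasing[OF this nz] obtain w where w: "Eo tp n i (ext_vector \<mu> f) w \<noteq> 0" "w \<in> words tp n k" "sorted_wrt (prec n) w"
    by blast
  obtain z \<tau> where z: "w = wrd z 1 \<tau>" "length \<tau> = n" "z = [] \<or> (z = [0] \<and> tp = A2_even)"
    using increasing_form[OF w(2,3)] by blast
  obtain p a s b where e: "w = p @ [a] @ s" "vec_e tp n i a b \<noteq> 0" "ext_vector \<mu> f (p @ [b] @ s) \<noteq> 0"
    using Eo_support[OF w(1)] by blast
  have wt: "wt w m = \<mu> m + simple_root tp n i m" if "m \<in> {1..n}" for m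
  proof -
    have "wt (p @ [b] @ s) m = \<mu> m" using e(3) that by (auto simp: ext_vector_def split: if_splits)
    then show ?thesis using vec_e_wt[OF i e(2) that] by (simp add: e(1))
  qed
  have "(\<Sum>m\<in>{1..n}. \<bar>\<mu> m + simple_root tp n i m\<bar>) = (\<Sum>m\<in>{1..n}. \<bar>wt w m\<bar>)"
    by (intro sum.cong) (simp_all add: wt)
  also have "\<dots> \<le> int k" using sum_abs_wt[of w] w(2) by (simp add: words_def)
  finally have "(\<Sum>m\<in>{1..n}. \<bar>\<mu> m + simple_root tp n i m\<bar>) \<le> int k" .
  moreover have "blk (\<tau> ! (m - 1)) = \<mu> m + simple_root tp n i m" if "m \<in> {1..n}" for m
    using wt_wrd1[of z \<tau> m] z that wt[OF that] by auto
  ultimately show ?thesis using w(1) z by blast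
qed

lemma wrd_in_words: "length \<tau> = n \<Longrightarrow> length (wrd [] 1 \<tau>) = k \<Longrightarrow> wrd [] 1 \<tau> \<in> words tp n k"
  using wrd_bounds[of 1 _ "[]" \<tau>] by (force simp: words_def idx_iff)

lemma ext_vector_same_weight:
  assumes "length \<tau> = n" "length \<tau>' = n" "map blk \<tau> = map blk \<tau>'" "length (wrd [] 1 \<tau>) = length (wrd [] 1 \<tau>')" "f \<tau> = c * f \<tau>'"
  shows "ext_vector \<mu> f (wrd [] 1 \<tau>) = c * ext_vector \<mu> f (wrd [] 1 \<tau>')"
proof -
  have "blk (\<tau> ! i) = blk (\<tau>' ! i)" if "i < n" for i
    using arg_cong[OF assms(3), of "\<lambda>l. l ! i"] that assms(1,2) by simp
  then have "blk (\<tau> ! (m - 1)) = blk (\<tau>' ! (m - 1))" if "m \<in> {1..n}" for m using that by fastforce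
  then have "wt (wrd [] 1 \<tau>) m = wt (wrd [] 1 \<tau>') m" if "m \<in> {1..n}" for m
    using that assms(1,2) by (simp add: wt_wrd1)
  moreover have "wrd [] 1 \<tau> \<in> words tp n k \<longleftrightarrow> wrd [] 1 \<tau>' \<in> words tp n k"
    using wrd_in_words[OF assms(1)] wrd_in_words[OF assms(2)] assms(4) by (auto simp: words_def)
  ultimately show ?thesis using assms(5) by (simp add: ext_vector_wrd assms(1,2))
qed

lemma sum_eps: "i \<in> {1..n} \<Longrightarrow> (\<Sum>m\<in>{1..n}. eps_wt i m) = 1"
  by (simp add: eps_wt_def)

text \<open>Only i with s < i < n pass the bounds of \<open>raised_leading_word\<close>, and only if
  s < k, hence in type \<open>A2_odd\<close>. There the two terms of \<open>Eo_exchange\<close>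
  cancel by the choice of f.\<close>

lemma exists_omega:
  assumes s: "s \<le> k" "k \<le> n" "even (k - s)" "tp = A2_odd \<or> s = k" and SA: "submod Anti"
  shows "\<exists>u\<in>Anti. prim u \<and> homog (\<lambda>i. q tp powi inner_wt n (simple_root tp n i) (omega s)) u \<and> u (base_word (omega s)) \<noteq> 0"
proof -
  \<comment> \<open>These are the values that \<open>prim_sorted\<close> forces on a primitive
    vector with value 1 at the base word.\<close>
  define f where "f \<tau> = (- q tp) ^ inv_count (map fst (drop s \<tau>))" for \<tau> :: "(bool \<times> bool) list"
  define u where "u = ext_vector (omega s) f"
  have om0: "0 \<le> omega s m" for m by (simp add: omega_eq)
  have sn: "s \<le> n" using s by simp
  have A: "u \<in> Anti" unfolding u_def
    by (rule ext_vector_Anti) (use s(4) om0 sum_omega[OF sn] in auto)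
  have "Eo tp n i u = 0" if i: "i \<in> {1..n}" for i
  proof (rule ccontr)
    assume nz: "Eo tp n i u \<noteq> 0"
    obtain z \<tau> where z: "Eo tp n i u (wrd z 1 \<tau>) \<noteq> 0" "length \<tau> = n" "z = [] \<or> (z = [0] \<and> tp = A2_even)"
      and b': "\<forall>m\<in>{1..n}. blk (\<tau> ! (m - 1)) = omega s m + simple_root tp n i m"
      and sum: "(\<Sum>m\<in>{1..n}. \<bar>omega s m + simple_root tp n i m\<bar>) \<le> int k"
      using raised_leading_word[OF SA A[unfolded u_def] i nz[unfolded u_def]] unfolding u_def by blast
    note b = b'[rule_format]
    have b1: "omega s m + simple_root tp n i m \<le> 1" if "m \<in> {1..n}" for m
      using b[OF that] blk_cases(5)[of "\<tau> ! (m - 1)"] by simp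
    show False
    proof (cases "i < n")
      case True
      have r: "simple_root tp n i m = eps_wt i m - eps_wt (i + 1) m" for m using True by (simp add: simple_root_def)
      have si: "s < i" using b1[OF i] i by (auto simp: r omega_eq eps_wt_def split: if_splits)
      \<comment> \<open>Raising creates 1 at i and -1 at i+1, two more nonzero coordinates than
        \<open>omega s\<close>; a word of length k = s is too short for them.\<close>
      have "(\<Sum>m\<in>{1..n}. \<bar>omega s m + simple_root tp n i m\<bar>) = (\<Sum>m\<in>{1..n}. omega s m + (eps_wt i m + eps_wt (i + 1) m))"
        by (intro sum.cong) (use si in \<open>auto simp: r omega_eq eps_wt_def\<close>)
      also have "\<dots> = int s + 2" using sum_omega[OF sn] sum_eps[of i] sum_eps[of "i + 1"] i True by (simp add: sum.distrib)
      finally have "s \<noteq> k" using sum by auto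
      then have tp: "tp = A2_odd" using s(4) by blast
      then have z0: "z = []" using z(3) by auto
      define \<tau>\<^sub>1 \<tau>\<^sub>2 where "\<tau>\<^sub>1 = take (i - 1) \<tau>" and "\<tau>\<^sub>2 = drop (Suc i) \<tau>"
      have "i - 1 \<le> length \<tau>" "1 \<le> i" using i z(2) by auto
      then have l1: "length \<tau>\<^sub>1 + 1 = i" by (simp add: \<tau>\<^sub>1_def min_absorb2)
      have "blk (\<tau> ! (i - 1)) = 1" using b[OF i] si by (simp add: r omega_eq eps_wt_def)
      then have t1: "\<tau> ! (i - 1) = (True, False)" by (simp add: blk_cases)
      have "blk (\<tau> ! i) = - 1" using b[of "i + 1"] si True by (simp add: r omega_eq eps_wt_def)
      then have t2: "\<tau> ! i = (False, True)" by (simp add: blk_cases)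
      have Si: "Suc (i - 1) = i" using i by simp
      have \<tau>: "\<tau> = \<tau>\<^sub>1 @ [(True, False), (False, True)] @ \<tau>\<^sub>2"
        using append_take_drop_id[of "i - 1" \<tau>] Cons_nth_drop_Suc[of "i - 1" \<tau>] Cons_nth_drop_Suc[of i \<tau>] z(2) True t1 t2
        unfolding Si \<tau>\<^sub>1_def \<tau>\<^sub>2_def by simp
      have l: "length \<tau>\<^sub>1 + length \<tau>\<^sub>2 + 2 = n" using z(2) \<tau> by (metis length_append add.assoc add.commute length_Cons list.size(3) numeral_2_eq_2 add_Suc_right)
      have sl: "s - length \<tau>\<^sub>1 = 0" using l1 si by simp
      have "u (wrd [] 1 (\<tau>\<^sub>1 @ [(False, False), (True, True)] @ \<tau>\<^sub>2)) = - q tp * u (wrd [] 1 (\<tau>\<^sub>1 @ [(True, True), (False, False)] @ \<tau>\<^sub>2))"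
        unfolding u_def
      proof (rule ext_vector_same_weight)
        show "f (\<tau>\<^sub>1 @ [(False, False), (True, True)] @ \<tau>\<^sub>2) = - q tp * f (\<tau>\<^sub>1 @ [(True, True), (False, False)] @ \<tau>\<^sub>2)"
          unfolding f_def by (simp add: sl inv_count_swap)
      qed (use l in \<open>simp_all add: length_wrd blk_def\<close>)
      then have "Eo tp n i u (wrd z 1 \<tau>) = 0"
        unfolding \<tau> using Eo_exchange[of i \<tau>\<^sub>1 z u \<tau>\<^sub>2] i True l1 z0 by simp
      then show False using z(1) by blast
    next
      case False
      then have "i = n" using i by simp
      have n: "n \<in> {1..n}" "n - 1 \<in> {1..n}" using n1 by auto
      show False
      proof (cases tp)
        case A2_even
        then have r: "simple_root tp n i m = eps_wt n m" for m using \<open>i = n\<close> by (simp add: simple_root_def)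
        have "(\<Sum>m\<in>{1..n}. \<bar>omega s m + simple_root tp n i m\<bar>) = (\<Sum>m\<in>{1..n}. omega s m + eps_wt n m)"
          by (intro sum.cong) (auto simp: r omega_eq eps_wt_def)
        also have "\<dots> = int s + 1" using sum_omega[OF sn] sum_eps[OF n(1)] by (simp add: sum.distrib)
        finally show False using sum s(4) A2_even by simp
      next
        case A2_odd_dagger
        then have r: "simple_root tp n i m = eps_wt (n - 1) m + eps_wt n m" for m using \<open>i = n\<close> by (simp add: simple_root_def)
        have "(\<Sum>m\<in>{1..n}. \<bar>omega s m + simple_root tp n i m\<bar>) = (\<Sum>m\<in>{1..n}. omega s m + (eps_wt (n - 1) m + eps_wt n m))"
          by (intro sum.cong) (auto simp: r omega_eq eps_wt_def)
        also have "\<dots> = int s + 2" using sum_omega[OF sn] sum_eps[OF n(1)] sum_eps[OF n(2)] by (simp add: sum.distrib)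
        finally show False using sum s(4) A2_odd_dagger by simp
      qed (use b1[OF n(1)] om0[of n] \<open>i = n\<close> in \<open>simp_all add: simple_root_def eps_wt_def\<close>)
    qed
  qed
  then have "prim u" using A by (simp add: prim_def Anti_def)
  moreover have "u (base_word (omega s)) \<noteq> 0"
  proof -
    define m where "m = (k - s) div 2"
    define \<tau> where "\<tau> = replicate s (True, False) @ dup (replicate m True @ replicate (n - s - m) False)"
    have m: "s + 2 * m = k" using s by (auto simp: m_def)
    have l: "length \<tau> = n" using m s(2) by (simp add: \<tau>_def)
    have "length (wrd [] 1 \<tau>) = k" unfolding \<tau>_def length_dup_word using m by simp
    then have "wrd [] 1 \<tau> \<in> words tp n k" by (rule wrd_in_words[OF l])
    moreover have "wt (wrd [] 1 \<tau>) j = omega s j" if j: "j \<in> {1..n}" for j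
    proof (cases "j \<le> s")
      case True
      moreover have "1 \<le> j" using j by simp
      ultimately have "j - 1 < s" by linarith
      then have "\<tau> ! (j - 1) = (True, False)" by (simp add: \<tau>_def nth_append)
      then show ?thesis using True j wt_wrd1[of "[]" \<tau> j] l by (simp add: omega_eq blk_def)
    next
      case False
      define \<beta> where "\<beta> = replicate m True @ replicate (n - s - m) False"
      have lb: "length \<beta> = n - s" using m s(2) by (simp add: \<beta>_def)
      have "1 \<le> j" "j \<le> n" using j by simp_all
      then have "\<not> j - 1 < s" "j - 1 - s < length \<beta>" using False unfolding lb by linarith+
      then have "\<tau> ! (j - 1) = (\<beta> ! (j - 1 - s), \<beta> ! (j - 1 - s))"
        unfolding \<tau>_def \<beta>_def[symmetric] by (simp add: nth_append)
      then show ?thesis using False j wt_wrd1[of "[]" \<tau> j] l by (simp add: omega_eq blk_def)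
    qed
    ultimately have "u (wrd [] 1 \<tau>) = f \<tau>" unfolding u_def by (simp add: ext_vector_wrd[OF l])
    moreover have "base_word (omega s) = wrd [] 1 \<tau>" unfolding base_word_omega[OF sn] \<tau>_def m_def ..
    ultimately show ?thesis by (simp add: f_def)
  qed
  ultimately show ?thesis using A ext_vector_homog[of "omega s" f] unfolding u_def by blast
qed

text \<open>Adding any simple root to this weight produces a coordinate 2, which no increasing word
  has; so raising annihilates the vector.\<close>

lemma exists_omega_bar:
  assumes tp: "tp = A2_odd_dagger" "k = n" and SA: "submod Anti"
  shows "\<exists>u\<in>Anti. prim u \<and> homog (\<lambda>i. q tp powi inner_wt n (simple_root tp n i) (omega_bar n)) u \<and> u (base_word (omega_bar n)) \<noteq> 0"
proof -
  define u where "u = ext_vector (omega_bar n) (\<lambda>_. 1)"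
  have ob: "omega_bar n m = (if m < n then 1 else - 1)" if "m \<in> {1..n}" for m
    using that n1 by (simp add: omega_bar_eq)
  have "(\<Sum>m\<in>{1..n}. \<bar>omega_bar n m\<bar>) = (\<Sum>m\<in>{1..n}. 1)" by (intro sum.cong) (simp_all add: ob)
  then have A: "u \<in> Anti" unfolding u_def by (intro ext_vector_Anti) (simp add: tp)
  have "Eo tp n i u = 0" if i: "i \<in> {1..n}" for i
  proof (rule ccontr)
    assume nz: "Eo tp n i u \<noteq> 0"
    obtain \<tau> where b': "\<forall>m\<in>{1..n}. blk (\<tau> ! (m - 1)) = omega_bar n m + simple_root tp n i m"
      using raised_leading_word[OF SA A[unfolded u_def] i nz[unfolded u_def]] by blast
    note b = b'[rule_format]
    have b1: "omega_bar n m + simple_root tp n i m \<le> 1" if "m \<in> {1..n}" for m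
      using b[OF that] blk_cases(5)[of "\<tau> ! (m - 1)"] by simp
    show False
    proof (cases "i < n")
      case True
      then show False using b1[OF i] ob[OF i] by (simp add: simple_root_def eps_wt_def)
    next
      case False
      have n: "n - 1 \<in> {1..n}" "n - 1 \<noteq> n" using n1 by auto
      show False using n(2) False b1[OF n(1)] ob[OF n(1)] n1 tp(1) by (simp add: simple_root_def eps_wt_def)
    qed
  qed
  then have "prim u" using A by (simp add: prim_def Anti_def)
  moreover have "u (base_word (omega_bar n)) \<noteq> 0"
  proof -
    define \<tau> where "\<tau> = replicate (n - 1) (True, False) @ [(False, True)]"
    have l: "length \<tau> = n" using n1 by (simp add: \<tau>_def)
    have "length (wrd [] 1 \<tau>) = k" unfolding \<tau>_def length_wrd using n1 tp by (simp add: sum_list_replicate)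
    then have "wrd [] 1 \<tau> \<in> words tp n k" by (rule wrd_in_words[OF l])
    moreover have "wt (wrd [] 1 \<tau>) j = omega_bar n j" if j: "j \<in> {1..n}" for j
    proof -
      have "blk (\<tau> ! (j - 1)) = (if j < n then 1 else - 1)"
        using j by (auto simp: \<tau>_def nth_append blk_def)
      then show ?thesis using j wt_wrd1[of "[]" \<tau> j] l ob[OF j] by simp
    qed
    ultimately have "u (wrd [] 1 \<tau>) = 1" unfolding u_def by (simp add: ext_vector_wrd[OF l])
    then show ?thesis by (simp add: base_word_omega_bar \<tau>_def)
  qed
  ultimately show ?thesis using A ext_vector_homog[of "omega_bar n" "\<lambda>_. 1"] unfolding u_def by blast
qed

section \<open>Assembling the decomposition\<close>

lemma V_quot_decomposition:
  assumes k: "k \<le> n" and D: "tp = A2_odd_dagger \<Longrightarrow> 2 < n"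
  shows "uq_module tp n (V_quot tp n k)" "iso_sum_V tp n (V_quot tp n k) highest"
    "highest = {\<mu>} \<Longrightarrow> is_V tp n \<mu> (V_quot tp n k)"
proof -
  have V: "V_quot tp n k = uq_quotient TP (perp Anti)" by (simp add: V_quot_def relations_eq)
  have A: "submod Anti" using submod_Anti D by blast
  interpret tensor_quotient tp n k "perp Anti" by unfold_locales (rule submod_perp[OF A])
  show "uq_module tp n (V_quot tp n k)" unfolding V by (rule uq_module_Qt)
  have "\<exists>u\<in>Anti. prim u \<and> homog (\<lambda>i. q tp powi inner_wt n (simple_root tp n i) \<mu>) u \<and> u (base_word \<mu>) \<noteq> 0"
    if \<mu>: "\<mu> \<in> highest" for \<mu>
  proof -
    from \<mu> consider s where "s \<le> k" "even (k - s)" "tp = A2_odd \<or> s = k" "\<mu> = omega s"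
      | "tp = A2_odd_dagger" "k = n" "\<mu> = omega_bar n"
      unfolding highest_def by (auto split: if_splits)
    then show ?thesis
    proof cases
      case 1
      then show ?thesis using exists_omega[OF _ k _ _ A, of s] by blast
    next
      case 2
      then show ?thesis using exists_omega_bar[OF _ _ A] by blast
    qed
  qed
  then obtain u where u: "\<And>\<mu>. \<mu> \<in> highest \<Longrightarrow> u \<mu> \<in> Anti \<and> prim (u \<mu>) \<and>
      homog (\<lambda>i. q tp powi inner_wt n (simple_root tp n i) \<mu>) (u \<mu>) \<and> u \<mu> (base_word \<mu>) \<noteq> 0" by metis
  have u': "prim (u \<mu>) \<and> homog (\<lambda>i. q tp powi inner_wt n (simple_root tp n i) \<mu>) (u \<mu>) \<and> u \<mu> \<noteq> 0 \<and> u \<mu> \<in> Anti" if "\<mu> \<in> highest" for \<mu>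
    using u[OF that] by (auto simp: fun_apply)
  have complete: "\<exists>\<mu>\<in>highest. \<exists>e. x = e \<star> u \<mu>" if x: "x \<in> Anti" "prim x" "homog b x" "x \<noteq> 0" for x b
  proof -
    obtain \<mu> where \<mu>: "\<mu> \<in> highest" "\<And>i. i \<in> {1..n} \<Longrightarrow> b i = q tp powi inner_wt n (simple_root tp n i) \<mu>"
      using classification[OF x k] by blast
    \<comment> \<open>Subtracting this multiple kills the coefficient at the base word. The
      difference is again primitive of the same weight, so by \<open>classification\<close> it is
      0.\<close>
    define e where "e = x (base_word \<mu>) / u \<mu> (base_word \<mu>)"
    define y where "y = x - e \<star> u \<mu>"
    note sA = subspD[OF submodD(1)[OF A]]
    have uC: "x \<in> Car" "u \<mu> \<in> Car" using x(2) u[OF \<mu>(1)] by (auto simp: prim_def)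
    have eC: "e \<star> u \<mu> \<in> Car" using car(3)[OF uC(2)] .
    have yA: "y \<in> Anti" unfolding y_def by (intro sA(5) x(1) sA(3)) (use u[OF \<mu>(1)] in blast)
    have yC: "y \<in> Car" using yA by (simp add: Anti_def)
    have yp: "prim y"
      using x(2) u[OF \<mu>(1)] uC eC yC unfolding y_def by (simp add: prim_def linD)
    have yh: "homog b y" unfolding homog_def
    proof (intro conjI ballI yC)
      fix i assume i: "i \<in> {1..n}"
      have "To tp n i x = b i \<star> x" using x(3) i by (simp add: homog_def)
      moreover have "To tp n i (u \<mu>) = b i \<star> u \<mu>" using u[OF \<mu>(1)] \<mu>(2)[OF i] i by (simp add: homog_def)
      ultimately have "ch tp n i w * x w = b i * x w" "ch tp n i w * u \<mu> w = b i * u \<mu> w" for w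
        by (auto simp: To_def fun_eq_iff fun_apply)
      note chu = this
      show "To tp n i y = b i \<star> y"
      proof
        fix w
        have "To tp n i y w = ch tp n i w * x w - e * (ch tp n i w * u \<mu> w)" by (simp add: To_def y_def fun_apply algebra_simps)
        also have "\<dots> = b i * x w - e * (b i * u \<mu> w)" unfolding chu ..
        also have "\<dots> = (b i \<star> y) w" by (simp add: y_def fun_apply algebra_simps)
        finally show "To tp n i y w = (b i \<star> y) w" .
      qed
    qed
    have y0: "y (base_word \<mu>) = 0" using u[OF \<mu>(1)] by (simp add: y_def fun_apply e_def)
    have "y = 0"
    proof (rule ccontr)
      assume "y \<noteq> 0"
      from classification[OF yA yp yh this k] obtain \<nu> where \<nu>: "\<nu> \<in> highest"
        "\<And>i. i \<in> {1..n} \<Longrightarrow> b i = q tp powi inner_wt n (simple_root tp n i) \<nu>" "y (base_word \<nu>) \<noteq> 0" by blast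
      have "\<mu> = \<nu>" using highest_distinct[OF \<mu>(1) \<nu>(1) k] \<mu>(2) \<nu>(2) powi_inject by metis
      then show False using \<nu>(3) y0 by simp
    qed
    then have "x = e \<star> u \<mu>" by (simp add: y_def)
    then show ?thesis using \<mu>(1) by blast
  qed
  have fin: "finite highest" unfolding highest_def by auto
  have ne: "highest \<noteq> {}" unfolding highest_def by auto
  have dist: "\<exists>i\<in>{1..n}. inner_wt n (simple_root tp n i) \<mu> \<noteq> inner_wt n (simple_root tp n i) \<nu>"
    if "\<mu> \<in> highest" "\<nu> \<in> highest" "\<mu> \<noteq> \<nu>" for \<mu> \<nu>
    using highest_distinct that k by blast
  note dec = quotient_decomposition[of Anti highest u, OF A u' complete fin ne dist]
  show "iso_sum_V tp n (V_quot tp n k) highest" unfolding V by (rule dec(1))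
  show "is_V tp n \<mu> (V_quot tp n k)" if "highest = {\<mu>}" unfolding V by (rule dec(2)) (use that in auto)
qed

end

theorem theorem2p4:
  fixes tp :: affine_type and n k :: nat
  assumes "tp \<in> {A2_even, C1} \<Longrightarrow> 2 \<le> n"
    and "tp \<in> {A2_odd, A2_odd_dagger} \<Longrightarrow> 3 \<le> n"
    and "1 \<le> k" and "k \<le> n"
  shows "uq_module tp n (V_quot tp n k) \<and>
    (if tp = A2_odd_dagger \<and> k = n then
       iso_sum_V tp n (V_quot tp n n) {omega n, omega_bar n}
     else if tp = A2_odd then
       iso_sum_V tp n (V_quot tp n k) {omega (k - 2 * j) |j. 2 * j \<le> k}
     else
       (\<exists>L :: (K, (int list \<Rightarrow> K) set) uq_rep.
          is_V tp n (omega k) L \<and> uq_iso n (V_quot tp n k) L))"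
proof -
  have n: "1 < n" "tp = A2_odd_dagger \<Longrightarrow> 2 < n" using assms(1,2) by (cases tp; simp)+
  interpret tensor_power tp n k by unfold_locales (rule n(1))
  have refl: "uq_iso n M M" for M :: "(K, (int list \<Rightarrow> K) set) uq_rep"
    unfolding uq_iso_def uq_hom_def by (intro bexI[of _ "\<lambda>x. x"]) (auto simp: bij_betw_def)
  have "{omega (k - 2 * j) |j. 2 * j \<le> k} = {omega s | s. s \<le> k \<and> even (k - s)}"
  proof (intro Set.set_eqI iffI)
    fix \<mu> assume "\<mu> \<in> {omega s | s. s \<le> k \<and> even (k - s)}"
    then obtain s where s: "\<mu> = omega s" "s \<le> k" "even (k - s)" by blast
    then obtain j where "k - s = 2 * j" by (elim evenE)
    then have "s = k - 2 * j" "2 * j \<le> k" using s(2) by linarith+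
    then show "\<mu> \<in> {omega (k - 2 * j) |j. 2 * j \<le> k}" using s(1) by blast
  next
    fix \<mu> assume "\<mu> \<in> {omega (k - 2 * j) |j. 2 * j \<le> k}"
    then obtain j where j: "\<mu> = omega (k - 2 * j)" "2 * j \<le> k" by blast
    then have "k - 2 * j \<le> k" "k - (k - 2 * j) = 2 * j" by linarith+
    then have "k - 2 * j \<le> k" "even (k - (k - 2 * j))" by simp_all
    then show "\<mu> \<in> {omega s | s. s \<le> k \<and> even (k - s)}" using j(1) by blast
  qed
  then have h: "highest = (if tp = A2_odd then {omega (k - 2 * j) |j. 2 * j \<le> k}
     else if tp = A2_odd_dagger \<and> k = n then {omega n, omega_bar n} else {omega k})"
    unfolding highest_def by simp
  note V = V_quot_decomposition[OF assms(4) n(2)]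
  show ?thesis
  proof (intro conjI V(1))
    consider "tp = A2_odd_dagger" "k = n" | "tp = A2_odd" | "tp \<noteq> A2_odd" "\<not> (tp = A2_odd_dagger \<and> k = n)" by blast
    then show "if tp = A2_odd_dagger \<and> k = n then iso_sum_V tp n (V_quot tp n n) {omega n, omega_bar n}
      else if tp = A2_odd then iso_sum_V tp n (V_quot tp n k) {omega (k - 2 * j) |j. 2 * j \<le> k}
      else \<exists>L :: (K, (int list \<Rightarrow> K) set) uq_rep. is_V tp n (omega k) L \<and> uq_iso n (V_quot tp n k) L"
    proof cases
      case 1
      then show ?thesis using V(2) h by simp
    next
      case 2
      then show ?thesis using V(2) h by simp
    next
      case 3
      have "highest = {omega k}" unfolding h using 3 by auto
      then have "is_V tp n (omega k) (V_quot tp n k)" using V(3) by blast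
      then show ?thesis using 3 refl by auto
    qed
  qed
qed

end
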